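(* Let $A \in \mathrm M_n(k)$ and let $((f_1,\boldsymbol\lambda_1),\dotsc,(f_e,\boldsymbol\lambda_e))$ be an elementary divisor vector of $A$ over $k$. Write $\boldsymbol\mu_i := \boldsymbol\lambda_i^* = (\mu_{i1},\mu_{i2},\dots)$. Then, for almost all $v \in \mathcal V_k$, $$\zeta_{A,\mathfrak o_v}(s) \Big\vert_{q_v\to q_v^{-1}} = (-1)^{\sum_{i=1}^e |\boldsymbol\lambda_i| \cdot \mathrm g_v(k[X]/(f_i))} \cdot q_v^{\sum_{i=1}^e \deg(f_i) \binom{|\boldsymbol\lambda_i|}{2} - \bigl(\sum_{i=1}^ e \deg(f_i) \sum_{j=1}^{\lambda_{i1}}j \mu_{ij}\bigr)s} \cdot \zeta_{A,\mathfrak o_v}(s).$$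
   Context: $k$ is a number field. For a number field $k'$, $\mathcal V_{k'}$ is the set of its non-Archimedean places. For $v\in\mathcal V_k$, $\mathfrak o_v$ is the valuation ring of the completion $k_v$ and $q_v$ its residue field size. "Almost all" means all but finitely many. For an extension $k'/k$ of number fields and $v\in\mathcal V_k$, $\mathrm g_v(k')$ is the number of places of $k'$ dividing $v$. Let $n\ge 1$. If $A\in\mathrm M_n(k)$ then $A\in\mathrm M_n(\mathfrak o_v)$ for almost all $v$. For such $v$, $\zeta_{A,\mathfrak o_v}(s)=\sum_{m\ge1}a_m(A,\mathfrak o_v)m^{-s}$, where $a_m(A,\mathfrak o_v)$ is the number of $A$-invariant $\mathfrak o_v$-submodules of $\mathfrak o_v^n$ of index $m$ (matrices act on row vectors by right multiplication). A partition $\boldsymbol\lambda=(\lambda_1,\dots,\lambda_r)$ is a non-increasing sequence of positive integers; $|\boldsymbol\lambda|=\sum\lambda_i$, and $\boldsymbol\lambda^{-1}(j)=\min\{i: j\le\lambda_1+\dots+\lambda_i\}$ for $1\le j\le|\boldsymbol\lambda|$. The dual partition is $\boldsymbol\lambda^*=(\mu_1,\dots,\mu_{\lambda_1})$ with $\mu_i=\#\{j:\lambda_j\ge i\}$. For monic $f=X^m+a_{m-1}X^{m-1}+\dots+a_0$, $\mathsf C(f)$ is the companion matrix with ones on the superdiagonal, last row $(-a_0,\dots,-a_{m-1})$, and zeros elsewhere. An elementary divisor vector of $A$ over $k$ is $((f_1,\boldsymbol\lambda_1),\dots,(f_e,\boldsymbol\lambda_e))$ with pairwise distinct monic irreducible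 $f_i\in k[X]$ and partitions $\boldsymbol\lambda_i=(\lambda_{i1},\lambda_{i2},\dots)$ of positive integers such that $A$ is similar over $k$ to the block diagonal matrix with blocks $\mathsf C(f_i^{\lambda_{ij}})$, over all $i$ and all parts $\lambda_{ij}$ of $\boldsymbol\lambda_i$; it is unique up to reordering. Meaning of $q_v\to q_v^{-1}$: put $k_i=k[X]/(f_i)$ and, for $w\in\mathcal V_{k_i}$ dividing $v$, define $\mathfrak f(w/v)$ by $q_w=q_v^{\mathfrak f(w/v)}$. For almost all $v$, $$\zeta_{A,\mathfrak o_v}(s)=\prod_{i=1}^e\prod_{j=1}^{|\boldsymbol\lambda_i|}\prod_{w\in\mathcal V_{k_i},\,w\mid v}\Bigl(1-q_v^{-\mathfrak f(w/v)\,((\boldsymbol\lambda_i^* )^{-1}(j)\, s-j+1)}\Bigr)^{-1},$$ and the operation $q_v\to q_v^{-1}$ replaces $q_v$ by $q_v^{-1}$ in this expression. *)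

theory Defs
  imports
    "HOL-Complex_Analysis.Complex_Analysis"
    "HOL-Algebra.Algebraic_Closure_Type"
    "Jordan_Normal_Form.Matrix"
begin

hide_const (open) Divisibility.irreducible
hide_const (open) Module.smult UnivPoly.monom UnivPoly.coeff Polynomials.degree

section \<open>Number fields and their non-Archimedean places\<close>

definition number_field :: "'k::field_char_0 itself \<Rightarrow> bool" where
  "number_field _ \<longleftrightarrow>
     (\<exists>B. finite_dimensional_vector_space (\<lambda>(q::rat) (x::'k). of_rat q * x) B)"

text \<open>
  Places are defined for fields given as records with a carrier, because the residue class
  fields \<open>k[X]/(f)\<close> occur alongside the ground field \<open>k\<close>.  Extensionality makes an absolute
  value determined by its values on the carrier.
\<close>

definition nonarch_abs :: "('a, 'm) ring_scheme \<Rightarrow> ('a \<Rightarrow> real) set" where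
  "nonarch_abs R = {\<phi> \<in> extensional (carrier R).
     (\<forall>x\<in>carrier R. 0 \<le> \<phi> x \<and> (\<phi> x = 0 \<longleftrightarrow> x = \<zero>\<^bsub>R\<^esub>)) \<and>
     (\<forall>x\<in>carrier R. \<forall>y\<in>carrier R. \<phi> (x \<otimes>\<^bsub>R\<^esub> y) = \<phi> x * \<phi> y) \<and>
     (\<forall>x\<in>carrier R. \<forall>y\<in>carrier R. \<phi> (x \<oplus>\<^bsub>R\<^esub> y) \<le> max (\<phi> x) (\<phi> y)) \<and>
     (\<exists>x\<in>carrier R. x \<noteq> \<zero>\<^bsub>R\<^esub> \<and> \<phi> x \<noteq> 1)}"

definition abs_equiv :: "('a, 'm) ring_scheme \<Rightarrow> (('a \<Rightarrow> real) \<times> ('a \<Rightarrow> real)) set" where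
  "abs_equiv R = {(\<phi>, \<psi>). \<phi> \<in> nonarch_abs R \<and> \<psi> \<in> nonarch_abs R \<and>
     (\<exists>c>0. \<forall>x\<in>carrier R. \<psi> x = \<phi> x powr c)}"

definition places :: "('a, 'm) ring_scheme \<Rightarrow> ('a \<Rightarrow> real) set set" where
  "places R = nonarch_abs R // abs_equiv R"

section \<open>Completions, valuation rings and residue fields\<close>

text \<open>
  The completion is the ring of Cauchy sequences modulo the ideal of null sequences.  All
  conditions below hold for one absolute value in the place iff they hold for all of them, so
  quantifying over the whole class avoids choosing a representative.
\<close>

definition cauchy_ring ::
    "('a, 'm) ring_scheme \<Rightarrow> ('a \<Rightarrow> real) set \<Rightarrow> (nat \<Rightarrow> 'a) ring" where
  "cauchy_ring R v = \<lparr>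
     carrier = {u. (\<forall>n. u n \<in> carrier R) \<and>
       (\<forall>\<phi>\<in>v. \<forall>e>0. \<exists>N. \<forall>m\<ge>N. \<forall>n\<ge>N. \<phi> (u m \<ominus>\<^bsub>R\<^esub> u n) < e)},
     monoid.mult = (\<lambda>u t n. u n \<otimes>\<^bsub>R\<^esub> t n),
     one = (\<lambda>_. \<one>\<^bsub>R\<^esub>),
     ring.zero = (\<lambda>_. \<zero>\<^bsub>R\<^esub>),
     add = (\<lambda>u t n. u n \<oplus>\<^bsub>R\<^esub> t n)\<rparr>"

definition null_seqs :: "('a, 'm) ring_scheme \<Rightarrow> ('a \<Rightarrow> real) set \<Rightarrow> (nat \<Rightarrow> 'a) set" where
  "null_seqs R v =
     {u \<in> carrier (cauchy_ring R v). \<forall>\<phi>\<in>v. (\<lambda>n. \<phi> (u n)) \<longlonglongrightarrow> 0}"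

definition completion ::
    "('a, 'm) ring_scheme \<Rightarrow> ('a \<Rightarrow> real) set \<Rightarrow> (nat \<Rightarrow> 'a) set ring" where
  "completion R v = cauchy_ring R v Quot null_seqs R v"

definition to_completion ::
    "('a, 'm) ring_scheme \<Rightarrow> ('a \<Rightarrow> real) set \<Rightarrow> 'a \<Rightarrow> (nat \<Rightarrow> 'a) set" where
  "to_completion R v x = null_seqs R v +>\<^bsub>cauchy_ring R v\<^esub> (\<lambda>_. x)"

text \<open>The absolute value of the class of a Cauchy sequence \<open>u\<close> is \<open>lim (\<lambda>n. \<phi> (u n))\<close>.\<close>

definition valuation_ring ::
    "('a, 'm) ring_scheme \<Rightarrow> ('a \<Rightarrow> real) set \<Rightarrow> (nat \<Rightarrow> 'a) set ring" where
  "valuation_ring R v = (completion R v)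
     \<lparr>carrier := {C \<in> carrier (completion R v). \<forall>\<phi>\<in>v. \<forall>u\<in>C. lim (\<lambda>n. \<phi> (u n)) \<le> 1}\<rparr>"

definition valuation_ideal ::
    "('a, 'm) ring_scheme \<Rightarrow> ('a \<Rightarrow> real) set \<Rightarrow> (nat \<Rightarrow> 'a) set set" where
  "valuation_ideal R v =
     {C \<in> carrier (completion R v). \<forall>\<phi>\<in>v. \<forall>u\<in>C. lim (\<lambda>n. \<phi> (u n)) < 1}"

definition residue_size :: "('a, 'm) ring_scheme \<Rightarrow> ('a \<Rightarrow> real) set \<Rightarrow> nat" where
  "residue_size R v = card (carrier (valuation_ring R v Quot valuation_ideal R v))"

section \<open>The extensions \<open>k[X]/(f)\<close>\<close>

abbreviation base_field :: "'k::field_char_0 ring" where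
  "base_field \<equiv> ring_of_type_algebra"

abbreviation polys :: "'k::field_char_0 poly ring" where
  "polys \<equiv> ring_of_type_algebra"

definition ext_field :: "'k::field_char_0 poly \<Rightarrow> 'k poly set ring" where
  "ext_field f = polys Quot (PIdl\<^bsub>polys\<^esub> f)"

definition ext_embed :: "'k::field_char_0 poly \<Rightarrow> 'k \<Rightarrow> 'k poly set" where
  "ext_embed f c = (PIdl\<^bsub>polys\<^esub> f) +>\<^bsub>polys\<^esub> [:c:]"

text \<open>\<open>w\<close> divides \<open>v\<close> iff the absolute values in \<open>w\<close> restrict to absolute values in \<open>v\<close>.\<close>

definition places_above ::
    "'k::field_char_0 poly \<Rightarrow> ('k \<Rightarrow> real) set \<Rightarrow> ('k poly set \<Rightarrow> real) set set" where
  "places_above f v = {w \<in> places (ext_field f). \<forall>\<psi>\<in>w. (\<lambda>c. \<psi> (ext_embed f c)) \<in> v}"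

definition residue_degree ::
    "'k::field_char_0 poly \<Rightarrow> ('k poly set \<Rightarrow> real) set \<Rightarrow> ('k \<Rightarrow> real) set \<Rightarrow> nat" where
  "residue_degree f w v =
     (THE d. residue_size (ext_field f) w = residue_size base_field v ^ d)"

section \<open>Partitions\<close>

definition is_partition :: "nat list \<Rightarrow> bool" where
  "is_partition l \<longleftrightarrow> sorted_wrt (\<ge>) l \<and> (\<forall>p\<in>set l. 0 < p)"

definition dual_partition :: "nat list \<Rightarrow> nat list" where
  "dual_partition l =
     (if l = [] then [] else map (\<lambda>i. card {j. j < length l \<and> i \<le> l ! j}) [1..<Suc (l ! 0)])"

definition partition_inv :: "nat list \<Rightarrow> nat \<Rightarrow> nat" where
  "partition_inv l j = (LEAST i. 1 \<le> i \<and> j \<le> sum_list (take i l))"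

section \<open>Elementary divisor vectors\<close>

definition companion :: "'a::comm_ring_1 poly \<Rightarrow> 'a mat" where
  "companion f = mat (degree f) (degree f) (\<lambda>(i, j).
     if Suc i = degree f then - coeff f j else if j = Suc i then 1 else 0)"

definition elementary_divisor_vector ::
    "'k::field_char_0 mat \<Rightarrow> ('k poly \<times> nat list) list \<Rightarrow> bool" where
  "elementary_divisor_vector A ed \<longleftrightarrow>
     distinct (map fst ed) \<and>
     (\<forall>(f, l)\<in>set ed. Polynomial.lead_coeff f = 1 \<and> Factorial_Ring.irreducible f \<and> is_partition l \<and> l \<noteq> []) \<and>
     similar_mat A
       (diag_block_mat (concat (map (\<lambda>(f, l). map (\<lambda>p. companion (f ^ p)) l) ed)))"

section \<open>Zeta functions of invariant submodules\<close>

definition free_module :: "('a, 'm) ring_scheme \<Rightarrow> nat \<Rightarrow> ('a, 'a vec) module" where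
  "free_module R n = \<lparr>
     carrier = {x \<in> carrier_vec n. \<forall>i<n. x $ i \<in> carrier R},
     monoid.mult = undefined,
     one = undefined,
     ring.zero = vec n (\<lambda>_. \<zero>\<^bsub>R\<^esub>),
     add = (\<lambda>x y. vec n (\<lambda>i. x $ i \<oplus>\<^bsub>R\<^esub> y $ i)),
     module.smult = (\<lambda>c x. vec n (\<lambda>i. c \<otimes>\<^bsub>R\<^esub> x $ i))\<rparr>"

definition integral_at :: "'k::field_char_0 mat \<Rightarrow> ('k \<Rightarrow> real) set \<Rightarrow> bool" where
  "integral_at A v \<longleftrightarrow> (\<forall>i<dim_row A. \<forall>j<dim_col A.
     to_completion base_field v (A $$ (i, j)) \<in> carrier (valuation_ring base_field v))"

text \<open>The row vector \<open>x A\<close>, for \<open>x\<close> over the valuation ring at \<open>v\<close> and \<open>A\<close> integral at \<open>v\<close>.\<close>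

definition row_action ::
    "'k::field_char_0 mat \<Rightarrow> ('k \<Rightarrow> real) set \<Rightarrow> (nat \<Rightarrow> 'k) set vec \<Rightarrow> (nat \<Rightarrow> 'k) set vec" where
  "row_action A v x = vec (dim_col A) (\<lambda>j.
     \<Oplus>\<^bsub>valuation_ring base_field v\<^esub> i \<in> {..<dim_row A}.
       x $ i \<otimes>\<^bsub>valuation_ring base_field v\<^esub> to_completion base_field v (A $$ (i, j)))"

definition num_invariant_submodules ::
    "'k::field_char_0 mat \<Rightarrow> ('k \<Rightarrow> real) set \<Rightarrow> nat \<Rightarrow> nat" where
  "num_invariant_submodules A v m =
     (let R = valuation_ring base_field v; M = free_module R (dim_row A) in
      card {N. submodule N R M \<and> (\<forall>x\<in>N. row_action A v x \<in> N) \<and> card (a_rcosets\<^bsub>M\<^esub> N) = m})"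

text \<open>
  \<open>Z\<close> is given by the Dirichlet series on some right half-plane and is meromorphic on the whole
  plane.  \<open>nicely_meromorphic_on\<close> fixes the value at poles to be \<open>0\<close> and removes removable
  singularities, so at most one \<open>Z\<close> has this property.
\<close>

definition is_zeta ::
    "'k::field_char_0 mat \<Rightarrow> ('k \<Rightarrow> real) set \<Rightarrow> (complex \<Rightarrow> complex) \<Rightarrow> bool" where
  "is_zeta A v Z \<longleftrightarrow> Z nicely_meromorphic_on UNIV \<and>
     (\<exists>\<sigma>::real. \<forall>s. Re s > \<sigma> \<longrightarrow>
       ((\<lambda>m. of_nat (num_invariant_submodules A v m) * of_nat m powr (- s)) has_sum Z s) {1..})"

text \<open>
  The explicit expression for the zeta function, with a free real parameter \<open>q\<close> in the places
  where the residue field size occurs; the residue degrees do not change with \<open>q\<close>.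
\<close>

definition zeta_expr ::
    "('k::field_char_0 poly \<times> nat list) list \<Rightarrow> ('k \<Rightarrow> real) set \<Rightarrow> real \<Rightarrow> complex \<Rightarrow> complex" where
  "zeta_expr ed v q s =
     (\<Prod>(f, l)\<leftarrow>ed. \<Prod>j = 1..sum_list l. \<Prod>w\<in>places_above f v.
        inverse (1 - of_real q powr (- (of_nat (residue_degree f w v) *
          (of_nat (partition_inv (dual_partition l) j) * s - of_nat j + 1)))))"

end

theory Submission
  imports Defs
begin

text \<open>
  For almost all \<open>v\<close>, reducing along a power of a uniformizer identifies the \<open>A\<close>-invariant lattices
  over the completion with the finite-index \<open>S\<close>-submodules \<open>N\<close> of \<open>M\<close> containing \<open>K\<close>, where
  \<open>S\<close> is the ring of polynomials with \<open>v\<close>-integral coefficients in \<open>k[X]\<close>, \<open>M\<close> is a free \<open>S\<close>-module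
  and \<open>K\<close> is generated by the elements \<open>f\<^sup>p\<close> on the axes, one for each block of \<open>A\<close>.

  Put \<open>M' = K + f M\<close>, so that \<open>M/M'\<close> is free over \<open>S/(f)\<close>, of rank \<open>m\<close> say.  For almost all \<open>v\<close> the
  ring \<open>S/(f)\<close> is a semilocal principal ideal domain, with one maximal ideal for each place of
  \<open>k[X]/(f)\<close> above \<open>v\<close>.  The map
  \<open>N \<mapsto> (N \<inter> M', N + M')\<close> has fibres of size \<open>0\<close> or \<open>(M' : (N \<inter> M') + f M')\<^sup>m\<close>, and for a given
  \<open>N \<inter> M'\<close> the sums \<open>N + M'\<close> that occur are all lattices between \<open>M'\<close> and a lattice that is
  again free of rank \<open>m\<close> modulo \<open>M'\<close>.  So each such step splits off \<open>m\<close> shifted zeta functions of \<open>S/(f)\<close> and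
  leaves a sum of the same shape over \<open>M'\<close>, with one weight shifted.  The ranks that occur for \<open>f\<close>
  are the parts of the dual partition; comaximality lets one treat the different \<open>f\<close> in turn.

  This gives the Euler product for large real \<open>s\<close>, hence everywhere by the identity theorem.  The
  functional equation is \<open>1/(1 - u) = - u\<^sup>-\<^sup>1/(1 - u\<^sup>-\<^sup>1)\<close> in each factor, where the residue degrees
  above \<open>v\<close> add up to the degree of \<open>f\<close>.
\<close>

section \<open>Cosets and indices\<close>

text \<open>The size of a fibre of the layer map depends on the lower member \<open>N1\<close>
  through a power of the index of \<open>N1 + f M'\<close>, so a bare lattice sum satisfies no
  recursion. The sums therefore carry a second exponent \<open>t\<close> on the index of
  \<open>N + f M\<close>, and a layer of rank \<open>m\<close> replaces it by
  \<open>m + t - s\<close>. Started at 0, it is the total rank already passed minus a multiple of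
  \<open>s\<close>; this is the origin of the arguments \<open>a s - j + 1\<close> in the Euler
  product, where \<open>a\<close> numbers the layers from 1 and \<open>j\<close> counts through
  their ranks. These sums are taken at real arguments in the extended non-negative reals, where
  rearrangement is free; finiteness is read off from the final product. Lattices are counted over
  the valuation ring inside \<open>k\<close>: the maximal ideals of \<open>S/(f)\<close> already see
  all places above \<open>v\<close>, and only density of \<open>k\<close> in the completion is used.
  Excluded are the places where an entry of \<open>A\<close> or of the matrices conjugating it to
  companion form, or a coefficient of some \<open>f\<close> or of a Bezout identity (for
  \<open>f\<close> and its derivative, or for two different \<open>f\<close>), is not
  integral.\<close>

definition sgp :: "'a::ab_group_add set \<Rightarrow> bool" where
  "sgp N \<longleftrightarrow> 0 \<in> N \<and> (\<forall>x\<in>N. \<forall>y\<in>N. x - y \<in> N)"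

definition coset :: "'a::ab_group_add set \<Rightarrow> 'a \<Rightarrow> 'a set" where
  "coset N x = {y. y - x \<in> N}"

text \<open>\<open>M\<close> is only a set. In the counting lemmas it is also the solution set of an
  affine condition, possibly empty, in which cosets of \<open>N\<close> are counted.\<close>

definition quo :: "'a::ab_group_add set \<Rightarrow> 'a set \<Rightarrow> 'a set set" where
  "quo M N = coset N ` M"

definition fin :: "'a::ab_group_add set \<Rightarrow> 'a set \<Rightarrow> bool" where
  "fin M N \<longleftrightarrow> finite (quo M N)"

definition idx :: "'a::ab_group_add set \<Rightarrow> 'a set \<Rightarrow> nat" where
  "idx M N = card (quo M N)"

definition sadd :: "'a::ab_group_add set \<Rightarrow> 'a set \<Rightarrow> 'a set" (infixl "\<uplus>" 65) where
  "A \<uplus> B = {a + b | a b. a \<in> A \<and> b \<in> B}"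

lemma sgp_0: "sgp N \<Longrightarrow> 0 \<in> N"
  by (simp add: sgp_def)

lemma sgp_diff: "sgp N \<Longrightarrow> x \<in> N \<Longrightarrow> y \<in> N \<Longrightarrow> x - y \<in> N"
  by (simp add: sgp_def)

lemma sgp_uminus: "sgp N \<Longrightarrow> x \<in> N \<Longrightarrow> - x \<in> N"
  using sgp_diff[of N 0 x] by (simp add: sgp_def)

lemma sgp_add: "sgp N \<Longrightarrow> x \<in> N \<Longrightarrow> y \<in> N \<Longrightarrow> x + y \<in> N"
  using sgp_diff[of N x "- y"] sgp_uminus[of N y] by simp

lemma sgp_swap: "sgp N \<Longrightarrow> x - y \<in> N \<longleftrightarrow> y - x \<in> N"
  using sgp_uminus[of N "x - y"] sgp_uminus[of N "y - x"] by auto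

lemma sgp_Int: "sgp N \<Longrightarrow> sgp L \<Longrightarrow> sgp (N \<inter> L)"
  by (simp add: sgp_def)

lemma saddI: "a \<in> A \<Longrightarrow> b \<in> B \<Longrightarrow> a + b \<in> A \<uplus> B"
  by (auto simp: sadd_def)

lemma saddE: assumes "x \<in> A \<uplus> B" obtains a b where "a \<in> A" "b \<in> B" "x = a + b"
  using assms by (auto simp: sadd_def)

lemma sgp_sadd: assumes "sgp N" "sgp L" shows "sgp (N \<uplus> L)"
  unfolding sgp_def
proof (intro conjI ballI)
  show "0 \<in> N \<uplus> L" using saddI[of 0 N 0 L] assms by (simp add: sgp_def)
  fix x y assume "x \<in> N \<uplus> L" "y \<in> N \<uplus> L"
  then obtain a b a' b' where *: "a \<in> N" "b \<in> L" "x = a + b" "a' \<in> N" "b' \<in> L" "y = a' + b'"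
    by (auto simp: sadd_def)
  have "x - y = (a - a') + (b - b')" using * by simp
  then show "x - y \<in> N \<uplus> L" using * assms by (metis saddI sgp_diff)
qed

lemma sadd_commute: "A \<uplus> B = B \<uplus> A"
  by (auto simp: sadd_def) (metis add.commute)+

lemma sadd_assoc: "A \<uplus> B \<uplus> C = A \<uplus> (B \<uplus> C)"
  by (auto simp: sadd_def) (metis add.assoc)+

lemma sadd_left: "sgp B \<Longrightarrow> A \<subseteq> A \<uplus> B"
  using saddI[of _ A 0 B] by (fastforce simp: sgp_def)

lemma sadd_right: "sgp A \<Longrightarrow> B \<subseteq> A \<uplus> B"
  using saddI[of 0 A _ B] by (fastforce simp: sgp_def)

lemma sadd_least: "sgp C \<Longrightarrow> A \<subseteq> C \<Longrightarrow> B \<subseteq> C \<Longrightarrow> A \<uplus> B \<subseteq> C"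
  by (auto simp: sadd_def intro: sgp_add)

lemma sadd_mono: "A \<subseteq> A' \<Longrightarrow> B \<subseteq> B' \<Longrightarrow> A \<uplus> B \<subseteq> A' \<uplus> B'"
  by (auto simp: sadd_def)

lemma sadd_absorb: "sgp C \<Longrightarrow> A \<subseteq> C \<Longrightarrow> sgp A \<Longrightarrow> A \<uplus> C = C"
  by (intro equalityI sadd_least sadd_right) auto

lemma modular:
  assumes "sgp M" "Q \<subseteq> M"
  shows "(N \<inter> M) \<uplus> Q = (N \<uplus> Q) \<inter> M"
proof (intro equalityI subsetI)
  fix x assume "x \<in> (N \<inter> M) \<uplus> Q"
  then show "x \<in> (N \<uplus> Q) \<inter> M" using assms by (auto simp: sadd_def intro: sgp_add)
next
  fix x assume x: "x \<in> (N \<uplus> Q) \<inter> M"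
  then obtain a b where ab: "a \<in> N" "b \<in> Q" "x = a + b" by (auto simp: sadd_def)
  have "a \<in> M" using sgp_diff[of M x b] x ab assms by auto
  then show "x \<in> (N \<inter> M) \<uplus> Q" using ab by (auto intro: saddI)
qed

lemma coset_eq_iff: assumes "sgp N" shows "coset N x = coset N y \<longleftrightarrow> x - y \<in> N"
proof
  assume "coset N x = coset N y"
  moreover have "x \<in> coset N x" using assms by (simp add: coset_def sgp_def)
  ultimately show "x - y \<in> N" by (simp add: coset_def)
next
  assume *: "x - y \<in> N"
  have "z - x \<in> N \<longleftrightarrow> z - y \<in> N" for z
    using sgp_add[OF assms _ *, of "z - x"] sgp_diff[OF assms _ *, of "z - y"] by auto
  then show "coset N x = coset N y" by (simp add: coset_def)
qed

text \<open>Quotients are images under a coset map, so any other map with the same fibres on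
  \<open>M\<close> computes the same index. Indices are compared in this way instead of through
  isomorphisms of quotients.\<close>

lemma image_equipotent:
  assumes "\<And>x y. x \<in> M \<Longrightarrow> y \<in> M \<Longrightarrow> a x = a y \<longleftrightarrow> b x = b y"
  shows "card (a ` M) = card (b ` M)" "finite (a ` M) \<longleftrightarrow> finite (b ` M)"
proof -
  have "bij_betw (\<lambda>C. b (inv_into M a C)) (a ` M) (b ` M)"
    unfolding bij_betw_def
  proof
    show "inj_on (\<lambda>C. b (inv_into M a C)) (a ` M)"
      by (rule inj_onI) (metis assms f_inv_into_f inv_into_into)
    have "b (inv_into M a (a x)) = b x" if "x \<in> M" for x
      using assms that by (metis f_inv_into_f imageI inv_into_into)
    then show "(\<lambda>C. b (inv_into M a C)) ` (a ` M) = b ` M" by (simp add: image_image)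
  qed
  then show "card (a ` M) = card (b ` M)" "finite (a ` M) \<longleftrightarrow> finite (b ` M)"
    by (auto simp: bij_betw_same_card bij_betw_finite)
qed

lemma idx_transfer:
  assumes "sgp N" "sgp N'"
    and "\<And>x. x \<in> M \<Longrightarrow> g x \<in> M'"
    and "\<And>x y. x \<in> M \<Longrightarrow> y \<in> M \<Longrightarrow> x - y \<in> N \<longleftrightarrow> g x - g y \<in> N'"
    and "\<And>z. z \<in> M' \<Longrightarrow> \<exists>x\<in>M. z - g x \<in> N'"
  shows "idx M N = idx M' N'" "fin M N \<longleftrightarrow> fin M' N'"
proof -
  have "quo M' N' = (\<lambda>x. coset N' (g x)) ` M"
    unfolding quo_def using assms(3,5) by (force simp: coset_eq_iff[OF assms(2)] image_iff)
  moreover have "quo M N = coset N ` M" by (simp add: quo_def)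
  moreover have "coset N x = coset N y \<longleftrightarrow> coset N' (g x) = coset N' (g y)" if "x \<in> M" "y \<in> M" for x y
    using that assms by (simp add: coset_eq_iff)
  ultimately show "idx M N = idx M' N'" "fin M N \<longleftrightarrow> fin M' N'"
    unfolding idx_def fin_def using image_equipotent[of M "coset N" "\<lambda>x. coset N' (g x)"] by simp_all
qed

text \<open>With a representative \<open>r\<close> chosen in every coset of \<open>L\<close>, the
  coset of \<open>x\<close> modulo \<open>L\<close> together with the coset of \<open>x - r\<close>
  modulo \<open>N\<close> separates exactly the cosets of \<open>N\<close>, and the pairs exhaust
  the product of the two quotients.\<close>

lemma idx_tower:
  assumes "sgp N" "sgp L" "sgp M" "N \<subseteq> L" "L \<subseteq> M"
  shows "idx M N = idx M L * idx L N" "fin M N \<longleftrightarrow> fin M L \<and> fin L N"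
proof -
  define r where "r C = (SOME x. x \<in> M \<and> coset L x = C)" for C
  have r: "r (coset L x) \<in> M" "x - r (coset L x) \<in> L" if "x \<in> M" for x
  proof -
    have "r (coset L x) \<in> M \<and> coset L (r (coset L x)) = coset L x"
      unfolding r_def by (rule someI[of _ x]) (use that in simp)
    then show "r (coset L x) \<in> M" "x - r (coset L x) \<in> L"
      using coset_eq_iff[OF assms(2)] sgp_swap[OF assms(2)] by blast+
  qed
  define h where "h x = (coset L x, coset N (x - r (coset L x)))" for x
  have "h ` M = quo M L \<times> quo L N"
  proof (intro equalityI subsetI)
    fix z assume "z \<in> h ` M"
    then show "z \<in> quo M L \<times> quo L N" using r by (auto simp: h_def quo_def)
  next
    fix z assume "z \<in> quo M L \<times> quo L N"
    then obtain x y where xy: "x \<in> M" "y \<in> L" "z = (coset L x, coset N y)" by (auto simp: quo_def)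
    let ?u = "r (coset L x) + y"
    have u: "?u \<in> M" using r(1)[OF xy(1)] xy assms by (blast intro: sgp_add)
    have "?u - x = y - (x - r (coset L x))" by simp
    then have "?u - x \<in> L" using r(2)[OF xy(1)] xy assms by (metis sgp_diff)
    then have "coset L ?u = coset L x" using coset_eq_iff[OF assms(2)] by blast
    then have "h ?u = z" using xy by (simp add: h_def)
    then show "z \<in> h ` M" using u by blast
  qed
  moreover have "coset N x = coset N y \<longleftrightarrow> h x = h y" if "x \<in> M" "y \<in> M" for x y
    using assms(4) by (auto simp: h_def coset_eq_iff[OF assms(1)] coset_eq_iff[OF assms(2)] in_mono)
      (metis (mono_tags, opaque_lifting) assms(2) coset_eq_iff diff_diff_eq2 diff_add_cancel subsetD)+
  ultimately have "card (quo M N) = card (quo M L \<times> quo L N)"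
      "finite (quo M N) \<longleftrightarrow> finite (quo M L \<times> quo L N)"
    unfolding quo_def[of M N] using image_equipotent[of M "coset N" h] by auto
  \<comment> \<open>Since neither factor is empty, finiteness of the product is finiteness of both
    factors.\<close>
  moreover have "quo M L \<noteq> {}" "quo L N \<noteq> {}"
    using assms by (auto simp: quo_def sgp_def)
  ultimately show "idx M N = idx M L * idx L N" "fin M N \<longleftrightarrow> fin M L \<and> fin L N"
    by (simp_all add: idx_def fin_def card_cartesian_product finite_cartesian_product_iff)
qed

lemma idx_second_iso:
  assumes "sgp N" "sgp L"
  shows "idx (N \<uplus> L) N = idx L (N \<inter> L)" "fin (N \<uplus> L) N \<longleftrightarrow> fin L (N \<inter> L)"
proof -
  have *: "idx L (N \<inter> L) = idx (N \<uplus> L) N" "fin L (N \<inter> L) \<longleftrightarrow> fin (N \<uplus> L) N"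
  proof -
    have 1: "x \<in> N \<uplus> L" if "x \<in> L" for x using sadd_right[OF assms(1)] that by blast
    have 2: "x - y \<in> N \<inter> L \<longleftrightarrow> x - y \<in> N" if "x \<in> L" "y \<in> L" for x y
      using that assms by (simp add: sgp_diff)
    have 3: "\<exists>x\<in>L. z - x \<in> N" if "z \<in> N \<uplus> L" for z
      using that by (auto simp: sadd_def intro!: bexI)
    show "idx L (N \<inter> L) = idx (N \<uplus> L) N" "fin L (N \<inter> L) \<longleftrightarrow> fin (N \<uplus> L) N"
      using idx_transfer[where g = "\<lambda>x. x", OF sgp_Int[OF assms] assms(1) 1 2 3] by blast+
  qed
  then show "idx (N \<uplus> L) N = idx L (N \<inter> L)" "fin (N \<uplus> L) N \<longleftrightarrow> fin L (N \<inter> L)" by simp_all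
qed

lemma idx_pos: "fin M N \<Longrightarrow> M \<noteq> {} \<Longrightarrow> 0 < idx M N"
  by (auto simp: fin_def idx_def quo_def card_gt_0_iff)

lemma idx_same: assumes "sgp N" shows "idx N N = 1" "fin N N"
proof -
  have "quo N N = {N}"
    using assms sgp_diff[OF assms] sgp_add[OF assms] sgp_0[OF assms]
    by (fastforce simp: quo_def coset_def image_iff)
  then show "idx N N = 1" "fin N N" by (simp_all add: idx_def fin_def)
qed

lemma idx_1D: assumes "sgp N" "0 \<in> M" "idx M N = 1" shows "M \<subseteq> N"
proof
  fix x assume "x \<in> M"
  moreover obtain C where "quo M N = {C}" using assms by (auto simp: idx_def card_Suc_eq)
  ultimately have "coset N x = coset N 0" using assms(2) unfolding quo_def by blast
  then show "x \<in> N" using coset_eq_iff[OF assms(1)] by fastforce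
qed

lemma fin_subset: "fin M N \<Longrightarrow> M' \<subseteq> M \<Longrightarrow> fin M' N"
  unfolding fin_def quo_def by (meson finite_subset image_mono)

lemma fin_mono:
  assumes "sgp N" "sgp L" "sgp M" "N \<subseteq> L" "L \<subseteq> M" "fin M N" shows "fin M L" "fin L N"
  using idx_tower(2)[OF assms(1-5)] assms(6) by auto

text \<open>An endomorphism of a finite group has kernel and cokernel of equal order: each of them,
  multiplied by the order of the image, gives the order of the group, here
  \<open>M/N\<close>.\<close>

lemma idx_kernel_cokernel:
  assumes "sgp N" "sgp M" "N \<subseteq> M" "fin M N"
    and add: "\<And>x y. g (x - y) = g x - (g y :: 'a::ab_group_add)"
    and gM: "\<And>x. x \<in> M \<Longrightarrow> g x \<in> M" and gN: "\<And>x. x \<in> N \<Longrightarrow> g x \<in> N"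
  shows "idx {t \<in> M. g t \<in> N} N = idx M (N \<uplus> g ` M)"
proof -
  let ?K = "{t \<in> M. g t \<in> N}"
  have g0: "g 0 = 0" using add[of 0 0] by simp
  have K: "sgp ?K" using assms by (auto simp: sgp_def g0 add)
  have gM': "sgp (g ` M)" unfolding sgp_def
    using assms(2) g0 by (auto simp: sgp_def add[symmetric] intro!: image_eqI[of _ g])
  have S: "sgp (N \<uplus> g ` M)" using assms gM' by (simp add: sgp_sadd)
  have NS: "N \<subseteq> N \<uplus> g ` M" by (rule sadd_left[OF gM'])
  have SM: "N \<uplus> g ` M \<subseteq> M" using assms by (intro sadd_least) auto
  have 1: "idx M N = idx M ?K * idx ?K N"
    using assms K gN by (intro idx_tower) auto
  have 2: "idx M N = idx M (N \<uplus> g ` M) * idx (N \<uplus> g ` M) N"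
    using assms S NS SM by (intro idx_tower) auto
  have 3: "idx M ?K = idx (N \<uplus> g ` M) N"
  proof (rule idx_transfer[where g = g])
    show "g x \<in> N \<uplus> g ` M" if "x \<in> M" for x
      using subsetD[OF sadd_right[OF assms(1)] imageI[OF that, of g]] .
    show "x - y \<in> ?K \<longleftrightarrow> g x - g y \<in> N" if "x \<in> M" "y \<in> M" for x y
      using sgp_diff[OF assms(2) that] by (simp add: add)
    show "\<exists>x\<in>M. z - g x \<in> N" if "z \<in> N \<uplus> g ` M" for z
      using that by (auto simp: sadd_def intro!: bexI)
  qed (use K assms in auto)
  have "M \<noteq> {}" using sgp_0[OF assms(2)] by blast
  then have "idx M ?K \<noteq> 0" using 1 idx_pos[OF assms(4)] by auto
  have cancel: "a * b = a * c \<Longrightarrow> a \<noteq> 0 \<Longrightarrow> b = c" for a b c :: nat by simp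
  show ?thesis
  proof (rule cancel)
    show "idx M ?K * idx ?K N = idx M ?K * idx M (N \<uplus> g ` M)"
      unfolding 1[symmetric] 2 unfolding 3 by (rule mult.commute)
  qed (fact \<open>idx M ?K \<noteq> 0\<close>)
qed

section \<open>Sums of extended non-negative reals over arbitrary sets\<close>

abbreviation esum :: "'a set \<Rightarrow> ('a \<Rightarrow> ennreal) \<Rightarrow> ennreal" where
  "esum U h \<equiv> nn_integral (count_space U) h"

lemma esum_cong: "(\<And>x. x \<in> U \<Longrightarrow> h x = h' x) \<Longrightarrow> esum U h = esum U h'"
  by (rule nn_integral_cong) simp

lemma esum_indicator: "esum U h = esum UNIV (\<lambda>x. h x * indicator U x)"
  by (simp add: nn_integral_count_space_indicator)

text \<open>Tonelli for the counting measure on pairs, applied to the indicator of the graph of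
  \<open>p\<close>. The sets may have any cardinality, which suits sums over lattices.\<close>

lemma esum_fibres:
  assumes "\<And>x. x \<in> U \<Longrightarrow> p x \<in> Y"
  shows "esum U h = esum Y (\<lambda>y. esum {x \<in> U. p x = y} h)"
proof -
  let ?f = "\<lambda>x y. h x * indicator {x. x \<in> U \<and> p x = y} x"
  have "esum Y (\<lambda>y. esum {x \<in> U. p x = y} h) = esum Y (\<lambda>y. esum UNIV (\<lambda>x. ?f x y))"
    by (simp add: esum_indicator[of "{x \<in> U. p x = _}"])
  also have "\<dots> = esum UNIV (\<lambda>y. esum UNIV (\<lambda>x. ?f x y))"
  proof (rule nn_integral_count_space_eq)
    fix y assume "y \<in> UNIV - Y"
    then have "?f x y = 0" for x using assms by (auto simp: indicator_def)
    then show "esum UNIV (\<lambda>x. ?f x y) = 0" by (simp only: nn_integral_const) simp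
  qed auto
  also have "\<dots> = esum UNIV (\<lambda>x. esum UNIV (\<lambda>y. ?f x y))"
    using nn_integral_fst_count_space[of "\<lambda>(y, x). ?f x y"]
      nn_integral_snd_count_space[of "\<lambda>(y, x). ?f x y"] by simp
  also have "\<dots> = esum UNIV (\<lambda>x. h x * indicator U x)"
  proof (intro nn_integral_cong)
    fix x
    show "esum UNIV (\<lambda>y. ?f x y) = h x * indicator U x"
      by (subst nn_integral_count_space'[of "{p x}"]) (auto simp: indicator_def)
  qed
  also have "\<dots> = esum U h"
    by (simp add: esum_indicator[of U])
  finally show ?thesis by simp
qed

lemma esum_const_fibres:
  assumes "\<And>x. x \<in> U \<Longrightarrow> p x \<in> Y"
    and "\<And>y. y \<in> Y \<Longrightarrow> finite {x \<in> U. p x = y}"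
  shows "esum U (\<lambda>x. h (p x)) = esum Y (\<lambda>y. of_nat (card {x \<in> U. p x = y}) * h y)"
proof -
  have "esum {x \<in> U. p x = y} (\<lambda>x. h (p x)) = of_nat (card {x \<in> U. p x = y}) * h y"
    if "y \<in> Y" for y
    using assms(2)[OF that] by (simp add: nn_integral_count_space_finite)
  then show ?thesis
    by (subst esum_fibres[of U p Y]) (auto intro!: esum_cong simp: assms(1))
qed

lemma esum_bij: "bij_betw g U Y \<Longrightarrow> esum U (\<lambda>x. h (g x)) = esum Y h"
  by (rule nn_integral_bij_count_space)

lemma esum_Times:
  "esum (U \<times> Y) (\<lambda>z. h (fst z) (snd z)) = esum U (\<lambda>x. esum Y (h x))"
proof -
  have "esum (U \<times> Y) (\<lambda>z. h (fst z) (snd z)) =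
     esum U (\<lambda>x. esum {z \<in> U \<times> Y. fst z = x} (\<lambda>z. h (fst z) (snd z)))"
    by (rule esum_fibres) auto
  also have "\<dots> = esum U (\<lambda>x. esum Y (h x))"
  proof (rule esum_cong)
    fix x assume "x \<in> U"
    then have "bij_betw (\<lambda>y. (x, y)) Y {z \<in> U \<times> Y. fst z = x}"
      by (auto simp: bij_betw_def inj_on_def)
    from esum_bij[OF this, of "\<lambda>z. h (fst z) (snd z)"]
    show "esum {z \<in> U \<times> Y. fst z = x} (\<lambda>z. h (fst z) (snd z)) = esum Y (h x)" by simp
  qed
  finally show ?thesis .
qed

lemma esum_cmult: "esum U (\<lambda>x. c * h x) = c * esum U h"
  by (rule nn_integral_cmult) simp

lemma esum_multc: "esum U (\<lambda>x. h x * c) = esum U h * c"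
  by (rule nn_integral_multc) simp

lemma esum_singleton: "esum {x} h = h x"
  by (simp add: nn_integral_count_space_finite)

text \<open>The term of a Dirichlet series at a real argument. Multiplicities are themselves weights
  of negative exponent, which is how the size of a fibre becomes a shift of \<open>s\<close>. At
  index 0, the value of \<open>card\<close> for an infinite quotient, the weight is 0.\<close>

definition wt :: "real \<Rightarrow> nat \<Rightarrow> ennreal" where
  "wt s m = ennreal (real m powr (- s))"

lemma wt_mult: "wt s (m * n) = wt s m * wt s n"
  by (simp add: wt_def powr_mult flip: ennreal_mult)

lemma wt_1 [simp]: "wt s (Suc 0) = 1" "wt s 1 = 1"
  by (simp_all add: wt_def)

lemma wt_add: "0 < m \<Longrightarrow> wt (s + t) m = wt s m * wt t m"
  by (simp add: wt_def flip: ennreal_mult powr_add)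

lemma of_nat_wt: "0 < m \<Longrightarrow> of_nat m = wt (-1) m"
  by (simp add: wt_def ennreal_of_nat_eq_real_of_nat)

lemma of_nat_power_wt: "0 < m \<Longrightarrow> of_nat (m ^ k) = wt (- real k) m"
  by (simp add: wt_def ennreal_of_nat_eq_real_of_nat powr_realpow)

section \<open>Counting submodules layer by layer\<close>

text \<open>Scalars come from the whole ring, while submodules are closed under \<open>S\<close>
  only. In the application the ring is \<open>k[X]\<close>: irreducibility and divisibility live
  there, lattices live over \<open>S\<close>.\<close>

locale subring_module = Modules.module scale
  for scale :: "'r::comm_ring_1 \<Rightarrow> 'v::ab_group_add \<Rightarrow> 'v" (infixr "*.." 75) +
  fixes S :: "'r set"
  assumes S_0: "0 \<in> S" and S_1: "1 \<in> S"
    and S_diff: "x \<in> S \<Longrightarrow> y \<in> S \<Longrightarrow> x - y \<in> S"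
    and S_mult: "x \<in> S \<Longrightarrow> y \<in> S \<Longrightarrow> x * y \<in> S"
begin

definition sub :: "'v set \<Rightarrow> bool" where
  "sub N \<longleftrightarrow> sgp N \<and> (\<forall>c\<in>S. \<forall>x\<in>N. c *.. x \<in> N)"

definition spn :: "'v \<Rightarrow> 'v set" where
  "spn b = (\<lambda>c. c *.. b) ` S"

text \<open>The finite-index ideals of \<open>S/(f)\<close>, represented by their preimages in
  \<open>S\<close>.\<close>

definition ideals :: "'r \<Rightarrow> 'r set set" where
  "ideals f = {J. J \<subseteq> S \<and> f \<in> J \<and> sgp J \<and> (\<forall>c\<in>S. \<forall>x\<in>J. c * x \<in> J) \<and> fin S J}"

text \<open>Every finite-index ideal of \<open>S/(f)\<close> is generated by a single non-zero-divisor.\<close>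

definition pid :: "'r \<Rightarrow> bool" where
  "pid f \<longleftrightarrow> (\<forall>J\<in>ideals f. \<exists>a\<in>J. J = {c * a + d * f | c d. c \<in> S \<and> d \<in> S} \<and>
     (\<forall>c\<in>S. c * a \<in> (*) f ` S \<longrightarrow> c \<in> (*) f ` S))"

definition ideal_zeta :: "'r \<Rightarrow> real \<Rightarrow> ennreal" where
  "ideal_zeta f s = esum (ideals f) (\<lambda>J. wt s (idx S J))"

definition lattices :: "'v set \<Rightarrow> 'v set \<Rightarrow> 'v set set" where
  "lattices K M = {N. sub N \<and> K \<subseteq> N \<and> N \<subseteq> M \<and> fin M N}"

text \<open>\<open>free f L m N\<close>: the quotient \<open>N/L\<close> is a free \<open>S/(f)\<close>-module of rank \<open>m\<close>.\<close>

inductive free :: "'r \<Rightarrow> 'v set \<Rightarrow> nat \<Rightarrow> 'v set \<Rightarrow> bool" for f L where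
  free_0: "free f L 0 L"
| free_Suc: "free f L m Q \<Longrightarrow> f *.. b \<in> L \<Longrightarrow> (\<And>c. c \<in> S \<Longrightarrow> c *.. b \<in> Q \<Longrightarrow> c \<in> (*) f ` S) \<Longrightarrow>
    free f L (Suc m) (Q \<uplus> spn b)"

section \<open>Submodules over the subring\<close>

lemma S_uminus: "x \<in> S \<Longrightarrow> - x \<in> S"
  using S_diff[of 0 x] S_0 by simp

lemma S_add: "x \<in> S \<Longrightarrow> y \<in> S \<Longrightarrow> x + y \<in> S"
  using S_diff[of x "- y"] S_uminus by simp

lemma sgp_S: "sgp S"
  by (simp add: sgp_def S_0 S_diff)

lemma sub_sgp: "sub N \<Longrightarrow> sgp N"
  by (simp add: sub_def)

lemma sub_scale: "sub N \<Longrightarrow> c \<in> S \<Longrightarrow> x \<in> N \<Longrightarrow> c *.. x \<in> N"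
  by (simp add: sub_def)

lemma sub_Int: "sub N \<Longrightarrow> sub L \<Longrightarrow> sub (N \<inter> L)"
  by (simp add: sub_def sgp_Int)

lemma sub_sadd: "sub N \<Longrightarrow> sub L \<Longrightarrow> sub (N \<uplus> L)"
  unfolding sub_def by (auto simp: sgp_sadd scale_right_distrib intro!: saddI elim!: saddE)

lemma sub_spn: "sub (spn b)"
  unfolding sub_def sgp_def spn_def
proof (intro conjI ballI)
  show "0 \<in> (\<lambda>c. c *.. b) ` S" using S_0 by (auto intro: image_eqI[of _ _ 0])
qed (auto simp: scale_left_diff_distrib[symmetric] intro: S_diff S_mult)

lemma spn_self: "b \<in> spn b"
  unfolding spn_def using S_1 by (auto intro: image_eqI[of _ _ 1])

lemma spn_least: "sub N \<Longrightarrow> b \<in> N \<Longrightarrow> spn b \<subseteq> N"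
  by (auto simp: spn_def sub_scale)

lemma sub_image: assumes "sub M" shows "sub ((*..) f ` M)"
  unfolding sub_def sgp_def
proof (intro conjI ballI)
  show "0 \<in> (*..) f ` M" using sgp_0[OF sub_sgp[OF assms]] by (auto intro: image_eqI[of _ _ 0])
next
  fix x y assume "x \<in> (*..) f ` M" "y \<in> (*..) f ` M"
  then show "x - y \<in> (*..) f ` M"
    by (auto simp: scale_right_diff_distrib[symmetric] intro!: imageI sgp_diff[OF sub_sgp[OF assms]])
next
  fix c x assume c: "c \<in> S" and "x \<in> (*..) f ` M"
  then obtain y where "y \<in> M" "x = f *.. y" by blast
  then show "c *.. x \<in> (*..) f ` M"
    using c by (intro image_eqI[of _ _ "c *.. y"]) (auto simp: sub_scale[OF assms] mult.commute)
qed

lemma free_sub: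
  assumes "free f L m N" "sub L" "f \<in> S"
  shows "sub N" "L \<subseteq> N" "\<And>x. x \<in> N \<Longrightarrow> f *.. x \<in> L"
  using assms
proof (induction rule: free.induct)
  case (free_Suc m Q b)
  { case 1 then show ?case using free_Suc by (simp add: sub_sadd sub_spn) }
  { case 2 then show ?case using free_Suc sadd_left[OF sub_sgp[OF sub_spn]] by blast }
  { case (3 x)
    then obtain y c where *: "y \<in> Q" "c \<in> S" "x = y + c *.. b" by (auto simp: sadd_def spn_def)
    then have "f *.. x = f *.. y + c *.. (f *.. b)" by (simp add: scale_right_distrib mult.commute)
    moreover have "f *.. y \<in> L" using * 3 free_Suc by blast
    moreover have "c *.. (f *.. b) \<in> L"
      by (rule sub_scale[OF 3(2) \<open>c \<in> S\<close>]) (use free_Suc in simp)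
    ultimately show ?case using 3 by (simp only: sgp_add sub_sgp) }
qed (auto simp: sub_scale)

text \<open>
  The submodules \<open>N\<close> with prescribed intersection \<open>L\<close> with \<open>Q\<close> and prescribed sum with \<open>Q\<close>
  are the \<open>L + S(b + t)\<close>, where \<open>t\<close> is determined modulo \<open>L\<close>.
\<close>

lemma extension_count:
  assumes L: "sub L" and Q: "sub Q" and LQ: "L \<subseteq> Q"
    and b: "\<And>c. c \<in> S \<Longrightarrow> c *.. b \<in> Q \<Longrightarrow> c \<in> (*) f ` S" "f *.. b \<in> Q" and f: "f \<in> S"
  defines "U \<equiv> {N. sub N \<and> N \<inter> Q = L \<and> N \<uplus> Q = Q \<uplus> spn b}"
    and "T \<equiv> {t \<in> Q. f *.. (b + t) \<in> L}"
  shows "card U = idx T L" "finite U \<longleftrightarrow> fin T L" and "U = (\<lambda>t. L \<uplus> spn (b + t)) ` T"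
proof -
  let ?N = "\<lambda>t. L \<uplus> spn (b + t)"
  have subN: "sub (?N t)" for t using L by (simp add: sub_sadd sub_spn)
  have bN: "b + t \<in> ?N t" for t
    using sadd_right[OF sub_sgp[OF L]] spn_self by blast
  have LN: "L \<subseteq> ?N t" for t using sadd_left[OF sub_sgp[OF sub_spn]] .
  have NQ: "?N t \<inter> Q = L" if "t \<in> T" for t
  proof (intro equalityI subsetI)
    fix x assume x: "x \<in> ?N t \<inter> Q"
    then obtain y c where *: "y \<in> L" "c \<in> S" "x = y + c *.. (b + t)" by (auto simp: sadd_def spn_def)
    have tQ: "t \<in> Q" using that by (simp add: T_def)
    have "c *.. b = (x - y) - c *.. t" using * by (simp add: scale_right_distrib)
    then have "c *.. b \<in> Q"
      using x *(1,2) LQ tQ Q by (simp only: sgp_diff sub_sgp sub_scale subsetD IntD2)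
    then obtain d where "d \<in> S" "c = f * d" using b(1) *(2) by blast
    then have "c *.. (b + t) = d *.. (f *.. (b + t))" by (simp add: mult.commute)
    moreover have "d *.. (f *.. (b + t)) \<in> L"
      by (rule sub_scale[OF L \<open>d \<in> S\<close>]) (use that in \<open>simp add: T_def\<close>)
    ultimately have "c *.. (b + t) \<in> L" by simp
    then show "x \<in> L" using * L by (auto intro: sgp_add sub_sgp)
  qed (use LN LQ in auto)
  have sum: "?N t \<uplus> Q = Q \<uplus> spn b" if "t \<in> T" for t
  proof -
    have tQ: "t \<in> Q" using that by (simp add: T_def)
    have s1: "sub (?N t \<uplus> Q)" "sub (Q \<uplus> spn b)" using subN Q by (simp_all add: sub_sadd sub_spn)
    have Q1: "Q \<subseteq> ?N t \<uplus> Q" using sadd_right[OF sub_sgp[OF subN]] .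
    have "b + t \<in> ?N t \<uplus> Q" using bN[of t] sadd_left[OF sub_sgp[OF Q]] by blast
    then have "b \<in> ?N t \<uplus> Q" using sgp_diff[OF sub_sgp[OF s1(1)], of "b + t" t] Q1 tQ by auto
    then have 2: "Q \<uplus> spn b \<subseteq> ?N t \<uplus> Q"
      using s1 Q1 by (intro sadd_least sub_sgp spn_least)
    have 3: "Q \<subseteq> Q \<uplus> spn b" using sadd_left[OF sub_sgp[OF sub_spn]] .
    have "b \<in> Q \<uplus> spn b" using sadd_right[OF sub_sgp[OF Q]] spn_self by blast
    then have "b + t \<in> Q \<uplus> spn b" using sgp_add[OF sub_sgp[OF s1(2)]] 3 tQ by blast
    then have "?N t \<uplus> Q \<subseteq> Q \<uplus> spn b"
      using s1 3 LQ by (intro sadd_least sub_sgp spn_least) auto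
    then show ?thesis using 2 by blast
  qed
  show eq: "U = ?N ` T"
  proof (intro equalityI subsetI)
    fix N assume "N \<in> U"
    then have N: "sub N" "N \<inter> Q = L" "N \<uplus> Q = Q \<uplus> spn b" by (auto simp: U_def)
    have "b \<in> N \<uplus> Q" using N(3) sadd_right[OF sub_sgp[OF Q]] spn_self by blast
    then obtain n q where nq: "n \<in> N" "q \<in> Q" "b = n + q" by (rule saddE)
    define t where "t = - q"
    have t: "t \<in> Q" "b + t \<in> N" using nq sgp_uminus[OF sub_sgp[OF Q]] by (auto simp: t_def)
    have "f *.. (b + t) \<in> N \<inter> Q"
    proof
      show "f *.. (b + t) \<in> N" by (rule sub_scale[OF N(1) f t(2)])
      show "f *.. (b + t) \<in> Q" unfolding scale_right_distrib
        by (intro sgp_add sub_sgp[OF Q] b(2) sub_scale[OF Q f] t)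
    qed
    then have T: "t \<in> T" using t N by (simp add: T_def)
    have "?N t \<subseteq> N" using N t by (intro sadd_least sub_sgp spn_least) auto
    moreover have "N \<subseteq> ?N t"
    proof
      fix x assume x: "x \<in> N"
      then have "x \<in> Q \<uplus> spn b" using N(3) sadd_left[OF sub_sgp[OF Q]] by blast
      then obtain y c where *: "y \<in> Q" "c \<in> S" "x = y + c *.. b" by (auto simp: sadd_def spn_def)
      have "x - c *.. (b + t) \<in> N" using x t *(2) N(1) by (intro sgp_diff sub_sgp sub_scale)
      moreover have "x - c *.. (b + t) = y - c *.. t" using * by (simp add: scale_right_distrib)
      moreover have "y - c *.. t \<in> Q" using * t Q by (intro sgp_diff sub_sgp sub_scale)
      ultimately have "x - c *.. (b + t) \<in> L" using N(2) by auto
      moreover have "c *.. (b + t) \<in> spn (b + t)" using * by (simp add: spn_def)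
      ultimately have "(x - c *.. (b + t)) + c *.. (b + t) \<in> ?N t" by (rule saddI)
      then show "x \<in> ?N t" by simp
    qed
    ultimately show "N \<in> ?N ` T" using T by blast
  next
    fix N assume "N \<in> ?N ` T"
    then show "N \<in> U" using NQ sum subN by (auto simp: U_def)
  qed
  have inj: "?N t = ?N t' \<longleftrightarrow> coset L t = coset L t'" if "t \<in> T" "t' \<in> T" for t t'
  proof
    assume eq: "?N t = ?N t'"
    have "(b + t) - (b + t') \<in> ?N t" using bN[of t] bN[of t'] eq sgp_diff[OF sub_sgp[OF subN]] by metis
    then have "t - t' \<in> ?N t" by simp
    moreover have "t - t' \<in> Q" using that sgp_diff[OF sub_sgp[OF Q]] by (auto simp: T_def)
    ultimately show "coset L t = coset L t'" using NQ[OF that(1)] coset_eq_iff[OF sub_sgp[OF L]] by blast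
  next
    assume "coset L t = coset L t'"
    then have *: "t - t' \<in> L" "t' - t \<in> L"
      using coset_eq_iff[OF sub_sgp[OF L]] sgp_swap[OF sub_sgp[OF L]] by blast+
    have le: "?N u \<subseteq> ?N u'" if "u - u' \<in> L" for u u'
    proof -
      have "(u - u') + (b + u') \<in> ?N u'" using LN bN that sgp_add[OF sub_sgp[OF subN]] by blast
      then have "b + u \<in> ?N u'" by (simp add: algebra_simps)
      then show ?thesis using LN subN by (intro sadd_least sub_sgp spn_least)
    qed
    show "?N t = ?N t'" using le * by blast
  qed
  show "card U = idx T L" "finite U \<longleftrightarrow> fin T L"
    unfolding eq idx_def fin_def quo_def using image_equipotent[OF inj, of T] by simp_all
qed

text \<open>A non-empty solution set is a translate of the kernel of \<open>f\<close> on
  \<open>Q/L\<close>, which has as many elements as the cokernel. It is non-empty exactly if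
  \<open>f *.. b\<close> vanishes in the cokernel.\<close>

lemma idx_solutions:
  assumes L: "sub L" and Q: "sub Q" and LQ: "L \<subseteq> Q" and f: "f \<in> S" and fin: "fin Q L"
  shows "idx {t \<in> Q. f *.. (b + t) \<in> L} L =
    (if f *.. b \<in> L \<uplus> (*..) f ` Q then idx Q (L \<uplus> (*..) f ` Q) else 0)"
proof (cases "f *.. b \<in> L \<uplus> (*..) f ` Q")
  case True
  then obtain l q where lq: "l \<in> L" "q \<in> Q" "f *.. b = l + f *.. q" by (auto simp: sadd_def)
  have "idx {t \<in> Q. f *.. (b + t) \<in> L} L = idx {t \<in> Q. f *.. t \<in> L} L"
  proof (rule idx_transfer[where g = "\<lambda>t. t + q"])
    fix t assume t: "t \<in> {t \<in> Q. f *.. (b + t) \<in> L}"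
    then have "f *.. (b + t) - l \<in> L" using lq sgp_diff[OF sub_sgp[OF L]] by blast
    moreover have "f *.. (b + t) - l = f *.. (t + q)"
      using lq by (simp add: scale_right_distrib add.commute)
    ultimately show "t + q \<in> {t \<in> Q. f *.. t \<in> L}"
      using t lq sgp_add[OF sub_sgp[OF Q]] by auto
  next
    fix z assume z: "z \<in> {t \<in> Q. f *.. t \<in> L}"
    have "f *.. (b + (z - q)) = l + f *.. z"
      using lq by (simp add: scale_right_distrib scale_right_diff_distrib)
    then have "z - q \<in> {t \<in> Q. f *.. (b + t) \<in> L}"
      using z lq sgp_add[OF sub_sgp[OF L]] sgp_diff[OF sub_sgp[OF Q]] by auto
    then show "\<exists>x\<in>{t \<in> Q. f *.. (b + t) \<in> L}. z - (x + q) \<in> L"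
      using sgp_0[OF sub_sgp[OF L]] by (intro bexI[of _ "z - q"]) auto
  qed (use L in \<open>auto simp: sub_sgp\<close>)
  also have "\<dots> = idx Q (L \<uplus> (*..) f ` Q)"
    using L Q LQ f fin by (intro idx_kernel_cokernel) (auto simp: sub_sgp sub_scale scale_right_diff_distrib)
  finally show ?thesis using True by simp
next
  case False
  have "f *.. (b + t) \<notin> L" if "t \<in> Q" for t
  proof
    assume "f *.. (b + t) \<in> L"
    then have "f *.. (b + t) + f *.. (- t) \<in> L \<uplus> (*..) f ` Q"
      using that sgp_uminus[OF sub_sgp[OF Q]] by (intro saddI imageI)
    then show False using False by (simp add: scale_right_distrib)
  qed
  then have "quo {t \<in> Q. f *.. (b + t) \<in> L} L = {}" by (auto simp: quo_def)
  then show ?thesis using False by (simp add: idx_def)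
qed

section \<open>Lattices with free quotient\<close>

lemma lattices_sub:
  assumes "N \<in> lattices K M" shows "sub N" "sgp N" "K \<subseteq> N" "N \<subseteq> M" "fin M N"
  using assms by (auto simp: lattices_def sub_sgp)

lemma ideals_D:
  assumes "J \<in> ideals f"
  shows "J \<subseteq> S" "f \<in> J" "sgp J" "\<And>c x. c \<in> S \<Longrightarrow> x \<in> J \<Longrightarrow> c * x \<in> J" "fin S J" "0 < idx S J"
  using assms S_0 idx_pos[of S J] by (auto simp: ideals_def)

text \<open>As \<open>P\<close> contains \<open>Q\<close>, sending \<open>c\<close> to
  \<open>c *.. b\<close> identifies \<open>S\<close> modulo the ideal of coefficients with
  \<open>Q \<uplus> spn b\<close> modulo \<open>P\<close>.\<close>

lemma idx_coeff_ideal: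
  assumes Q: "sub Q" and P: "sub P" "Q \<subseteq> P"
  shows "idx S {c \<in> S. c *.. b \<in> P} = idx (Q \<uplus> spn b) P"
    "fin S {c \<in> S. c *.. b \<in> P} \<longleftrightarrow> fin (Q \<uplus> spn b) P"
proof -
  have 0: "sgp {c \<in> S. c *.. b \<in> P}"
    using sub_sgp[OF P(1)] by (auto simp: sgp_def S_0 S_diff scale_left_diff_distrib)
  have 1: "c *.. b \<in> Q \<uplus> spn b" if "c \<in> S" for c
    using saddI[OF sgp_0[OF sub_sgp[OF Q]], of "c *.. b" "spn b"] that by (auto simp: spn_def)
  have 2: "x - y \<in> {c \<in> S. c *.. b \<in> P} \<longleftrightarrow> x *.. b - y *.. b \<in> P" if "x \<in> S" "y \<in> S" for x y
    using that by (auto simp: S_diff scale_left_diff_distrib)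
  have 3: "\<exists>c\<in>S. z - c *.. b \<in> P" if "z \<in> Q \<uplus> spn b" for z
  proof -
    obtain q c where "q \<in> Q" "c \<in> S" "z = q + c *.. b" using \<open>z \<in> Q \<uplus> spn b\<close> by (auto simp: sadd_def spn_def)
    then show ?thesis using P(2) by (intro bexI[of _ c]) auto
  qed
  show "idx S {c \<in> S. c *.. b \<in> P} = idx (Q \<uplus> spn b) P"
    "fin S {c \<in> S. c *.. b \<in> P} \<longleftrightarrow> fin (Q \<uplus> spn b) P"
    using idx_transfer[OF 0 sub_sgp[OF P(1)] 1 2 3] by blast+
qed

text \<open>The count by Hermite normal forms. A lattice in \<open>Q \<uplus> spn b\<close> amounts
  to its intersection with \<open>Q\<close>, its ideal of \<open>b\<close>-coefficients with
  generator \<open>a\<close>, and the off-diagonal part of a vector with leading coefficient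
  \<open>a\<close>, which is arbitrary modulo the intersection. The last choice shifts
  \<open>s\<close> by 1 in the sum over \<open>Q\<close>. Since \<open>a\<close> is no zero divisor
  modulo \<open>f\<close>, the lattice is again free of the same rank.\<close>

lemma free_lattices:
  assumes f: "f \<in> S" "pid f" and L: "sub L" and free: "free f L m M"
  shows "N \<in> lattices L M \<Longrightarrow> free f L m N"
    and "esum (lattices L M) (\<lambda>N. wt s (idx M N)) = (\<Prod>j<m. ideal_zeta f (s - real j))"
  using free
proof (induction arbitrary: N s rule: free.induct)
  case free_0
  have eq: "lattices L L = {L}"
    using L idx_same[OF sub_sgp[OF L]] by (auto simp: lattices_def)
  { case 1 then show ?case using eq free.free_0 by auto }
  { case 2 show ?case unfolding eq esum_singleton using idx_same[OF sub_sgp[OF L]] by simp }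
next
  case (free_Suc m Q b)
  let ?M = "Q \<uplus> spn b" and ?cf = "\<lambda>N. {c \<in> S. c *.. b \<in> N \<uplus> Q}"
    and ?fib = "\<lambda>N1 a. {N. sub N \<and> N \<inter> Q = N1 \<and> N \<uplus> Q = Q \<uplus> spn (a *.. b)}"
  have Q: "sub Q" "L \<subseteq> Q" "\<And>x. x \<in> Q \<Longrightarrow> f *.. x \<in> L"
    using free_sub[OF free_Suc.hyps(1) L f(1)] by blast+
  have M: "sub ?M" using Q by (simp add: sub_sadd sub_spn)
  have QM: "Q \<subseteq> ?M" using sadd_left[OF sub_sgp[OF sub_spn]] .
  have bM: "b \<in> ?M" using sadd_right[OF sub_sgp[OF Q(1)]] spn_self by blast
  have fb: "f *.. b \<in> Q" using free_Suc.hyps(2) Q by blast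
  have idx1: "idx ?M N = idx S (?cf N) * idx Q (N \<inter> Q)"
      "fin ?M N \<longleftrightarrow> fin S (?cf N) \<and> fin Q (N \<inter> Q)" if N: "sub N" "N \<subseteq> ?M" for N
  proof -
    have s: "sub (N \<uplus> Q)" using N Q by (simp add: sub_sadd)
    have i: "N \<subseteq> N \<uplus> Q" "Q \<subseteq> N \<uplus> Q" "N \<uplus> Q \<subseteq> ?M"
      using sadd_left[OF sub_sgp[OF Q(1)]] sadd_right[OF sub_sgp[OF N(1)]]
        sadd_least[OF sub_sgp[OF M] N(2) QM] by blast+
    show "idx ?M N = idx S (?cf N) * idx Q (N \<inter> Q)"
      "fin ?M N \<longleftrightarrow> fin S (?cf N) \<and> fin Q (N \<inter> Q)"
      using idx_tower[of N "N \<uplus> Q" ?M] idx_coeff_ideal[OF Q(1) s i(2), of b]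
        idx_second_iso[of N Q] N s M Q i by (simp_all add: sub_sgp)
  qed
  have cf: "?cf N \<in> ideals f" and NQ: "N \<inter> Q \<in> lattices L Q" if N: "N \<in> lattices L ?M" for N
  proof -
    have s: "sub (N \<uplus> Q)" using lattices_sub[OF N] Q by (simp add: sub_sadd)
    have "fin S (?cf N)" "fin Q (N \<inter> Q)" using idx1[of N] lattices_sub[OF N] by simp_all
    moreover have "sgp (?cf N)"
      using sub_sgp[OF s] by (auto simp: sgp_def S_0 S_diff scale_left_diff_distrib)
    moreover have "f *.. b \<in> N \<uplus> Q" using fb sadd_right[OF lattices_sub(2)[OF N]] by blast
    moreover have "(c * x) *.. b \<in> N \<uplus> Q" if "c \<in> S" "x *.. b \<in> N \<uplus> Q" for c x
      using sub_scale[OF s that] by simp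
    ultimately show "?cf N \<in> ideals f" "N \<inter> Q \<in> lattices L Q"
      using f S_mult Q lattices_sub[OF N] by (auto simp: ideals_def lattices_def sub_Int)
  qed
  \<comment> \<open>Modulo \<open>Q\<close> the lattice is \<open>J b\<close> with
    \<open>J = (a, f)\<close>, and \<open>f b\<close> lies in \<open>Q\<close>. So fixing
    \<open>J\<close> is the same as fixing \<open>N \<uplus> Q\<close> to be generated by
    \<open>Q\<close> and \<open>a b\<close>.\<close>
  have fibre: "{N \<in> lattices L ?M. (N \<inter> Q, ?cf N) = (N1, J)} =
        ?fib N1 a"
    if N1: "N1 \<in> lattices L Q" and J: "J \<in> ideals f" and a: "a \<in> J"
      "J = {c * a + d * f | c d. c \<in> S \<and> d \<in> S}" for N1 J a
  proof -
    have aS: "a \<in> S" using a ideals_D(1)[OF J] by blast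
    have main: "N \<uplus> Q = Q \<uplus> spn (a *.. b)" if N: "sub N" "N \<subseteq> ?M" "?cf N = J" for N
    proof
      have s: "sub (N \<uplus> Q)" using N Q by (simp add: sub_sadd)
      have Qi: "Q \<subseteq> N \<uplus> Q" using sadd_right[OF sub_sgp[OF N(1)]] .
      have "a *.. b \<in> N \<uplus> Q" using a N by blast
      then show "Q \<uplus> spn (a *.. b) \<subseteq> N \<uplus> Q"
        using s Qi by (intro sadd_least sub_sgp spn_least)
      show "N \<uplus> Q \<subseteq> Q \<uplus> spn (a *.. b)"
      proof
        fix x assume x: "x \<in> N \<uplus> Q"
        have "x \<in> ?M" using x sadd_least[OF sub_sgp[OF M] N(2) QM] by blast
        then obtain q c where qc: "q \<in> Q" "c \<in> S" "x = q + c *.. b" by (auto simp: sadd_def spn_def)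
        then have "c *.. b \<in> N \<uplus> Q" using sgp_diff[OF sub_sgp[OF s] x, of q] Qi by auto
        then have "c \<in> J" using N qc by blast
        then obtain c' d where cd: "c' \<in> S" "d \<in> S" "c = c' * a + d * f" using a by blast
        then have "x = (q + d *.. (f *.. b)) + c' *.. (a *.. b)"
          using qc by (simp add: scale_left_distrib)
        moreover have "q + d *.. (f *.. b) \<in> Q"
          by (intro sgp_add sub_sgp Q qc sub_scale cd fb)
        moreover have "c' *.. (a *.. b) \<in> spn (a *.. b)" using cd(1) unfolding spn_def by blast
        ultimately show "x \<in> Q \<uplus> spn (a *.. b)" by (simp only: saddI)
      qed
    qed
    have conv: "N \<in> lattices L ?M \<and> ?cf N = J"
      if N: "sub N" "N \<inter> Q = N1" "N \<uplus> Q = Q \<uplus> spn (a *.. b)" for N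
    proof -
      have P: "sub (Q \<uplus> spn (a *.. b))" using Q by (simp add: sub_sadd sub_spn)
      have "spn (a *.. b) \<subseteq> ?M" using M sub_scale[OF M aS bM] by (intro spn_least)
      then have "Q \<uplus> spn (a *.. b) \<subseteq> ?M" using QM M by (intro sadd_least sub_sgp)
      then have NM: "N \<subseteq> ?M" using N sadd_left[OF sub_sgp[OF Q(1)], of N] by simp
      have QP: "Q \<subseteq> Q \<uplus> spn (a *.. b)" using sadd_left[OF sub_sgp[OF sub_spn]] .
      have abP: "a *.. b \<in> Q \<uplus> spn (a *.. b)" using sadd_right[OF sub_sgp[OF Q(1)]] spn_self by blast
      have J': "?cf N = J"
      proof (intro equalityI subsetI)
        fix c assume "c \<in> ?cf N"
        then have cS: "c \<in> S" and "c *.. b \<in> Q \<uplus> spn (a *.. b)" using N by auto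
        then obtain q c' where *: "c \<in> S" "q \<in> Q" "c' \<in> S" "c *.. b = q + c' *.. (a *.. b)"
          unfolding sadd_def spn_def by auto
        then have "(c - c' * a) *.. b \<in> Q" by (simp add: scale_left_diff_distrib)
        then obtain d where "d \<in> S" "c - c' * a = f * d"
          using free_Suc.hyps(3)[of "c - c' * a"] * aS by (auto simp: S_diff S_mult)
        then have "c = c' * a + d * f" by (simp add: algebra_simps)
        then show "c \<in> J" using a \<open>c' \<in> S\<close> \<open>d \<in> S\<close> by blast
      next
        fix c assume cJ: "c \<in> J"
        then obtain c' d where cd: "c' \<in> S" "d \<in> S" "c = c' * a + d * f" using a by blast
        then have "c *.. b = d *.. (f *.. b) + c' *.. (a *.. b)" by (simp add: scale_left_distrib)
        moreover have "d *.. (f *.. b) \<in> Q" by (intro Q sub_scale cd fb)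
        moreover have "c' *.. (a *.. b) \<in> spn (a *.. b)" using cd(1) unfolding spn_def by blast
        ultimately have "c *.. b \<in> Q \<uplus> spn (a *.. b)" by (simp only: saddI)
        then show "c \<in> ?cf N" using N cJ ideals_D(1)[OF J] by auto
      qed
      have "fin ?M N" using idx1[OF N(1) NM] J' ideals_D(5)[OF J] N N1 by (auto simp: lattices_def)
      then show ?thesis using J' N N1 NM by (auto simp: lattices_def)
    qed
    show ?thesis
    proof (intro equalityI subsetI)
      fix N assume "N \<in> {N \<in> lattices L ?M. (N \<inter> Q, ?cf N) = (N1, J)}"
      then have "N \<in> lattices L ?M" "N \<inter> Q = N1" "?cf N = J" by simp_all
      then show "N \<in> ?fib N1 a"
        using main[OF lattices_sub(1,4)] lattices_sub(1) by simp
    next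
      fix N assume "N \<in> ?fib N1 a"
      then show "N \<in> {N \<in> lattices L ?M. (N \<inter> Q, ?cf N) = (N1, J)}"
        using conv[of N] by (simp only: mem_Collect_eq prod.inject simp_thms)
    qed
  qed
  have ext: "card (?fib N1 a) = idx Q N1"
      "finite (?fib N1 a)"
      "N \<in> ?fib N1 a \<Longrightarrow>
         \<exists>t\<in>Q. N = N1 \<uplus> spn (a *.. b + t)"
      and nzd: "\<And>c. c \<in> S \<Longrightarrow> c *.. (a *.. b) \<in> Q \<Longrightarrow> c \<in> (*) f ` S"
      and fab: "f *.. (a *.. b) \<in> L"
    if N1: "N1 \<in> lattices L Q" and aS: "a \<in> S"
      and a: "\<And>c. c \<in> S \<Longrightarrow> c * a \<in> (*) f ` S \<Longrightarrow> c \<in> (*) f ` S" for N1 a N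
  proof -
    show nz: "c \<in> (*) f ` S" if c: "c \<in> S" "c *.. (a *.. b) \<in> Q" for c
    proof (rule a[OF c(1)], rule free_Suc.hyps(3)[OF S_mult[OF c(1) aS]])
      show "(c * a) *.. b \<in> Q" using c(2) by simp
    qed
    have "a *.. (f *.. b) \<in> L" by (rule sub_scale[OF L aS free_Suc.hyps(2)])
    then show fab: "f *.. (a *.. b) \<in> L" by (simp add: mult.commute)
    \<comment> \<open>\<open>f\<close> annihilates everything modulo \<open>L\<close>, so the
      condition on \<open>t\<close> in \<open>extension_count\<close> is satisfied by all of
      \<open>Q\<close>.\<close>
    have "f *.. (a *.. b + t) \<in> N1" if "t \<in> Q" for t
      unfolding scale_right_distrib
      by (intro sgp_add[OF lattices_sub(2)[OF N1]] subsetD[OF lattices_sub(3)[OF N1]] fab Q(3) that)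
    then have T: "{t \<in> Q. f *.. (a *.. b + t) \<in> N1} = Q" by blast
    have *: "f *.. (a *.. b) \<in> Q" using fab Q(2) by blast
    note E = extension_count[OF lattices_sub(1)[OF N1] Q(1) lattices_sub(4)[OF N1] nz * f(1), unfolded T]
    show "card (?fib N1 a) = idx Q N1"
      by (rule E(1))
    show "finite (?fib N1 a)"
      using E(2) lattices_sub(5)[OF N1] by blast
    show "\<exists>t\<in>Q. N = N1 \<uplus> spn (a *.. b + t)"
      if "N \<in> ?fib N1 a"
    proof -
      have "?fib N1 a =
          (\<lambda>t. N1 \<uplus> spn (a *.. b + t)) ` Q" by (rule E(3))
      then show ?thesis using that by (simp only: image_iff)
    qed
  qed
  have gen: "\<exists>a\<in>S. a \<in> J \<and> J = {c * a + d * f | c d. c \<in> S \<and> d \<in> S} \<and>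
     (\<forall>c\<in>S. c * a \<in> (*) f ` S \<longrightarrow> c \<in> (*) f ` S)" if Jid: "J \<in> ideals f" for J
  proof -
    obtain a where a: "a \<in> J" "J = {c * a + d * f | c d. c \<in> S \<and> d \<in> S} \<and>
        (\<forall>c\<in>S. c * a \<in> (*) f ` S \<longrightarrow> c \<in> (*) f ` S)"
      using bspec[OF f(2)[unfolded pid_def] Jid] by (elim bexE)
    show ?thesis
      by (rule bexI[of _ a], rule conjI[OF a], rule subsetD[OF ideals_D(1)[OF Jid] a(1)])
  qed
  {
    case 1
    obtain a where a: "a \<in> S" "a \<in> ?cf N" "?cf N = {c * a + d * f | c d. c \<in> S \<and> d \<in> S}"
       "\<And>c. c \<in> S \<Longrightarrow> c * a \<in> (*) f ` S \<Longrightarrow> c \<in> (*) f ` S"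
      using gen[OF cf[OF 1]] by (elim bexE conjE) (erule that; assumption | blast)
    have "N \<in> {N' \<in> lattices L ?M. (N' \<inter> Q, ?cf N') = (N \<inter> Q, ?cf N)}" using 1 by simp
    then have "N \<in> ?fib (N \<inter> Q) a"
      unfolding fibre[OF NQ[OF 1] cf[OF 1] a(2,3)] .
    from ext(3)[OF NQ[OF 1] a(1,4) this]
    obtain t where t: "t \<in> Q" "N = (N \<inter> Q) \<uplus> spn (a *.. b + t)" by blast
    have "free f L (Suc m) ((N \<inter> Q) \<uplus> spn (a *.. b + t))"
    proof (rule free.free_Suc)
      show "free f L m (N \<inter> Q)" by (rule free_Suc.IH(1)[OF NQ[OF 1]])
      show "f *.. (a *.. b + t) \<in> L"
        unfolding scale_right_distrib
        by (intro sgp_add sub_sgp[OF L] fab[OF NQ[OF 1] a(1,4)] Q(3) t)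
      fix c assume c: "c \<in> S" "c *.. (a *.. b + t) \<in> N \<inter> Q"
      then have "c *.. (a *.. b + t) - c *.. t \<in> Q"
        using t(1) Q(1) by (simp only: sgp_diff sub_sgp sub_scale IntD2)
      then have "c *.. (a *.. b) \<in> Q" by (simp add: scale_right_distrib)
      then show "c \<in> (*) f ` S" using nzd[OF NQ[OF 1] a(1,4)] c by blast
    qed
    then show ?case using t(2) by simp
  next
    case 2
    let ?Y = "lattices L Q \<times> ideals f"
    let ?p = "\<lambda>N. (N \<inter> Q, ?cf N)"
    let ?h = "\<lambda>z. wt s (idx S (snd z) * idx Q (fst z))"
    have card: "card {N \<in> lattices L ?M. ?p N = z} = idx Q (fst z)"
       "finite {N \<in> lattices L ?M. ?p N = z}" if "z \<in> ?Y" for z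
    proof -
      obtain N1 J where z: "z = (N1, J)" "N1 \<in> lattices L Q" "J \<in> ideals f"
        using \<open>z \<in> ?Y\<close> by auto
      obtain a where a: "a \<in> S" "a \<in> J" "J = {c * a + d * f | c d. c \<in> S \<and> d \<in> S}"
         "\<And>c. c \<in> S \<Longrightarrow> c * a \<in> (*) f ` S \<Longrightarrow> c \<in> (*) f ` S"
        using gen[OF z(3)] by (elim bexE conjE) (erule that; assumption | blast)
      show "card {N \<in> lattices L ?M. ?p N = z} = idx Q (fst z)"
        "finite {N \<in> lattices L ?M. ?p N = z}"
        unfolding z(1) fibre[OF z(2,3) a(2,3)] using ext(1,2)[OF z(2) a(1,4)] by simp_all
    qed
    have "esum (lattices L ?M) (\<lambda>N. wt s (idx ?M N)) = esum (lattices L ?M) (\<lambda>N. ?h (?p N))"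
      by (rule esum_cong) (simp add: idx1 lattices_sub)
    also have "\<dots> = esum ?Y (\<lambda>z. of_nat (card {N \<in> lattices L ?M. ?p N = z}) * ?h z)"
      by (rule esum_const_fibres) (use card cf NQ in auto)
    \<comment> \<open>The number of lifts is the index of the first component in \<open>Q\<close>, a
      weight of exponent -1; it lowers \<open>s\<close> to \<open>s - 1\<close> there.\<close>
    also have "\<dots> = esum ?Y (\<lambda>z. wt (s - 1) (idx Q (fst z)) * wt s (idx S (snd z)))"
    proof (rule esum_cong)
      fix z assume z: "z \<in> ?Y"
      moreover have "Q \<noteq> {}" using sgp_0[OF sub_sgp[OF Q(1)]] by blast
      ultimately have "0 < idx Q (fst z)" by (intro idx_pos) (auto simp: lattices_def)
      then show "of_nat (card {N \<in> lattices L ?M. ?p N = z}) * ?h z =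
          wt (s - 1) (idx Q (fst z)) * wt s (idx S (snd z))"
        using wt_add[of "idx Q (fst z)" "-1" s]
        by (simp add: card[OF z] of_nat_wt wt_mult mult_ac)
    qed
    also have "\<dots> = esum (lattices L Q) (\<lambda>N. wt (s - 1) (idx Q N)) * ideal_zeta f s"
      by (simp add: esum_Times[where h = "\<lambda>N J. wt (s - 1) (idx Q N) * wt s (idx S J)"]
          esum_cmult esum_multc ideal_zeta_def)
    also have "\<dots> = (\<Prod>j<Suc m. ideal_zeta f (s - real j))"
      by (simp add: free_Suc.IH(2) prod.lessThan_Suc_shift mult.commute algebra_simps del: prod.lessThan_Suc)
    finally show ?case .
  }
qed

text \<open>The generators of \<open>N2\<close> over \<open>M'\<close> are added one at a time. When
  \<open>b\<close> joins \<open>Q\<close>, every \<open>P\<close> found so far extends in as many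
  ways as the equation for \<open>b\<close> has solutions modulo \<open>P\<close>. That number is
  the order of a cokernel on \<open>Q/P\<close>, and because \<open>P \<uplus> M' = Q\<close> it can
  be computed inside \<open>M'\<close>, independently of \<open>P\<close>.\<close>

lemma fibre_count:
  assumes f: "f \<in> S" and M': "sub M'" and N1: "sub N1" "N1 \<subseteq> M'" "fin M' N1"
    and free: "free f M' m N2"
  shows "finite {N. sub N \<and> N \<inter> M' = N1 \<and> N \<uplus> M' = N2}"
    and "card {N. sub N \<and> N \<inter> M' = N1 \<and> N \<uplus> M' = N2} =
      (if \<forall>x\<in>N2. f *.. x \<in> N1 \<uplus> (*..) f ` M' then idx M' (N1 \<uplus> (*..) f ` M') ^ m else 0)"
  using free
proof (induction rule: free.induct)
  let ?F = "(*..) f ` M'"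
  have F: "sub ?F" "?F \<subseteq> M'" using sub_image[OF M'] sub_scale[OF M' f] by auto
  { case free_0
    have "N = N1" if "N \<inter> M' = N1" "N \<uplus> M' = M'" for N
      using that sadd_left[OF sub_sgp[OF M'], of N] by auto
    then have *: "{N. sub N \<and> N \<inter> M' = N1 \<and> N \<uplus> M' = M'} = {N1}"
      using N1 sadd_absorb[OF sub_sgp[OF M'] N1(2) sub_sgp[OF N1(1)]] by auto
    have "f *.. x \<in> N1 \<uplus> ?F" if "x \<in> M'" for x
      using sadd_right[OF sub_sgp[OF N1(1)], of ?F] that by blast
    then show "finite {N. sub N \<and> N \<inter> M' = N1 \<and> N \<uplus> M' = M'}"
      "card {N. sub N \<and> N \<inter> M' = N1 \<and> N \<uplus> M' = M'} =
      (if \<forall>x\<in>M'. f *.. x \<in> N1 \<uplus> ?F then idx M' (N1 \<uplus> ?F) ^ 0 else 0)"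
      unfolding * by simp_all }
  { case (free_Suc m Q b)
    let ?fib = "\<lambda>N2. {N. sub N \<and> N \<inter> M' = N1 \<and> N \<uplus> M' = N2}"
    let ?ext = "\<lambda>P. {N. sub N \<and> N \<inter> Q = P \<and> N \<uplus> Q = Q \<uplus> spn b}"
    let ?k = "idx M' (N1 \<uplus> ?F)"
    have Q: "sub Q" "M' \<subseteq> Q" "\<And>x. x \<in> Q \<Longrightarrow> f *.. x \<in> M'"
      using free_sub[OF free_Suc.hyps(1) M' f] by blast+
    have Qb: "sub (Q \<uplus> spn b)" "Q \<subseteq> Q \<uplus> spn b" "b \<in> Q \<uplus> spn b"
      using sub_sadd[OF Q(1) sub_spn] sadd_left[OF sub_sgp[OF sub_spn]]
        subsetD[OF sadd_right[OF sub_sgp[OF Q(1)]] spn_self] by simp_all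
    have union: "?fib (Q \<uplus> spn b) = (\<Union>P\<in>?fib Q. ?ext P)"
    proof (intro equalityI subsetI)
      fix N assume "N \<in> ?fib (Q \<uplus> spn b)"
      then have N: "sub N" "N \<inter> M' = N1" "N \<uplus> M' = Q \<uplus> spn b" by auto
      have "(N \<inter> Q) \<uplus> M' = Q"
        using modular[OF sub_sgp[OF Q(1)] Q(2), of N] N(3) Qb(2) by auto
      moreover have "N \<inter> Q \<inter> M' = N1" using N(2) Q(2) by blast
      ultimately have P: "N \<inter> Q \<in> ?fib Q" using N Q by (simp add: sub_Int)
      have "N \<subseteq> Q \<uplus> spn b" using N(3) sadd_left[OF sub_sgp[OF M'], of N] by simp
      then have "N \<uplus> Q \<subseteq> Q \<uplus> spn b" using Qb by (intro sadd_least sub_sgp)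
      moreover have "Q \<uplus> spn b \<subseteq> N \<uplus> Q" unfolding N(3)[symmetric] using Q(2) by (intro sadd_mono) auto
      ultimately have "N \<in> ?ext (N \<inter> Q)" using N by blast
      then show "N \<in> (\<Union>P\<in>?fib Q. ?ext P)" using P by blast
    next
      fix N assume "N \<in> (\<Union>P\<in>?fib Q. ?ext P)"
      then obtain P where P: "P \<inter> M' = N1" "P \<uplus> M' = Q"
        and N: "sub N" "N \<inter> Q = P" "N \<uplus> Q = Q \<uplus> spn b" by auto
      have "N \<inter> M' = N1" using P N Q by blast
      moreover have "N \<uplus> M' \<subseteq> Q \<uplus> spn b" unfolding N(3)[symmetric] using Q(2) by (intro sadd_mono) auto
      moreover have "Q \<uplus> spn b \<subseteq> N \<uplus> M'"
      proof -
        have "Q \<subseteq> N \<uplus> M'" unfolding P(2)[symmetric] using N(2) by (intro sadd_mono) auto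
        then show ?thesis unfolding N(3)[symmetric]
          using sub_sadd[OF N(1) M'] sadd_left[OF sub_sgp[OF M']] by (intro sadd_least sub_sgp)
      qed
      ultimately show "N \<in> ?fib (Q \<uplus> spn b)" using N by auto
    qed
    have card: "finite (?ext P)" "card (?ext P) = (if f *.. b \<in> N1 \<uplus> ?F then ?k else 0)"
      if P: "P \<in> ?fib Q" for P
    proof -
      have P: "sub P" "P \<inter> M' = N1" "P \<uplus> M' = Q" using that by auto
      have PQ: "P \<subseteq> Q" using P(3) sadd_left[OF sub_sgp[OF M'], of P] by simp
      have finP: "fin Q P" using idx_second_iso(2)[OF sub_sgp[OF P(1)] sub_sgp[OF M']] P N1 by simp
      have fb: "f *.. b \<in> Q" using free_Suc.hyps(2) Q by blast
      have PF: "sub (P \<uplus> ?F)" "?F \<subseteq> P \<uplus> ?F" "P \<subseteq> P \<uplus> ?F"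
        using sub_sadd[OF P(1) F(1)] sadd_left[OF sub_sgp[OF F(1)]] sadd_right[OF sub_sgp[OF P(1)]]
        by simp_all
      \<comment> \<open>\<open>f\<close> maps \<open>P\<close> into \<open>P\<close>, so only the
        image of \<open>M'\<close> contributes.\<close>
      have eq: "P \<uplus> (*..) f ` Q = P \<uplus> ?F"
      proof
        show "P \<uplus> ?F \<subseteq> P \<uplus> (*..) f ` Q" using Q(2) by (intro sadd_mono) auto
        have "(*..) f ` Q \<subseteq> P \<uplus> ?F"
        proof
          fix x assume "x \<in> (*..) f ` Q"
          then obtain p m where "p \<in> P" "m \<in> M'" "x = f *.. p + f *.. m"
            unfolding P(3)[symmetric] by (auto simp: sadd_def scale_right_distrib)
          then show "x \<in> P \<uplus> ?F" using sub_scale[OF P(1) f] by (auto intro!: saddI)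
        qed
        then show "P \<uplus> (*..) f ` Q \<subseteq> P \<uplus> ?F" using PF by (intro sadd_least sub_sgp)
      qed
      have int: "(P \<uplus> ?F) \<inter> M' = N1 \<uplus> ?F"
        using modular[OF sub_sgp[OF M'] F(2), of P] P(2) by simp
      then have 1: "f *.. b \<in> P \<uplus> ?F \<longleftrightarrow> f *.. b \<in> N1 \<uplus> ?F"
        using free_Suc.hyps(2) by blast
      have "(P \<uplus> ?F) \<uplus> M' = Q"
        using P(3) sadd_absorb[OF sub_sgp[OF M'] F(2) sub_sgp[OF F(1)]] by (simp add: sadd_assoc)
      then have 2: "idx Q (P \<uplus> ?F) = ?k"
        using idx_second_iso(1)[OF sub_sgp[OF PF(1)] sub_sgp[OF M']] int by simp
      note E = extension_count[OF P(1) Q(1) PQ free_Suc.hyps(3) fb f]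
      show "card (?ext P) = (if f *.. b \<in> N1 \<uplus> ?F then ?k else 0)"
        using E(1) idx_solutions[OF P(1) Q(1) PQ f finP, of b] unfolding eq 1 2 by simp
      have "fin {t \<in> Q. f *.. (b + t) \<in> P} P" by (rule fin_subset[OF finP]) auto
      then show "finite (?ext P)" using E(2) by simp
    qed
    show "finite (?fib (Q \<uplus> spn b))" unfolding union using card(1) free_Suc.IH(1) by blast
    have "card (?fib (Q \<uplus> spn b)) = (\<Sum>P\<in>?fib Q. card (?ext P))"
      unfolding union using card(1) free_Suc.IH(1) by (intro card_UN_disjoint) auto
    also have "\<dots> = card (?fib Q) * (if f *.. b \<in> N1 \<uplus> ?F then ?k else 0)"
      by (simp only: card(2) cong: sum.cong) simp
    finally have c: "card (?fib (Q \<uplus> spn b)) = card (?fib Q) * (if f *.. b \<in> N1 \<uplus> ?F then ?k else 0)" .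
    have NF: "sub (N1 \<uplus> ?F)" using N1 F by (simp add: sub_sadd)
    have "(\<forall>x\<in>Q \<uplus> spn b. f *.. x \<in> N1 \<uplus> ?F) \<longleftrightarrow>
        (\<forall>x\<in>Q. f *.. x \<in> N1 \<uplus> ?F) \<and> f *.. b \<in> N1 \<uplus> ?F" (is "?A \<longleftrightarrow> ?B")
    proof
      assume ?A then show ?B using Qb by blast
    next
      assume B: ?B
      show ?A
      proof
        fix x assume "x \<in> Q \<uplus> spn b"
        then obtain q c where qc: "q \<in> Q" "c \<in> S" "x = q + c *.. b" by (auto simp: sadd_def spn_def)
        have "f *.. x = f *.. q + c *.. (f *.. b)" using qc by (simp add: scale_right_distrib mult.commute)
        also have "\<dots> \<in> N1 \<uplus> ?F"
          using B qc by (simp only: sgp_add sub_sgp[OF NF] sub_scale[OF NF])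
        finally show "f *.. x \<in> N1 \<uplus> ?F" .
      qed
    qed
    then show "card (?fib (Q \<uplus> spn b)) =
      (if \<forall>x\<in>Q \<uplus> spn b. f *.. x \<in> N1 \<uplus> ?F then ?k ^ Suc m else 0)"
      unfolding c free_Suc.IH(2) by simp }
qed

text \<open>The second weight is forced by \<open>fibre_count\<close>, which produces powers of this
  index one layer further down. It is trivial at both ends of the recursion: for
  \<open>t = 0\<close>, and once \<open>M = K + f M\<close>.\<close>

definition layer_sum :: "'r \<Rightarrow> 'v set \<Rightarrow> 'v set \<Rightarrow> real \<Rightarrow> real \<Rightarrow> ennreal" where
  "layer_sum f K M s t =
     esum (lattices K M) (\<lambda>N. wt s (idx M N) * wt (- t) (idx M (N \<uplus> (*..) f ` M)))"

lemma esum_if: "esum U (\<lambda>x. if P x then h x else 0) = esum {x \<in> U. P x} h"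
  unfolding esum_indicator[of U] esum_indicator[of "{x \<in> U. P x}"]
  by (rule esum_cong) (auto simp: indicator_def)

text \<open>For each lower member \<open>N1\<close> of the pair, the upper members \<open>N2\<close>
  are summed first. The fibre contributes a weight of exponent \<open>- m\<close> in the index of
  \<open>N1 + f M'\<close>, the sum over \<open>N2\<close> one of exponent \<open>s - t\<close>;
  together they form the new second weight.\<close>

lemma layer_sum_step:
  assumes f: "f \<in> S" "pid f" and K: "sub K" and M: "sub M"
    and M': "M' = K \<uplus> (*..) f ` M" and free: "free f M' m M"
  shows "layer_sum f K M s t =
    (\<Prod>j<m. ideal_zeta f (s - t - real j)) * layer_sum f K M' s (real m + t - s)"
proof -
  have sM': "sub M'" unfolding M' by (simp add: sub_sadd sub_image K M)
  have MM: "M' \<subseteq> M" and fM: "\<And>x. x \<in> M \<Longrightarrow> f *.. x \<in> M'"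
    using free_sub[OF free sM' f(1)] by blast+
  have KM': "K \<subseteq> M'" unfolding M' using sadd_left[OF sub_sgp[OF sub_image[OF M]]] .
  let ?F = "(*..) f ` M'"
  let ?k = "\<lambda>N1. idx M' (N1 \<uplus> ?F)"
  let ?ok = "\<lambda>N1 N2. \<forall>x\<in>N2. f *.. x \<in> N1 \<uplus> ?F"
  let ?Y = "lattices K M' \<times> lattices M' M"
  let ?p = "\<lambda>N. (N \<inter> M', N \<uplus> M')"
  let ?h = "\<lambda>z. wt s (idx M' (fst z) * idx M (snd z)) * wt (- t) (idx M (snd z))"
  have F: "sub ?F" "?F \<subseteq> M'" using sub_image[OF sM'] sub_scale[OF sM' f(1)] by auto
  \<comment> \<open>As \<open>N\<close> contains \<open>K\<close>, the second weight of this stage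
    depends on the upper member \<open>N \<uplus> M'\<close> alone.\<close>
  have sum_eq: "N \<uplus> (*..) f ` M = N \<uplus> M'" if "N \<in> lattices K M" for N
    unfolding M' sadd_assoc[symmetric]
    using sadd_absorb[OF lattices_sub(2)[OF that] lattices_sub(3)[OF that] sub_sgp[OF K]]
    by (simp add: sadd_commute)
  have step: "idx M N = idx M' (N \<inter> M') * idx M (N \<uplus> M')"
     "fin M N \<longleftrightarrow> fin M' (N \<inter> M') \<and> fin M (N \<uplus> M')" if "sub N" "N \<subseteq> M" for N
  proof -
    have "N \<uplus> M' \<subseteq> M" using that MM M by (intro sadd_least sub_sgp)
    then show "idx M N = idx M' (N \<inter> M') * idx M (N \<uplus> M')"
       "fin M N \<longleftrightarrow> fin M' (N \<inter> M') \<and> fin M (N \<uplus> M')"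
      using idx_tower[of N "N \<uplus> M'" M] idx_second_iso[of N M'] that M sM' sadd_left[OF sub_sgp[OF sM'], of N]
      by (auto simp: sub_sgp sub_sadd)
  qed
  have pY: "?p N \<in> ?Y" if "N \<in> lattices K M" for N
    using lattices_sub[OF that] step[of N] KM' sadd_right[OF lattices_sub(2)[OF that], of M']
      sadd_least[OF sub_sgp[OF M] lattices_sub(4)[OF that] MM] sM'
    by (auto simp: lattices_def sub_Int sub_sadd)
  have fibre: "{N \<in> lattices K M. ?p N = (N1, N2)} = {N. sub N \<and> N \<inter> M' = N1 \<and> N \<uplus> M' = N2}"
    if "N1 \<in> lattices K M'" "N2 \<in> lattices M' M" for N1 N2
  proof (intro equalityI subsetI)
    fix N assume "N \<in> {N. sub N \<and> N \<inter> M' = N1 \<and> N \<uplus> M' = N2}"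
    then have N: "sub N" "N \<inter> M' = N1" "N \<uplus> M' = N2" by auto
    have "N \<subseteq> M" using N(3) sadd_left[OF sub_sgp[OF sM'], of N] lattices_sub(4)[OF that(2)] by blast
    then show "N \<in> {N \<in> lattices K M. ?p N = (N1, N2)}"
      using N step(2)[of N] lattices_sub[OF that(1)] lattices_sub[OF that(2)]
      by (auto simp: lattices_def)
  qed (auto simp: lattices_def)
  have card: "card {N \<in> lattices K M. ?p N = z} =
        (if ?ok (fst z) (snd z) then ?k (fst z) ^ m else 0)"
      "finite {N \<in> lattices K M. ?p N = z}" if "z \<in> ?Y" for z
  proof -
    obtain N1 N2 where z: "z = (N1, N2)" "N1 \<in> lattices K M'" "N2 \<in> lattices M' M"
      using \<open>z \<in> ?Y\<close> by auto
    note c = fibre_count[OF f(1) sM' lattices_sub(1,4,5)[OF z(2)] free_lattices(1)[OF f sM' free z(3)]]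
    show "card {N \<in> lattices K M. ?p N = z} = (if ?ok (fst z) (snd z) then ?k (fst z) ^ m else 0)"
      "finite {N \<in> lattices K M. ?p N = z}"
      unfolding z(1) fibre[OF z(2,3)] using c by simp_all
  qed
  have inner: "esum (lattices M' M) (\<lambda>N2. if ?ok N1 N2 then wt (s - t) (idx M N2) else 0) =
      wt (s - t) (?k N1) * (\<Prod>j<m. ideal_zeta f (s - t - real j))"
    if N1: "N1 \<in> lattices K M'" for N1
  proof -
    \<comment> \<open>The largest \<open>N2\<close> with a non-empty fibre over \<open>N1\<close>.
      Multiplication by \<open>f\<close> identifies \<open>M/M1\<close> with \<open>M'\<close>
      modulo \<open>N1 + f M'\<close>; surjectivity holds since \<open>M' = K + f M\<close> and
      \<open>K\<close> lies in \<open>N1\<close>.\<close>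
    define M1 where "M1 = {x \<in> M. f *.. x \<in> N1 \<uplus> ?F}"
    have NF: "sub (N1 \<uplus> ?F)" using lattices_sub(1)[OF N1] F by (simp add: sub_sadd)
    have M1: "sub M1"
      unfolding sub_def
    proof (intro conjI ballI)
      show "sgp M1" using sub_sgp[OF NF] sub_sgp[OF M]
        by (auto simp: M1_def sgp_def scale_right_diff_distrib)
      fix c x assume c: "c \<in> S" and x: "x \<in> M1"
      have "f *.. x \<in> N1 \<uplus> ?F" using x by (simp add: M1_def)
      then have "c *.. (f *.. x) \<in> N1 \<uplus> ?F" by (rule sub_scale[OF NF c])
      then have "f *.. (c *.. x) \<in> N1 \<uplus> ?F" by (simp add: mult.commute)
      then show "c *.. x \<in> M1" using c x sub_scale[OF M] by (simp add: M1_def)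
    qed
    have M'M1: "M' \<subseteq> M1"
      using MM sadd_right[OF lattices_sub(2)[OF N1], of ?F] by (auto simp: M1_def)
    have finN: "fin M' (N1 \<uplus> ?F)"
      using fin_mono(1)[of N1 "N1 \<uplus> ?F" M'] lattices_sub[OF N1] NF sM' sadd_left[OF sub_sgp[OF F(1)]]
        sadd_least[OF sub_sgp[OF sM'] lattices_sub(4)[OF N1] F(2)] by (simp add: sub_sgp)
    have tr: "idx M M1 = ?k N1" "fin M M1 \<longleftrightarrow> fin M' (N1 \<uplus> ?F)"
    proof -
      have 2: "x - y \<in> M1 \<longleftrightarrow> f *.. x - f *.. y \<in> N1 \<uplus> ?F" if "x \<in> M" "y \<in> M" for x y
        using sgp_diff[OF sub_sgp[OF M] that] by (simp add: M1_def scale_right_diff_distrib)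
      have 3: "\<exists>x\<in>M. z - f *.. x \<in> N1 \<uplus> ?F" if "z \<in> M'" for z
      proof -
        obtain k x where "k \<in> K" "x \<in> M" "z = k + f *.. x" using \<open>z \<in> M'\<close> unfolding M' by (auto elim!: saddE)
        then show ?thesis
          using lattices_sub(3)[OF N1] sadd_left[OF sub_sgp[OF F(1)], of N1] by (intro bexI[of _ x]) auto
      qed
      show "idx M M1 = ?k N1" "fin M M1 \<longleftrightarrow> fin M' (N1 \<uplus> ?F)"
        using idx_transfer[OF sub_sgp[OF M1] sub_sgp[OF NF] fM 2 3] by blast+
    qed
    have M1M: "M1 \<in> lattices M' M"
      using M1 M'M1 finN tr(2) by (auto simp: lattices_def M1_def)
    have tower: "idx M N = idx M M1 * idx M1 N" "fin M N \<longleftrightarrow> fin M1 N"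
      if "sub N" "N \<subseteq> M1" for N
      using idx_tower[of N M1 M] that M M1 lattices_sub[OF M1M] by (simp_all add: sub_sgp)
    have eq: "{N2 \<in> lattices M' M. ?ok N1 N2} = lattices M' M1"
    proof (intro equalityI subsetI)
      fix N assume "N \<in> {N2 \<in> lattices M' M. ?ok N1 N2}"
      then have N: "N \<in> lattices M' M" "?ok N1 N" by auto
      then have "N \<subseteq> M1" using lattices_sub(4)[OF N(1)] by (auto simp: M1_def)
      then show "N \<in> lattices M' M1" using lattices_sub[OF N(1)] tower(2)[of N] by (simp add: lattices_def)
    next
      fix N assume "N \<in> lattices M' M1"
      note N = lattices_sub[OF this]
      have "N \<subseteq> M" using N(4) unfolding M1_def by blast
      moreover have "?ok N1 N" using N(4) unfolding M1_def by blast
      ultimately show "N \<in> {N2 \<in> lattices M' M. ?ok N1 N2}"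
        using N tower(2)[OF N(1,4)] by (simp add: lattices_def)
    qed
    have "esum (lattices M' M) (\<lambda>N2. if ?ok N1 N2 then wt (s - t) (idx M N2) else 0) =
        esum (lattices M' M1) (\<lambda>N2. wt (s - t) (idx M M1) * wt (s - t) (idx M1 N2))"
      unfolding esum_if eq by (rule esum_cong) (simp add: tower(1) lattices_sub wt_mult)
    also have "\<dots> = wt (s - t) (?k N1) * (\<Prod>j<m. ideal_zeta f (s - t - real j))"
      unfolding esum_cmult tr(1)
      using free_lattices(2)[OF f sM' free_lattices(1)[OF f sM' free M1M]] by simp
    finally show ?thesis .
  qed
  have kpos: "0 < ?k N1" if "N1 \<in> lattices K M'" for N1
  proof (rule idx_pos)
    show "fin M' (N1 \<uplus> ?F)"
      using fin_mono(1)[of N1 "N1 \<uplus> ?F" M'] lattices_sub[OF that] sub_sadd[OF _ F(1), of N1] sM'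
        sadd_left[OF sub_sgp[OF F(1)]] sadd_least[OF sub_sgp[OF sM'] lattices_sub(4)[OF that] F(2)]
      by (simp add: sub_sgp)
    show "M' \<noteq> {}" using sgp_0[OF sub_sgp[OF sM']] by blast
  qed
  have ipos: "0 < idx M N" if "N \<in> lattices M' M" for N
    using idx_pos[OF lattices_sub(5)[OF that]] sgp_0[OF sub_sgp[OF M]] by blast
  have "layer_sum f K M s t = esum (lattices K M) (\<lambda>N. ?h (?p N))"
    unfolding layer_sum_def by (rule esum_cong) (simp add: sum_eq step(1) lattices_sub)
  also have "\<dots> = esum ?Y (\<lambda>z. of_nat (card {N \<in> lattices K M. ?p N = z}) * ?h z)"
    by (rule esum_const_fibres) (use card(2) pY in auto)
  also have "\<dots> = esum ?Y (\<lambda>z. (wt s (idx M' (fst z)) * wt (- real m) (?k (fst z))) *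
      (if ?ok (fst z) (snd z) then wt (s - t) (idx M (snd z)) else 0))"
  proof (rule esum_cong)
    fix z assume z: "z \<in> ?Y"
    have pos: "0 < ?k (fst z)" "0 < idx M (snd z)" using z kpos ipos by auto
    show "of_nat (card {N \<in> lattices K M. ?p N = z}) * ?h z =
      (wt s (idx M' (fst z)) * wt (- real m) (?k (fst z))) *
      (if ?ok (fst z) (snd z) then wt (s - t) (idx M (snd z)) else 0)"
      unfolding card(1)[OF z]
      using of_nat_power_wt[OF pos(1), of m] wt_add[OF pos(2), of s "- t"]
      by (simp add: wt_mult mult_ac)
  qed
  also have "\<dots> = esum (lattices K M') (\<lambda>N1. (wt s (idx M' N1) * wt (- real m) (?k N1)) *
      (wt (s - t) (?k N1) * (\<Prod>j<m. ideal_zeta f (s - t - real j))))"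
    unfolding esum_Times[where h = "\<lambda>N1 N2. (wt s (idx M' N1) * wt (- real m) (?k N1)) *
      (if ?ok N1 N2 then wt (s - t) (idx M N2) else 0)"]
    by (rule esum_cong) (simp only: esum_cmult inner)
  also have "\<dots> = esum (lattices K M') (\<lambda>N1. (\<Prod>j<m. ideal_zeta f (s - t - real j)) *
      (wt s (idx M' N1) * wt (- (real m + t - s)) (?k N1)))"
  proof (rule esum_cong)
    fix N1 assume "N1 \<in> lattices K M'"
    from kpos[OF this] have "wt (- (real m + t - s)) (?k N1) = wt (- real m) (?k N1) * wt (s - t) (?k N1)"
      using wt_add[of "?k N1" "- real m" "s - t"] by (simp add: algebra_simps)
    then show "(wt s (idx M' N1) * wt (- real m) (?k N1)) *
      (wt (s - t) (?k N1) * (\<Prod>j<m. ideal_zeta f (s - t - real j))) =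
      (\<Prod>j<m. ideal_zeta f (s - t - real j)) *
      (wt s (idx M' N1) * wt (- (real m + t - s)) (?k N1))" by (simp only: mult_ac)
  qed
  also have "\<dots> = (\<Prod>j<m. ideal_zeta f (s - t - real j)) * layer_sum f K M' s (real m + t - s)"
    by (simp only: esum_cmult layer_sum_def)
  finally show ?thesis .
qed

text \<open>If \<open>M = K + f M\<close>, then \<open>N + f M = M\<close> for every
  \<open>N\<close> containing \<open>K\<close>, and the second weight is that of index 1.\<close>

lemma layer_sum_stable:
  assumes K: "sub K" and M: "sub M" and eq: "M = K \<uplus> (*..) f ` M"
  shows "layer_sum f K M s t = esum (lattices K M) (\<lambda>N. wt s (idx M N))"
  unfolding layer_sum_def
proof (rule esum_cong)
  fix N assume N: "N \<in> lattices K M"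
  have "M \<subseteq> N \<uplus> (*..) f ` M" using eq sadd_mono[OF lattices_sub(3)[OF N] subset_refl] by blast
  moreover have "(*..) f ` M \<subseteq> M" using eq sadd_right[OF sub_sgp[OF K], of "(*..) f ` M"] by simp
  then have "N \<uplus> (*..) f ` M \<subseteq> M" using lattices_sub(4)[OF N] M by (intro sadd_least sub_sgp)
  ultimately have "N \<uplus> (*..) f ` M = M" by blast
  then show "wt s (idx M N) * wt (- t) (idx M (N \<uplus> (*..) f ` M)) = wt s (idx M N)"
    using idx_same[OF sub_sgp[OF M]] by simp
qed

lemma layer_sum_0: "layer_sum f K M s 0 = esum (lattices K M) (\<lambda>N. wt s (idx M N))" if "sub M" "f \<in> S" "K \<subseteq> M"
  unfolding layer_sum_def
proof (rule esum_cong)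
  fix N assume N: "N \<in> lattices K M"
  have F: "sub ((*..) f ` M)" "(*..) f ` M \<subseteq> M" using sub_image[OF that(1)] sub_scale[OF that(1,2)] by auto
  have "N \<uplus> (*..) f ` M \<subseteq> M" using lattices_sub(4)[OF N] F sub_sgp[OF that(1)] by (intro sadd_least)
  then have "fin M (N \<uplus> (*..) f ` M)"
    using fin_mono(1)[of N "N \<uplus> (*..) f ` M" M] lattices_sub[OF N] sub_sgp[OF that(1)]
      sadd_left[OF sub_sgp[OF F(1)]] sgp_sadd[OF lattices_sub(2)[OF N] sub_sgp[OF F(1)]] by simp
  \<comment> \<open>Exponent 0 gives weight 1 only at a positive index, since \<open>powr\<close>
    sends 0 to 0 for every exponent.\<close>
  then have "0 < idx M (N \<uplus> (*..) f ` M)"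
    using idx_pos sgp_0[OF sub_sgp[OF that(1)]] by blast
  then show "wt s (idx M N) * wt (- 0) (idx M (N \<uplus> (*..) f ` M)) = wt s (idx M N)"
    by (simp add: wt_def)
qed

end

section \<open>Polynomials over a discrete valuation ring\<close>

text \<open>A discrete valuation ring of \<open>k\<close> with finite residue field and uniformizer
  \<open>t\<close>, described by an absolute value. Any representative of the place may be used, so
  \<open>\<phi> t\<close> is just some number between 0 and 1.\<close>

locale dvr_abs =
  fixes \<phi> :: "'k::field_char_0 \<Rightarrow> real" and t :: 'k
  assumes abs_nonneg: "0 \<le> \<phi> x"
    and abs_eq_0: "\<phi> x = 0 \<longleftrightarrow> x = 0"
    and abs_mult: "\<phi> (x * y) = \<phi> x * \<phi> y"
    and abs_add: "\<phi> (x + y) \<le> max (\<phi> x) (\<phi> y)"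
    and t_nz: "t \<noteq> 0" and t_less: "\<phi> t < 1"
    and discrete: "\<phi> x < 1 \<Longrightarrow> \<phi> x \<le> \<phi> t"
    and residue_fin: "fin {x. \<phi> x \<le> 1} {x. \<phi> x < 1}"
begin

definition q :: nat where "q = idx {x. \<phi> x \<le> 1} {x. \<phi> x < 1}"

definition S :: "'k poly set" where "S = {h. \<forall>i. \<phi> (coeff h i) \<le> 1}"

section \<open>Ultrametric arithmetic\<close>

lemma abs_0 [simp]: "\<phi> 0 = 0"
  by (simp add: abs_eq_0)

lemma abs_1 [simp]: "\<phi> 1 = 1"
  using abs_mult[of 1 1] abs_eq_0[of 1] by simp

lemma abs_minus [simp]: "\<phi> (- x) = \<phi> x"
proof -
  have "\<phi> (-1) * \<phi> (-1) = 1" using abs_mult[of "-1" "-1"] by simp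
  then have "\<phi> (-1) = 1" using abs_nonneg[of "-1"]
    by (simp add: square_eq_1_iff)
  then show ?thesis using abs_mult[of "-1" x] by simp
qed

lemma abs_power: "\<phi> (x ^ n) = \<phi> x ^ n"
  by (induction n) (simp_all add: abs_mult)

lemma abs_inverse: "\<phi> (inverse x) = inverse (\<phi> x)"
proof (cases "x = 0")
  case False
  then have "\<phi> (inverse x) * \<phi> x = 1" using abs_mult[of "inverse x" x] by simp
  then show ?thesis by (metis inverse_unique mult.commute)
qed simp

lemma abs_divide: "\<phi> (x / y) = \<phi> x / \<phi> y"
  by (simp add: divide_inverse abs_mult abs_inverse)

lemma abs_diff: "\<phi> (x - y) \<le> max (\<phi> x) (\<phi> y)"
  using abs_add[of x "- y"] by simp

lemma abs_add_le: "\<phi> x \<le> c \<Longrightarrow> \<phi> y \<le> c \<Longrightarrow> \<phi> (x + y) \<le> c"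
  using abs_add[of x y] by simp

lemma abs_add_less: "\<phi> x < c \<Longrightarrow> \<phi> y < c \<Longrightarrow> \<phi> (x + y) < c"
  using abs_add[of x y] by simp

lemma abs_diff_le: "\<phi> x \<le> c \<Longrightarrow> \<phi> y \<le> c \<Longrightarrow> \<phi> (x - y) \<le> c"
  using abs_diff[of x y] by simp

lemma abs_diff_less: "\<phi> x < c \<Longrightarrow> \<phi> y < c \<Longrightarrow> \<phi> (x - y) < c"
  using abs_diff[of x y] by simp

lemma abs_sum_le: "0 \<le> c \<Longrightarrow> (\<And>i. i \<in> A \<Longrightarrow> \<phi> (h i) \<le> c) \<Longrightarrow> \<phi> (sum h A) \<le> c"
  by (induction A rule: infinite_finite_induct) (simp_all add: abs_add_le)

lemma abs_sum_less: "0 < c \<Longrightarrow> (\<And>i. i \<in> A \<Longrightarrow> \<phi> (h i) < c) \<Longrightarrow> \<phi> (sum h A) < c"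
  by (induction A rule: infinite_finite_induct) (simp_all add: abs_add_less)

lemma abs_add_eq: "\<phi> y < \<phi> x \<Longrightarrow> \<phi> (x + y) = \<phi> x"
  using abs_add[of x y] abs_diff[of "x + y" y] by auto

lemma abs_le_mult: "\<phi> x \<le> 1 \<Longrightarrow> \<phi> y \<le> 1 \<Longrightarrow> \<phi> (x * y) \<le> 1"
  by (simp add: abs_mult mult_le_one abs_nonneg)

lemma t_pos: "0 < \<phi> t"
  using abs_nonneg[of t] abs_eq_0[of t] t_nz by linarith

lemma sgp_R: "sgp {x. \<phi> x \<le> 1}" and sgp_m: "sgp {x. \<phi> x < 1}"
  by (auto simp: sgp_def abs_diff_le abs_diff_less)

lemma q_gt_1: "1 < q"
proof -
  have "q \<noteq> 1" unfolding q_def 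
  proof
    assume "idx {x. \<phi> x \<le> 1} {x. \<phi> x < 1} = 1"
    from idx_1D[OF sgp_m _ this] have "{x. \<phi> x \<le> 1} \<subseteq> {x. \<phi> x < 1}" by simp
    then have "1 \<in> {x. \<phi> x < 1}" by (rule subsetD) simp
    then show False by simp
  qed
  moreover have "0 < q" unfolding q_def using idx_pos[OF residue_fin] abs_0 by (metis empty_iff mem_Collect_eq zero_le_one)
  ultimately show ?thesis by linarith
qed

sublocale S: subring_module "(*)" S
proof
  show "0 \<in> S" "1 \<in> S" by (auto simp: S_def)
  show "x - y \<in> S" if "x \<in> S" "y \<in> S" for x y
    using that by (auto simp: S_def abs_diff_le)
  show "x * y \<in> S" if "x \<in> S" "y \<in> S" for x y
    using that by (auto simp: S_def coeff_mult intro!: abs_sum_le abs_le_mult)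
qed (simp_all add: algebra_simps)

section \<open>The ring of integral polynomials\<close>

lemma S_const [simp]: "[:c:] \<in> S \<longleftrightarrow> \<phi> c \<le> 1"
  by (auto simp: S_def coeff_pCons split: nat.splits)

lemma S_monom: "\<phi> c \<le> 1 \<Longrightarrow> monom c n \<in> S"
  by (simp add: S_def)

lemma S_sum: "(\<And>i. i \<in> A \<Longrightarrow> h i \<in> S) \<Longrightarrow> sum h A \<in> S"
  by (induction A rule: infinite_finite_induct) (simp_all add: S.S_0 S.S_add)

lemma S_prod: "(\<And>i. i \<in> A \<Longrightarrow> h i \<in> S) \<Longrightarrow> prod h A \<in> S"
  by (induction A rule: infinite_finite_induct) (simp_all add: S.S_1 S.S_mult)

lemma S_power: "x \<in> S \<Longrightarrow> x ^ n \<in> S"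
  by (induction n) (simp_all add: S.S_1 S.S_mult)

lemma S_numeral: "numeral n \<in> S"
proof -
  have "of_nat m \<in> S" for m by (induction m) (simp_all add: S.S_0 S.S_1 S.S_add)
  from this[of "numeral n"] show ?thesis by simp
qed

lemma t_S: "[:t:] \<in> S"
  using t_less by simp

definition tS :: "'k poly set" where "tS = (*) [:t:] ` S"

text \<open>Discreteness makes division by \<open>t\<close> possible: a coefficient of absolute
  value below 1 has absolute value at most \<open>\<phi> t\<close>.\<close>

lemma tS_iff: "h \<in> tS \<longleftrightarrow> (\<forall>i. \<phi> (coeff h i) < 1)"
proof
  assume "h \<in> tS"
  then obtain g where g: "g \<in> S" "h = [:t:] * g" by (auto simp: tS_def)
  have "\<phi> t * \<phi> (coeff g i) < 1" for i
  proof -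
    have "\<phi> t * \<phi> (coeff g i) \<le> \<phi> t * 1" using g(1) t_pos by (intro mult_left_mono) (auto simp: S_def)
    then show ?thesis using t_less by simp
  qed
  then show "\<forall>i. \<phi> (coeff h i) < 1" using g by (simp add: abs_mult)
next
  assume h: "\<forall>i. \<phi> (coeff h i) < 1"
  have "\<phi> (coeff h i) / \<phi> t \<le> 1" for i using discrete h t_pos by simp
  then have "Polynomial.smult (inverse t) h \<in> S"
    by (simp add: S_def abs_mult abs_inverse divide_inverse mult.commute)
  moreover have "h = [:t:] * Polynomial.smult (inverse t) h" using t_nz by simp
  ultimately show "h \<in> tS" unfolding tS_def by blast
qed

lemma tS_sub: "tS \<subseteq> S"
  using tS_iff by (auto simp: S_def less_imp_le)

lemma sgp_tS: "sgp tS"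
  by (auto simp: sgp_def tS_iff abs_diff_less)

lemma tS_multI: "a \<in> S \<Longrightarrow> [:t:] * a \<in> tS" 
  by (auto simp: tS_def)

lemma tS_S_mult:
  assumes "a \<in> S" "b \<in> tS" shows "a * b \<in> tS" "b * a \<in> tS"
proof -
  obtain s where s: "s \<in> S" "b = [:t:] * s" using assms(2) by (auto simp only: tS_def)
  have "a * b = [:t:] * (a * s)" unfolding s(2) by (rule mult.left_commute)
  then show "a * b \<in> tS" using tS_multI[OF S.S_mult[OF assms(1) s(1)]] by simp
  then show "b * a \<in> tS" by (simp only: mult.commute)
qed

lemma one_notin_tS: "1 \<notin> tS"
  by (auto simp: tS_iff intro!: exI[of _ 0])

lemma clear_denominators: "\<exists>N. Polynomial.smult (t ^ N) h \<in> S"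
proof -
  have ex: "\<exists>N. \<phi> t ^ N * c \<le> 1" for c
  proof -
    have "(\<lambda>N. \<phi> t ^ N * c) \<longlonglongrightarrow> 0 * c"
      using t_pos t_less by (intro tendsto_mult LIMSEQ_power_zero tendsto_const) auto
    then have "eventually (\<lambda>N. \<phi> t ^ N * c < 1) sequentially"
      using order_tendstoD(2)[of "\<lambda>N. \<phi> t ^ N * c" 0 sequentially 1] by simp
    then show ?thesis by (meson eventually_sequentially less_imp_le order_refl)
  qed
  define c where "c = Max ((\<lambda>i. \<phi> (coeff h i)) ` {..degree h})"
  obtain N where N: "\<phi> t ^ N * c \<le> 1" using ex by blast
  have "\<phi> t ^ N * \<phi> (coeff h i) \<le> 1" for i
  proof (cases "i \<le> degree h")
    case True
    then have "\<phi> (coeff h i) \<le> c" unfolding c_def by (intro Max_ge) auto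
    then have "\<phi> t ^ N * \<phi> (coeff h i) \<le> \<phi> t ^ N * c" using t_pos by (intro mult_left_mono) auto
    then show ?thesis using N by linarith
  qed (simp add: coeff_eq_0)
  then show ?thesis by (auto simp: S_def abs_mult abs_power)
qed

text \<open>Because \<open>d\<close> is monic, each step of the division algorithm subtracts an
  integral multiple of \<open>d\<close>.\<close>

lemma monic_division:
  assumes "d \<in> S" "Polynomial.lead_coeff d = 1" "h \<in> S"
  shows "\<exists>c\<in>S. \<exists>r\<in>S. h = d * c + r \<and> (r = 0 \<or> degree r < degree d)"
  using assms(3)
proof (induction "degree h" arbitrary: h rule: less_induct)
  case less
  show ?case
  proof (cases "h = 0 \<or> degree h < degree d")
    case True
    then show ?thesis using less.prems S.S_0 by (intro bexI[of _ 0] bexI[of _ h]) auto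
  next
    case False
    define m where "m = monom (Polynomial.lead_coeff h) (degree h - degree d)"
    have m: "m \<in> S" using less.prems by (auto simp: m_def S_def)
    have lc: "\<phi> (Polynomial.lead_coeff h) \<le> 1" using less.prems by (simp add: S_def)
    have d0: "d \<noteq> 0" using assms by auto
    have m0: "m \<noteq> 0" using False by (simp add: m_def)
    have degm: "degree m = degree h - degree d" unfolding m_def using False by (intro degree_monom_eq) auto
    have deg: "degree (d * m) = degree h"
    proof -
      show ?thesis using False degree_mult_eq[OF d0 m0] degm by simp
    qed
    have lceq: "Polynomial.lead_coeff (d * m) = Polynomial.lead_coeff h"
    proof -
      have "coeff m (degree m) = Polynomial.lead_coeff h" unfolding degm by (simp add: m_def)
      then show ?thesis using assms(2) by (simp add: lead_coeff_mult)
    qed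
    define h' where "h' = h - d * m"
    have h': "h' \<in> S" unfolding h'_def using less.prems m assms by (intro S.S_diff S.S_mult)
    show ?thesis
    proof (cases "h' = 0")
      case True
      then have "h = d * m + 0" by (simp add: h'_def)
      then show ?thesis using m S.S_0 by blast
    next
      case h'0: False
      have "degree h' < degree h"
      proof (cases "degree h = 0")
        case True
        then have "coeff h' 0 = 0" using deg lceq by (simp add: h'_def)
        moreover have "degree h' = 0" using True deg degree_diff_le_max[of h "d * m"] by (simp add: h'_def)
        ultimately have "h' = 0" by (metis leading_coeff_0_iff)
        then show ?thesis using h'0 by simp
      next
        case False
        have "degree h' \<le> degree h" using deg degree_diff_le_max[of h "d * m"] by (simp add: h'_def)
        moreover have "coeff h' (degree h) = 0" using deg lceq by (simp add: h'_def)
        ultimately show ?thesis using h'0 by (metis le_neq_implies_less leading_coeff_0_iff)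
      qed
      from less.hyps[OF this h'] obtain c r where
        "c \<in> S" "r \<in> S" "h' = d * c + r" "r = 0 \<or> degree r < degree d" by blast
      moreover have "h = d * (m + c) + r" using calculation by (simp add: h'_def algebra_simps)
      ultimately show ?thesis using m by (blast intro: S.S_add)
    qed
  qed
qed

lemma monic_mod:
  assumes "d \<in> S" "Polynomial.lead_coeff d = 1" "h \<in> S"
  shows "h div d \<in> S" "h mod d \<in> S"
proof -
  obtain c r where *: "c \<in> S" "r \<in> S" "h = d * c + r" "r = 0 \<or> degree r < degree d"
    using monic_division[OF assms] by blast
  have "d \<noteq> 0" using assms by auto
  then have "h div d = c" "h mod d = r"
    using * by (auto simp: div_poly_less mod_poly_less)
  then show "h div d \<in> S" "h mod d \<in> S" using * by simp_all
qed

lemma monic_dvd: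
  assumes "d \<in> S" "Polynomial.lead_coeff d = 1" "h \<in> S"
  shows "d dvd h \<longleftrightarrow> h \<in> (*) d ` S"
proof
  assume "d dvd h"
  then have "h = d * (h div d)" by simp
  then show "h \<in> (*) d ` S" using monic_mod(1)[OF assms] by blast
qed auto

text \<open>\<open>M/L\<close> is a vector space over the residue field because \<open>t M\<close>
  lies in \<open>L\<close>. Enlarging \<open>L\<close> by the line through an \<open>x\<close>
  outside it accounts for a factor of exactly \<open>q\<close>, and a smaller index remains. This is
  what makes residue degrees exist.\<close>

lemma idx_R_modules:
  assumes "sgp M" "sgp L" "L \<subseteq> M" "fin M L"
    and "\<And>c x. \<phi> c \<le> 1 \<Longrightarrow> x \<in> M \<Longrightarrow> [:c:] * x \<in> M"
    and "\<And>c x. \<phi> c \<le> 1 \<Longrightarrow> x \<in> L \<Longrightarrow> [:c:] * x \<in> L"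
    and "\<And>x. x \<in> M \<Longrightarrow> [:t:] * x \<in> L"
  shows "\<exists>d. idx M L = q ^ d"
  using assms(2-4,6,7)
proof (induction "idx M L" arbitrary: L rule: less_induct)
  case less
  show ?case
  proof (cases "M \<subseteq> L")
    case True
    then have "M = L" using less.prems by blast
    then show ?thesis using idx_same[OF assms(1)] by (intro exI[of _ 0]) simp
  next
    case False
    then obtain x where x: "x \<in> M" "x \<notin> L" by blast
    let ?Rx = "(\<lambda>c. [:c:] * x) ` {c. \<phi> c \<le> 1}"
    define L' where "L' = L \<uplus> ?Rx"
    have Rx: "sgp ?Rx"
      unfolding sgp_def
    proof (intro conjI ballI)
      show "0 \<in> ?Rx" by (auto intro!: image_eqI[of _ _ 0])
      fix y z assume "y \<in> ?Rx" "z \<in> ?Rx"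
      then obtain c d where "\<phi> c \<le> 1" "\<phi> d \<le> 1" "y = [:c:] * x" "z = [:d:] * x" by blast
      then show "y - z \<in> ?Rx"
        by (intro image_eqI[of _ _ "c - d"]) (auto simp: abs_diff_le smult_diff_left)
    qed
    have L': "sgp L'" "L \<subseteq> L'" "L' \<subseteq> M"
    proof -
      have "?Rx \<subseteq> M" using assms(5)[OF _ x(1)] by blast
      then show "sgp L'" "L \<subseteq> L'" "L' \<subseteq> M"
        unfolding L'_def by (intro sgp_sadd[OF less.prems(1) Rx] sadd_left[OF Rx]
            sadd_least[OF assms(1) less.prems(2)])+
    qed
    have "idx {c. \<phi> c \<le> 1} {c. \<phi> c < 1} = idx L' L"
    proof (rule idx_transfer[where g = "\<lambda>c. [:c:] * x"])
      show "[:c:] * x \<in> L'" if "c \<in> {c. \<phi> c \<le> 1}" for c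
        unfolding L'_def by (rule subsetD[OF sadd_right[OF less.prems(1)] imageI[OF that]])
      show "c - d \<in> {c. \<phi> c < 1} \<longleftrightarrow> [:c:] * x - [:d:] * x \<in> L"
        if "c \<in> {c. \<phi> c \<le> 1}" "d \<in> {c. \<phi> c \<le> 1}" for c d
      proof -
        have le: "\<phi> (c - d) \<le> 1" using that by (simp add: abs_diff_le)
        have eq: "[:c:] * x - [:d:] * x = [:c - d:] * x" by (simp add: smult_diff_left)
        show ?thesis
        proof
          assume "c - d \<in> {c. \<phi> c < 1}"
          then have "\<phi> ((c - d) / t) \<le> 1" using discrete t_pos by (simp add: abs_divide)
          then have "[:(c - d) / t:] * ([:t:] * x) \<in> L" using less.prems x by blast
          moreover have "[:(c - d) / t:] * ([:t:] * x) = [:c - d:] * x" using t_nz by simp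
          ultimately show "[:c:] * x - [:d:] * x \<in> L" using eq by simp
        next
          assume L: "[:c:] * x - [:d:] * x \<in> L"
          show "c - d \<in> {c. \<phi> c < 1}"
          proof (rule ccontr)
            assume "c - d \<notin> {c. \<phi> c < 1}"
            then have 1: "\<phi> (c - d) = 1" using le by simp
            then have nz: "c - d \<noteq> 0" using abs_eq_0[of "c - d"] by auto
            have "[:inverse (c - d):] * ([:c - d:] * x) \<in> L"
              by (rule less.prems(4)) (use 1 L eq in \<open>simp_all add: abs_inverse\<close>)
            moreover have "[:inverse (c - d):] * ([:c - d:] * x) = x" using nz by simp
            ultimately show False using x by simp
          qed
        qed
      qed
      show "\<exists>c\<in>{c. \<phi> c \<le> 1}. z - [:c:] * x \<in> L" if "z \<in> L'" for z
        using that unfolding L'_def by (auto elim!: saddE)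
    qed (use sgp_m less.prems in auto)
    then have q: "idx L' L = q" by (simp add: q_def)
    have tower: "idx M L = idx M L' * idx L' L" "fin M L'" "fin L' L"
      using idx_tower[of L L' M] less.prems L' assms(1) by auto
    have "0 < idx M L'" using idx_pos[OF tower(2)] x by blast
    then have "idx M L' < idx M L" using tower(1) q q_gt_1 by simp
    moreover have "[:c:] * y \<in> L'" if c: "\<phi> c \<le> 1" and "y \<in> L'" for c y
    proof -
      obtain l d where ld: "l \<in> L" "\<phi> d \<le> 1" "y = l + [:d:] * x" using \<open>y \<in> L'\<close> by (auto simp: L'_def elim!: saddE)
      have "[:c:] * y = [:c:] * l + [:c * d:] * x" using ld by (simp add: smult_add_right)
      also have "\<dots> \<in> L'"
        unfolding L'_def using less.prems(4)[OF c ld(1)] abs_le_mult[OF c ld(2)] by (intro saddI) blast+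
      finally show ?thesis .
    qed
    ultimately obtain d where "idx M L' = q ^ d"
      using less.hyps[of L'] L' tower(2) less.prems(5) by blast
    then have "idx M L = q ^ Suc d" using tower(1) q by simp
    then show ?thesis by blast
  qed
qed

end

text \<open>A non-zero combination of least degree divides both polynomials, so it is a
  unit.\<close>

lemma irreducible_bezout:
  fixes f g :: "'k::field poly"
  assumes "Factorial_Ring.irreducible f" "\<not> f dvd g"
  shows "\<exists>u v. u * g + v * f = 1"
proof -
  let ?D = "\<lambda>d. d \<noteq> 0 \<and> (\<exists>u v. d = u * g + v * f)"
  have "f = 0 * g + 1 * f" by simp
  then have "?D f" using assms(1) by (metis not_irreducible_zero)
  define d where "d = arg_min degree ?D"
  have d: "?D d" "\<And>e. ?D e \<Longrightarrow> degree d \<le> degree e"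
    unfolding d_def using arg_min_natI[of ?D f degree] arg_min_nat_le[of ?D _ degree] \<open>?D f\<close> by auto
  then obtain u v where uv: "d = u * g + v * f" by blast
  have dvd: "d dvd h" if h: "h = a * g + b * f" for h a b
  proof -
    have "h mod d = h - h div d * d" by (simp add: minus_div_mult_eq_mod)
    also have "\<dots> = (a - h div d * u) * g + (b - h div d * v) * f"
      using h uv by (simp add: algebra_simps)
    finally have "h mod d = 0 \<or> degree d \<le> degree (h mod d)" using d(2) by blast
    then have "h mod d = 0" using degree_mod_less[of d h] d(1) by auto
    then show ?thesis by auto
  qed
  have df: "d dvd f" by (rule dvd[of _ 0 1]) simp
  have dg: "d dvd g" by (rule dvd[of _ 1 0]) simp
  obtain c where c: "f = d * c" using df by blast
  have "d dvd 1 \<or> c dvd 1" using Factorial_Ring.irreducibleD[OF assms(1) c] .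
  moreover have "\<not> c dvd 1"
  proof
    assume "c dvd 1"
    then have "f dvd d" using c by (metis dvd_mult_unit_iff dvd_refl)
    then show False using assms dg dvd_trans by blast
  qed
  ultimately obtain e where "1 = d * e" by blast
  then have "(e * u) * g + (e * v) * f = 1" using uv by (simp add: algebra_simps)
  then show ?thesis by blast
qed

section \<open>The ring \<open>S/(f)\<close> for a separable \<open>f\<close>\<close>

text \<open>The last assumption keeps \<open>f\<close> coprime to its derivative modulo
  \<open>t\<close>, so the place is unramified in \<open>k[X]/(f)\<close>. Demanding only that
  certain coefficients be integral, it holds outside finitely many places.\<close>

locale dvr_poly = dvr_abs +
  fixes f :: "'a poly"
  assumes f_S: "f \<in> S" and f_monic: "Polynomial.lead_coeff f = 1"
    and f_irr: "Factorial_Ring.irreducible f"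
    and f_sep: "\<exists>u\<in>S. \<exists>v\<in>S. u * f + v * pderiv f = 1"
begin

text \<open>Ideals of \<open>S/(f)\<close> are handled as ideals of \<open>S\<close> containing
  \<open>f\<close>; this one stands for the principal ideal of \<open>a\<close>.\<close>

definition gen :: "'a poly \<Rightarrow> 'a poly set" where
  "gen a = {a * x + f * y | x y. x \<in> S \<and> y \<in> S}"

definition ideal :: "'a poly set \<Rightarrow> bool" where
  "ideal J \<longleftrightarrow> J \<subseteq> S \<and> sgp J \<and> (\<forall>c\<in>S. \<forall>x\<in>J. c * x \<in> J)"

text \<open>The finite-index maximal ideals of \<open>S/(f)\<close>: by \<open>prime_above\<close>,
  the condition on \<open>t\<close> loses none of them.\<close>

definition primes :: "'a poly set set" where
  "primes = {P. ideal P \<and> [:t:] \<in> P \<and> f \<in> P \<and> 1 \<notin> P \<and> (\<forall>J. ideal J \<and> P \<subseteq> J \<and> 1 \<notin> J \<longrightarrow> J = P)}"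

section \<open>Ideals containing f\<close>

lemma f_nz: "f \<noteq> 0"
  using f_monic by auto

lemma f_deg: "0 < degree f"
proof (rule ccontr)
  assume "\<not> 0 < degree f"
  then obtain c where "f = [:c:]" by (auto elim: degree_eq_zeroE)
  then have "f = 1" using f_monic by (simp add: one_pCons)
  then show False using Factorial_Ring.irreducible_not_unit[OF f_irr] by simp
qed

lemma f_prime: "f dvd a * b \<longleftrightarrow> f dvd a \<or> f dvd b"
  using prime_elem_dvd_mult_iff[OF field_poly_irreducible_imp_prime[OF f_irr]] .

lemma f_dvd_iff: "h \<in> S \<Longrightarrow> f dvd h \<longleftrightarrow> h \<in> (*) f ` S"
  by (rule monic_dvd[OF f_S f_monic])

lemma f_dvdE: assumes "h \<in> S" "f dvd h" obtains y where "y \<in> S" "h = f * y"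
  using f_dvd_iff assms by blast

lemma idealD:
  assumes "ideal J"
  shows "J \<subseteq> S" "sgp J" "\<And>c x. c \<in> S \<Longrightarrow> x \<in> J \<Longrightarrow> c * x \<in> J" "\<And>c x. c \<in> S \<Longrightarrow> x \<in> J \<Longrightarrow> x * c \<in> J"
    "0 \<in> J" "\<And>x y. x \<in> J \<Longrightarrow> y \<in> J \<Longrightarrow> x + y \<in> J" "\<And>x y. x \<in> J \<Longrightarrow> y \<in> J \<Longrightarrow> x - y \<in> J"
    "\<And>x. x \<in> J \<Longrightarrow> x \<in> S"
proof -
  show 1: "J \<subseteq> S" and 2: "sgp J" and 3: "\<And>c x. c \<in> S \<Longrightarrow> x \<in> J \<Longrightarrow> c * x \<in> J"
    using assms by (auto simp: ideal_def)
  show "\<And>c x. c \<in> S \<Longrightarrow> x \<in> J \<Longrightarrow> x * c \<in> J"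
  proof -
    fix c x assume "c \<in> S" "x \<in> J"
    from 3[OF this] show "x * c \<in> J" by (simp add: mult.commute)
  qed
  show "0 \<in> J" "\<And>x y. x \<in> J \<Longrightarrow> y \<in> J \<Longrightarrow> x + y \<in> J" "\<And>x y. x \<in> J \<Longrightarrow> y \<in> J \<Longrightarrow> x - y \<in> J"
    by (rule sgp_0[OF 2], rule sgp_add[OF 2], assumption+, rule sgp_diff[OF 2])
  show "\<And>x. x \<in> J \<Longrightarrow> x \<in> S" using 1 by blast
qed

lemma ideal_1: assumes "ideal J" "1 \<in> J" shows "J = S"
  using idealD(1)[OF assms(1)] idealD(3)[OF assms(1) _ assms(2)] by auto

lemma genI: "x \<in> S \<Longrightarrow> y \<in> S \<Longrightarrow> a * x + f * y \<in> gen a"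
  by (auto simp: gen_def)

lemma genE: assumes "h \<in> gen a" obtains x y where "x \<in> S" "y \<in> S" "h = a * x + f * y"
  using assms by (auto simp: gen_def)

lemma gen_ideal: assumes "a \<in> S" shows "ideal (gen a)"
  unfolding ideal_def sgp_def
proof (intro conjI ballI)
  show "gen a \<subseteq> S" using assms f_S by (auto simp: gen_def intro!: S.S_add S.S_mult)
  show "0 \<in> gen a" using genI[OF S.S_0 S.S_0, of a] by simp
next
  fix x y assume "x \<in> gen a" "y \<in> gen a"
  then obtain x1 x2 y1 y2 where *: "x1 \<in> S" "x2 \<in> S" "y1 \<in> S" "y2 \<in> S" "x = a * x1 + f * x2" "y = a * y1 + f * y2"
    by (auto simp: gen_def)
  have "x - y = a * (x1 - y1) + f * (x2 - y2)" unfolding *(5,6) by Groebner_Basis.algebra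
  also have "\<dots> \<in> gen a" by (intro genI S.S_diff *)
  finally show "x - y \<in> gen a" .
next
  fix c x assume c: "c \<in> S" and "x \<in> gen a"
  then obtain x1 x2 where *: "x1 \<in> S" "x2 \<in> S" "x = a * x1 + f * x2"
    by (auto simp: gen_def)
  have "c * x = a * (c * x1) + f * (c * x2)" unfolding *(3) by Groebner_Basis.algebra
  also have "\<dots> \<in> gen a" by (intro genI S.S_mult c *)
  finally show "c * x \<in> gen a" .
qed

lemma gen_self: "a \<in> gen a" and gen_f: "f \<in> gen a"
  using genI[OF S.S_1 S.S_0, of a] genI[OF S.S_0 S.S_1, of a] by simp_all

lemma gen_least: assumes "ideal J" "a \<in> J" "f \<in> J" shows "gen a \<subseteq> J"
  unfolding gen_def
proof clarify
  fix x y assume "x \<in> S" "y \<in> S"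
  then show "a * x + f * y \<in> J" by (intro idealD(6)[OF assms(1)] idealD(4)[OF assms(1)] assms(2,3))
qed

lemma gen_1: "gen 1 = S"
  using ideal_1[OF gen_ideal[OF S.S_1] gen_self] .

text \<open>With \<open>x\<close> replaced by its remainder modulo \<open>f\<close>, the polynomial
  \<open>1 - t x\<close> is a multiple of \<open>f\<close> of smaller degree, hence 0, although
  \<open>t\<close> is no unit of \<open>S\<close>.\<close>

lemma one_notin_gen_t: "1 \<notin> gen [:t:]"
proof
  assume "1 \<in> gen [:t:]"
  then obtain x y where xy: "x \<in> S" "y \<in> S" "1 = [:t:] * x + f * y" by (rule genE)
  define r where "r = x mod f"
  have r: "r \<in> S" unfolding r_def by (rule monic_mod(2)[OF f_S f_monic xy(1)])
  have "x = f * (x div f) + r" by (simp add: r_def)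
  then have "1 - [:t:] * r = f * (y + [:t:] * (x div f))"
    using xy(3) by (simp add: algebra_simps) (metis add.commute smult_add_right mult_smult_right)
  then have dvd: "f dvd 1 - [:t:] * r" by simp
  have "degree r < degree f" using degree_mod_less[OF f_nz, of x] f_deg by (auto simp: r_def)
  then have "degree (1 - [:t:] * r) < degree f"
    using f_deg by (intro degree_diff_less) (auto intro: le_less_trans[OF degree_smult_le])
  then have "1 - [:t:] * r = 0" using dvd by (meson dvd_imp_degree_le not_le)
  then have "1 = [:t:] * r" by simp
  then have "1 \<in> tS" using tS_multI[OF r] by metis
  then show False using one_notin_tS by simp
qed

lemma t_notin_fS: "\<not> f dvd [:t:]"
  using f_deg t_nz by (auto dest!: dvd_imp_degree_le)

lemma ideal_tS:
  assumes "ideal J" "[:t:] \<in> J" "a \<in> tS" shows "a \<in> J"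
proof -
  obtain s where "s \<in> S" "a = [:t:] * s" using assms(3) by (auto simp only: tS_def)
  then show ?thesis using idealD(4)[OF assms(1) _ assms(2)] by simp
qed

text \<open>Modulo \<open>t\<close> the ideal becomes one of a polynomial ring over the residue
  field, hence principal. The generator comes from an element of least degree among those that do
  not vanish modulo \<open>t\<close>, scaled to be monic.\<close>

lemma residue_generator:
  assumes J: "ideal J" "[:t:] \<in> J" "f \<in> J"
  shows "\<exists>d\<in>J. Polynomial.lead_coeff d = 1 \<and> (\<forall>h\<in>J. \<exists>b\<in>S. h - d * b \<in> tS)"
proof -
  have "f \<notin> tS" using f_monic by (auto simp: tS_iff intro!: exI[of _ "degree f"])
  define D where "D = (\<lambda>d. d \<in> J \<and> d \<notin> tS)"
  define d where "d = arg_min degree D"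
  have d: "d \<in> J" "d \<notin> tS" "\<And>e. e \<in> J \<Longrightarrow> e \<notin> tS \<Longrightarrow> degree d \<le> degree e"
  proof -
    have "D f" using J(3) \<open>f \<notin> tS\<close> by (simp add: D_def)
    then have "D d" unfolding d_def by (rule arg_min_natI)
    then show "d \<in> J" "d \<notin> tS" by (simp_all add: D_def)
    fix e assume "e \<in> J" "e \<notin> tS"
    then have "D e" by (simp add: D_def)
    then show "degree d \<le> degree e" unfolding d_def by (rule arg_min_nat_le)
  qed
  let ?c = "Polynomial.lead_coeff d"
  have dS: "d \<in> S" using d(1) idealD(1)[OF J(1)] by blast
  have c1: "\<phi> ?c \<le> 1" using dS by (simp add: S_def)
  \<comment> \<open>If the leading coefficient vanished modulo \<open>t\<close>, dropping the
    leading term would leave an element of the same kind and of smaller degree.\<close>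
  have "\<phi> ?c = 1"
  proof (rule ccontr)
    assume "\<phi> ?c \<noteq> 1"
    then have "\<phi> ?c < 1" using c1 by simp
    then have m: "monom ?c (degree d) \<in> tS" by (simp add: tS_iff)
    define e where "e = d - monom ?c (degree d)"
    have "e \<in> J" unfolding e_def by (rule idealD(7)[OF J(1) d(1) ideal_tS[OF J(1,2) m]])
    moreover have "e \<notin> tS"
    proof
      assume "e \<in> tS"
      then have "e + monom ?c (degree d) \<in> tS" using m sgp_add[OF sgp_tS] by blast
      then show False using d(2) by (simp add: e_def)
    qed
    ultimately have "degree d \<le> degree e" by (rule d(3))
    moreover have "degree e \<le> degree d" unfolding e_def by (intro degree_diff_le) (auto simp: degree_monom_le)
    moreover have "coeff e (degree d) = 0" by (simp add: e_def)
    ultimately have "e = 0" by (metis le_antisym leading_coeff_0_iff)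
    then show False using \<open>e \<notin> tS\<close> sgp_0[OF sgp_tS] by simp
  qed
  then have c: "?c \<noteq> 0" "\<phi> (inverse ?c) = 1" using abs_eq_0[of ?c] by (auto simp: abs_inverse)
  define e where "e = [:inverse ?c:] * d"
  have eJ: "e \<in> J" unfolding e_def using c d(1) by (intro idealD(3)[OF J(1)]) auto
  have elc: "Polynomial.lead_coeff e = 1" using c by (simp add: e_def)
  have edeg: "degree e = degree d" using c by (simp add: e_def)
  have "\<exists>b\<in>S. h - e * b \<in> tS" if h: "h \<in> J" for h
  proof -
    have eS: "e \<in> S" and hS: "h \<in> S" using eJ h idealD(1)[OF J(1)] by blast+
    obtain b r where br: "b \<in> S" "r \<in> S" "h = e * b + r" "r = 0 \<or> degree r < degree e"
      using monic_division[OF eS elc hS] by blast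
    have "r = h - e * b" using br by simp
    then have rJ: "r \<in> J" using idealD(7)[OF J(1) h idealD(4)[OF J(1) br(1) eJ]] by simp
    have "r \<in> tS"
    proof (rule ccontr)
      assume n: "r \<notin> tS"
      then have "degree d \<le> degree r" using d(3)[OF rJ] by simp
      moreover have "r \<noteq> 0" using n sgp_0[OF sgp_tS] by auto
      ultimately show False using br(4) edeg by simp
    qed
    then show ?thesis using br by (intro bexI[of _ b]) auto
  qed
  then show ?thesis using eJ elc by blast
qed

text \<open>
  With \<open>f = d c\<close> modulo \<open>t\<close>, separability gives \<open>1 = c A + d B\<close> modulo \<open>t\<close>, and \<open>c A\<close> is the
  idempotent modulo \<open>(t, f)\<close> that belongs to the ideal \<open>(t, d)\<close>.
\<close>

lemma residue_idempotent:
  assumes J: "ideal J" "[:t:] \<in> J" "f \<in> J"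
  shows "\<exists>e\<in>S. 1 - e \<in> J \<and> (\<forall>h\<in>J. e * h \<in> gen [:t:])"
proof -
  obtain d where d: "d \<in> J" "Polynomial.lead_coeff d = 1" "\<And>h. h \<in> J \<Longrightarrow> \<exists>b\<in>S. h - d * b \<in> tS"
    using residue_generator[OF J] by blast
  have dS: "d \<in> S" using d(1) idealD(1)[OF J(1)] by blast
  obtain c where c: "c \<in> S" "f - d * c \<in> tS" using d(3)[OF J(3)] by blast
  then obtain x where x: "x \<in> S" "f - d * c = [:t:] * x" by (auto simp only: tS_def)
  obtain u v where uv: "u \<in> S" "v \<in> S" "u * f + v * pderiv f = 1" using f_sep by blast
  have pd: "pderiv h \<in> S" if "h \<in> S" for h
  proof -
    have "\<phi> (of_nat m) \<le> 1" for m by (induction m) (simp_all add: abs_add_le)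
    from this[of "Suc n" for n] show ?thesis
      using that by (auto simp: S_def coeff_pderiv simp del: of_nat_Suc intro!: abs_le_mult)
  qed
  have f: "f = d * c + [:t:] * x" using x by (simp add: algebra_simps)
  have "pderiv f = pderiv d * c + d * pderiv c + [:t:] * pderiv x"
    unfolding f pderiv_add pderiv_mult by (simp add: pderiv_pCons)
  then have *: "1 = c * (u * d + v * pderiv d) + d * (v * pderiv c) + [:t:] * (u * x + v * pderiv x)"
    using uv(3) f by Groebner_Basis.algebra
  define e where "e = c * (u * d + v * pderiv d)"
  have eS: "e \<in> S" unfolding e_def by (intro S.S_mult S.S_add c uv dS pd)
  have "1 - e = (v * pderiv c) * d + (u * x + v * pderiv x) * [:t:]"
    unfolding e_def using * by Groebner_Basis.algebra
  moreover have "\<dots> \<in> J"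
    by (intro idealD(6)[OF J(1)] idealD(3)[OF J(1)] d J S.S_mult S.S_add c uv dS pd x)
  ultimately have "1 - e \<in> J" by simp
  moreover have "e * h \<in> gen [:t:]" if h: "h \<in> J" for h
  proof -
    obtain b where b: "b \<in> S" "h - d * b \<in> tS" using d(3)[OF h] by blast
    then obtain y where y: "y \<in> S" "h - d * b = [:t:] * y" by (auto simp only: tS_def)
    let ?A = "u * d + v * pderiv d"
    have A: "?A \<in> S" by (intro S.S_mult S.S_add c uv dS pd)
    have h: "h = d * b + [:t:] * y" using y by (simp add: algebra_simps)
    have "d * c = f - [:t:] * x" using f by simp
    then have "e * h = [:t:] * (e * y - x * ?A * b) + f * (?A * b)"
      unfolding e_def h by Groebner_Basis.algebra
    then show ?thesis using genI[of "e * y - x * ?A * b" "?A * b" "[:t:]"] A b x y eS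
      by (metis S.S_diff S.S_mult)
  qed
  ultimately show ?thesis using eS by blast
qed

lemma power_t_gen: "Polynomial.smult (t ^ N) h = [:t:] ^ N * h"
  by (simp add: poly_const_pow)

text \<open>Over \<open>k\<close> there is a Bezout identity for \<open>a\<close> and
  \<open>f\<close>; clearing its denominators turns the 1 into a power of \<open>t\<close>.\<close>

lemma power_t_in:
  assumes "a \<in> S" "\<not> f dvd a" shows "\<exists>N. [:t:] ^ N \<in> gen a"
proof -
  obtain u v where uv: "u * a + v * f = 1" using irreducible_bezout[OF f_irr assms(2)] by blast
  obtain N1 where N1: "Polynomial.smult (t ^ N1) u \<in> S" using clear_denominators by blast
  obtain N2 where N2: "Polynomial.smult (t ^ N2) v \<in> S" using clear_denominators by blast
  let ?T = "[:t:] ^ (N1 + N2)"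
  have T: "[:t:] ^ N \<in> S" for N by (rule S_power[OF t_S])
  have "?T = ?T * (u * a + v * f)" using uv by simp
  also have "\<dots> = a * ([:t:] ^ N2 * ([:t:] ^ N1 * u)) + f * ([:t:] ^ N1 * ([:t:] ^ N2 * v))"
    by (simp only: power_add algebra_simps)
  also have "\<dots> \<in> gen a"
    by (intro genI S.S_mult T N1[unfolded power_t_gen] N2[unfolded power_t_gen])
  finally show ?thesis by blast
qed

text \<open>Modulo \<open>J\<close> the element \<open>t\<close> is nilpotent while
  \<open>t z\<close> equals 1. Concretely, membership of \<open>t^(N+1)\<close> descends to
  membership of \<open>t^N\<close>.\<close>

lemma ideal_unit_t:
  assumes J: "ideal J" and "1 - [:t:] * z \<in> J" "z \<in> S" "[:t:] ^ N \<in> J"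
  shows "J = S"
proof -
  have "1 \<in> J" using assms(4)
  proof (induction N)
    case (Suc N)
    have "[:t:] ^ N = [:t:] ^ N * (1 - [:t:] * z) + z * [:t:] ^ Suc N"
      unfolding power_Suc by Groebner_Basis.algebra
    also have "\<dots> \<in> J"
      by (intro idealD(6)[OF J] idealD(3)[OF J] S_power t_S assms(2,3) Suc.prems)
    finally show ?case by (rule Suc.IH)
  qed simp
  then show ?thesis by (rule ideal_1[OF J])
qed

text \<open>An idempotent \<open>e\<close> that is 1 at the maximal ideals above \<open>J\<close>
  and 0 at the others makes \<open>p = 1 - e + t e\<close> look like \<open>t\<close> above
  \<open>J\<close> and like 1 elsewhere.\<close>

lemma principal_generator:
  assumes J: "ideal J" "[:t:] \<in> J" "f \<in> J"
  shows "\<exists>p\<in>S. J = gen p"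
proof -
  obtain e0 where e0: "e0 \<in> S" "1 - e0 \<in> J" "\<And>h. h \<in> J \<Longrightarrow> e0 * h \<in> gen [:t:]"
    using residue_idempotent[OF J] by blast
  have G: "ideal (gen [:t:])" by (rule gen_ideal[OF t_S])
  have e0': "e0 * (1 - e0) \<in> gen [:t:]" using e0(2,3) by blast
  \<comment> \<open>Newton step for idempotents: the error of \<open>e0\<close> lies in
    \<open>(t, f)\<close>, that of \<open>e\<close> in \<open>(t^2, f)\<close>. With
    \<open>e0\<close> itself the error in the product computed below would have the same order as
    \<open>t\<close>.\<close>
  define e where "e = e0 * e0 * (3 - 2 * e0)"
  have one_e: "1 - e = (1 - e0) * (1 - e0) * (1 + 2 * e0)" unfolding e_def by Groebner_Basis.algebra
  have n: "3 - 2 * e0 \<in> S" "1 + 2 * e0 \<in> S" "1 - e0 \<in> S"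
    using e0(1) by (simp_all add: S.S_add S.S_diff S.S_mult S.S_1 S_numeral)
  have eS: "e \<in> S" unfolding e_def by (intro S.S_mult e0 n)
  have eJ: "1 - e \<in> J" unfolding one_e
    by (intro idealD(4)[OF J(1)] e0 n)
  have eh: "e * h \<in> gen [:t:]" if "h \<in> J" for h
  proof -
    have "e * h = (e0 * (3 - 2 * e0)) * (e0 * h)" unfolding e_def by (simp only: mult_ac)
    also have "\<dots> \<in> gen [:t:]" by (intro idealD(3)[OF G] S.S_mult e0 n that)
    finally show ?thesis .
  qed
  obtain x y where xy: "x \<in> S" "y \<in> S" "e0 * (1 - e0) = [:t:] * x + f * y" using e0' by (rule genE)
  define w where "w = (3 - 2 * e0) * (1 + 2 * e0)"
  have w: "w \<in> S" unfolding w_def by (intro S.S_mult n)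
  have sq: "e * (1 - e) = [:t:] * [:t:] * (x * x * w) + f * (w * (2 * [:t:] * x * y + f * y * y))"
  proof -
    have "e * (1 - e) = (e0 * (1 - e0)) * (e0 * (1 - e0)) * w" unfolding one_e unfolding e_def w_def by Groebner_Basis.algebra
    then show ?thesis unfolding xy(3) by Groebner_Basis.algebra
  qed
  define \<alpha> \<beta> where "\<alpha> = x * x * w" and "\<beta> = w * (2 * [:t:] * x * y + f * y * y)"
  have ab: "\<alpha> \<in> S" "\<beta> \<in> S" unfolding \<alpha>_def \<beta>_def by (intro S.S_mult S.S_add w xy t_S f_S S_numeral)+
  define p where "p = 1 - e + [:t:] * e"
  have pS: "p \<in> S" unfolding p_def by (intro S.S_add S.S_diff S.S_mult S.S_1 eS t_S)
  have P: "ideal (gen p)" by (rule gen_ideal[OF pS])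
  \<comment> \<open>The product of \<open>p\<close> and \<open>e + t (1 - e)\<close> is
    \<open>t + e (1 - e) (1 - t)^2\<close>. Modulo \<open>f\<close> this equals
    \<open>t (1 - t z)\<close> with \<open>z\<close> being minus
    \<open>\<alpha> (1 - t)^2\<close>.\<close>
  define z where "z = - ([:t:] * \<alpha> * [:t:] + \<alpha> - 2 * [:t:] * \<alpha>)"
  have zS: "z \<in> S" unfolding z_def by (intro S.S_uminus S.S_diff S.S_add S.S_mult ab t_S S_numeral)
  have "p * (e + [:t:] * (1 - e)) = [:t:] * (1 - [:t:] * z) + f * (\<beta> + [:t:] * [:t:] * \<beta> - 2 * [:t:] * \<beta>)"
  proof -
    have "p * (e + [:t:] * (1 - e)) = [:t:] + e * (1 - e) * (1 + [:t:] * [:t:] - 2 * [:t:])"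
      unfolding p_def by Groebner_Basis.algebra
    then show ?thesis unfolding sq \<alpha>_def[symmetric] \<beta>_def[symmetric] z_def by Groebner_Basis.algebra
  qed
  then have "[:t:] * (1 - [:t:] * z) = p * (e + [:t:] * (1 - e)) + f * (- (\<beta> + [:t:] * [:t:] * \<beta> - 2 * [:t:] * \<beta>))"
    by Groebner_Basis.algebra
  moreover have "\<dots> \<in> gen p"
    by (intro genI S.S_uminus S.S_diff S.S_add S.S_mult ab t_S S_numeral eS S.S_1)
  ultimately have tz: "[:t:] * (1 - [:t:] * z) \<in> gen p" by simp
  have uS: "1 - [:t:] * z \<in> S" by (intro S.S_diff S.S_mult S.S_1 t_S zS)
  have "\<not> f dvd 1 - [:t:] * z"
  proof
    assume "f dvd 1 - [:t:] * z"
    then obtain y where "y \<in> S" "1 - [:t:] * z = f * y" using f_dvdE[OF uS] by blast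
    then have "1 = [:t:] * z + f * y" by (simp add: algebra_simps)
    then have "1 \<in> gen [:t:]" using genI[OF zS \<open>y \<in> S\<close>, of "[:t:]"] by simp
    then show False using one_notin_gen_t by simp
  qed
  \<comment> \<open>\<open>1 - t z\<close> is a unit modulo \<open>f\<close>, so that
    \<open>t\<close> itself lies in \<open>gen p\<close>.\<close>
  then obtain N where "[:t:] ^ N \<in> gen (1 - [:t:] * z)" using power_t_in[OF uS] by blast
  then have "gen (1 - [:t:] * z) = S"
    using ideal_unit_t[OF gen_ideal[OF uS] gen_self zS] by blast
  then obtain a b where ab1: "a \<in> S" "b \<in> S" "1 = (1 - [:t:] * z) * a + f * b"
    using S.S_1 by (metis genE)
  have "[:t:] = a * ([:t:] * (1 - [:t:] * z)) + f * ([:t:] * b)"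
  proof -
    have "[:t:] = [:t:] * ((1 - [:t:] * z) * a + f * b)" using ab1(3) by simp
    then show ?thesis by Groebner_Basis.algebra
  qed
  also have "\<dots> \<in> gen p"
    by (intro idealD(6)[OF P] idealD(3)[OF P] idealD(4)[OF P] gen_f S.S_mult t_S ab1 tz)
  finally have tp: "[:t:] \<in> gen p" .
  have "gen p \<subseteq> J"
  proof (rule gen_least[OF J(1) _ J(3)])
    show "p \<in> J" unfolding p_def by (intro idealD(6)[OF J(1)] idealD(4)[OF J(1)] eJ J eS)
  qed
  moreover have "J \<subseteq> gen p"
  proof
    fix h assume h: "h \<in> J"
    have hS: "h \<in> S" using h idealD(1)[OF J(1)] by blast
    have "e * h \<in> gen p" using eh[OF h] gen_least[OF P tp gen_f] by blast
    moreover have "1 - e \<in> gen p"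
    proof -
      have "1 - e = p - e * [:t:]" by (simp add: p_def)
      then show ?thesis using idealD(7)[OF P gen_self] idealD(3)[OF P eS tp] by simp
    qed
    then have "(1 - e) * h \<in> gen p" by (rule idealD(4)[OF P hS])
    ultimately have "e * h + (1 - e) * h \<in> gen p" by (rule idealD(6)[OF P])
    moreover have "e * h + (1 - e) * h = h" by (simp add: left_diff_distrib)
    ultimately show "h \<in> gen p" by simp
  qed
  ultimately show ?thesis using pS by blast
qed

section \<open>Maximal ideals and the quotient by (t, f)\<close>

lemma primesD:
  assumes "P \<in> primes"
  shows "ideal P" "[:t:] \<in> P" "f \<in> P" "1 \<notin> P"
    "\<And>J. ideal J \<Longrightarrow> P \<subseteq> J \<Longrightarrow> 1 \<notin> J \<Longrightarrow> J = P"
  using assms by (auto simp: primes_def)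

text \<open>By maximality, \<open>P\<close> and \<open>s\<close> together generate the unit
  ideal.\<close>

lemma prime_inverse:
  assumes P: "P \<in> primes" and s: "s \<in> S" "s \<notin> P"
  shows "\<exists>r\<in>S. 1 - s * r \<in> P"
proof -
  note PD = idealD[OF primesD(1)[OF P]]
  let ?J = "P \<uplus> (*) s ` S"
  have "S.sub S" unfolding S.sub_def by (simp add: S.sgp_S S.S_mult)
  then have A: "sgp ((*) s ` S)" by (rule S.sub_sgp[OF S.sub_image])
  have J: "ideal ?J"
    unfolding ideal_def
  proof (intro conjI ballI)
    show "?J \<subseteq> S" using PD(1) s by (intro sadd_least S.sgp_S) (auto simp: S.S_mult)
    show "sgp ?J" by (intro sgp_sadd PD A)
    fix c x assume c: "c \<in> S" and "x \<in> ?J"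
    then obtain y s' where ys: "y \<in> P" "s' \<in> S" "x = y + s * s'" by (auto elim!: saddE)
    have "c * x = c * y + s * (c * s')" unfolding ys(3) by Groebner_Basis.algebra
    moreover have "\<dots> \<in> ?J" by (intro saddI PD(3) imageI S.S_mult ys c)
    ultimately show "c * x \<in> ?J" by simp
  qed
  have PJ: "P \<subseteq> ?J" by (rule sadd_left[OF A])
  have "s * 1 \<in> ?J" by (rule subsetD[OF sadd_right[OF PD(2)] imageI[OF S.S_1]])
  then have "s \<in> ?J" by simp
  then have "1 \<in> ?J" using primesD(5)[OF P J PJ] s by blast
  then obtain y r where "y \<in> P" "r \<in> S" "1 = y + s * r" by (auto elim!: saddE)
  moreover from this have "y = 1 - s * r" by (simp add: eq_diff_eq)
  ultimately show ?thesis by auto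
qed

lemma prime_mult:
  assumes P: "P \<in> primes" and ab: "a \<in> S" "b \<in> S" "a * b \<in> P"
  shows "a \<in> P \<or> b \<in> P"
proof (rule disjCI)
  assume "b \<notin> P"
  then obtain r where r: "r \<in> S" "1 - b * r \<in> P" using prime_inverse[OF P ab(2)] by blast
  have "a = a * (1 - b * r) + r * (a * b)" by Groebner_Basis.algebra
  also have "\<dots> \<in> P"
    by (intro idealD(6)[OF primesD(1)[OF P]] idealD(3)[OF primesD(1)[OF P]] r ab)
  finally show "a \<in> P" .
qed

lemma prime_prod:
  assumes P: "P \<in> primes" and "finite A" "\<And>i. i \<in> A \<Longrightarrow> h i \<in> S" "\<And>i. i \<in> A \<Longrightarrow> h i \<notin> P"
  shows "prod h A \<notin> P"
  using assms(2-)
proof (induction A)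
  case empty
  then show ?case using primesD(4)[OF P] by simp
next
  case (insert i A)
  have "prod h A \<in> S" using insert.prems by (intro S_prod) auto
  then show ?case using prime_mult[OF P, of "h i" "prod h A"] insert by auto
qed

lemma prime_power: "P \<in> primes \<Longrightarrow> s \<in> S \<Longrightarrow> s \<notin> P \<Longrightarrow> s ^ n \<notin> P"
  using prime_prod[of P "{..<n}" "\<lambda>_. s"] by simp

lemma gen_t_iff: assumes "a \<in> S" shows "a \<in> gen [:t:] \<longleftrightarrow> a mod f \<in> tS"
proof
  assume "a \<in> gen [:t:]"
  then obtain x y where xy: "x \<in> S" "y \<in> S" "a = [:t:] * x + f * y" by (rule genE)
  have "a mod f = [:t:] * (x mod f)" unfolding xy(3) by (simp add: mod_smult_left)
  then show "a mod f \<in> tS" using tS_multI[OF monic_mod(2)[OF f_S f_monic xy(1)]] by simp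
next
  assume "a mod f \<in> tS"
  then obtain x where x: "x \<in> S" "a mod f = [:t:] * x" by (auto simp only: tS_def)
  have "a = [:t:] * x + f * (a div f)" unfolding x(2)[symmetric] by simp
  then show "a \<in> gen [:t:]" using genI[OF x(1) monic_mod(1)[OF f_S f_monic assms]] by metis
qed

text \<open>Remainders modulo the monic \<open>f\<close>, with coefficients reduced modulo the
  maximal ideal, identify \<open>S/(t, f)\<close> with \<open>degree f\<close> copies of the residue
  field.\<close>

lemma idx_gen_t: "fin S (gen [:t:])" "idx S (gen [:t:]) = q ^ degree f"
proof -
  let ?n = "degree f" and ?R = "{x. \<phi> x \<le> 1}" and ?m = "{x. \<phi> x < 1}"
  have G: "sgp (gen [:t:])" by (rule idealD(2)[OF gen_ideal[OF t_S]])
  define g where "g h = (\<lambda>i\<in>{..<?n}. coset ?m (coeff (h mod f) i))" for h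
  have dm: "degree (h mod f) < ?n" for h
    using degree_mod_less[OF f_nz, of h] f_deg by auto
  have "coset (gen [:t:]) h = coset (gen [:t:]) h' \<longleftrightarrow> g h = g h'" if h: "h \<in> S" "h' \<in> S" for h h'
  proof -
    have "coset (gen [:t:]) h = coset (gen [:t:]) h' \<longleftrightarrow> (h - h') mod f \<in> tS"
      unfolding coset_eq_iff[OF G] by (rule gen_t_iff[OF S.S_diff[OF h]])
    also have "\<dots> \<longleftrightarrow> (\<forall>i<?n. \<phi> (coeff (h mod f) i - coeff (h' mod f) i) < 1)"
    proof -
      have "\<phi> (coeff ((h - h') mod f) i) < 1" if "\<not> i < ?n" for i
        using coeff_eq_0[of "(h - h') mod f" i] dm[of "h - h'"] that by simp
      then have "(h - h') mod f \<in> tS \<longleftrightarrow> (\<forall>i<?n. \<phi> (coeff ((h - h') mod f) i) < 1)"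
        unfolding tS_iff by blast
      then show ?thesis by (simp add: poly_mod_diff_left)
    qed
    also have "\<dots> \<longleftrightarrow> (\<forall>i<?n. coset ?m (coeff (h mod f) i) = coset ?m (coeff (h' mod f) i))"
      by (simp add: coset_eq_iff[OF sgp_m])
    also have "\<dots> \<longleftrightarrow> g h = g h'"
      unfolding g_def fun_eq_iff by (auto simp: restrict_def)
    finally show ?thesis .
  qed
  from image_equipotent[of S "coset (gen [:t:])" g, OF this]
  have eq: "card (quo S (gen [:t:])) = card (g ` S)" "finite (quo S (gen [:t:])) \<longleftrightarrow> finite (g ` S)"
    unfolding quo_def by simp_all
  have "g ` S = PiE {..<?n} (\<lambda>_. quo ?R ?m)"
  proof (intro equalityI subsetI)
    fix y assume "y \<in> g ` S"
    then obtain h where "h \<in> S" "y = g h" by blast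
    then show "y \<in> PiE {..<?n} (\<lambda>_. quo ?R ?m)"
      using monic_mod(2)[OF f_S f_monic, of h] by (auto simp: g_def quo_def S_def)
  next
    fix y assume y: "y \<in> PiE {..<?n} (\<lambda>_. quo ?R ?m)"
    define c where "c i = (SOME c. c \<in> ?R \<and> y i = coset ?m c)" for i
    have c: "c i \<in> ?R \<and> y i = coset ?m (c i)" if "i < ?n" for i
    proof -
      have "y i \<in> quo ?R ?m" using y that by auto
      then have "\<exists>c. c \<in> ?R \<and> y i = coset ?m c" unfolding quo_def by blast
      then show ?thesis unfolding c_def by (rule someI_ex)
    qed
    define h where "h = (\<Sum>i<?n. monom (c i) i)"
    have hS: "h \<in> S" unfolding h_def using c by (intro S_sum S_monom) auto
    have "degree h \<le> ?n - 1" unfolding h_def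
      by (intro degree_sum_le) (auto intro: order.trans[OF degree_monom_le])
    then have "degree h < ?n" using f_deg by simp
    then have "h mod f = h" by (rule mod_poly_less)
    moreover have "coeff h i = c i" if "i < ?n" for i
      unfolding h_def using that by (simp add: coeff_sum)
    ultimately have "g h i = y i" for i
      using c y by (cases "i < ?n") (auto simp: g_def PiE_def extensional_def)
    then have "g h = y" by blast
    then show "y \<in> g ` S" using hS by blast
  qed
  then have "finite (g ` S)" "card (g ` S) = q ^ ?n"
    using residue_fin by (auto simp: fin_def q_def idx_def card_PiE intro!: finite_PiE)
  then show "fin S (gen [:t:])" "idx S (gen [:t:]) = q ^ degree f"
    unfolding fin_def idx_def eq by simp_all
qed

text \<open>An ideal above \<open>(t, f)\<close> is the union of its cosets, hence determined by a
  subset of a finite quotient.\<close>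

lemma finite_ideals_above: "finite {I. ideal I \<and> [:t:] \<in> I \<and> f \<in> I}"
proof (rule inj_on_finite[where f = "\<lambda>I. quo I (gen [:t:])"])
  let ?G = "gen [:t:]"
  have G: "sgp ?G" by (rule idealD(2)[OF gen_ideal[OF t_S]])
  show "(\<lambda>I. quo I ?G) ` {I. ideal I \<and> [:t:] \<in> I \<and> f \<in> I} \<subseteq> Pow (quo S ?G)"
    using idealD(1) unfolding quo_def by blast
  show "finite (Pow (quo S ?G))" using idx_gen_t(1) by (simp add: fin_def)
  have un: "\<Union> (quo I ?G) = I" if "ideal I" "[:t:] \<in> I" "f \<in> I" for I
  proof (intro equalityI subsetI)
    fix x assume "x \<in> \<Union> (quo I ?G)"
    then obtain y where "y \<in> I" "x - y \<in> ?G" by (auto simp: quo_def coset_def)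
    then have "(x - y) + y \<in> I" using gen_least[OF that] idealD(6)[OF that(1)] by blast
    then show "x \<in> I" by simp
  next
    fix x assume "x \<in> I"
    moreover have "x \<in> coset ?G x" using sgp_0[OF G] by (simp add: coset_def)
    ultimately show "x \<in> \<Union> (quo I ?G)" unfolding quo_def by blast
  qed
  show "inj_on (\<lambda>I. quo I ?G) {I. ideal I \<and> [:t:] \<in> I \<and> f \<in> I}"
    by (rule inj_onI) (metis (mono_tags, lifting) mem_Collect_eq un)
qed

lemma finite_primes: "finite primes"
  by (rule finite_subset[OF _ finite_ideals_above]) (auto simp: primes_def)

lemma ideals_iff: "J \<in> S.ideals f \<longleftrightarrow> ideal J \<and> f \<in> J \<and> fin S J"
  by (auto simp: S.ideals_def ideal_def)

text \<open>By the pigeonhole principle two powers of \<open>t\<close> agree modulo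
  \<open>J\<close>, and \<open>1 - t^d\<close> with \<open>d > 0\<close> is a unit of the valuation
  ring.\<close>

lemma power_t_finite:
  assumes J: "ideal J" and fin: "fin S J" shows "\<exists>N. [:t:] ^ N \<in> J"
proof -
  have "(\<lambda>n. coset J ([:t:] ^ n)) ` UNIV \<subseteq> quo S J"
    using S_power[OF t_S] by (auto simp: quo_def)
  then have "finite (range (\<lambda>n. coset J ([:t:] ^ n)))"
    using fin unfolding fin_def by (rule finite_subset)
  then have "\<not> inj (\<lambda>n. coset J ([:t:] ^ n))" using finite_imageD by blast
  then obtain a b where "a < b" and eq: "coset J ([:t:] ^ a) = coset J ([:t:] ^ b)"
    unfolding inj_def by (metis linorder_neqE_nat)
  define d where "d = b - a"
  have d: "0 < d" "b = a + d" using \<open>a < b\<close> by (simp_all add: d_def)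
  have "[:t:] ^ a - [:t:] ^ b \<in> J" using eq coset_eq_iff[OF idealD(2)[OF J]] by blast
  moreover have "\<phi> (t ^ d) < 1" using d(1) t_pos t_less by (simp add: abs_power power_less_one_iff)
  then have "\<phi> (1 - t ^ d) = 1" using abs_add_eq[of "- (t ^ d)" 1] by simp
  then have nz: "1 - t ^ d \<noteq> 0" and "[:inverse (1 - t ^ d):] \<in> S"
    using abs_eq_0[of "1 - t ^ d"] by (auto simp: abs_inverse)
  ultimately have "[:inverse (1 - t ^ d):] * ([:t:] ^ a - [:t:] ^ b) \<in> J"
    using idealD(3)[OF J] by blast
  moreover have "[:inverse (1 - t ^ d):] * ([:t:] ^ a - [:t:] ^ b) = [:t:] ^ a"
  proof -
    have "[:t:] ^ a - [:t:] ^ b = [:t ^ a * (1 - t ^ d):]"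
      unfolding d(2) by (simp add: poly_const_pow power_add algebra_simps)
    then show ?thesis using nz by (simp add: poly_const_pow)
  qed
  ultimately show ?thesis by metis
qed

text \<open>By \<open>ideal_unit_t\<close> the ideal generated by \<open>J\<close> and
  \<open>t\<close> is still proper; among the finitely many ideals above \<open>(t, f)\<close> a
  maximal proper one can be chosen over it.\<close>

lemma prime_above:
  assumes J: "ideal J" "f \<in> J" "fin S J" "1 \<notin> J"
  shows "\<exists>P\<in>primes. J \<subseteq> P"
proof -
  let ?J = "J \<uplus> tS"
  have sJ: "sgp ?J" by (intro sgp_sadd idealD(2)[OF J(1)] sgp_tS)
  have id: "ideal ?J"
    unfolding ideal_def
  proof (intro conjI ballI sJ)
    show "?J \<subseteq> S" using idealD(1)[OF J(1)] tS_sub by (intro sadd_least S.sgp_S)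
    fix c x assume c: "c \<in> S" and "x \<in> ?J"
    then obtain y z where yz: "y \<in> J" "z \<in> tS" "x = y + z" by (auto elim!: saddE)
    have "c * x = c * y + c * z" unfolding yz(3) by (rule distrib_left)
    also have "\<dots> \<in> ?J" by (intro saddI idealD(3)[OF J(1)] tS_S_mult c yz)
    finally show "c * x \<in> ?J" .
  qed
  have JJ: "J \<subseteq> ?J" by (rule sadd_left[OF sgp_tS])
  have "[:t:] * 1 \<in> ?J"
    by (rule subsetD[OF sadd_right[OF idealD(2)[OF J(1)]] tS_multI[OF S.S_1]])
  then have tJ: "[:t:] \<in> ?J" by simp
  have "1 \<notin> ?J"
  proof
    assume "1 \<in> ?J"
    then obtain y z where yz: "y \<in> J" "z \<in> tS" "1 = y + z" by (auto elim!: saddE)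
    then obtain s where s: "s \<in> S" "z = [:t:] * s" by (auto simp only: tS_def)
    have "1 - [:t:] * s = y" using yz s by (simp add: diff_eq_eq)
    moreover obtain N where "[:t:] ^ N \<in> J" using power_t_finite[OF J(1,3)] by blast
    ultimately have "J = S" using ideal_unit_t[OF J(1) _ s(1)] yz(1) by metis
    then show False using J(4) S.S_1 by simp
  qed
  let ?U = "{I. ideal I \<and> [:t:] \<in> I \<and> f \<in> I \<and> 1 \<notin> I}"
  have "finite ?U" by (rule finite_subset[OF _ finite_ideals_above]) auto
  moreover have "?J \<in> ?U" using id tJ J(2) JJ \<open>1 \<notin> ?J\<close> by blast
  ultimately have "\<exists>P\<in>?U. ?J \<subseteq> P \<and> (\<forall>I\<in>?U. P \<subseteq> I \<longrightarrow> P = I)"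
    by (rule finite_has_maximal2)
  then obtain P where P: "P \<in> ?U" "?J \<subseteq> P" "\<forall>I\<in>?U. P \<subseteq> I \<longrightarrow> P = I"
    by (elim bexE conjE)
  have "P \<in> primes"
    unfolding primes_def using P(1) P(3) by blast
  then show ?thesis using P(2) JJ by blast
qed

definition pg :: "'a poly set \<Rightarrow> 'a poly" where
  "pg P = (SOME p. p \<in> S \<and> P = gen p)"

section \<open>Unique factorisation of finite-index ideals\<close>

lemma pg:
  assumes "P \<in> primes" shows "pg P \<in> S" "gen (pg P) = P" "pg P \<in> P" "\<not> f dvd pg P"
proof -
  have "\<exists>p. p \<in> S \<and> P = gen p" using principal_generator[OF primesD(1-3)[OF assms]] by blast
  then have *: "pg P \<in> S \<and> P = gen (pg P)" unfolding pg_def by (rule someI_ex)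
  then show 1: "pg P \<in> S" "gen (pg P) = P" by simp_all
  then show "pg P \<in> P" using gen_self[of "pg P"] by simp
  show "\<not> f dvd pg P"
  proof
    assume dvd: "f dvd pg P"
    have "[:t:] \<in> gen (pg P)" using primesD(2)[OF assms] 1 by simp
    then obtain x y where "[:t:] = pg P * x + f * y" by (rule genE)
    then have "f dvd [:t:]" using dvd by simp
    then show False using t_notin_fS by simp
  qed
qed

text \<open>As the irreducible \<open>f\<close> does not divide \<open>a\<close>, multiplication by
  \<open>a\<close> is injective on \<open>S/(f)\<close> and identifies \<open>S/(b, f)\<close> with
  \<open>(a, f)/(ab, f)\<close>.\<close>

lemma idx_gen_mult:
  assumes "a \<in> S" "b \<in> S" "\<not> f dvd a"
  shows "idx S (gen (a * b)) = idx S (gen a) * idx S (gen b)"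
    "fin S (gen (a * b)) \<longleftrightarrow> fin S (gen a) \<and> fin S (gen b)"
proof -
  note A = gen_ideal[OF assms(1)] and B = gen_ideal[OF assms(2)]
    and AB = gen_ideal[OF S.S_mult[OF assms(1,2)]]
  have sub: "gen (a * b) \<subseteq> gen a"
    by (intro gen_least[OF A] gen_f idealD(4)[OF A assms(2) gen_self])
  have "x - y \<in> gen b \<longleftrightarrow> a * x - a * y \<in> gen (a * b)" if "x \<in> S" "y \<in> S" for x y
  proof
    assume "x - y \<in> gen b"
    then obtain u v where uv: "u \<in> S" "v \<in> S" "x - y = b * u + f * v" by (rule genE)
    have "a * x - a * y = a * b * u + f * (a * v)"
      using uv(3) by Groebner_Basis.algebra
    also have "\<dots> \<in> gen (a * b)" by (intro genI S.S_mult uv assms)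
    finally show "a * x - a * y \<in> gen (a * b)" .
  next
    assume "a * x - a * y \<in> gen (a * b)"
    then obtain u v where uv: "u \<in> S" "v \<in> S" "a * x - a * y = a * b * u + f * v" by (rule genE)
    then have "a * (x - y - b * u) = f * v" by Groebner_Basis.algebra
    then have "f dvd a * (x - y - b * u)" by simp
    then have "f dvd x - y - b * u" using f_prime assms(3) by blast
    moreover have "x - y - b * u \<in> S" by (intro S.S_diff S.S_mult that assms uv)
    ultimately obtain w where "w \<in> S" "x - y - b * u = f * w" using f_dvdE by blast
    then have "x - y = b * u + f * w" by Groebner_Basis.algebra
    then show "x - y \<in> gen b" using genI[OF uv(1) \<open>w \<in> S\<close>, of b] by simp
  qed
  moreover have "a * x \<in> gen a" if "x \<in> S" for x using idealD(4)[OF A that gen_self] .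
  moreover have "\<exists>x\<in>S. z - a * x \<in> gen (a * b)" if z: "z \<in> gen a" for z
  proof -
    obtain u v where uv: "u \<in> S" "v \<in> S" "z = a * u + f * v" using z by (rule genE)
    have "z - a * u \<in> gen (a * b)" using idealD(4)[OF AB uv(2) gen_f] uv(3) by simp
    then show ?thesis using uv(1) by blast
  qed
  ultimately have "idx S (gen b) = idx (gen a) (gen (a * b))" "fin S (gen b) \<longleftrightarrow> fin (gen a) (gen (a * b))"
    using idx_transfer[OF idealD(2)[OF B] idealD(2)[OF AB], of S "(*) a" "gen a"] by blast+
  then show "idx S (gen (a * b)) = idx S (gen a) * idx S (gen b)"
    "fin S (gen (a * b)) \<longleftrightarrow> fin S (gen a) \<and> fin S (gen b)"
    using idx_tower[OF idealD(2)[OF AB] idealD(2)[OF A] S.sgp_S sub idealD(1)[OF A]] by simp_all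
qed

lemma fin_gen: assumes "a \<in> S" "\<not> f dvd a" shows "fin S (gen a)"
proof -
  obtain N where N: "[:t:] ^ N \<in> gen a" using power_t_in[OF assms] by blast
  have "fin S (gen ([:t:] ^ N))"
  proof (induction N)
    case 0
    then show ?case using idx_same[OF S.sgp_S] by (simp add: gen_1)
  next
    case (Suc N)
    then show ?case using idx_gen_mult(2)[OF t_S S_power[OF t_S] t_notin_fS] idx_gen_t(1) by simp
  qed
  moreover have "gen ([:t:] ^ N) \<subseteq> gen a" by (rule gen_least[OF gen_ideal[OF assms(1)] N gen_f])
  ultimately show ?thesis
    using fin_mono(1)[of "gen ([:t:] ^ N)" "gen a" S] idealD(1,2)[OF gen_ideal] assms(1) S_power[OF t_S]
      S.sgp_S by blast
qed

text \<open>Powers of \<open>pg P\<close> can be cancelled modulo \<open>f\<close>, so an exponent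
  \<open>k > a\<close> would put \<open>s\<close> into \<open>P\<close>.\<close>

lemma power_val:
  assumes P: "P \<in> primes" and s: "s \<in> S" "s \<notin> P"
  shows "pg P ^ a * s \<in> gen (pg P ^ k) \<longleftrightarrow> k \<le> a"
proof
  let ?p = "pg P"
  assume "?p ^ a * s \<in> gen (?p ^ k)"
  then obtain x y where xy: "x \<in> S" "y \<in> S" "?p ^ a * s = ?p ^ k * x + f * y" by (rule genE)
  show "k \<le> a"
  proof (rule ccontr)
    assume "\<not> k \<le> a"
    then obtain d where d: "k = a + Suc d" by (metis add_Suc_right less_natE not_le)
    have "A * (s - p * (D * x)) = f * y" if "A * s = A * (p * D) * x + f * y" for A D p
      using that by Groebner_Basis.algebra
    then have "?p ^ a * (s - ?p * (?p ^ d * x)) = f * y"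
      using xy(3) unfolding d power_add power_Suc by blast
    then have "f dvd ?p ^ a * (s - ?p * (?p ^ d * x))" by simp
    moreover have "\<not> f dvd ?p ^ a"
    proof (induction a)
      case 0 then show ?case using Factorial_Ring.irreducible_not_unit[OF f_irr] by simp
    next
      case (Suc a) then show ?case using f_prime pg(4)[OF P] by simp
    qed
    ultimately have "f dvd s - ?p * (?p ^ d * x)" using f_prime by blast
    moreover have m: "?p * (?p ^ d * x) \<in> P"
      by (intro idealD(4)[OF primesD(1)[OF P]] pg(3)[OF P] S.S_mult S_power pg(1)[OF P] xy)
    then have "s - ?p * (?p ^ d * x) \<in> S" using s idealD(1)[OF primesD(1)[OF P]] by (blast intro: S.S_diff)
    ultimately obtain w where w: "w \<in> S" "s - ?p * (?p ^ d * x) = f * w" using f_dvdE by blast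
    have "s = f * w + ?p * (?p ^ d * x)" using w(2) by (simp only: diff_eq_eq)
    also have "\<dots> \<in> P"
      by (intro idealD(6)[OF primesD(1)[OF P]] m idealD(4)[OF primesD(1)[OF P]] primesD(3)[OF P] w)
    finally show False using s by simp
  qed
next
  assume "k \<le> a"
  then obtain d where d: "a = k + d" using le_Suc_ex by blast
  have "pg P ^ a * s = pg P ^ k * (pg P ^ d * s) + f * 0" unfolding d by (simp add: power_add)
  also have "\<dots> \<in> gen (pg P ^ k)" by (intro genI S.S_mult S_power pg(1)[OF P] s S.S_0)
  finally show "pg P ^ a * s \<in> gen (pg P ^ k)" .
qed

definition prodP :: "('a poly set \<Rightarrow> nat) \<Rightarrow> 'a poly" where
  "prodP m = (\<Prod>P\<in>primes. pg P ^ m P)"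

lemma prodP_split:
  assumes "P \<in> primes"
  shows "\<exists>s\<in>S. s \<notin> P \<and> prodP m = pg P ^ m P * s"
proof -
  let ?s = "\<Prod>Q\<in>primes - {P}. pg Q ^ m Q"
  have "pg Q ^ m Q \<notin> P" if "Q \<in> primes - {P}" for Q
  proof (rule prime_power[OF assms])
    have Q: "Q \<in> primes" "Q \<noteq> P" using that by auto
    show "pg Q \<in> S" by (rule pg(1)[OF Q(1)])
    show "pg Q \<notin> P"
    proof
      assume "pg Q \<in> P"
      then have "gen (pg Q) \<subseteq> P" using gen_least[OF primesD(1)[OF assms]] primesD(3)[OF assms] by blast
      then have "Q \<subseteq> P" using pg(2)[OF Q(1)] by simp
      then show False using primesD(5)[OF Q(1) primesD(1)[OF assms]] primesD(4)[OF assms] Q(2) by blast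
    qed
  qed
  then have "?s \<notin> P" using finite_primes by (intro prime_prod[OF assms]) (auto intro: S_power pg(1))
  moreover have "?s \<in> S" by (intro S_prod S_power pg(1)) auto
  moreover have "prodP m = pg P ^ m P * ?s"
    unfolding prodP_def using finite_primes assms by (rule prod.remove)
  ultimately show ?thesis by blast
qed

lemma prodP_S: "prodP m \<in> S"
  unfolding prodP_def by (intro S_prod S_power pg(1))

lemma prodP_nd: "\<not> f dvd prodP m"
proof -
  have *: "\<not> f dvd (\<Prod>P\<in>A. pg P ^ m P)" if "A \<subseteq> primes" for A
    using finite_subset[OF that finite_primes] that
  proof (induction A)
    case empty
    then show ?case using Factorial_Ring.irreducible_not_unit[OF f_irr] by simp
  next
    case (insert P A)
    have "\<not> f dvd pg P ^ m P"
      using prime_elem_dvd_power[OF field_poly_irreducible_imp_prime[OF f_irr]] pg(4)[of P] insert.prems by blast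
    then show ?case using insert f_prime by simp
  qed
  then show ?thesis unfolding prodP_def by simp
qed

lemma prodP_gen_iff: "P \<in> primes \<Longrightarrow> prodP m \<in> gen (pg P ^ k) \<longleftrightarrow> k \<le> m P"
  using prodP_split[of P m] power_val by metis

lemma idx_prodP: "idx S (gen (prodP m)) = (\<Prod>P\<in>primes. idx S P ^ m P)"
proof -
  have pow: "idx S (gen (pg P ^ k * b)) = idx S P ^ k * idx S (gen b)" if "P \<in> primes" "b \<in> S" for P b k
  proof (induction k)
    case (Suc k)
    have "idx S (gen (pg P * (pg P ^ k * b))) = idx S (gen (pg P)) * idx S (gen (pg P ^ k * b))"
      by (rule idx_gen_mult(1)[OF pg(1)[OF that(1)]
            S.S_mult[OF S_power[OF pg(1)[OF that(1)]] that(2)] pg(4)[OF that(1)]])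
    then show ?case by (simp only: power_Suc mult.assoc Suc.IH pg(2)[OF that(1)])
  qed simp
  have "idx S (gen (\<Prod>P\<in>A. pg P ^ m P)) = (\<Prod>P\<in>A. idx S P ^ m P)" if "A \<subseteq> primes" for A
    using finite_subset[OF that finite_primes] that
  proof (induction A)
    case empty
    then show ?case using idx_same[OF S.sgp_S] by (simp add: gen_1)
  next
    case (insert P A)
    have "(\<Prod>P\<in>A. pg P ^ m P) \<in> S" using insert.prems by (intro S_prod S_power pg(1)) auto
    then show ?case using insert pow[of P "\<Prod>P\<in>A. pg P ^ m P" "m P"] by simp
  qed
  then show ?thesis unfolding prodP_def by simp
qed

text \<open>Induction on the index: if \<open>J\<close> lies in the maximal ideal generated by
  \<open>p\<close> and \<open>f\<close>, dividing by \<open>p\<close> gives an ideal whose index is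
  smaller by the factor \<open>idx S P\<close>.\<close>

lemma ideal_factor:
  assumes "ideal J" "f \<in> J" "fin S J" shows "\<exists>m. J = gen (prodP m)"
  using assms
proof (induction "idx S J" arbitrary: J rule: less_induct)
  case less
  note J = less.prems
  show ?case
  proof (cases "1 \<in> J")
    case True
    then have "J = gen (prodP (\<lambda>_. 0))" using ideal_1[OF J(1)] by (simp add: prodP_def gen_1)
    then show ?thesis by blast
  next
    case False
    obtain P where P: "P \<in> primes" "J \<subseteq> P" using prime_above[OF J False] by blast
    let ?p = "pg P"
    note PD = primesD[OF P(1)] and pD = pg[OF P(1)]
    define J1 where "J1 = {h \<in> S. ?p * h \<in> J}"
    have J1: "ideal J1"
      unfolding ideal_def
    proof (intro conjI ballI)
      show "sgp J1" using idealD(5,7)[OF J(1)] S.S_0 S.S_diff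
        by (auto simp: sgp_def J1_def right_diff_distrib)
      fix c x assume "c \<in> S" "x \<in> J1"
      then show "c * x \<in> J1" using idealD(3)[OF J(1), of c "?p * x"] S.S_mult[of c x]
        unfolding J1_def mem_Collect_eq mult.left_commute[of ?p c x] by blast
    qed (auto simp: J1_def)
    have fJ1: "f \<in> J1" using idealD(3)[OF J(1) pD(1) J(2)] f_S by (simp add: J1_def)
    have "idx S J1 = idx P J" "fin S J1 \<longleftrightarrow> fin P J"
    proof -
      have 1: "?p * x \<in> P" if "x \<in> S" for x using idealD(4)[OF PD(1) that pD(3)] .
      have 2: "x - y \<in> J1 \<longleftrightarrow> ?p * x - ?p * y \<in> J" if "x \<in> S" "y \<in> S" for x y
        using S.S_diff[OF that] by (simp add: J1_def right_diff_distrib)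
      have 3: "\<exists>x\<in>S. z - ?p * x \<in> J" if z: "z \<in> P" for z
      proof -
        have "z \<in> gen ?p" using z pD(2) by simp
        then obtain x y where xy: "x \<in> S" "y \<in> S" "z = ?p * x + f * y" by (rule genE)
        then show ?thesis using idealD(4)[OF J(1) xy(2) J(2)] by (intro bexI[of _ x]) auto
      qed
      show "idx S J1 = idx P J" "fin S J1 \<longleftrightarrow> fin P J"
        using idx_transfer[OF idealD(2)[OF J1] idealD(2)[OF J(1)] 1 2 3] by blast+
    qed
    then have idx: "idx S J = idx S P * idx S J1" and fin1: "fin S J1" and "fin S P"
      using idx_tower[OF idealD(2)[OF J(1)] idealD(2)[OF PD(1)] S.sgp_S P(2) idealD(1)[OF PD(1)]] J(3)
      by simp_all
    have "S \<noteq> {}" using S.S_1 by blast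
    have "idx S P \<noteq> 1" using idx_1D[OF idealD(2)[OF PD(1)] S.S_0] PD(4) S.S_1 by blast
    then have "1 < idx S P" using idx_pos[OF \<open>fin S P\<close> \<open>S \<noteq> {}\<close>] by linarith
    moreover have "0 < idx S J1" using idx_pos[OF fin1 \<open>S \<noteq> {}\<close>] .
    ultimately have "idx S J1 < idx S J" unfolding idx by simp
    from less.hyps[OF this J1 fJ1 fin1] obtain m where m: "J1 = gen (prodP m)" by blast
    define m' where "m' = m(P := Suc (m P))"
    have pp: "prodP m' = ?p * prodP m"
    proof -
      have "(\<Prod>Q\<in>primes - {P}. pg Q ^ m' Q) = (\<Prod>Q\<in>primes - {P}. pg Q ^ m Q)"
        by (rule prod.cong) (auto simp: m'_def)
      then show ?thesis unfolding prodP_def prod.remove[OF finite_primes P(1)] by (simp add: m'_def)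
    qed
    have "gen (prodP m') = J"
    proof
      have "prodP m \<in> J1" unfolding m by (rule gen_self)
      then show "gen (prodP m') \<subseteq> J" unfolding pp by (intro gen_least J) (simp add: J1_def)
      show "J \<subseteq> gen (prodP m')"
      proof
        fix h assume h: "h \<in> J"
        then have "h \<in> gen ?p" using P(2) pD(2) by blast
        then obtain x y where xy: "x \<in> S" "y \<in> S" "h = ?p * x + f * y" by (rule genE)
        have "?p * x = h - f * y" using xy(3) by simp
        then have "?p * x \<in> J" using idealD(7)[OF J(1) h idealD(4)[OF J(1) xy(2) J(2)]] by simp
        then have "x \<in> gen (prodP m)" using xy(1) m by (auto simp: J1_def)
        then obtain u v where uv: "u \<in> S" "v \<in> S" "x = prodP m * u + f * v" by (rule genE)
        have "h = prodP m' * u + f * (?p * v + y)" unfolding xy(3) uv(3) pp by Groebner_Basis.algebra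
        also have "\<dots> \<in> gen (prodP m')" by (intro genI S.S_add S.S_mult uv xy pD)
        finally show "h \<in> gen (prodP m')" .
      qed
    qed
    then show ?thesis by blast
  qed
qed

text \<open>Exponents are recovered from containment in the powers of the maximal ideals.
  \<open>PiE\<close> fixes the values outside \<open>primes\<close>, so that each ideal has a single
  exponent function.\<close>

lemma ideals_bij: "bij_betw (\<lambda>m. gen (prodP m)) (PiE primes (\<lambda>_. UNIV)) (S.ideals f)"
  unfolding bij_betw_def
proof
  have val: "gen (prodP m) \<subseteq> gen (pg P ^ k) \<longleftrightarrow> k \<le> m P" if "P \<in> primes" for m k P
    using prodP_gen_iff[OF that, of m k] gen_least[OF gen_ideal[OF S_power[OF pg(1)[OF that]]] _ gen_f]
      gen_self by blast
  show "inj_on (\<lambda>m. gen (prodP m)) (PiE primes (\<lambda>_. UNIV))"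
  proof (rule inj_onI)
    fix m m' assume m: "m \<in> PiE primes (\<lambda>_. UNIV)" "m' \<in> PiE primes (\<lambda>_. UNIV)"
      and eq: "gen (prodP m) = gen (prodP m')"
    show "m = m'"
    proof (rule PiE_ext[OF m])
      fix P assume P: "P \<in> primes"
      show "m P = m' P" using val[OF P, of m] val[OF P, of m'] eq by (metis le_antisym order_refl)
    qed
  qed
  show "(\<lambda>m. gen (prodP m)) ` PiE primes (\<lambda>_. UNIV) = S.ideals f"
  proof (intro equalityI subsetI)
    fix J assume "J \<in> (\<lambda>m. gen (prodP m)) ` PiE primes (\<lambda>_. UNIV)"
    then show "J \<in> S.ideals f"
      using gen_ideal[OF prodP_S] gen_f fin_gen[OF prodP_S prodP_nd] by (auto simp: ideals_iff)
  next
    fix J assume "J \<in> S.ideals f"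
    then obtain m where m: "J = gen (prodP m)" using ideal_factor by (auto simp: ideals_iff)
    have "prodP m = prodP (restrict m primes)" unfolding prodP_def by (rule prod.cong) auto
    then show "J \<in> (\<lambda>m. gen (prodP m)) ` PiE primes (\<lambda>_. UNIV)"
      using m by (intro image_eqI[of _ _ "restrict m primes"]) auto
  qed
qed

text \<open>This supplies the hypothesis under which free lattices were counted. The generator is a
  product of the \<open>pg P\<close>, which \<open>f\<close> does not divide, hence no zero divisor
  modulo \<open>f\<close>.\<close>

lemma pid_f: "S.pid f"
  unfolding S.pid_def
proof
  fix J assume "J \<in> S.ideals f"
  then obtain m where m: "J = gen (prodP m)" using ideal_factor by (auto simp: ideals_iff)
  have "J = {c * prodP m + d * f | c d. c \<in> S \<and> d \<in> S}"
    unfolding m gen_def by (simp only: mult.commute)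
  moreover have "c \<in> (*) f ` S" if "c \<in> S" "c * prodP m \<in> (*) f ` S" for c
  proof -
    have "f dvd c * prodP m" using that by auto
    then have "f dvd c" using f_prime prodP_nd by blast
    then show ?thesis using f_dvd_iff that by blast
  qed
  moreover have "prodP m \<in> J" unfolding m by (rule gen_self)
  ultimately show "\<exists>a\<in>J. J = {c * a + d * f | c d. c \<in> S \<and> d \<in> S} \<and>
     (\<forall>c\<in>S. c * a \<in> (*) f ` S \<longrightarrow> c \<in> (*) f ` S)" by blast
qed

end

section \<open>Euler product of the ideal zeta function\<close>

lemma esum_PiE:
  fixes h :: "'a \<Rightarrow> nat \<Rightarrow> ennreal"
  assumes "finite A"
  shows "esum (PiE A (\<lambda>_. UNIV)) (\<lambda>m. \<Prod>a\<in>A. h a (m a)) = (\<Prod>a\<in>A. esum UNIV (h a))"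
  using assms
proof (induction A)
  case empty
  then show ?case by (simp add: esum_singleton)
next
  case (insert a A)
  let ?F = "PiE A (\<lambda>_. UNIV :: nat set)"
  have "bij_betw (\<lambda>(y, g). g(a := y)) (UNIV \<times> ?F) (PiE (insert a A) (\<lambda>_. UNIV))"
    unfolding bij_betw_def PiE_insert_eq using inj_combinator[OF insert.hyps(2), of "\<lambda>_. UNIV"] by simp
  from esum_bij[OF this, of "\<lambda>m. \<Prod>a\<in>insert a A. h a (m a)", symmetric]
  have "esum (PiE (insert a A) (\<lambda>_. UNIV)) (\<lambda>m. \<Prod>a\<in>insert a A. h a (m a)) =
      esum (UNIV \<times> ?F) (\<lambda>z. h a (fst z) * (\<Prod>b\<in>A. h b (snd z b)))"
  proof (rule trans, intro esum_cong)
    fix z :: "nat \<times> ('a \<Rightarrow> nat)"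
    have "(\<Prod>b\<in>A. h b (((snd z)(a := fst z)) b)) = (\<Prod>b\<in>A. h b (snd z b))"
      using insert.hyps(2) by (intro prod.cong) auto
    then show "(\<Prod>b\<in>insert a A. h b ((case z of (y, g) \<Rightarrow> g(a := y)) b)) =
        h a (fst z) * (\<Prod>b\<in>A. h b (snd z b))"
      using insert.hyps by (simp add: case_prod_beta)
  qed
  also have "\<dots> = esum UNIV (\<lambda>y. h a y * esum ?F (\<lambda>m. \<Prod>b\<in>A. h b (m b)))"
    unfolding esum_Times[where h = "\<lambda>y m. h a y * (\<Prod>b\<in>A. h b (m b))"] by (simp only: esum_cmult)
  also have "\<dots> = (\<Prod>b\<in>insert a A. esum UNIV (h b))"
    using insert by (simp add: esum_multc)
  finally show ?case .
qed

lemma esum_geometric: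
  assumes "0 \<le> r" "r < 1" shows "esum UNIV (\<lambda>k::nat. ennreal (r ^ k)) = ennreal (1 / (1 - r))"
proof -
  have "(\<lambda>k. r ^ k) sums (1 / (1 - r))" using assms by (intro geometric_sums) simp
  then show ?thesis
    unfolding nn_integral_count_space_nat using assms by (intro suminf_ennreal_eq) auto
qed

context dvr_poly
begin

lemma idx_prime:
  assumes "P \<in> primes" shows "fin S P" "1 < idx S P" "\<exists>d. idx S P = q ^ d"
proof -
  note PD = primesD[OF assms]
  show fin: "fin S P" using fin_gen[OF pg(1,4)[OF assms]] pg(2)[OF assms] by simp
  have "S \<noteq> {}" using S.S_1 by blast
  moreover have "idx S P \<noteq> 1" using idx_1D[OF idealD(2)[OF PD(1)] S.S_0] PD(4) S.S_1 by blast
  ultimately show "1 < idx S P" using idx_pos[OF fin] by fastforce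
  show "\<exists>d. idx S P = q ^ d"
    by (rule idx_R_modules[OF S.sgp_S idealD(2)[OF PD(1)] idealD(1)[OF PD(1)] fin])
      (use S.S_mult idealD(3)[OF PD(1)] idealD(4)[OF PD(1) _ PD(2)] in \<open>simp_all only: S_const\<close>)
qed

text \<open>Here separability enters through \<open>residue_idempotent\<close>: some
  \<open>e\<close> outside \<open>P\<close> carries \<open>P\<close> into \<open>(t, f)\<close>. If
  \<open>t\<close> lay in the square of \<open>P\<close>, so would \<open>e * pg P\<close>,
  contradicting \<open>power_val\<close>.\<close>

lemma t_notin_square: assumes P: "P \<in> primes" shows "[:t:] \<notin> gen (pg P ^ 2)"
proof
  note PD = primesD[OF P] and pD = pg[OF P]
  assume "[:t:] \<in> gen (pg P ^ 2)"
  then have G: "gen [:t:] \<subseteq> gen (pg P ^ 2)" by (intro gen_least gen_ideal S_power pD(1) gen_f)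
  obtain e where e: "e \<in> S" "1 - e \<in> P" "\<And>h. h \<in> P \<Longrightarrow> e * h \<in> gen [:t:]"
    using residue_idempotent[OF PD(1-3)] by blast
  have eP: "e \<notin> P"
  proof
    assume "e \<in> P"
    then have "(1 - e) + e \<in> P" by (rule idealD(6)[OF PD(1) e(2)])
    then show False using PD(4) by simp
  qed
  have "e * pg P \<in> gen (pg P ^ 2)" using e(3)[OF pD(3)] G by blast
  then have "pg P ^ 1 * e \<in> gen (pg P ^ 2)" by (simp only: power_one_right mult.commute[of e])
  then have "2 \<le> (1::nat)" using power_val[OF P e(1) eP] by blast
  then show False by simp
qed

text \<open>Every maximal ideal occurs exactly once in the factorisation of \<open>(t, f)\<close>.
  In terms of exponents of \<open>q\<close>: the residue degrees add up to the degree of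
  \<open>f\<close>.\<close>

lemma prod_idx_primes: "(\<Prod>P\<in>primes. idx S P) = q ^ degree f"
proof -
  obtain m where m: "gen [:t:] = gen (prodP m)"
    using ideal_factor[OF gen_ideal[OF t_S] gen_f idx_gen_t(1)] by blast
  have "m P = 1" if P: "P \<in> primes" for P
  proof -
    note PD = primesD[OF P] and pD = pg[OF P]
    have sub: "gen [:t:] \<subseteq> gen (pg P ^ k) \<longleftrightarrow> k \<le> m P" for k
      unfolding m using prodP_gen_iff[OF P, of m k]
        gen_least[OF gen_ideal[OF S_power[OF pD(1)]] _ gen_f] gen_self by blast
    have "gen [:t:] \<subseteq> gen (pg P ^ 1)" using gen_least[OF PD(1) PD(2,3)] pD(2) by simp
    then have "1 \<le> m P" using sub by blast
    moreover have "\<not> 2 \<le> m P" using t_notin_square[OF P] sub gen_self by blast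
    ultimately show ?thesis by simp
  qed
  then have "(\<Prod>P\<in>primes. idx S P ^ m P) = (\<Prod>P\<in>primes. idx S P)" by simp
  then show ?thesis using idx_prodP[of m] m idx_gen_t(2) by simp
qed

text \<open>By unique factorisation the sum runs over exponent functions and splits into geometric
  series, whose ratios are below 1 because \<open>s\<close> is positive.\<close>

lemma ideal_zeta_product:
  assumes "0 < s"
  shows "S.ideal_zeta f s = (\<Prod>P\<in>primes. ennreal (1 / (1 - real (idx S P) powr (- s))))"
proof -
  have "S.ideal_zeta f s = esum (PiE primes (\<lambda>_. UNIV)) (\<lambda>m. wt s (idx S (gen (prodP m))))"
    unfolding S.ideal_zeta_def by (rule esum_bij[OF ideals_bij, symmetric])
  also have "\<dots> = esum (PiE primes (\<lambda>_. UNIV)) (\<lambda>m. \<Prod>P\<in>primes. ennreal ((real (idx S P) powr (- s)) ^ m P))"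
  proof (rule esum_cong)
    fix m
    have pow: "wt s (N ^ k) = ennreal ((real N powr (- s)) ^ k)" for N k
      by (induction k) (simp_all add: wt_mult, simp add: wt_def ennreal_mult)
    have "wt s (\<Prod>P\<in>A. idx S P ^ m P) = (\<Prod>P\<in>A. ennreal ((real (idx S P) powr (- s)) ^ m P))" for A
      by (induction A rule: infinite_finite_induct) (simp_all add: wt_mult pow)
    then show "wt s (idx S (gen (prodP m))) = (\<Prod>P\<in>primes. ennreal ((real (idx S P) powr (- s)) ^ m P))"
      unfolding idx_prodP .
  qed
  also have "\<dots> = (\<Prod>P\<in>primes. ennreal (1 / (1 - real (idx S P) powr (- s))))"
    unfolding esum_PiE[OF finite_primes, of "\<lambda>P k. ennreal ((real (idx S P) powr (- s)) ^ k)"]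
  proof (rule prod.cong[OF refl], rule esum_geometric)
    fix P assume "P \<in> primes"
    then have "1 < idx S P" by (rule idx_prime)
    then show "real (idx S P) powr (- s) < 1"
      using powr_less_cancel_iff[of "real (idx S P)" "- s" 0] assms by simp
  qed simp
  finally show ?thesis .
qed

subsection \<open>Extensions of the absolute value to \<open>k[X]/(f)\<close>\<close>

text \<open>Absolute values of the field \<open>k[X]/(f)\<close> that extend \<open>\<phi>\<close>,
  pulled back to polynomials.\<close>

definition ext_abs :: "('a poly \<Rightarrow> real) \<Rightarrow> bool" where
  "ext_abs \<psi> \<longleftrightarrow> (\<forall>h. 0 \<le> \<psi> h \<and> (\<psi> h = 0 \<longleftrightarrow> f dvd h)) \<and> (\<forall>g h. \<psi> (g * h) = \<psi> g * \<psi> h) \<and>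
     (\<forall>g h. \<psi> (g + h) \<le> max (\<psi> g) (\<psi> h)) \<and> (\<forall>c. \<psi> [:c:] = \<phi> c)"

definition center :: "('a poly \<Rightarrow> real) \<Rightarrow> 'a poly set" where
  "center \<psi> = {h \<in> S. \<psi> h < 1}"

text \<open>\<open>h\<close> and the product of the \<open>pg\<close> powers divide each other
  modulo \<open>f\<close>, so the cofactor \<open>x\<close> is a unit modulo \<open>f\<close> and
  only the power at \<open>P\<close> matters.\<close>

lemma prime_rep:
  assumes P: "P \<in> primes" and h: "h \<in> S" "\<not> f dvd h"
  shows "\<exists>k. \<exists>s\<in>S. \<exists>y\<in>S. s \<notin> P \<and> h = pg P ^ k * s + f * y"
proof -
  note PD = primesD[OF P]
  obtain m where m: "gen h = gen (prodP m)"
    using ideal_factor[OF gen_ideal[OF h(1)] gen_f fin_gen[OF h]] by blast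
  obtain s where s: "s \<in> S" "s \<notin> P" "prodP m = pg P ^ m P * s" using prodP_split[OF P] by blast
  have "h \<in> gen (prodP m)" using m gen_self by blast
  then obtain x y where xy: "x \<in> S" "y \<in> S" "h = prodP m * x + f * y" by (rule genE)
  have "prodP m \<in> gen h" using m gen_self by blast
  then obtain u v where uv: "u \<in> S" "v \<in> S" "prodP m = h * u + f * v" by (rule genE)
  have "prodP m * (1 - x * u) = f * (y * u + v)" using xy(3) uv(3) by Groebner_Basis.algebra
  then have "f dvd prodP m * (1 - x * u)" by simp
  then have "f dvd 1 - x * u" using f_prime prodP_nd by blast
  moreover have "1 - x * u \<in> S" by (intro S.S_diff S.S_mult S.S_1 xy uv)
  ultimately obtain w where w: "w \<in> S" "1 - x * u = f * w" using f_dvdE by blast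
  have "x \<notin> P"
  proof
    assume "x \<in> P"
    have "1 = x * u + f * w" using w(2) by (simp add: diff_eq_eq add.commute)
    also have "\<dots> \<in> P" by (intro idealD(6)[OF PD(1)] idealD(4)[OF PD(1)] PD uv w \<open>x \<in> P\<close>)
    finally show False using PD(4) by simp
  qed
  then have "s * x \<notin> P" using prime_mult[OF P s(1) xy(1)] s(2) by blast
  moreover have "s * x \<in> S" by (intro S.S_mult s xy)
  moreover have "h = pg P ^ m P * (s * x) + f * y" using xy(3) unfolding s(3) by (simp only: mult.assoc)
  ultimately show ?thesis using xy(2) by blast
qed

text \<open>The valuation at \<open>P\<close>; \<open>val_unique\<close> shows that the choice is
  immaterial.\<close>

definition val :: "'a poly set \<Rightarrow> 'a poly \<Rightarrow> nat" where
  "val P h = (SOME k. \<exists>s\<in>S. \<exists>y\<in>S. s \<notin> P \<and> h = pg P ^ k * s + f * y)"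

lemma val_rep:
  assumes P: "P \<in> primes" and h: "h \<in> S" "\<not> f dvd h"
  shows "\<exists>s\<in>S. \<exists>y\<in>S. s \<notin> P \<and> h = pg P ^ val P h * s + f * y"
  unfolding val_def using prime_rep[OF assms] by (rule someI_ex)

lemma val_gen:
  assumes P: "P \<in> primes" and h: "h \<in> S" "\<not> f dvd h"
  shows "h \<in> gen (pg P ^ k) \<longleftrightarrow> k \<le> val P h"
proof -
  obtain s y where sy: "s \<in> S" "y \<in> S" "s \<notin> P" "h = pg P ^ val P h * s + f * y"
    using val_rep[OF assms] by blast
  have G: "ideal (gen (pg P ^ k))" by (intro gen_ideal S_power pg(1)[OF P])
  have y: "f * y \<in> gen (pg P ^ k)" by (rule idealD(4)[OF G sy(2) gen_f])
  have "h \<in> gen (pg P ^ k) \<longleftrightarrow> pg P ^ val P h * s \<in> gen (pg P ^ k)"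
  proof
    assume "h \<in> gen (pg P ^ k)"
    then have "h - f * y \<in> gen (pg P ^ k)" using idealD(7)[OF G _ y] by blast
    moreover have "h - f * y = pg P ^ val P h * s" by (subst sy(4)) simp
    ultimately show "pg P ^ val P h * s \<in> gen (pg P ^ k)" by simp
  next
    assume "pg P ^ val P h * s \<in> gen (pg P ^ k)"
    then show "h \<in> gen (pg P ^ k)" by (subst sy(4)) (rule idealD(6)[OF G _ y])
  qed
  then show ?thesis using power_val[OF P sy(1,3)] by simp
qed

lemma val_unique:
  assumes P: "P \<in> primes" and h: "h \<in> S" "\<not> f dvd h"
    and "s \<in> S" "y \<in> S" "s \<notin> P" "h = pg P ^ k * s + f * y"
  shows "val P h = k"
proof -
  have "j \<le> val P h \<longleftrightarrow> j \<le> k" for j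
  proof -
    have G: "ideal (gen (pg P ^ j))" by (intro gen_ideal S_power pg(1)[OF P])
    have y: "f * y \<in> gen (pg P ^ j)" by (rule idealD(4)[OF G assms(5) gen_f])
    have "h \<in> gen (pg P ^ j) \<longleftrightarrow> pg P ^ k * s \<in> gen (pg P ^ j)"
    proof
      assume "h \<in> gen (pg P ^ j)"
      then have "h - f * y \<in> gen (pg P ^ j)" using idealD(7)[OF G _ y] by blast
      moreover have "h - f * y = pg P ^ k * s" using assms(7) by simp
      ultimately show "pg P ^ k * s \<in> gen (pg P ^ j)" by simp
    next
      assume "pg P ^ k * s \<in> gen (pg P ^ j)"
      then show "h \<in> gen (pg P ^ j)" unfolding assms(7) by (rule idealD(6)[OF G _ y])
    qed
    then show ?thesis using power_val[OF P assms(4,6)] val_gen[OF P h] by simp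
  qed
  then show ?thesis by (metis le_antisym order_refl)
qed

lemma val_mult:
  assumes P: "P \<in> primes" and g: "g \<in> S" "\<not> f dvd g" and h: "h \<in> S" "\<not> f dvd h"
  shows "val P (g * h) = val P g + val P h"
proof -
  obtain s y where sy: "s \<in> S" "y \<in> S" "s \<notin> P" "g = pg P ^ val P g * s + f * y"
    using val_rep[OF P g] by blast
  obtain s' y' where sy': "s' \<in> S" "y' \<in> S" "s' \<notin> P" "h = pg P ^ val P h * s' + f * y'"
    using val_rep[OF P h] by blast
  show ?thesis
  proof (rule val_unique[OF P])
    show "g * h \<in> S" by (rule S.S_mult[OF g(1) h(1)])
    show "\<not> f dvd g * h" using f_prime g h by blast
    show "s * s' \<in> S" by (rule S.S_mult[OF sy(1) sy'(1)])
    show "s * s' \<notin> P" using prime_mult[OF P sy(1) sy'(1)] sy(3) sy'(3) by blast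
    show "y * h + pg P ^ val P g * s * y' \<in> S"
      by (intro S.S_add S.S_mult S_power pg(1)[OF P] sy sy' h)
    have "g * h = (A * s + f * y) * h \<Longrightarrow> h = B * s' + f * y' \<Longrightarrow>
        g * h = A * B * (s * s') + f * (y * h + A * s * y')" for A B
      by Groebner_Basis.algebra
    then show "g * h = pg P ^ (val P g + val P h) * (s * s') + f * (y * h + pg P ^ val P g * s * y')"
      using sy(4) sy'(4) unfolding power_add by metis
  qed
qed

text \<open>Unramifiedness: this value fixes the normalisation of the extended absolute
  value.\<close>

lemma val_t: assumes P: "P \<in> primes" shows "val P [:t:] = 1"
proof -
  note PD = primesD[OF P] and pD = pg[OF P]
  have "[:t:] \<in> gen (pg P ^ 1)" using PD(2) pD(2) by simp
  then have "1 \<le> val P [:t:]" using val_gen[OF P t_S t_notin_fS] by blast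
  moreover have "\<not> 2 \<le> val P [:t:]" using t_notin_square[OF P] val_gen[OF P t_S t_notin_fS] by blast
  ultimately show ?thesis by simp
qed

lemma f_dvd_const: "f dvd [:c:] \<longleftrightarrow> c = 0"
  using f_deg by (auto dest!: dvd_imp_degree_le)

lemma t_power_S: "[:t:] ^ N \<in> S" and t_power_nd: "\<not> f dvd [:t:] ^ N"
  by (rule S_power[OF t_S]) (simp add: poly_const_pow f_dvd_const t_nz)

lemma val_t_power: "P \<in> primes \<Longrightarrow> val P ([:t:] ^ N) = N"
proof (induction N)
  case 0
  show ?case
    by (rule val_unique[OF 0, where s = 1 and y = 0])
      (use primesD(4)[OF 0] S.S_0 S.S_1 t_power_nd[of 0] in auto)
next
  case (Suc N)
  then show ?case using val_mult[OF Suc.prems t_S t_notin_fS t_power_S t_power_nd] val_t by simp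
qed

text \<open>With base \<open>\<phi> t\<close> this extends \<open>\<phi>\<close>, because
  \<open>t\<close> has valuation 1 at \<open>P\<close>. The power of \<open>t\<close> clears
  denominators and cancels again, whichever \<open>N\<close> is chosen, by
  \<open>pabs_eq\<close>.\<close>

definition pabs :: "'a poly set \<Rightarrow> 'a poly \<Rightarrow> real" where
  "pabs P h = (if f dvd h then 0 else
     let N = (SOME N. [:t:] ^ N * h \<in> S) in \<phi> t ^ val P ([:t:] ^ N * h) / \<phi> t ^ N)"

lemma pabs_eq:
  assumes P: "P \<in> primes" and h: "[:t:] ^ N * h \<in> S" "\<not> f dvd h"
  shows "pabs P h = \<phi> t ^ val P ([:t:] ^ N * h) / \<phi> t ^ N"
proof -
  define M where "M = (SOME N. [:t:] ^ N * h \<in> S)"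
  have M: "[:t:] ^ M * h \<in> S" unfolding M_def using h(1) by (rule someI)
  have nd: "\<not> f dvd [:t:] ^ K * h" for K using f_prime t_power_nd h(2) by blast
  have "[:t:] ^ M * ([:t:] ^ N * h) = [:t:] ^ N * ([:t:] ^ M * h)" by (rule mult.left_commute)
  then have "M + val P ([:t:] ^ N * h) = N + val P ([:t:] ^ M * h)"
    using val_mult[OF P t_power_S t_power_nd h(1) nd, of M] val_mult[OF P t_power_S t_power_nd M nd, of N]
    by (simp only: val_t_power[OF P])
  then have "\<phi> t ^ M * \<phi> t ^ val P ([:t:] ^ N * h) = \<phi> t ^ N * \<phi> t ^ val P ([:t:] ^ M * h)"
    by (metis power_add)
  then have "\<phi> t ^ val P ([:t:] ^ M * h) / \<phi> t ^ M = \<phi> t ^ val P ([:t:] ^ N * h) / \<phi> t ^ N"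
    using t_pos by (simp add: divide_simps mult.commute)
  then show ?thesis using h(2) by (simp add: pabs_def M_def[symmetric] Let_def)
qed

lemma clear_t: "\<exists>N. [:t:] ^ N * h \<in> S"
  using clear_denominators[of h] by (simp only: power_t_gen)

lemma pabs_S: "P \<in> primes \<Longrightarrow> h \<in> S \<Longrightarrow> \<not> f dvd h \<Longrightarrow> pabs P h = \<phi> t ^ val P h"
  using pabs_eq[of P 0 h] by simp

lemma pabs_center:
  assumes P: "P \<in> primes" shows "center (pabs P) = P"
proof (intro equalityI subsetI)
  fix h assume "h \<in> center (pabs P)"
  then have h: "h \<in> S" "pabs P h < 1" by (auto simp: center_def)
  show "h \<in> P"
  proof (cases "f dvd h")
    case True
    then obtain y where "y \<in> S" "h = f * y" using f_dvdE[OF h(1)] by blast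
    then show ?thesis using idealD(4)[OF primesD(1)[OF P] _ primesD(3)[OF P]] by simp
  next
    case False
    then have "val P h \<noteq> 0" using h pabs_S[OF P h(1)] by (intro notI) simp
    then show ?thesis using val_gen[OF P h(1) False, of 1] pg(2)[OF P] by simp
  qed
next
  fix h assume h: "h \<in> P"
  then have hS: "h \<in> S" using idealD(1)[OF primesD(1)[OF P]] by blast
  have "pabs P h < 1"
  proof (cases "f dvd h")
    case False
    then have "1 \<le> val P h" using val_gen[OF P hS False, of 1] pg(2)[OF P] h by simp
    then show ?thesis using pabs_S[OF P hS False] t_pos t_less by (simp add: power_less_one_iff)
  qed (simp add: pabs_def)
  then show "h \<in> center (pabs P)" using hS by (simp add: center_def)
qed

text \<open>For the last power of \<open>t\<close> whose absolute value is at least that of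
  \<open>c\<close>, the quotient has absolute value in the interval from \<open>\<phi> t\<close>
  (exclusive) to 1, hence 1 by discreteness.\<close>

lemma abs_power_t: assumes "c \<noteq> 0" "\<phi> c \<le> 1" shows "\<exists>k u. c = t ^ k * u \<and> \<phi> u = 1"
proof -
  have "\<exists>k. \<phi> t ^ k < \<phi> c"
    using real_arch_pow_inv[of "\<phi> c" "\<phi> t"] t_less abs_eq_0[of c] abs_nonneg[of c] assms by force
  define k where "k = (LEAST k. \<phi> t ^ k < \<phi> c)"
  have k: "\<phi> t ^ k < \<phi> c" unfolding k_def using \<open>\<exists>k. \<phi> t ^ k < \<phi> c\<close> by (rule LeastI_ex)
  then have "k \<noteq> 0" using assms by (intro notI) simp
  then obtain j where j: "k = Suc j" using not0_implies_Suc by blast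
  have "\<not> \<phi> t ^ j < \<phi> c" using not_less_Least[of j "\<lambda>k. \<phi> t ^ k < \<phi> c"] j unfolding k_def by simp
  then have le: "\<phi> (c / t ^ j) \<le> 1" using t_pos by (simp add: abs_divide abs_power)
  have "\<phi> t < \<phi> (c / t ^ j)" using k t_pos by (simp add: j abs_divide abs_power pos_less_divide_eq)
  then have "\<phi> (c / t ^ j) = 1" using le discrete[of "c / t ^ j"] by fastforce
  then show ?thesis using t_nz by (intro exI[of _ j] exI[of _ "c / t ^ j"]) simp
qed

lemma pabs_const:
  assumes P: "P \<in> primes" shows "pabs P [:c:] = \<phi> c"
proof (cases "c = 0")
  case True
  then show ?thesis by (simp add: pabs_def)
next
  case False
  then have nd: "\<not> f dvd [:c:]" by (simp add: f_dvd_const)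
  obtain N where N: "[:t:] ^ N * [:c:] \<in> S" using clear_t by blast
  have eq: "[:t:] ^ N * [:c:] = [:t ^ N * c:]" by (simp add: poly_const_pow)
  obtain k u where ku: "t ^ N * c = t ^ k * u" "\<phi> u = 1"
    using abs_power_t[of "t ^ N * c"] False t_nz N unfolding eq S_const by auto
  have u: "u \<noteq> 0" using ku(2) abs_eq_0[of u] by auto
  have uS: "[:u:] \<in> S" "[:inverse u:] \<in> S" using ku(2) by (simp_all add: abs_inverse)
  have "[:u:] \<notin> P"
  proof
    assume "[:u:] \<in> P"
    then have "[:inverse u:] * [:u:] \<in> P" by (rule idealD(3)[OF primesD(1)[OF P] uS(2)])
    then show False using u primesD(4)[OF P] by (simp add: one_pCons)
  qed
  then have "val P [:u:] = 0"
    using u uS S.S_0 by (intro val_unique[OF P, where s = "[:u:]" and y = 0]) (auto simp: f_dvd_const)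
  moreover have "[:t ^ N * c:] = [:t:] ^ k * [:u:]" using ku(1) by (simp add: poly_const_pow)
  ultimately have "val P ([:t:] ^ N * [:c:]) = k"
    using val_mult[OF P t_power_S[of k] t_power_nd[of k] uS(1)] u val_t_power[OF P, of k]
    unfolding eq by (simp only: f_dvd_const) simp
  then have "pabs P [:c:] = \<phi> t ^ k / \<phi> t ^ N" using pabs_eq[OF P N nd] by simp
  also have "\<phi> t ^ N * \<phi> c = \<phi> t ^ k"
    using arg_cong[OF ku(1), of \<phi>] ku(2) by (simp add: abs_mult abs_power)
  then have "\<phi> t ^ k / \<phi> t ^ N = \<phi> c" using t_pos by (simp add: field_simps)
  finally show ?thesis .
qed

lemma pabs_ext_abs: assumes P: "P \<in> primes" shows "ext_abs (pabs P)"
proof -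
  have pos: "0 < pabs P h" if "\<not> f dvd h" for h
  proof -
    obtain N where N: "[:t:] ^ N * h \<in> S" using clear_t by blast
    then show ?thesis using pabs_eq[OF P N that] t_pos by simp
  qed
  have 0: "pabs P h = 0" if "f dvd h" for h using that by (simp add: pabs_def)
  have mult: "pabs P (g * h) = pabs P g * pabs P h" for g h
  proof (cases "f dvd g \<or> f dvd h")
    case True
    then have "f dvd g * h" using f_prime by blast
    then show ?thesis using True 0 by auto
  next
    case False
    obtain N where N: "[:t:] ^ N * g \<in> S" using clear_t by blast
    obtain M where M: "[:t:] ^ M * h \<in> S" using clear_t by blast
    have nd: "\<not> f dvd [:t:] ^ N * g" "\<not> f dvd [:t:] ^ M * h" "\<not> f dvd g * h"
      using f_prime False t_power_nd by blast+
    have eq: "[:t:] ^ (N + M) * (g * h) = ([:t:] ^ N * g) * ([:t:] ^ M * h)"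
      by (simp only: power_add mult_ac)
    have "[:t:] ^ (N + M) * (g * h) \<in> S" unfolding eq by (rule S.S_mult[OF N M])
    from pabs_eq[OF P this nd(3)] have "pabs P (g * h) = \<phi> t ^ (val P ([:t:] ^ N * g) + val P ([:t:] ^ M * h)) / \<phi> t ^ (N + M)"
      unfolding eq val_mult[OF P N nd(1) M nd(2)] .
    then show ?thesis using pabs_eq[OF P N] pabs_eq[OF P M] False by (simp add: power_add)
  qed
  have add: "pabs P (g + h) \<le> max (pabs P g) (pabs P h)" for g h
  proof (cases "f dvd g \<or> f dvd h \<or> f dvd g + h")
    case True
    \<comment> \<open>A summand divisible by \<open>f\<close> has no valuation; it only changes the
      multiple of \<open>f\<close> in the representation of the other summand.\<close>
    have same: "pabs P (a + b) = pabs P b" if "f dvd a" for a b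
    proof (cases "f dvd b")
      case True
      then show ?thesis using that 0 by simp
    next
      case False
      then have nab: "\<not> f dvd a + b" using that by (simp add: dvd_add_right_iff)
      obtain N where N: "[:t:] ^ N * a \<in> S" using clear_t by blast
      obtain M where M: "[:t:] ^ M * b \<in> S" using clear_t by blast
      let ?T = "[:t:] ^ (N + M)"
      have A: "?T * a \<in> S" and B: "?T * b \<in> S"
        using S.S_mult[OF t_power_S[of M] N] S.S_mult[OF t_power_S[of N] M]
        by (simp_all only: power_add mult_ac)
      have AB: "?T * (a + b) \<in> S" using S.S_add[OF A B] by (simp only: distrib_left)
      have nB: "\<not> f dvd ?T * b" and nAB: "\<not> f dvd ?T * (a + b)" using f_prime t_power_nd False nab by blast+
      obtain y where y: "y \<in> S" "?T * a = f * y" by (rule f_dvdE[OF A dvd_mult[OF \<open>f dvd a\<close>]])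
      obtain s z where sz: "s \<in> S" "z \<in> S" "s \<notin> P" "?T * b = pg P ^ val P (?T * b) * s + f * z"
        using val_rep[OF P B nB] by blast
      have "val P (?T * (a + b)) = val P (?T * b)"
      proof (rule val_unique[OF P AB nAB sz(1) S.S_add[OF y(1) sz(2)] sz(3)])
        show "?T * (a + b) = pg P ^ val P (?T * b) * s + f * (y + z)"
          unfolding distrib_left y(2) by (subst sz(4)) simp
      qed
      then show ?thesis using pabs_eq[OF P AB nab] pabs_eq[OF P B False] by simp
    qed
    have nn: "0 \<le> pabs P h" for h using pos[of h] 0[of h] by (cases "f dvd h") auto
    show ?thesis using True same[of g h] same[of h g] 0[of "g + h"] nn by (auto simp: add.commute le_max_iff_disj)
  next
    case False
    obtain N where N: "[:t:] ^ N * g \<in> S" using clear_t by blast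
    obtain M where M: "[:t:] ^ M * h \<in> S" using clear_t by blast
    let ?T = "[:t:] ^ (N + M)"
    have A: "?T * g \<in> S" and B: "?T * h \<in> S"
      using S.S_mult[OF t_power_S[of M] N] S.S_mult[OF t_power_S[of N] M]
      by (simp_all only: power_add mult_ac)
    have AB: "?T * (g + h) \<in> S" using S.S_add[OF A B] by (simp only: distrib_left)
    have nd: "\<not> f dvd ?T * g" "\<not> f dvd ?T * h" "\<not> f dvd ?T * (g + h)"
      using f_prime t_power_nd False by blast+
    let ?k = "min (val P (?T * g)) (val P (?T * h))"
    have G: "ideal (gen (pg P ^ ?k))" by (intro gen_ideal S_power pg(1)[OF P])
    have "?T * g \<in> gen (pg P ^ ?k)" "?T * h \<in> gen (pg P ^ ?k)"
      unfolding val_gen[OF P A nd(1)] val_gen[OF P B nd(2)] by simp_all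
    then have "?T * (g + h) \<in> gen (pg P ^ ?k)" using idealD(6)[OF G] by (simp only: distrib_left)
    then have "?k \<le> val P (?T * (g + h))" using val_gen[OF P AB nd(3)] by blast
    then have le: "\<phi> t ^ val P (?T * (g + h)) \<le> \<phi> t ^ ?k" using t_pos t_less by (intro power_decreasing) auto
    have "\<phi> t ^ ?k = max (\<phi> t ^ val P (?T * g)) (\<phi> t ^ val P (?T * h))"
      using t_pos t_less power_decreasing[of _ _ "\<phi> t"]
      by (cases "val P (?T * g) \<le> val P (?T * h)") (auto simp: min_def max_def intro: antisym)
    then have "\<phi> t ^ val P (?T * (g + h)) / \<phi> t ^ (N + M) \<le>
        max (\<phi> t ^ val P (?T * g) / \<phi> t ^ (N + M)) (\<phi> t ^ val P (?T * h) / \<phi> t ^ (N + M))"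
      using divide_right_mono[OF le, of "\<phi> t ^ (N + M)"] t_pos
      by (cases "\<phi> t ^ val P (?T * g) \<le> \<phi> t ^ val P (?T * h)")
        (simp_all add: max.absorb1 max.absorb2 divide_right_mono le_max_iff_disj)
    then show ?thesis using pabs_eq[OF P AB] pabs_eq[OF P A] pabs_eq[OF P B] False by simp
  qed
  have "0 \<le> pabs P h \<and> (pabs P h = 0 \<longleftrightarrow> f dvd h)" for h
    using pos[of h] 0[of h] by (cases "f dvd h") auto
  then show ?thesis unfolding ext_abs_def using mult add pabs_const[OF P] by blast
qed

lemma ext_absD:
  assumes "ext_abs \<psi>"
  shows "0 \<le> \<psi> h" "\<psi> h = 0 \<longleftrightarrow> f dvd h" "\<psi> (g * h) = \<psi> g * \<psi> h"
    "\<psi> (g + h) \<le> max (\<psi> g) (\<psi> h)" "\<psi> [:c:] = \<phi> c" "\<psi> (- h) = \<psi> h" "\<psi> (g - h) \<le> max (\<psi> g) (\<psi> h)"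
    "\<psi> 0 = 0" "\<psi> 1 = 1" "\<psi> (h ^ n) = \<psi> h ^ n" "f dvd g - h \<Longrightarrow> \<psi> g = \<psi> h"
proof -
  note * = assms[unfolded ext_abs_def]
  show 1: "0 \<le> \<psi> h" "\<psi> h = 0 \<longleftrightarrow> f dvd h" and m: "\<psi> (g * h) = \<psi> g * \<psi> h"
    and a: "\<psi> (g + h) \<le> max (\<psi> g) (\<psi> h)" and c: "\<psi> [:c:] = \<phi> c" for g h c using * by blast+
  show u: "\<psi> (- h) = \<psi> h" for h using m[of "[:-1:]" h] c[of "-1"] by simp
  show d: "\<psi> (g - h) \<le> max (\<psi> g) (\<psi> h)" for g h using a[of g "- h"] u[of h] by simp
  show "\<psi> 0 = 0" "\<psi> 1 = 1" using c[of 0] c[of 1] by (simp_all add: one_pCons)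
  then show "\<psi> (h ^ n) = \<psi> h ^ n" by (induction n) (simp_all add: m)
  assume "f dvd g - h"
  then have z: "\<psi> (g - h) = 0" "\<psi> (h - g) = 0" using * u[of "g - h"] by (simp, metis minus_diff_eq)
  have "\<psi> g \<le> \<psi> h" using a[of "g - h" h] z * by simp
  moreover have "\<psi> h \<le> \<psi> g" using a[of "h - g" g] z * by simp
  ultimately show "\<psi> g = \<psi> h" by simp
qed

lemma ext_sum:
  assumes "ext_abs \<psi>" "0 \<le> c" "\<And>i. i \<in> A \<Longrightarrow> \<psi> (h i) \<le> c"
  shows "\<psi> (sum h A) \<le> c"
  using assms(3)
proof (induction A rule: infinite_finite_induct)
  case (insert i A)
  have "\<psi> (h i) \<le> c" "\<psi> (sum h A) \<le> c" using insert by simp_all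
  then have "max (\<psi> (h i)) (\<psi> (sum h A)) \<le> c" by simp
  then have "\<psi> (h i + sum h A) \<le> c" by (rule order.trans[OF ext_absD(4)[OF assms(1)]])
  then show ?case using insert.hyps by simp
qed (use ext_absD(8)[OF assms(1)] assms(2) in simp_all)

text \<open>\<open>X\<close> is integral modulo the monic integral \<open>f\<close>: if its value
  exceeded 1, the leading term of \<open>f\<close> would exceed all others.\<close>

lemma ext_abs_S:
  assumes E: "ext_abs \<psi>" and h: "h \<in> S" shows "\<psi> h \<le> 1"
proof -
  let ?x = "monom 1 1 :: 'a poly"
  define r where "r = \<psi> ?x"
  have mon: "\<psi> (monom c i) = \<phi> c * r ^ i" for c i
  proof -
    have "monom c i = [:c:] * ?x ^ i" by (simp add: monom_power smult_monom)
    then show ?thesis by (simp only: ext_absD(3,5,10)[OF E] r_def)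
  qed
  have r0: "0 \<le> r" unfolding r_def by (rule ext_absD(1)[OF E])
  have "r \<le> 1"
  proof (rule ccontr)
    assume "\<not> r \<le> 1"
    then have gt: "1 < r" by simp
    obtain n where n: "degree f = Suc n" using f_deg by (metis not0_implies_Suc neq0_conv)
    have "f = (\<Sum>i\<le>n. monom (coeff f i) i) + monom 1 (Suc n)"
      using poly_as_sum_of_monoms[of f] f_monic by (simp add: n)
    then have eq: "monom 1 (Suc n) - - (\<Sum>i\<le>n. monom (coeff f i) i) = f" by (simp add: add.commute)
    have "\<psi> (monom 1 (Suc n)) = \<psi> (- (\<Sum>i\<le>n. monom (coeff f i) i))"
      by (rule ext_absD(11)[OF E]) (simp only: eq dvd_refl)
    also have "\<dots> \<le> r ^ n"
      unfolding ext_absD(6)[OF E]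
    proof (rule ext_sum[OF E])
      fix i assume "i \<in> {..n}"
      then have "r ^ i \<le> r ^ n" using gt by (intro power_increasing) auto
      moreover have "\<phi> (coeff f i) * r ^ i \<le> 1 * r ^ i"
        using f_S gt by (intro mult_right_mono) (auto simp: S_def)
      ultimately show "\<psi> (monom (coeff f i) i) \<le> r ^ n" unfolding mon by simp
    qed (use gt in simp)
    finally have "r ^ Suc n \<le> r ^ n" unfolding mon by simp
    then show False using gt by simp
  qed
  then have le: "r ^ i \<le> 1" for i using r0 by (simp add: power_le_one)
  have "\<psi> (\<Sum>i\<le>degree h. monom (coeff h i) i) \<le> 1"
    using h le r0 by (intro ext_sum[OF E]) (auto simp: mon S_def abs_nonneg intro!: mult_le_one)
  then show ?thesis by (simp only: poly_as_sum_of_monoms)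
qed

text \<open>Maximality comes from finiteness of \<open>S\<close> modulo the centre. For
  \<open>h\<close> of value 1 two powers agree there, so \<open>1 - h^(d+1)\<close> lies in the
  centre, and an ideal containing both the centre and \<open>h\<close> contains 1.\<close>

lemma center_prime:
  assumes E: "ext_abs \<psi>" shows "center \<psi> \<in> primes"
proof -
  let ?P = "center \<psi>"
  have P: "ideal ?P"
    unfolding ideal_def sgp_def
  proof (intro conjI ballI)
    show "?P \<subseteq> S" by (auto simp: center_def)
    show "0 \<in> ?P" using S.S_0 ext_absD(8)[OF E] by (simp add: center_def)
  next
    fix x y assume "x \<in> ?P" "y \<in> ?P"
    then show "x - y \<in> ?P" using S.S_diff ext_absD(7)[OF E, of x y] by (auto simp: center_def)
  next
    fix c x assume cx: "c \<in> S" "x \<in> ?P"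
    have "\<psi> c * \<psi> x \<le> 1 * \<psi> x"
      using cx ext_absD(1)[OF E] by (intro mult_right_mono ext_abs_S[OF E]) auto
    then show "c * x \<in> ?P" using cx S.S_mult ext_absD(3)[OF E, of c x] by (auto simp: center_def)
  qed
  have "[:t:] \<in> ?P" using t_S t_less ext_absD(5)[OF E] by (simp add: center_def)
  moreover have "f \<in> ?P" using f_S ext_absD(2)[OF E, of f] by (simp add: center_def)
  moreover have "1 \<notin> ?P" using ext_absD(9)[OF E] by (simp add: center_def)
  moreover have "J = ?P" if J: "ideal J" "?P \<subseteq> J" "1 \<notin> J" for J
  proof (rule ccontr)
    assume "J \<noteq> ?P"
    then obtain h where h: "h \<in> J" "h \<notin> ?P" using J(2) by blast
    then have hS: "h \<in> S" using idealD(1)[OF J(1)] by blast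
    then have h1: "\<psi> h = 1" using h(2) ext_abs_S[OF E] by (auto simp: center_def not_less intro: antisym)
    have "(\<lambda>n. coset ?P (h ^ n)) ` UNIV \<subseteq> quo S ?P"
      using S_power[OF hS] by (auto simp: quo_def)
    moreover have "fin S ?P"
      using fin_mono(1)[of "gen [:t:]" ?P S] idx_gen_t(1) idealD(1,2)[OF P] S.sgp_S
        idealD(2)[OF gen_ideal[OF t_S]] gen_least[OF P] \<open>[:t:] \<in> ?P\<close> \<open>f \<in> ?P\<close> by blast
    ultimately have "finite (range (\<lambda>n. coset ?P (h ^ n)))"
      unfolding fin_def using finite_subset by blast
    then have "\<not> inj (\<lambda>n. coset ?P (h ^ n))" using finite_imageD by blast
    then obtain a b where "a < b" and eq: "coset ?P (h ^ a) = coset ?P (h ^ b)"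
      unfolding inj_def by (metis linorder_neqE_nat)
    then obtain d where b: "b = a + Suc d" by (metis less_iff_Suc_add add_Suc_right)
    have "h ^ a - h ^ b \<in> ?P" using eq coset_eq_iff[OF idealD(2)[OF P]] by blast
    then have "\<psi> (h ^ a * (1 - h * h ^ d)) < 1"
      unfolding b power_add power_Suc by (simp only: center_def mem_Collect_eq right_diff_distrib mult_1_right)
    then have "\<psi> (1 - h * h ^ d) < 1" unfolding ext_absD(3,10)[OF E] h1 by simp
    moreover have "h * h ^ d \<in> S" by (intro S.S_mult S_power hS)
    ultimately have "1 - h * h ^ d \<in> ?P" using S.S_diff[OF S.S_1] by (simp add: center_def)
    then have "1 - h * h ^ d \<in> J" using J(2) by blast
    then have "(1 - h * h ^ d) + h * h ^ d \<in> J"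
      by (rule idealD(6)[OF J(1)]) (intro idealD(4)[OF J(1)] S_power hS h)
    then show False using J(3) by simp
  qed
  ultimately show ?thesis unfolding primes_def using P by blast
qed

text \<open>Elements of \<open>S\<close> outside the centre have value 1, so every value is a power
  of the value of the generator. Comparison at \<open>t\<close>, which has valuation 1, shows that
  this base is \<open>\<phi> t\<close>.\<close>

lemma ext_abs_val:
  assumes E: "ext_abs \<psi>" and h: "h \<in> S" "\<not> f dvd h"
  shows "\<psi> h = \<phi> t ^ val (center \<psi>) h"
proof -
  let ?P = "center \<psi>"
  note P = center_prime[OF E]
  have main: "\<psi> g = \<psi> (pg ?P) ^ val ?P g" if g: "g \<in> S" "\<not> f dvd g" for g
  proof -
    obtain s y where sy: "s \<in> S" "y \<in> S" "s \<notin> ?P" "g = pg ?P ^ val ?P g * s + f * y"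
      using val_rep[OF P g] by blast
    have "\<psi> g = \<psi> (pg ?P ^ val ?P g * s)" by (rule ext_absD(11)[OF E], subst sy(4)) simp
    moreover have "\<psi> s = 1" using sy(1,3) ext_abs_S[OF E sy(1)] by (auto simp: center_def)
    ultimately show ?thesis by (simp add: ext_absD(3,10)[OF E])
  qed
  have "\<psi> (pg ?P) = \<phi> t" using main[OF t_S t_notin_fS] val_t[OF P] ext_absD(5)[OF E] by simp
  then show ?thesis using main[OF h] by simp
qed

lemma ext_abs_eq_pabs: assumes E: "ext_abs \<psi>" shows "\<psi> = pabs (center \<psi>)"
proof
  fix h
  show "\<psi> h = pabs (center \<psi>) h"
  proof (cases "f dvd h")
    case True
    then show ?thesis using ext_absD(2)[OF E] by (simp add: pabs_def)
  next
    case False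
    obtain N where N: "[:t:] ^ N * h \<in> S" using clear_t by blast
    have nd: "\<not> f dvd [:t:] ^ N * h" using f_prime t_power_nd False by blast
    have "\<phi> t ^ N * \<psi> h = \<phi> t ^ val (center \<psi>) ([:t:] ^ N * h)"
      using ext_abs_val[OF E N nd] by (simp only: ext_absD(3,5,10)[OF E])
    then show ?thesis unfolding pabs_eq[OF center_prime[OF E] N False] using t_pos
      by (simp add: field_simps)
  qed
qed

lemma ext_abs_bij: "bij_betw center {\<psi>. ext_abs \<psi>} primes"
  unfolding bij_betw_def
proof
  show "inj_on center {\<psi>. ext_abs \<psi>}" by (rule inj_onI) (metis ext_abs_eq_pabs mem_Collect_eq)
  show "center ` {\<psi>. ext_abs \<psi>} = primes"
    using center_prime pabs_ext_abs pabs_center by force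
qed

text \<open>The point is surjectivity: an element of value at most 1 is congruent to an element of
  \<open>S\<close>, although its coefficients need not be integral.\<close>

lemma ext_abs_residue:
  assumes E: "ext_abs \<psi>"
  shows "idx {h. \<psi> h \<le> 1} {h. \<psi> h < 1} = idx S (center \<psi>)"
proof -
  let ?P = "center \<psi>"
  note P = center_prime[OF E]
  have "idx S ?P = idx {h. \<psi> h \<le> 1} {h. \<psi> h < 1}"
  proof (rule idx_transfer(1)[where g = "\<lambda>h. h"])
    show "sgp ?P" by (rule idealD(2)[OF primesD(1)[OF P]])
    show "sgp {h. \<psi> h < 1}" unfolding sgp_def
      using ext_absD(8)[OF E] by (auto intro!: le_less_trans[OF ext_absD(7)[OF E]])
    show "h \<in> {h. \<psi> h \<le> 1}" if "h \<in> S" for h using ext_abs_S[OF E that] by simp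
    show "g - h \<in> ?P \<longleftrightarrow> g - h \<in> {h. \<psi> h < 1}" if "g \<in> S" "h \<in> S" for g h
      using S.S_diff[OF that] by (simp add: center_def)
    fix h assume "h \<in> {h. \<psi> h \<le> 1}"
    then have h1: "\<psi> h \<le> 1" by simp
    show "\<exists>g\<in>S. h - g \<in> {h. \<psi> h < 1}"
    proof (cases "\<psi> h < 1")
      case True
      then show ?thesis using S.S_0 by (intro bexI[of _ 0]) auto
    next
      case False
      then have h1: "\<psi> h = 1" using h1 by simp
      then have nh: "\<not> f dvd h" using ext_absD(2)[OF E, of h] by auto
      obtain N where N: "[:t:] ^ N * h \<in> S" using clear_t by blast
      have nd: "\<not> f dvd [:t:] ^ N * h" using f_prime t_power_nd nh by blast
      have "\<phi> t ^ val ?P ([:t:] ^ N * h) = \<phi> t ^ N"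
        using ext_abs_val[OF E N nd] h1 by (simp add: ext_absD(3,5,10)[OF E])
      then have v: "val ?P ([:t:] ^ N * h) = N"
        using t_pos t_less power_inject_exp'[of "\<phi> t"] by (metis not_less_iff_gr_or_eq power_strict_decreasing)
      obtain s y where sy: "s \<in> S" "y \<in> S" "s \<notin> ?P" "[:t:] ^ N * h = pg ?P ^ N * s + f * y"
        using val_rep[OF P N nd] unfolding v by blast
      obtain s' y' where sy': "s' \<in> S" "y' \<in> S" "s' \<notin> ?P" "[:t:] ^ N = pg ?P ^ N * s' + f * y'"
        using val_rep[OF P t_power_S t_power_nd, of N] unfolding val_t_power[OF P] by blast
      \<comment> \<open>Modulo \<open>f\<close>, \<open>h\<close> is the quotient of
        \<open>s\<close> by \<open>s'\<close>; replacing the reciprocal of \<open>s'\<close> by its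
        inverse \<open>r\<close> modulo the centre changes \<open>h\<close> by an element of value
        below 1.\<close>
      obtain r where r: "r \<in> S" "1 - s' * r \<in> ?P" using prime_inverse[OF P sy'(1,3)] by blast
      have one: "\<psi> s = 1" "\<psi> s' = 1"
        using sy(1,3) sy'(1,3) ext_abs_S[OF E sy(1)] ext_abs_S[OF E sy'(1)] by (auto simp: center_def)
      have "T * (h - r * s) - A * (s * (1 - s' * r)) = f * (y - y' * r * s)"
        if "T * h = A * s + f * y" "T = A * s' + f * y'" for T A
        using that by Groebner_Basis.algebra
      from this[OF sy(4) sy'(4)]
      have "\<psi> ([:t:] ^ N * (h - r * s)) = \<psi> (pg ?P ^ N * (s * (1 - s' * r)))"
        by (intro ext_absD(11)[OF E]) simp
      moreover have "\<psi> ([:t:] ^ N) = \<psi> (pg ?P ^ N * s')" by (rule ext_absD(11)[OF E], subst sy'(4)) simp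
      then have "\<psi> ([:t:] ^ N) = \<psi> (pg ?P ^ N)" by (simp add: ext_absD(3)[OF E] one)
      moreover have "\<psi> ([:t:] ^ N) \<noteq> 0" using ext_absD(2)[OF E] t_power_nd by blast
      ultimately have "\<psi> (h - r * s) = \<psi> (1 - s' * r)" by (simp add: ext_absD(3)[OF E] one)
      then have "\<psi> (h - r * s) < 1" using r(2) by (simp add: center_def)
      then show ?thesis using S.S_mult[OF r(1) sy(1)] by (intro bexI[of _ "r * s"]) auto
    qed
  qed
  then show ?thesis by simp
qed

end

section \<open>Non-Archimedean absolute values on number fields\<close>

definition nabs :: "('k::field_char_0 \<Rightarrow> real) \<Rightarrow> bool" where
  "nabs \<phi> \<longleftrightarrow> (\<forall>x. 0 \<le> \<phi> x \<and> (\<phi> x = 0 \<longleftrightarrow> x = 0)) \<and> (\<forall>x y. \<phi> (x * y) = \<phi> x * \<phi> y) \<and>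
     (\<forall>x y. \<phi> (x + y) \<le> max (\<phi> x) (\<phi> y)) \<and> (\<exists>x. x \<noteq> 0 \<and> \<phi> x \<noteq> 1)"

section \<open>Absolute values, integers and primes\<close>

lemma nonarch_abs_base: "nonarch_abs (base_field :: 'k::field_char_0 ring) = {\<phi>. nabs \<phi>}"
  by (auto simp: nonarch_abs_def nabs_def ring_of_type_algebra_def extensional_def)

lemma nabsD:
  assumes "nabs \<phi>"
  shows "0 \<le> \<phi> x" "\<phi> x = 0 \<longleftrightarrow> x = 0" "\<phi> (x * y) = \<phi> x * \<phi> y" "\<phi> (x + y) \<le> max (\<phi> x) (\<phi> y)"
    "\<phi> 0 = 0" "\<phi> 1 = 1" "\<phi> (- x) = \<phi> x" "\<phi> (x ^ n) = \<phi> x ^ n" "\<phi> (inverse x) = inverse (\<phi> x)"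
    "\<phi> (x / y) = \<phi> x / \<phi> y" "\<phi> y < \<phi> x \<Longrightarrow> \<phi> (x + y) = \<phi> x"
proof -
  note * = assms[unfolded nabs_def]
  show 0: "0 \<le> \<phi> x" "\<phi> x = 0 \<longleftrightarrow> x = 0" and m: "\<phi> (x * y) = \<phi> x * \<phi> y"
    and a: "\<phi> (x + y) \<le> max (\<phi> x) (\<phi> y)" for x y using * by blast+
  show "\<phi> 0 = 0" using 0 by simp
  show one: "\<phi> 1 = 1" using m[of 1 1] 0(2)[of 1] by simp
  have "\<phi> (-1) * \<phi> (-1) = 1" using m[of "-1" "-1"] one by simp
  then have "\<phi> (-1) = 1" using 0(1)[of "-1"] by (simp add: square_eq_1_iff)
  then show u: "\<phi> (- x) = \<phi> x" for x using m[of "-1" x] by simp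
  show "\<phi> (x ^ n) = \<phi> x ^ n" by (induction n) (simp_all add: m one)
  show i: "\<phi> (inverse x) = inverse (\<phi> x)" for x
  proof (cases "x = 0")
    case False
    then have "\<phi> (inverse x) * \<phi> x = 1" using m[of "inverse x" x] one by simp
    then show ?thesis by (metis inverse_unique mult.commute)
  qed (simp add: 0(2)[of 0, simplified])
  show "\<phi> (x / y) = \<phi> x / \<phi> y" by (simp add: divide_inverse m i)
  assume "\<phi> y < \<phi> x"
  then show "\<phi> (x + y) = \<phi> x" using a[of x y] a[of "x + y" "- y"] u[of y] by auto
qed

lemma nabs_sum_le: "nabs \<phi> \<Longrightarrow> 0 \<le> c \<Longrightarrow> (\<And>i. i \<in> A \<Longrightarrow> \<phi> (h i) \<le> c) \<Longrightarrow> \<phi> (sum h A) \<le> c"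
proof (induction A rule: infinite_finite_induct)
  case (insert i A)
  then have "max (\<phi> (h i)) (\<phi> (sum h A)) \<le> c" by simp
  then have "\<phi> (h i + sum h A) \<le> c" by (rule order.trans[OF nabsD(4)[OF insert.prems(1)]])
  then show ?case using insert.hyps by simp
qed (simp_all add: nabsD)

lemma nabs_sum_less: "nabs \<phi> \<Longrightarrow> 0 < c \<Longrightarrow> (\<And>i. i \<in> A \<Longrightarrow> \<phi> (h i) < c) \<Longrightarrow> \<phi> (sum h A) < c"
proof (induction A rule: infinite_finite_induct)
  case (insert i A)
  then have "max (\<phi> (h i)) (\<phi> (sum h A)) < c" by simp
  then have "\<phi> (h i + sum h A) < c" by (rule le_less_trans[OF nabsD(4)[OF insert.prems(1)]])
  then show ?case using insert.hyps by simp
qed (simp_all add: nabsD)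

lemma nabs_of_nat: assumes "nabs \<phi>" shows "\<phi> (of_nat n) \<le> 1"
proof (induction n)
  case (Suc n)
  then show ?case using nabsD(4)[OF assms, of 1 "of_nat n"] nabsD(6)[OF assms] by simp
qed (simp add: nabsD[OF assms])

lemma nabs_of_int: assumes "nabs \<phi>" shows "\<phi> (of_int n) \<le> 1"
proof (cases n rule: int_cases2)
  case (nonneg m)
  then show ?thesis using nabs_of_nat[OF assms, of m] by simp
next
  case (nonpos m)
  then show ?thesis using nabs_of_nat[OF assms, of m] nabsD(7)[OF assms, of "of_nat m"] by simp
qed

lemma nabs_prime_coprime:
  assumes "nabs \<phi>" "Factorial_Ring.prime p" "\<phi> (of_nat p) < 1" "\<not> int p dvd c"
  shows "\<phi> (of_int c) = 1"
proof (rule ccontr)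
  assume "\<phi> (of_int c) \<noteq> 1"
  then have lt: "\<phi> (of_int c) < 1" using nabs_of_int[OF assms(1), of c] by simp
  have "coprime (int p) c" using assms(2,4) by (intro prime_imp_coprime) auto
  then obtain u v where "u * int p + v * c = 1" using bezout_int[of "int p" c] by auto
  then have "of_int u * of_nat p + of_int v * of_int c = (1::'a)"
    by (metis of_int_1 of_int_add of_int_mult of_int_of_nat_eq)
  moreover have "\<phi> (of_int u * of_nat p) < 1" "\<phi> (of_int v * of_int c) < 1"
    using nabs_of_int[OF assms(1)] assms(3) lt nabsD(1)[OF assms(1)] nabsD(3)[OF assms(1)]
    by (auto intro: le_less_trans[OF mult_right_mono[of _ 1]])
  ultimately show False
    using nabsD(4)[OF assms(1), of "of_int u * of_nat p" "of_int v * of_int c"] nabsD(6)[OF assms(1)] by simp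
qed

lemma nabs_prime_divisor:
  assumes "nabs \<phi>" "c \<noteq> 0" "\<phi> (of_nat c) < 1" shows "\<exists>p. Factorial_Ring.prime p \<and> p dvd c \<and> \<phi> (of_nat p) < 1"
  using assms(2,3)
proof (induction c rule: less_induct)
  case (less c)
  have "c \<noteq> 1" using less.prems nabsD(6)[OF assms(1)] by auto
  then obtain p where p: "Factorial_Ring.prime p" "p dvd c" using prime_factor_nat by blast
  then obtain c' where c': "c = p * c'" by blast
  show ?case
  proof (cases "\<phi> (of_nat p) < 1")
    case False
    then have "\<phi> (of_nat p) = 1" using nabs_of_nat[OF assms(1), of p] by simp
    then have "\<phi> (of_nat c') < 1" using less.prems nabsD(3)[OF assms(1), of "of_nat p" "of_nat c'"] c' by simp
    moreover have "c' < c" "c' \<noteq> 0" using c' less.prems(1) prime_gt_1_nat[OF p(1)] by auto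
    ultimately show ?thesis using less.IH[of c'] c' by (metis dvd_mult)
  qed (use p in blast)
qed

text \<open>\<open>d\<close> is the degree over the rationals. Dependence is stated for a family, so
  that repeated elements are covered, and denominators are cleared because integers have absolute
  value at most 1.\<close>

lemma number_field_dependence:
  assumes "number_field TYPE('k::field_char_0)"
  shows "\<exists>d. \<forall>x::nat \<Rightarrow> 'k. \<exists>c::nat \<Rightarrow> int. (\<exists>i\<le>d. c i \<noteq> 0) \<and> (\<Sum>i\<le>d. of_int (c i) * x i) = 0"
proof -
  let ?s = "\<lambda>(r::rat) (x::'k). of_rat r * x"
  obtain B where B: "finite_dimensional_vector_space ?s B"
    using assms unfolding number_field_def by blast
  interpret V: finite_dimensional_vector_space ?s B by (rule B)
  show ?thesis
  proof (intro exI[of _ "V.dimension"] allI)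
    fix x :: "nat \<Rightarrow> 'k"
    let ?d = "V.dimension"
    have "\<exists>r::nat \<Rightarrow> rat. (\<exists>i\<le>?d. r i \<noteq> 0) \<and> (\<Sum>i\<le>?d. of_rat (r i) * x i) = 0"
    proof (cases "inj_on x {..?d}")
      case True
      have "V.dependent (x ` {..?d})"
      proof (rule ccontr)
        assume "\<not> V.dependent (x ` {..?d})"
        then have "card (x ` {..?d}) \<le> ?d"
          using V.dim_eq_card_independent V.dim_subset_UNIV by metis
        then show False using card_image[OF True] by simp
      qed
      then obtain u where u: "\<exists>v\<in>x ` {..?d}. u v \<noteq> 0" "(\<Sum>v\<in>x ` {..?d}. of_rat (u v) * v) = 0"
        using V.dependent_finite[of "x ` {..?d}"] by auto
      have "(\<Sum>i\<le>?d. of_rat (u (x i)) * x i) = 0"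
        using u(2) by (simp add: sum.reindex[OF True])
      then show ?thesis using u(1) by (intro exI[of _ "\<lambda>i. u (x i)"]) auto
    next
      case False
      then obtain i j where ij: "i \<le> ?d" "j \<le> ?d" "i \<noteq> j" "x i = x j" by (auto simp: inj_on_def)
      let ?r = "\<lambda>k. if k = i then 1 else if k = j then - 1 else (0::rat)"
      have "(\<Sum>k\<le>?d. of_rat (?r k) * x k) = (\<Sum>k\<in>{i, j}. of_rat (?r k) * x k)"
        using ij by (intro sum.mono_neutral_right) auto
      also have "\<dots> = 0" using ij by simp
      finally show ?thesis using ij by (intro exI[of _ ?r]) auto
    qed
    then obtain r :: "nat \<Rightarrow> rat" where r: "\<exists>i\<le>?d. r i \<noteq> 0" "(\<Sum>i\<le>?d. of_rat (r i) * x i) = 0" by blast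
    define D where "D = (\<Prod>i\<le>?d. snd (quotient_of (r i)))"
    have Dpos: "D > 0" unfolding D_def using quotient_of_denom_pos' by (intro prod_pos) auto
    have "\<exists>c. of_int D * r i = of_int c" if "i \<le> ?d" for i
    proof -
      have "snd (quotient_of (r i)) dvd D" unfolding D_def using that by (intro dvd_prodI) auto
      then obtain e where e: "D = snd (quotient_of (r i)) * e" by blast
      have "r i = of_int (fst (quotient_of (r i))) / of_int (snd (quotient_of (r i)))"
        by (rule quotient_of_div) simp
      moreover have "snd (quotient_of (r i)) \<noteq> 0" using quotient_of_denom_pos'[of "r i"] by simp
      ultimately have "of_int D * r i = of_int (fst (quotient_of (r i)) * e)"
        unfolding e by (simp add: field_simps)
      then show ?thesis by blast
    qed
    then obtain c where c: "\<And>i. i \<le> ?d \<Longrightarrow> of_int D * r i = of_int (c i)" by metis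
    have "(\<Sum>i\<le>?d. of_int (c i) * x i) = (\<Sum>i\<le>?d. of_int D * (of_rat (r i) * x i))"
    proof (rule sum.cong[OF refl])
      fix i assume "i \<in> {..?d}"
      then have "of_rat (of_int (c i)) = (of_rat (of_int D * r i) :: 'k)" using c[of i] by simp
      then show "of_int (c i) * x i = of_int D * (of_rat (r i) * x i)" by (simp add: of_rat_mult mult.assoc)
    qed
    also have "\<dots> = 0" using r(2) by (simp flip: sum_distrib_left)
    finally have "(\<Sum>i\<le>?d. of_int (c i) * x i) = 0" .
    moreover have "\<exists>i\<le>?d. c i \<noteq> 0" using r(1) c Dpos by (metis mult_eq_0_iff of_int_0 of_int_eq_0_iff order_less_irrefl)
    ultimately show "\<exists>c. (\<exists>i\<le>?d. c i \<noteq> 0) \<and> (\<Sum>i\<le>?d. of_int (c i) * x i) = 0" by blast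
  qed
qed

text \<open>Divide by \<open>p\<close> as long as all coefficients are divisible; the sum of their
  absolute values drops each time.\<close>

lemma primitive_dependence:
  fixes x :: "nat \<Rightarrow> 'k::field_char_0" and c :: "nat \<Rightarrow> int"
  assumes "Factorial_Ring.prime p" "\<exists>i\<le>d. c i \<noteq> 0" "(\<Sum>i\<le>d. of_int (c i) * x i) = 0"
  shows "\<exists>c. (\<exists>i\<le>d. \<not> int p dvd c i) \<and> (\<Sum>i\<le>d. of_int (c i) * x i) = 0"
  using assms(2,3)
proof (induction "\<Sum>i\<le>d. nat \<bar>c i\<bar>" arbitrary: c rule: less_induct)
  case less
  show ?case
  proof (cases "\<exists>i\<le>d. \<not> int p dvd c i")
    case False
    define c' where "c' i = c i div int p" for i
    have c: "c i = int p * c' i" if "i \<le> d" for i using False that by (simp add: c'_def)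
    have p: "1 < int p" using prime_gt_1_nat[OF assms(1)] by simp
    have le: "nat \<bar>c' i\<bar> \<le> nat \<bar>c i\<bar>" if "i \<le> d" for i
      using c[OF that] p by (simp add: abs_mult mult_le_cancel_right1 nat_mono)
    obtain i0 where i0: "i0 \<le> d" "c i0 \<noteq> 0" using less.prems by blast
    then have "c' i0 \<noteq> 0" using c[of i0] by auto
    then have "nat \<bar>c' i0\<bar> < nat \<bar>c i0\<bar>" using c[OF i0(1)] p by (simp add: abs_mult)
    then have "(\<Sum>i\<le>d. nat \<bar>c' i\<bar>) < (\<Sum>i\<le>d. nat \<bar>c i\<bar>)"
      using le i0 by (intro sum_strict_mono_ex1) auto
    moreover have "(\<Sum>i\<le>d. of_int (c' i) * x i) = 0"
    proof -
      have "of_nat p * (\<Sum>i\<le>d. of_int (c' i) * x i) = (\<Sum>i\<le>d. of_int (c i) * x i)"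
        unfolding sum_distrib_left by (rule sum.cong) (simp_all add: c mult.assoc)
      moreover have "of_nat p \<noteq> (0::'k)" using p by simp
      ultimately show ?thesis using less.prems by simp
    qed
    ultimately show ?thesis using less.hyps[of c'] i0 \<open>c' i0 \<noteq> 0\<close> by blast
  qed (use less.prems in blast)
qed

text \<open>If all non-zero coefficients had absolute value 1, the highest power of \<open>x\<close>
  would strictly dominate the relation.\<close>

lemma nabs_algebraic:
  assumes "nabs \<phi>" "\<exists>i\<le>d. c i \<noteq> 0" "(\<Sum>i\<le>d. of_int (c i) * x ^ i) = 0" "1 < \<phi> x"
  shows "\<exists>i\<le>d. c i \<noteq> 0 \<and> \<phi> (of_int (c i)) < 1"
proof (rule ccontr)
  assume n: "\<not> ?thesis"
  define m where "m = Max {i. i \<le> d \<and> c i \<noteq> 0}"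
  have "{i. i \<le> d \<and> c i \<noteq> 0} \<noteq> {}" using assms(2) by blast
  then have m: "m \<le> d" "c m \<noteq> 0" using Max_in[of "{i. i \<le> d \<and> c i \<noteq> 0}"] unfolding m_def by auto
  have max: "i \<le> m" if "i \<le> d" "c i \<noteq> 0" for i unfolding m_def using that by (intro Max_ge) auto
  have "(\<Sum>i\<le>d. of_int (c i) * x ^ i) = (\<Sum>i\<in>{..<m}. of_int (c i) * x ^ i) + of_int (c m) * x ^ m"
  proof -
    have "(\<Sum>i\<le>d. of_int (c i) * x ^ i) = (\<Sum>i\<le>m. of_int (c i) * x ^ i)"
      using m max by (intro sum.mono_neutral_right) force+
    then show ?thesis by (simp add: lessThan_Suc_atMost[symmetric])
  qed
  then have eq: "of_int (c m) * x ^ m = - (\<Sum>i<m. of_int (c i) * x ^ i)"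
    using assms(3) by (simp add: eq_neg_iff_add_eq_0 add.commute)
  have "\<phi> (of_int (c m)) = 1" using n m nabs_of_int[OF assms(1), of "c m"] by force
  then have "\<phi> x ^ m = \<phi> (\<Sum>i<m. of_int (c i) * x ^ i)"
    using arg_cong[OF eq, of \<phi>] by (simp add: nabsD[OF assms(1)])
  also have "\<dots> < \<phi> x ^ m"
  proof (rule nabs_sum_less[OF assms(1)])
    fix i assume "i \<in> {..<m}"
    then have "\<phi> x ^ i < \<phi> x ^ m" using assms(4) by (intro power_strict_increasing) auto
    moreover have "\<phi> (of_int (c i) * x ^ i) \<le> \<phi> x ^ i"
      using nabs_of_int[OF assms(1), of "c i"] assms(4) by (simp add: nabsD[OF assms(1)] mult_left_le_one_le)
    ultimately show "\<phi> (of_int (c i) * x ^ i) < \<phi> x ^ m" by linarith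
  qed (use assms(4) in simp)
  finally show False by simp
qed

text \<open>Non-triviality provides an element of absolute value above 1. A relation between its
  powers has a non-zero coefficient of absolute value below 1, and so has one of the prime divisors
  of that coefficient.\<close>

lemma nabs_residue_prime:
  assumes "number_field TYPE('k)" "nabs (\<phi> :: 'k::field_char_0 \<Rightarrow> real)"
  shows "\<exists>p. Factorial_Ring.prime p \<and> \<phi> (of_nat p) < 1"
proof -
  obtain d where d: "\<And>x::nat \<Rightarrow> 'k. \<exists>c::nat \<Rightarrow> int. (\<exists>i\<le>d. c i \<noteq> 0) \<and> (\<Sum>i\<le>d. of_int (c i) * x i) = 0"
    using number_field_dependence[OF assms(1)] by blast
  obtain x where x: "x \<noteq> 0" "\<phi> x \<noteq> 1" using assms(2) unfolding nabs_def by blast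
  define y where "y = (if 1 < \<phi> x then x else inverse x)"
  have y: "1 < \<phi> y"
  proof (cases "1 < \<phi> x")
    case False
    then have "0 < \<phi> x" "\<phi> x < 1" using x nabsD(1,2)[OF assms(2), of x] by linarith+
    then show ?thesis using False by (simp add: y_def nabsD[OF assms(2)] one_less_inverse)
  qed (simp add: y_def)
  obtain c :: "nat \<Rightarrow> int" where c: "\<exists>i\<le>d. c i \<noteq> 0" "(\<Sum>i\<le>d. of_int (c i) * y ^ i) = 0" using d by blast
  obtain i where i: "c i \<noteq> 0" "\<phi> (of_int (c i)) < 1" using nabs_algebraic[OF assms(2) c y] by blast
  have "\<phi> (of_nat (nat \<bar>c i\<bar>)) = \<phi> (of_int (c i))"
    using nabsD(7)[OF assms(2), of "of_int (c i)"] by (simp add: abs_if)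
  then show ?thesis using nabs_prime_divisor[OF assms(2), of "nat \<bar>c i\<bar>"] i by auto
qed

text \<open>A family of integral elements that is independent over the prime field modulo
  \<open>p\<close> has at most \<open>d\<close> members, since \<open>d + 1\<close> elements satisfy
  a primitive integral relation. For a family of maximal size, combinations with coefficients below
  \<open>p\<close> represent all classes.\<close>

lemma finite_mod_p:
  assumes nf: "number_field TYPE('k)" and \<phi>: "nabs (\<phi> :: 'k::field_char_0 \<Rightarrow> real)"
    and p: "Factorial_Ring.prime p" "\<phi> (of_nat p) < 1"
  shows "fin {x. \<phi> x \<le> 1} {x. \<phi> x \<le> \<phi> (of_nat p)}"
proof -
  let ?R = "{x. \<phi> x \<le> 1}" and ?p = "of_nat p :: 'k"
  let ?pR = "{x. \<phi> x \<le> \<phi> ?p}"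
  note D = nabsD[OF \<phi>]
  have pR: "sgp ?pR" unfolding sgp_def using D(1,5)
    by (auto simp: D(7) intro!: order.trans[OF D(4)[of _ "- y" for y, simplified]])
  obtain d where d: "\<And>x::nat \<Rightarrow> 'k. \<exists>c::nat \<Rightarrow> int. (\<exists>i\<le>d. c i \<noteq> 0) \<and> (\<Sum>i\<le>d. of_int (c i) * x i) = 0"
    using number_field_dependence[OF nf] by blast
  define indep where "indep r x \<longleftrightarrow> (\<forall>i<r. \<phi> (x i) \<le> 1) \<and>
     (\<forall>c::nat \<Rightarrow> int. (\<Sum>i<r. of_int (c i) * x i) \<in> ?pR \<longrightarrow> (\<forall>i<r. int p dvd c i))" for r and x :: "nat \<Rightarrow> 'k"
  have bound: "r \<le> d" if "indep r x" for r x
  proof (rule ccontr)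
    assume "\<not> r \<le> d"
    then have dr: "d < r" by simp
    obtain c where c: "\<exists>i\<le>d. \<not> int p dvd c i" "(\<Sum>i\<le>d. of_int (c i) * x i) = 0"
      using d[of x] primitive_dependence[OF p(1)] by blast
    define c' where "c' i = (if i \<le> d then c i else 0)" for i
    have "(\<Sum>i<r. of_int (c' i) * x i) = (\<Sum>i\<le>d. of_int (c i) * x i)"
      using dr by (intro sum.mono_neutral_cong_right) (auto simp: c'_def)
    then have "(\<Sum>i<r. of_int (c' i) * x i) \<in> ?pR" using c(2) D(1,5) by simp
    then have "\<forall>i<r. int p dvd c' i" using that unfolding indep_def by blast
    then show False using c(1) dr by (auto simp: c'_def dest!: spec split: if_splits)
  qed
  define P where "P r \<longleftrightarrow> (\<exists>x. indep r x)" for r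
  have "P 0" by (auto simp: P_def indep_def)
  moreover have "\<And>r. P r \<Longrightarrow> r \<le> d" using bound unfolding P_def by blast
  ultimately obtain r where r: "P r" "\<And>s. P s \<Longrightarrow> s \<le> r"
    using GreatestI_nat[of P 0 d] Greatest_le_nat[of P _ d] by metis
  obtain x where x: "indep r x" using r(1) unfolding P_def by blast
  have xR: "\<phi> (x i) \<le> 1" if "i < r" for i using x that unfolding indep_def by blast
  let ?F = "(\<lambda>a. \<Sum>i<r. of_nat (a i) * x i) ` (PiE {..<r} (\<lambda>_. {..<p}))"
  have cover: "\<exists>z\<in>?F. y - z \<in> ?pR" if y: "\<phi> y \<le> 1" for y
  proof -
    have "\<not> indep (Suc r) (x(r := y))" using r(2)[of "Suc r"] unfolding P_def by auto
    moreover have "\<forall>i<Suc r. \<phi> ((x(r := y)) i) \<le> 1" using xR y by (auto simp: less_Suc_eq)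
    ultimately obtain c where c: "(\<Sum>i<Suc r. of_int (c i) * (x(r := y)) i) \<in> ?pR"
      "\<not> (\<forall>i<Suc r. int p dvd c i)" unfolding indep_def by blast
    have c': "(\<Sum>i<r. of_int (c i) * x i) + of_int (c r) * y \<in> ?pR" using c(1) by simp
    have small: "of_int m * z \<in> ?pR" if "int p dvd m" "\<phi> z \<le> 1" for m z
    proof -
      note z = that(2)
      obtain k where "m = int p * k" using \<open>int p dvd m\<close> by blast
      moreover have "\<phi> (of_int k) * \<phi> z \<le> 1" using nabs_of_int[OF \<phi>, of k] z by (intro mult_le_one D(1))
      ultimately show ?thesis using D(1)[of ?p] by (simp add: D(3) mult.assoc mult_left_le)
    qed
    have nd: "\<not> int p dvd c r"
    proof
      assume dv: "int p dvd c r"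
      have "(\<Sum>i<r. of_int (c i) * x i) + of_int (c r) * y - of_int (c r) * y \<in> ?pR"
        by (rule sgp_diff[OF pR c' small[OF dv y]])
      then have "\<forall>i<r. int p dvd c i" using x unfolding indep_def by simp
      then show False using c(2) dv by (auto simp: less_Suc_eq)
    qed
    then have "coprime (c r) (int p)" using p(1) by (metis coprime_commute prime_imp_coprime prime_nat_int_transfer)
    \<comment> \<open>Inverting the coefficient of \<open>y\<close> modulo \<open>p\<close>
      expresses \<open>y\<close> through the family.\<close>
    then obtain u v where uv: "u * c r + v * int p = 1" using bezout_int[of "c r" "int p"] by auto
    define a where "a i = (if i < r then nat ((- u * c i) mod int p) else undefined)" for i
    have ppos: "0 < int p" using prime_gt_0_nat[OF p(1)] by simp
    have a: "a \<in> PiE {..<r} (\<lambda>_. {..<p})"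
    proof (rule PiE_I)
      show "a i \<in> {..<p}" if "i \<in> {..<r}" for i using ppos that by (simp add: a_def nat_less_iff)
      show "a i = undefined" if "i \<notin> {..<r}" for i using that by (simp add: a_def)
    qed
    have ai: "int p dvd u * c i + int (a i)" if "i < r" for i
    proof -
      have "int (a i) = (- u * c i) mod int p" using that ppos by (simp add: a_def)
      then have "(u * c i + int (a i)) mod int p = (u * c i + - u * c i) mod int p"
        by (simp only: mod_add_right_eq)
      then show ?thesis by (simp add: dvd_eq_mod_eq_0)
    qed
    have ua: "of_int u * ((\<Sum>i<r. of_int (c i) * x i) + of_int (c r) * y) \<in> ?pR"
      using c' nabs_of_int[OF \<phi>, of u] D(1)
      by (simp add: D(3)) (meson mult_left_le_one_le order.trans)
    have s1: "(\<Sum>i<r. of_int (u * c i + int (a i)) * x i) \<in> ?pR"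
      using small[OF ai xR] D(1) by (auto intro!: nabs_sum_le[OF \<phi>])
    have s2: "of_int (v * int p) * y \<in> ?pR" by (rule small[OF _ y]) simp
    have "y - (\<Sum>i<r. of_nat (a i) * x i) =
        of_int u * ((\<Sum>i<r. of_int (c i) * x i) + of_int (c r) * y) + of_int (v * int p) * y
        - (\<Sum>i<r. of_int (u * c i + int (a i)) * x i)"
    proof -
      have "y = of_int (u * c r + v * int p) * y" unfolding uv by simp
      then have "y = of_int u * (of_int (c r) * y) + of_int (v * int p) * y"
        by (simp only: of_int_add of_int_mult distrib_right mult.assoc)
      moreover have "(\<Sum>i<r. of_int (u * c i + int (a i)) * x i) =
          of_int u * (\<Sum>i<r. of_int (c i) * x i) + (\<Sum>i<r. of_nat (a i) * x i)"
        by (simp add: distrib_right sum.distrib sum_distrib_left mult.assoc)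
      ultimately show ?thesis by (simp add: distrib_left)
    qed
    also have "\<dots> \<in> ?pR" by (intro sgp_diff[OF pR] sgp_add[OF pR] ua s1 s2)
    finally show ?thesis using a by blast
  qed
  have "quo ?R ?pR \<subseteq> coset ?pR ` ?F"
  proof
    fix C assume "C \<in> quo ?R ?pR"
    then obtain y where y: "\<phi> y \<le> 1" "C = coset ?pR y" by (auto simp: quo_def)
    obtain z where "z \<in> ?F" "y - z \<in> ?pR" using cover[OF y(1)] by blast
    then show "C \<in> coset ?pR ` ?F" using y(2) coset_eq_iff[OF pR] by blast
  qed
  moreover have "finite (coset ?pR ` ?F)" by (intro finite_imageI finite_PiE) auto
  ultimately show ?thesis unfolding fin_def by (rule finite_subset)
qed

text \<open>An absolute value strictly between that of \<open>p\<close> and 1 depends only on the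
  class modulo \<open>p\<close>. So there are finitely many, and the largest one below 1 is attained
  by a uniformizer.\<close>

lemma nabs_dvr:
  assumes nf: "number_field TYPE('k)" and \<phi>: "nabs (\<phi> :: 'k::field_char_0 \<Rightarrow> real)"
  shows "\<exists>t. dvr_abs \<phi> t"
proof -
  note D = nabsD[OF \<phi>]
  obtain p where p: "Factorial_Ring.prime p" "\<phi> (of_nat p) < 1" using nabs_residue_prime[OF nf \<phi>] by blast
  let ?R = "{x. \<phi> x \<le> 1}" and ?p = "of_nat p :: 'k"
  let ?pR = "{x. \<phi> x \<le> \<phi> ?p}"
  have diff: "\<phi> (x - y) \<le> max (\<phi> x) (\<phi> y)" for x y using D(4)[of x "- y"] D(7)[of y] by simp
  have p0: "?p \<noteq> 0" using p(1) by auto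
  have fin: "fin ?R ?pR" by (rule finite_mod_p[OF nf \<phi> p])
  have sg: "sgp ?pR" "sgp {x. \<phi> x < 1}" "sgp ?R"
    using D(1,5) by (auto simp: sgp_def intro: order.trans[OF diff] le_less_trans[OF diff])
  let ?V = "\<phi> ` {x. \<phi> ?p \<le> \<phi> x \<and> \<phi> x < 1}"
  have "\<phi> ` {x. \<phi> ?p < \<phi> x \<and> \<phi> x < 1} \<subseteq> (\<lambda>C. \<phi> (SOME x. x \<in> C)) ` quo ?R ?pR"
  proof
    fix r assume "r \<in> \<phi> ` {x. \<phi> ?p < \<phi> x \<and> \<phi> x < 1}"
    then obtain x where x: "r = \<phi> x" "\<phi> ?p < \<phi> x" "\<phi> x < 1" by blast
    define y where "y = (SOME y. y \<in> coset ?pR x)"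
    have "x \<in> coset ?pR x" using D(1,5) by (simp add: coset_def)
    then have "y \<in> coset ?pR x" unfolding y_def by (rule someI)
    then have "\<phi> (y - x) < \<phi> x" using x(2) by (simp add: coset_def)
    then have "\<phi> (x + (y - x)) = \<phi> x" by (rule D(11))
    then have "\<phi> y = r" using x by simp
    moreover have "coset ?pR x \<in> quo ?R ?pR" using x by (simp add: quo_def)
    ultimately show "r \<in> (\<lambda>C. \<phi> (SOME x. x \<in> C)) ` quo ?R ?pR" unfolding y_def by blast
  qed
  then have "finite (\<phi> ` {x. \<phi> ?p < \<phi> x \<and> \<phi> x < 1})"
    using fin unfolding fin_def by (meson finite_imageI finite_subset)
  moreover have "?V \<subseteq> insert (\<phi> ?p) (\<phi> ` {x. \<phi> ?p < \<phi> x \<and> \<phi> x < 1})" by (auto simp: image_iff le_less)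
  ultimately have finV: "finite ?V" by (meson finite.insertI finite_subset)
  have "\<phi> ?p \<in> ?V" using p(2) by blast
  then have "Max ?V \<in> ?V" using finV by (intro Max_in) auto
  then obtain t where t: "Max ?V = \<phi> t" "\<phi> ?p \<le> \<phi> t" "\<phi> t < 1" by auto
  have disc: "\<phi> x \<le> \<phi> t" if "\<phi> x < 1" for x
  proof (cases "\<phi> ?p \<le> \<phi> x")
    case True
    then have "\<phi> x \<in> ?V" using that by blast
    then show ?thesis using Max_ge[OF finV] t(1) by metis
  qed (use t in linarith)
  have "fin ?R {x. \<phi> x < 1}"
    using fin_mono(1)[OF sg(1,2,3) _ _ fin] p(2) by fastforce
  moreover have "t \<noteq> 0" using t(2) p0 D(1,2,5) by (metis order_antisym)
  ultimately show ?thesis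
    using t(3) disc D(1-4) by (intro exI[of _ t]) (unfold_locales; simp)
qed

subsection \<open>Places and weak approximation\<close>

lemma equiv_abs_equiv: "equiv (nonarch_abs R) (abs_equiv R)"
proof (rule equivI)
  have nn: "0 \<le> \<phi> x" if "\<phi> \<in> nonarch_abs R" "x \<in> carrier R" for \<phi> x
    using that by (simp add: nonarch_abs_def)
  show "abs_equiv R \<subseteq> nonarch_abs R \<times> nonarch_abs R" by (auto simp: abs_equiv_def)
  show "refl_on (nonarch_abs R) (abs_equiv R)"
    by (rule refl_onI) (auto simp: abs_equiv_def nn intro!: exI[of _ 1])
  show "sym (abs_equiv R)"
  proof (rule symI)
    fix \<phi> \<psi> assume "(\<phi>, \<psi>) \<in> abs_equiv R"
    then obtain c where c: "\<phi> \<in> nonarch_abs R" "\<psi> \<in> nonarch_abs R" "c > 0" "\<And>x. x \<in> carrier R \<Longrightarrow> \<psi> x = \<phi> x powr c"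
      by (auto simp: abs_equiv_def)
    then have "\<phi> x = \<psi> x powr (1 / c)" if "x \<in> carrier R" for x
      using nn[OF c(1) that] that by (simp add: powr_powr)
    then show "(\<psi>, \<phi>) \<in> abs_equiv R" using c by (auto simp: abs_equiv_def intro!: exI[of _ "1 / c"])
  qed
  show "trans (abs_equiv R)"
  proof (rule transI)
    fix \<phi> \<psi> \<theta> assume "(\<phi>, \<psi>) \<in> abs_equiv R" "(\<psi>, \<theta>) \<in> abs_equiv R"
    then obtain c d where "\<phi> \<in> nonarch_abs R" "\<theta> \<in> nonarch_abs R" "c > 0" "d > 0"
      "\<And>x. x \<in> carrier R \<Longrightarrow> \<psi> x = \<phi> x powr c" "\<And>x. x \<in> carrier R \<Longrightarrow> \<theta> x = \<psi> x powr d"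
      by (auto simp: abs_equiv_def)
    then show "(\<phi>, \<theta>) \<in> abs_equiv R"
      by (auto simp: abs_equiv_def powr_powr intro!: exI[of _ "c * d"])
  qed
qed

lemma placesD:
  assumes "v \<in> places R"
  shows "\<exists>\<phi>. \<phi> \<in> v" "\<phi> \<in> v \<Longrightarrow> \<phi> \<in> nonarch_abs R" "\<phi> \<in> v \<Longrightarrow> \<psi> \<in> v \<longleftrightarrow> (\<phi>, \<psi>) \<in> abs_equiv R"
proof -
  note E = equiv_abs_equiv[of R] and v = assms[unfolded places_def]
  show "\<exists>\<phi>. \<phi> \<in> v" using in_quotient_imp_non_empty[OF E v] by blast
  show "\<phi> \<in> v \<Longrightarrow> \<phi> \<in> nonarch_abs R" using in_quotient_imp_subset[OF E v] by blast
  show "\<phi> \<in> v \<Longrightarrow> \<psi> \<in> v \<longleftrightarrow> (\<phi>, \<psi>) \<in> abs_equiv R"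
    using in_quotient_imp_in_rel[OF E v] in_quotient_imp_closed[OF E v] by blast
qed

lemma place_eqI:
  assumes "v \<in> places R" "w \<in> places R" "\<phi> \<in> v" "\<psi> \<in> w" "(\<phi>, \<psi>) \<in> abs_equiv R"
  shows "v = w"
  using quotient_eqI[OF equiv_abs_equiv assms(1,2)[unfolded places_def] assms(3-5)] .

text \<open>Units for \<open>\<phi>\<close> are units for \<open>\<psi>\<close>: if
  \<open>\<psi> u\<close> exceeded 1, then \<open>u^n t\<close> would be small for
  \<open>\<phi>\<close> and large for \<open>\<psi>\<close>; inverting \<open>u\<close> excludes the
  other case. By discreteness both absolute values are then determined by their values at
  \<open>t\<close>.\<close>

lemma nabs_equivI:
  assumes nf: "number_field TYPE('k)" and \<phi>: "nabs (\<phi> :: 'k::field_char_0 \<Rightarrow> real)" and \<psi>: "nabs \<psi>"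
    and imp: "\<And>x. \<phi> x < 1 \<Longrightarrow> \<psi> x < 1"
  shows "\<exists>c>0. \<forall>x. \<psi> x = \<phi> x powr c"
proof -
  obtain t where "dvr_abs \<phi> t" using nabs_dvr[OF nf \<phi>] by blast
  then interpret dvr_abs \<phi> t .
  note D = nabsD[OF \<phi>] and E = nabsD[OF \<psi>]
  have unit_le: "\<psi> u \<le> 1" if "\<phi> u = 1" for u
  proof (rule ccontr)
    assume "\<not> \<psi> u \<le> 1"
    then have gt: "1 < \<psi> u" by simp
    have t0: "0 < \<psi> t" using E(1,2)[of t] t_nz by linarith
    obtain n where "1 / \<psi> t < \<psi> u ^ n" using real_arch_pow[OF gt] by blast
    then have "1 < \<psi> (u ^ n * t)" using t0 by (simp add: E(3,8) pos_divide_less_eq)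
    moreover have "\<phi> (u ^ n * t) < 1" using that t_less by (simp add: D(3,8))
    ultimately show False using imp by fastforce
  qed
  have unit: "\<psi> u = 1" if "\<phi> u = 1" for u
  proof -
    have "\<psi> (inverse u) \<le> 1" using that by (intro unit_le) (simp add: D(9))
    moreover have "0 < \<psi> u" using that E(1,2)[of u] D(5) by (metis less_eq_real_def zero_neq_one)
    ultimately have "1 \<le> \<psi> u" by (simp add: E(9) inverse_le_1_iff)
    then show ?thesis using unit_le[OF that] by simp
  qed
  have tpsi: "0 < \<psi> t" "\<psi> t < 1" using imp[OF t_less] E(1,2)[of t] t_nz by linarith+
  define c where "c = ln (\<psi> t) / ln (\<phi> t)"
  have lnneg: "ln (\<phi> t) < 0" "ln (\<psi> t) < 0" using t_pos t_less tpsi by simp_all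
  then have c0: "0 < c" unfolding c_def by (rule divide_neg_neg[rotated])
  have ct: "\<psi> t = \<phi> t powr c" using lnneg tpsi t_pos by (simp add: c_def powr_def)
  have small: "\<psi> x = \<phi> x powr c" if "\<phi> x \<le> 1" for x
  proof (cases "x = 0")
    case False
    have "\<exists>k. \<phi> t ^ k < \<phi> x"
      using real_arch_pow_inv[of "\<phi> x" "\<phi> t"] t_less D(1,2)[of x] False by fastforce
    define k where "k = (LEAST k. \<phi> t ^ k < \<phi> x)"
    have k: "\<phi> t ^ k < \<phi> x" unfolding k_def using \<open>\<exists>k. \<phi> t ^ k < \<phi> x\<close> by (rule LeastI_ex)
    then have "k \<noteq> 0" using that by (intro notI) simp
    then obtain j where j: "k = Suc j" using not0_implies_Suc by blast
    have "\<not> \<phi> t ^ j < \<phi> x" using not_less_Least[of j "\<lambda>k. \<phi> t ^ k < \<phi> x"] j unfolding k_def by simp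
    then have le: "\<phi> (x / t ^ j) \<le> 1" using t_pos by (simp add: abs_divide abs_power)
    have "\<phi> t < \<phi> (x / t ^ j)" using k t_pos by (simp add: j abs_divide abs_power pos_less_divide_eq)
    then have "\<phi> (x / t ^ j) = 1" using le discrete[of "x / t ^ j"] by fastforce
    then have "\<psi> (x / t ^ j) = 1" by (rule unit)
    moreover have eq: "\<phi> x = \<phi> t ^ j" using \<open>\<phi> (x / t ^ j) = 1\<close> t_pos by (auto simp: D(8,10))
    ultimately have "\<psi> x = \<psi> t ^ j" using tpsi by (auto simp: E(8,10))
    also have "\<dots> = \<phi> x powr c" unfolding eq ct using t_pos
      by (simp add: powr_powr flip: powr_realpow) (simp add: mult.commute)
    finally show ?thesis .
  qed (simp add: D(5) E(5))
  have "\<psi> x = \<phi> x powr c" for x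
  proof (cases "\<phi> x \<le> 1")
    case False
    then have "\<phi> (inverse x) \<le> 1" by (simp add: D(9) inverse_le_1_iff)
    then have "inverse (\<psi> x) = inverse (\<phi> x) powr c" using small[of "inverse x"] by (simp add: D(9) E(9))
    also have "\<dots> = inverse (\<phi> x powr c)" using D(1)[of x] by (simp add: inverse_powr)
    finally show ?thesis by simp
  qed (rule small)
  then show ?thesis using c0 by blast
qed

text \<open>Induction on the set of places where \<open>z\<close> is to be small, with
  \<open>w\<close> separating \<open>a\<close> from the new index \<open>b\<close>. If
  \<open>z\<close> is not large at \<open>b\<close>, the product of \<open>w\<close> with a high
  power \<open>z^m\<close> works. Otherwise \<open>z^m\<close> is replaced by
  \<open>z^m / (1 + z^m)\<close>, which has value 1 where \<open>z\<close> is large and stays small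
  where \<open>z\<close> is small.\<close>

lemma weak_approximation:
  assumes nf: "number_field TYPE('k)" and "finite A"
    and \<phi>: "\<And>i. i \<in> insert a A \<Longrightarrow> nabs (\<phi> i :: 'k::field_char_0 \<Rightarrow> real)"
    and ineq: "\<And>i. i \<in> A \<Longrightarrow> \<not> (\<exists>c>0. \<forall>x. \<phi> i x = \<phi> a x powr c) \<and> \<not> (\<exists>c>0. \<forall>x. \<phi> a x = \<phi> i x powr c)"
  shows "\<exists>z. 1 < \<phi> a z \<and> (\<forall>i\<in>A. \<phi> i z < 1)"
  using assms(2-)
proof (induction A)
  case empty
  obtain x where x: "x \<noteq> 0" "\<phi> a x \<noteq> 1" using empty.prems(1)[of a] unfolding nabs_def by auto
  note D = nabsD[OF empty.prems(1)[of a, simplified]]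
  show ?case
  proof (cases "1 < \<phi> a x")
    case False
    then have "0 < \<phi> a x" "\<phi> a x < 1" using x D(1,2)[of x] by linarith+
    then have "1 < \<phi> a (inverse x)" by (simp add: D(9) one_less_inverse)
    then show ?thesis by blast
  qed blast
next
  case (insert b A)
  have na: "nabs (\<phi> i)" if "i \<in> insert a (insert b A)" for i using insert.prems(1) that by blast
  note D = nabsD[OF na]
  obtain z where z: "1 < \<phi> a z" "\<forall>i\<in>A. \<phi> i z < 1" using insert.IH insert.prems by auto
  have "\<exists>w. 1 < \<phi> a w \<and> \<phi> b w < 1"
  proof -
    have "\<not> (\<forall>x. \<phi> a x < 1 \<longrightarrow> \<phi> b x < 1)" "\<not> (\<forall>x. \<phi> b x < 1 \<longrightarrow> \<phi> a x < 1)"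
      using nabs_equivI[OF nf na na, of a b] nabs_equivI[OF nf na na, of b a] insert.prems(2)[of b] by blast+
    then obtain x y where xy: "\<phi> a x < 1" "1 \<le> \<phi> b x" "\<phi> b y < 1" "1 \<le> \<phi> a y" by (auto simp: not_less)
    have "x \<noteq> 0" using xy(2) D(5)[of b] by auto
    then have "0 < \<phi> a x" using D(1,2)[of a x] by (simp add: less_le)
    then have "1 < \<phi> a (y / x)" using xy D(10)[of a y x] by (simp add: less_divide_eq)
    moreover have "\<phi> b (y / x) < 1" using xy D(10)[of b y x] by (simp add: divide_less_eq)
    ultimately show ?thesis by blast
  qed
  then obtain w where w: "1 < \<phi> a w" "\<phi> b w < 1" by blast
  have small: "eventually (\<lambda>m. \<phi> i z ^ m * \<phi> i w < 1) sequentially" if "i \<in> A" for i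
  proof -
    have "(\<lambda>m. \<phi> i z ^ m * \<phi> i w) \<longlonglongrightarrow> 0 * \<phi> i w"
      using z(2) that D(1)[of i z] by (intro tendsto_mult LIMSEQ_power_zero tendsto_const) auto
    then show ?thesis using order_tendstoD(2)[of "\<lambda>m. \<phi> i z ^ m * \<phi> i w" 0 sequentially 1] by simp
  qed
  have "eventually (\<lambda>m. \<forall>i\<in>A. \<phi> i z ^ m * \<phi> i w < 1) sequentially"
    using small insert.hyps(1) by (simp add: eventually_ball_finite)
  then have "eventually (\<lambda>m. (\<forall>i\<in>A. \<phi> i z ^ m * \<phi> i w < 1) \<and> 1 \<le> m) sequentially"
    using eventually_ge_at_top[of 1] by (rule eventually_conj)
  then obtain m where m: "\<And>i. i \<in> A \<Longrightarrow> \<phi> i z ^ m * \<phi> i w < 1" "1 \<le> m"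
    by (auto simp: eventually_sequentially)
  show ?case
  proof (cases "\<phi> b z \<le> 1")
    case True
    have "1 * 1 < \<phi> a z ^ m * \<phi> a w" using z(1) w(1) m(2) one_le_power[of "\<phi> a z" m]
      by (intro mult_le_less_imp_less) auto
    moreover have "\<phi> b z ^ m * \<phi> b w < 1"
      using True w(2) D(1)[of b z] D(1)[of b w] power_le_one[of "\<phi> b z" m]
      by (intro le_less_trans[OF mult_left_le_one_le]) auto
    ultimately show ?thesis using m(1) by (intro exI[of _ "z ^ m * w"]) (auto simp: D(3,8))
  next
    case False
    define u where "u = z ^ m / (1 + z ^ m)"
    have big: "\<phi> i u = 1" if "i \<in> insert a (insert b A)" "1 < \<phi> i z" for i
    proof -
      have gt: "1 < \<phi> i (z ^ m)" using that m(2) by (simp add: D(8) one_less_power)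
      then have "\<phi> i (z ^ m + 1) = \<phi> i (z ^ m)" using that by (intro D(11)) (simp_all add: D(6))
      then show ?thesis using gt that by (simp add: u_def D(10) add.commute)
    qed
    have sm: "\<phi> i u = \<phi> i z ^ m" if "i \<in> A" for i
    proof -
      have "\<phi> i (z ^ m) < 1" using z(2) m(2) that D(1)[of i z] by (simp add: D(8) power_less_one_iff)
      then have "\<phi> i (1 + z ^ m) = \<phi> i 1" using that by (intro D(11)) (simp_all add: D(6))
      then show ?thesis using that by (simp add: u_def D(6,8,10))
    qed
    have "\<phi> a (u * w) = \<phi> a w" "\<phi> b (u * w) = \<phi> b w" using big z(1) False by (simp_all add: D(3))
    moreover have "\<phi> i (u * w) < 1" if "i \<in> A" for i using m(1)[OF that] that by (simp add: D(3) sm)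
    ultimately show ?thesis using w by (intro exI[of _ "u * w"]) auto
  qed
qed

text \<open>For \<open>d + 1\<close> places above \<open>p\<close>, take elements each of which is
  large at its own place and small at the others. In a primitive integral relation between them some
  coefficient is prime to \<open>p\<close>, and at the place of that coefficient its term
  dominates.\<close>

lemma finite_places_over_prime:
  assumes nf: "number_field TYPE('k::field_char_0)" and p: "Factorial_Ring.prime p"
  shows "finite {v \<in> places (base_field :: 'k ring). \<exists>\<phi>\<in>v. \<phi> (of_nat p) < 1}"
proof (rule ccontr)
  let ?V = "{v \<in> places (base_field :: 'k ring). \<exists>\<phi>\<in>v. \<phi> (of_nat p) < 1}"
  assume "infinite ?V"
  obtain d where d: "\<And>x::nat \<Rightarrow> 'k. \<exists>c::nat \<Rightarrow> int. (\<exists>i\<le>d. c i \<noteq> 0) \<and> (\<Sum>i\<le>d. of_int (c i) * x i) = 0"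
    using number_field_dependence[OF nf] by blast
  obtain W where W: "finite W" "card W = Suc d" "W \<subseteq> ?V"
    using infinite_arbitrarily_large[OF \<open>infinite ?V\<close>] by blast
  obtain v where v: "bij_betw v {..d} W"
    using ex_bij_betw_nat_finite[OF W(1)] W(2) by (metis atLeast0LessThan lessThan_Suc_atMost)
  have vW: "v i \<in> ?V" if "i \<le> d" for i using bij_betwE[OF v] W(3) that by auto
  define \<phi> where "\<phi> i = (SOME \<phi>. \<phi> \<in> v i \<and> \<phi> (of_nat p) < 1)" for i
  have \<phi>: "\<phi> i \<in> v i \<and> \<phi> i (of_nat p) < 1" if "i \<le> d" for i
    using someI_ex[of "\<lambda>\<phi>. \<phi> \<in> v i \<and> \<phi> (of_nat p) < 1"] vW[OF that] unfolding \<phi>_def by blast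
  have na: "nabs (\<phi> i)" if "i \<le> d" for i
    using placesD(2)[of "v i" base_field "\<phi> i"] vW[OF that] \<phi>[OF that] nonarch_abs_base by blast
  have ineq: "\<not> (\<exists>c>0. \<forall>x. \<phi> j x = \<phi> i x powr c)" if "i \<le> d" "j \<le> d" "i \<noteq> j" for i j
  proof
    assume "\<exists>c>0. \<forall>x. \<phi> j x = \<phi> i x powr c"
    then have "(\<phi> i, \<phi> j) \<in> abs_equiv base_field"
      using na that nonarch_abs_base by (auto simp: abs_equiv_def)
    then have "v i = v j" using place_eqI[of "v i" base_field "v j"] vW \<phi> that by blast
    then show False using bij_betw_imp_inj_on[OF v] that by (auto simp: inj_on_def)
  qed
  have "\<exists>z. 1 < \<phi> i z \<and> (\<forall>j\<in>{..d} - {i}. \<phi> j z < 1)" if i: "i \<le> d" for i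
    by (rule weak_approximation[OF nf]) (use na ineq i in auto)
  then obtain z where z: "\<And>i. i \<le> d \<Longrightarrow> 1 < \<phi> i (z i)" "\<And>i j. i \<le> d \<Longrightarrow> j \<le> d \<Longrightarrow> j \<noteq> i \<Longrightarrow> \<phi> j (z i) < 1"
    by (metis atMost_iff DiffI singletonD)
  obtain c where c: "\<exists>i\<le>d. \<not> int p dvd c i" "(\<Sum>i\<le>d. of_int (c i) * z i) = 0"
    using d[of z] primitive_dependence[OF p] by blast
  then obtain j where j: "j \<le> d" "\<not> int p dvd c j" by blast
  note D = nabsD[OF na[OF j(1)]]
  have "(\<Sum>i\<le>d. of_int (c i) * z i) = of_int (c j) * z j + (\<Sum>i\<in>{..d} - {j}. of_int (c i) * z i)"
    using j by (intro sum.remove) auto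
  moreover have "\<phi> j (\<Sum>i\<in>{..d} - {j}. of_int (c i) * z i) < 1"
  proof (rule nabs_sum_less[OF na[OF j(1)]])
    fix i assume "i \<in> {..d} - {j}"
    then have "\<phi> j (z i) < 1" using z(2)[of i j] j by auto
    then show "\<phi> j (of_int (c i) * z i) < 1"
      using nabs_of_int[OF na[OF j(1)], of "c i"] D(1) by (simp add: D(3)) (meson le_less_trans mult_left_le_one_le)
  qed simp
  moreover have "\<phi> j (of_int (c j) * z j) = \<phi> j (z j)"
    using nabs_prime_coprime[OF na[OF j(1)] p _ j(2)] \<phi>[OF j(1)] by (simp add: D(3))
  ultimately have "\<phi> j (\<Sum>i\<le>d. of_int (c i) * z i) = \<phi> j (z j)"
    using D(11) z(1)[OF j(1)] by fastforce
  then show False using c(2) z(1)[OF j(1)] by (simp add: D(5))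
qed

text \<open>The powers of \<open>x\<close> satisfy an integral relation. Wherever \<open>x\<close>
  is not integral, some non-zero coefficient is a non-unit, so the place lies above one of finitely
  many primes.\<close>

lemma finite_places_large:
  assumes nf: "number_field TYPE('k::field_char_0)"
  shows "finite {v \<in> places (base_field :: 'k ring). \<exists>\<phi>\<in>v. 1 < \<phi> x}"
proof -
  obtain d where d: "\<And>x::nat \<Rightarrow> 'k. \<exists>c::nat \<Rightarrow> int. (\<exists>i\<le>d. c i \<noteq> 0) \<and> (\<Sum>i\<le>d. of_int (c i) * x i) = 0"
    using number_field_dependence[OF nf] by blast
  obtain c :: "nat \<Rightarrow> int" where c: "\<exists>i\<le>d. c i \<noteq> 0" "(\<Sum>i\<le>d. of_int (c i) * x ^ i) = 0" using d by blast
  let ?P = "\<Union>i\<in>{i. i \<le> d \<and> c i \<noteq> 0}. {p. Factorial_Ring.prime p \<and> p dvd nat \<bar>c i\<bar>}"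
  let ?V = "\<lambda>p. {v \<in> places (base_field :: 'k ring). \<exists>\<phi>\<in>v. \<phi> (of_nat p) < 1}"
  have "{v \<in> places (base_field :: 'k ring). \<exists>\<phi>\<in>v. 1 < \<phi> x} \<subseteq> (\<Union>p\<in>?P. ?V p)"
  proof
    fix v assume "v \<in> {v \<in> places (base_field :: 'k ring). \<exists>\<phi>\<in>v. 1 < \<phi> x}"
    then obtain \<phi> where v: "v \<in> places base_field" "\<phi> \<in> v" "1 < \<phi> x" by blast
    have \<phi>: "nabs \<phi>" using placesD(2)[OF v(1,2)] nonarch_abs_base by blast
    obtain i where i: "i \<le> d" "c i \<noteq> 0" "\<phi> (of_int (c i)) < 1" using nabs_algebraic[OF \<phi> c v(3)] by blast
    have "\<phi> (of_nat (nat \<bar>c i\<bar>)) = \<phi> (of_int (c i))"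
      using nabsD(7)[OF \<phi>, of "of_int (c i)"] by (simp add: abs_if)
    then obtain p where "Factorial_Ring.prime p" "p dvd nat \<bar>c i\<bar>" "\<phi> (of_nat p) < 1"
      using nabs_prime_divisor[OF \<phi>, of "nat \<bar>c i\<bar>"] i by auto
    then show "v \<in> (\<Union>p\<in>?P. ?V p)" using v i by blast
  qed
  moreover have "finite (\<Union>p\<in>?P. ?V p)"
  proof (rule finite_UN_I)
    show "finite ?P"
    proof (rule finite_UN_I)
      fix i assume "i \<in> {i. i \<le> d \<and> c i \<noteq> 0}"
      then have "nat \<bar>c i\<bar> \<noteq> 0" by simp
      then have "finite {p. p dvd nat \<bar>c i\<bar>}" by (intro finite_divisors_nat) simp
      then show "finite {p. Factorial_Ring.prime p \<and> p dvd nat \<bar>c i\<bar>}" by (rule rev_finite_subset) auto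
    qed simp
    show "finite (?V p)" if "p \<in> ?P" for p using that finite_places_over_prime[OF nf] by blast
  qed
  ultimately show ?thesis by (rule finite_subset)
qed

section \<open>Completions and residue fields\<close>

lemma (in ring) minus_eqI:
  assumes "a \<in> carrier R" "b \<in> carrier R" "a \<oplus> b = c" shows "c \<ominus> b = a"
  using assms by (auto simp: minus_eq a_assoc r_neg)

text \<open>One representative of the place is fixed. Conditions quantified over all representatives
  reduce to it, because the others are its positive powers.\<close>

locale valued = field R for R (structure) +
  fixes v :: "('a \<Rightarrow> real) set" and \<phi> :: "'a \<Rightarrow> real"
  assumes v_place: "v \<in> places R" and phi_v: "\<phi> \<in> v"
begin

lemma phi_nonarch: "\<phi> \<in> nonarch_abs R"
  by (rule placesD(2)[OF v_place phi_v])

lemma v_iff: "\<psi> \<in> v \<longleftrightarrow> \<psi> \<in> nonarch_abs R \<and> (\<exists>c>0. \<forall>x\<in>carrier R. \<psi> x = \<phi> x powr c)"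
  using placesD(3)[OF v_place phi_v, of \<psi>] phi_nonarch by (auto simp: abs_equiv_def)

lemma v_powr: assumes "\<psi> \<in> v" obtains c where "c > 0" "\<And>x. x \<in> carrier R \<Longrightarrow> \<psi> x = \<phi> x powr c"
  using assms v_iff by blast

section \<open>Arithmetic of a representative\<close>

lemma phi_nonneg: "x \<in> carrier R \<Longrightarrow> 0 \<le> \<phi> x"
  and phi_eq_0: "x \<in> carrier R \<Longrightarrow> \<phi> x = 0 \<longleftrightarrow> x = \<zero>"
  and phi_mult: "x \<in> carrier R \<Longrightarrow> y \<in> carrier R \<Longrightarrow> \<phi> (x \<otimes> y) = \<phi> x * \<phi> y"
  and phi_add: "x \<in> carrier R \<Longrightarrow> y \<in> carrier R \<Longrightarrow> \<phi> (x \<oplus> y) \<le> max (\<phi> x) (\<phi> y)"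
  using phi_nonarch by (auto simp: nonarch_abs_def)

lemma phi_0: "\<phi> \<zero> = 0"
  by (simp add: phi_eq_0)

lemma phi_1: "\<phi> \<one> = 1"
  using phi_mult[of \<one> \<one>] phi_eq_0[of \<one>] by simp

lemma phi_minus: assumes "x \<in> carrier R" shows "\<phi> (\<ominus> x) = \<phi> x"
proof -
  have "\<phi> (\<ominus> \<one>) * \<phi> (\<ominus> \<one>) = 1" using phi_mult[of "\<ominus> \<one>" "\<ominus> \<one>"] phi_1 by (simp add: l_minus)
  then have 1: "\<phi> (\<ominus> \<one>) = 1" using phi_nonneg[of "\<ominus> \<one>"] by (simp add: square_eq_1_iff)
  have "\<ominus> x = \<ominus> \<one> \<otimes> x" using assms by (simp add: l_minus)
  then show ?thesis using phi_mult[of "\<ominus> \<one>" x] assms 1 by simp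
qed

lemma phi_diff: "x \<in> carrier R \<Longrightarrow> y \<in> carrier R \<Longrightarrow> \<phi> (x \<ominus> y) \<le> max (\<phi> x) (\<phi> y)"
  unfolding a_minus_def using phi_add[of x "\<ominus> y"] by (simp add: phi_minus)

lemma phi_diff_commute: assumes "x \<in> carrier R" "y \<in> carrier R" shows "\<phi> (x \<ominus> y) = \<phi> (y \<ominus> x)"
proof -
  have "x \<ominus> y = \<ominus> (y \<ominus> x)" using assms by (simp add: a_minus_def minus_add a_comm)
  then show ?thesis using assms phi_minus[of "y \<ominus> x"] by simp
qed

lemma phi_abs_diff: assumes "x \<in> carrier R" "y \<in> carrier R" shows "\<bar>\<phi> x - \<phi> y\<bar> \<le> \<phi> (x \<ominus> y)"
proof -
  have *: "\<phi> a \<le> \<phi> (a \<ominus> b) + \<phi> b" if "a \<in> carrier R" "b \<in> carrier R" for a b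
  proof -
    have "a = (a \<ominus> b) \<oplus> b" using that by (simp add: a_minus_def a_assoc l_neg)
    then have "\<phi> a \<le> max (\<phi> (a \<ominus> b)) (\<phi> b)" using phi_add[of "a \<ominus> b" b] that by simp
    then show ?thesis using phi_nonneg[of "a \<ominus> b"] phi_nonneg[of b] that by simp
  qed
  show ?thesis using *[OF assms] *[OF assms(2,1)] phi_diff_commute[OF assms] by linarith
qed

abbreviation C where "C \<equiv> cauchy_ring R v"
abbreviation N where "N \<equiv> null_seqs R v"
abbreviation Kv where "Kv \<equiv> completion R v"
abbreviation Ov where "Ov \<equiv> valuation_ring R v"
abbreviation Pv where "Pv \<equiv> valuation_ideal R v"
abbreviation iota where "iota \<equiv> to_completion R v"

section \<open>The ring of Cauchy sequences\<close>

lemma C_simps: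
  "u \<oplus>\<^bsub>C\<^esub> w = (\<lambda>n. u n \<oplus> w n)" "u \<otimes>\<^bsub>C\<^esub> w = (\<lambda>n. u n \<otimes> w n)"
  "\<zero>\<^bsub>C\<^esub> = (\<lambda>_. \<zero>)" "\<one>\<^bsub>C\<^esub> = (\<lambda>_. \<one>)"
  by (simp_all add: cauchy_ring_def)

lemma C_iff: "u \<in> carrier C \<longleftrightarrow> (\<forall>n. u n \<in> carrier R) \<and>
    (\<forall>e>0. \<exists>M. \<forall>m\<ge>M. \<forall>n\<ge>M. \<phi> (u m \<ominus> u n) < e)"
proof
  assume "u \<in> carrier C"
  then show "(\<forall>n. u n \<in> carrier R) \<and> (\<forall>e>0. \<exists>M. \<forall>m\<ge>M. \<forall>n\<ge>M. \<phi> (u m \<ominus> u n) < e)"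
    using phi_v by (simp add: cauchy_ring_def)
next
  assume u: "(\<forall>n. u n \<in> carrier R) \<and> (\<forall>e>0. \<exists>M. \<forall>m\<ge>M. \<forall>n\<ge>M. \<phi> (u m \<ominus> u n) < e)"
  have "\<exists>M. \<forall>m\<ge>M. \<forall>n\<ge>M. \<psi> (u m \<ominus> u n) < e" if "\<psi> \<in> v" and e: "0 < e" for \<psi> and e :: real
  proof -
    obtain c where c: "c > 0" "\<And>x. x \<in> carrier R \<Longrightarrow> \<psi> x = \<phi> x powr c" using v_powr[OF \<open>\<psi> \<in> v\<close>] by blast
    have "0 < e powr (1 / c)" using e by simp
    then obtain M where M: "\<And>m n. m \<ge> M \<Longrightarrow> n \<ge> M \<Longrightarrow> \<phi> (u m \<ominus> u n) < e powr (1 / c)" using u by blast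
    have "\<psi> (u m \<ominus> u n) < e" if "m \<ge> M" "n \<ge> M" for m n
    proof -
      have "\<phi> (u m \<ominus> u n) powr c < (e powr (1 / c)) powr c"
        using M[OF that] c u phi_nonneg by (intro powr_less_mono2) auto
      then show ?thesis using c u e by (simp add: powr_powr)
    qed
    then show ?thesis by blast
  qed
  then show "u \<in> carrier C" using u by (simp add: cauchy_ring_def)
qed

lemma C_carrier: "u \<in> carrier C \<Longrightarrow> u n \<in> carrier R"
  using C_iff by blast

lemma C_cauchy: "u \<in> carrier C \<Longrightarrow> 0 < e \<Longrightarrow> \<exists>M. \<forall>m\<ge>M. \<forall>n\<ge>M. \<phi> (u m \<ominus> u n) < e"
  using C_iff by blast

lemma C_convergent: assumes "u \<in> carrier C" shows "convergent (\<lambda>n. \<phi> (u n))"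
proof -
  have "Cauchy (\<lambda>n. \<phi> (u n))"
    unfolding Cauchy_def dist_real_def
  proof (intro allI impI)
    fix e :: real assume "0 < e"
    then obtain M where "\<And>m n. m \<ge> M \<Longrightarrow> n \<ge> M \<Longrightarrow> \<phi> (u m \<ominus> u n) < e" using C_cauchy[OF assms] by blast
    then show "\<exists>M. \<forall>m\<ge>M. \<forall>n\<ge>M. \<bar>\<phi> (u m) - \<phi> (u n)\<bar> < e"
      using phi_abs_diff C_carrier[OF assms] by (meson le_less_trans)
  qed
  then show ?thesis by (rule Cauchy_convergent)
qed

text \<open>The absolute value of the completion, on the level of Cauchy sequences;
  \<open>cl_mem\<close> shows that it is constant on classes.\<close>

definition labs where "labs u = lim (\<lambda>n. \<phi> (u n))"

lemma labs: "u \<in> carrier C \<Longrightarrow> (\<lambda>n. \<phi> (u n)) \<longlonglongrightarrow> labs u"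
  unfolding labs_def using C_convergent convergent_LIMSEQ_iff by blast

lemma labs_nonneg: "u \<in> carrier C \<Longrightarrow> 0 \<le> labs u"
  by (rule LIMSEQ_le_const[OF labs]) (auto simp: phi_nonneg C_carrier)

lemma C_const: "a \<in> carrier R \<Longrightarrow> (\<lambda>_. a) \<in> carrier C"
  by (auto simp: C_iff a_minus_def r_neg phi_0)

lemma C_add: assumes "u \<in> carrier C" "w \<in> carrier C" shows "(\<lambda>n. u n \<oplus> w n) \<in> carrier C"
  unfolding C_iff
proof (intro conjI allI impI)
  note c = C_carrier[OF assms(1)] C_carrier[OF assms(2)]
  show "u n \<oplus> w n \<in> carrier R" for n using c by simp
  fix e :: real assume e: "0 < e"
  obtain M1 where M1: "\<And>m n. m \<ge> M1 \<Longrightarrow> n \<ge> M1 \<Longrightarrow> \<phi> (u m \<ominus> u n) < e" using C_cauchy[OF assms(1) e] by blast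
  obtain M2 where M2: "\<And>m n. m \<ge> M2 \<Longrightarrow> n \<ge> M2 \<Longrightarrow> \<phi> (w m \<ominus> w n) < e" using C_cauchy[OF assms(2) e] by blast
  have "\<phi> ((u m \<oplus> w m) \<ominus> (u n \<oplus> w n)) < e" if "m \<ge> max M1 M2" "n \<ge> max M1 M2" for m n
  proof -
    have "(u m \<oplus> w m) \<ominus> (u n \<oplus> w n) = (u m \<ominus> u n) \<oplus> (w m \<ominus> w n)"
      using c by (simp add: a_minus_def minus_add a_ac)
    then have "\<phi> ((u m \<oplus> w m) \<ominus> (u n \<oplus> w n)) \<le> max (\<phi> (u m \<ominus> u n)) (\<phi> (w m \<ominus> w n))"
      using phi_add[of "u m \<ominus> u n" "w m \<ominus> w n"] c by simp
    then show ?thesis using M1[of m n] M2[of m n] that by simp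
  qed
  then show "\<exists>M. \<forall>m\<ge>M. \<forall>n\<ge>M. \<phi> ((u m \<oplus> w m) \<ominus> (u n \<oplus> w n)) < e" by blast
qed

lemma C_minus: assumes "u \<in> carrier C" shows "(\<lambda>n. \<ominus> u n) \<in> carrier C"
proof -
  note c = C_carrier[OF assms]
  have "\<phi> (\<ominus> u m \<ominus> \<ominus> u n) = \<phi> (u m \<ominus> u n)" for m n
  proof -
    have "\<ominus> u m \<ominus> \<ominus> u n = \<ominus> (u m \<ominus> u n)" using c by (simp add: a_minus_def minus_add)
    then show ?thesis using phi_minus[of "u m \<ominus> u n"] c by simp
  qed
  then show ?thesis using assms c by (simp add: C_iff)
qed

lemma C_bounded: assumes "u \<in> carrier C" shows "\<exists>B>0. \<forall>n. \<phi> (u n) \<le> B"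
proof -
  obtain B where "B > 0" "\<And>n. norm (\<phi> (u n)) \<le> B"
    using convergent_imp_Bseq[OF C_convergent[OF assms]] unfolding Bseq_def by blast
  then have "\<phi> (u n) \<le> B" for n by (metis real_norm_def abs_le_iff)
  then show ?thesis using \<open>B > 0\<close> by blast
qed

lemma C_mult: assumes "u \<in> carrier C" "w \<in> carrier C" shows "(\<lambda>n. u n \<otimes> w n) \<in> carrier C"
  unfolding C_iff
proof (intro conjI allI impI)
  note c = C_carrier[OF assms(1)] C_carrier[OF assms(2)]
  show "u n \<otimes> w n \<in> carrier R" for n using c by simp
  fix e :: real assume e: "0 < e"
  obtain A where A: "A > 0" "\<And>n. \<phi> (u n) \<le> A" using C_bounded[OF assms(1)] by blast
  obtain B where B: "B > 0" "\<And>n. \<phi> (w n) \<le> B" using C_bounded[OF assms(2)] by blast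
  obtain M1 where M1: "\<And>m n. m \<ge> M1 \<Longrightarrow> n \<ge> M1 \<Longrightarrow> \<phi> (u m \<ominus> u n) < e / B"
    using C_cauchy[OF assms(1), of "e / B"] e B by auto
  obtain M2 where M2: "\<And>m n. m \<ge> M2 \<Longrightarrow> n \<ge> M2 \<Longrightarrow> \<phi> (w m \<ominus> w n) < e / A"
    using C_cauchy[OF assms(2), of "e / A"] e A by auto
  have "\<phi> ((u m \<otimes> w m) \<ominus> (u n \<otimes> w n)) < e" if "m \<ge> max M1 M2" "n \<ge> max M1 M2" for m n
  proof -
    have "(u m \<otimes> w m) \<ominus> (u n \<otimes> w n) = u m \<otimes> (w m \<ominus> w n) \<oplus> (u m \<ominus> u n) \<otimes> w n"
      using c by (simp add: a_minus_def l_distr r_distr l_minus r_minus a_assoc[symmetric])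
        (simp add: a_assoc l_neg)
    moreover have "\<phi> (u m \<otimes> (w m \<ominus> w n)) < e"
    proof -
      have "\<phi> (u m) * \<phi> (w m \<ominus> w n) \<le> A * \<phi> (w m \<ominus> w n)"
        using A c phi_nonneg by (intro mult_right_mono) auto
      also have "\<dots> < A * (e / A)" using M2[of m n] that A by (intro mult_strict_left_mono) auto
      finally show ?thesis using A c by (simp add: phi_mult)
    qed
    moreover have "\<phi> ((u m \<ominus> u n) \<otimes> w n) < e"
    proof -
      have "\<phi> (u m \<ominus> u n) * \<phi> (w n) \<le> \<phi> (u m \<ominus> u n) * B"
        using B c phi_nonneg by (intro mult_left_mono) auto
      also have "\<dots> < (e / B) * B" using M1[of m n] that B by (intro mult_strict_right_mono) auto
      finally show ?thesis using B c by (simp add: phi_mult)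
    qed
    ultimately show ?thesis
      using phi_add[of "u m \<otimes> (w m \<ominus> w n)" "(u m \<ominus> u n) \<otimes> w n"] c by simp
  qed
  then show "\<exists>M. \<forall>m\<ge>M. \<forall>n\<ge>M. \<phi> ((u m \<otimes> w m) \<ominus> (u n \<otimes> w n)) < e" by blast
qed

lemma C_cring: "cring C"
proof (rule cringI)
  show "abelian_group C"
  proof (rule abelian_groupI)
    fix x assume "x \<in> carrier C"
    then show "\<exists>y\<in>carrier C. y \<oplus>\<^bsub>C\<^esub> x = \<zero>\<^bsub>C\<^esub>"
      using C_minus[of x] by (intro bexI[of _ "\<lambda>n. \<ominus> x n"]) (auto simp: C_simps l_neg C_carrier)
  qed (simp_all add: C_simps C_add C_const C_carrier a_ac)
  show "comm_monoid C"
    by (rule comm_monoidI) (simp_all add: C_simps C_mult C_const C_carrier m_ac)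
qed (simp add: C_simps C_carrier l_distr)

lemma C_minus_eq: assumes "u \<in> carrier C" "w \<in> carrier C" shows "u \<ominus>\<^bsub>C\<^esub> w = (\<lambda>n. u n \<ominus> w n)"
proof -
  interpret C: cring C by (rule C_cring)
  have "(\<lambda>n. u n \<ominus> w n) \<oplus>\<^bsub>C\<^esub> w = u"
    using assms by (simp add: C_simps a_minus_def a_assoc l_neg C_carrier)
  moreover have "(\<lambda>n. u n \<ominus> w n) \<in> carrier C"
    using C_add[OF assms(1) C_minus[OF assms(2)]] by (simp add: a_minus_def)
  ultimately show ?thesis using assms by (intro C.minus_eqI)
qed

lemma N_iff: "u \<in> N \<longleftrightarrow> u \<in> carrier C \<and> labs u = 0"
proof
  assume u: "u \<in> N"
  then have "(\<lambda>n. \<phi> (u n)) \<longlonglongrightarrow> 0" using phi_v by (simp add: null_seqs_def)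
  then show "u \<in> carrier C \<and> labs u = 0" using u by (simp add: null_seqs_def labs_def limI)
next
  assume u: "u \<in> carrier C \<and> labs u = 0"
  then have lim: "(\<lambda>n. \<phi> (u n)) \<longlonglongrightarrow> 0" using labs by metis
  have "(\<lambda>n. \<psi> (u n)) \<longlonglongrightarrow> 0" if "\<psi> \<in> v" for \<psi>
  proof -
    obtain c where c: "c > 0" "\<And>x. x \<in> carrier R \<Longrightarrow> \<psi> x = \<phi> x powr c"
      using v_powr[OF \<open>\<psi> \<in> v\<close>] by blast
    have "(\<lambda>n. \<phi> (u n) powr c) \<longlonglongrightarrow> 0 powr c"
      using c u by (intro tendsto_powr' lim tendsto_const) (auto simp: phi_nonneg C_carrier)
    then show ?thesis using c u by (simp add: C_carrier)
  qed
  then show "u \<in> N" using u by (simp add: null_seqs_def)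
qed

lemma labs_add: assumes "u \<in> carrier C" "w \<in> carrier C"
  shows "labs (\<lambda>n. u n \<oplus> w n) \<le> max (labs u) (labs w)"
  by (rule LIMSEQ_le[OF labs[OF C_add[OF assms]] tendsto_max[OF labs[OF assms(1)] labs[OF assms(2)]]])
    (use phi_add C_carrier assms in auto)

lemma labs_mult: assumes "u \<in> carrier C" "w \<in> carrier C"
  shows "labs (\<lambda>n. u n \<otimes> w n) = labs u * labs w"
proof (rule LIMSEQ_unique[OF labs[OF C_mult[OF assms]]])
  show "(\<lambda>n. \<phi> (u n \<otimes> w n)) \<longlonglongrightarrow> labs u * labs w"
    using tendsto_mult[OF labs[OF assms(1)] labs[OF assms(2)]] C_carrier assms by (simp add: phi_mult)
qed

lemma labs_minus: "u \<in> carrier C \<Longrightarrow> labs (\<lambda>n. \<ominus> u n) = labs u"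
  by (simp add: labs_def phi_minus C_carrier)

lemma labs_const: "labs (\<lambda>_. a) = \<phi> a"
  by (simp add: labs_def limI)

lemma N_ideal: "ideal N C"
proof -
  interpret C: cring C by (rule C_cring)
  show ?thesis
  proof (rule idealI[OF C.ring_axioms])
    show "subgroup N (add_monoid C)"
    proof (rule C.add.subgroupI)
      show "N \<subseteq> carrier C" using N_iff by blast
      show "N \<noteq> {}" using C_const[of \<zero>] labs_const[of \<zero>] phi_0 N_iff by fastforce
    next
      fix u assume "u \<in> N"
      then have u: "u \<in> carrier C" "labs u = 0" using N_iff by blast+
      have "\<ominus>\<^bsub>C\<^esub> u = (\<lambda>n. \<ominus> u n)"
        using C_minus[OF u(1)] u(1) by (intro C.minus_equality) (auto simp: C_simps l_neg C_carrier)
      then show "\<ominus>\<^bsub>C\<^esub> u \<in> N" using u C_minus labs_minus by (simp add: N_iff)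
    next
      fix u w assume "u \<in> N" "w \<in> N"
      then have *: "u \<in> carrier C" "labs u = 0" "w \<in> carrier C" "labs w = 0" using N_iff by blast+
      then show "u \<oplus>\<^bsub>C\<^esub> w \<in> N"
        using labs_add[OF *(1,3)] labs_nonneg[OF C_add[OF *(1,3)]] C_add by (simp add: N_iff C_simps)
    qed
  next
    fix u w assume "u \<in> N" "w \<in> carrier C"
    then show "w \<otimes>\<^bsub>C\<^esub> u \<in> N" "u \<otimes>\<^bsub>C\<^esub> w \<in> N"
      using N_iff labs_mult C_mult by (auto simp: C_simps)
  qed
qed

section \<open>The completion and its valuation ring\<close>

lemma Kv_cring: "cring Kv"
  unfolding completion_def by (rule ideal.quotient_is_cring[OF N_ideal C_cring])

definition cl where "cl u = N +>\<^bsub>C\<^esub> u"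

lemma iota_cl: "iota a = cl (\<lambda>_. a)"
  by (simp add: to_completion_def cl_def)

lemma cl_hom: "ring_hom_ring C Kv cl"
  using ideal.rcos_ring_hom_ring[OF N_ideal] unfolding completion_def cl_def .

lemma Kv_carrier: "carrier Kv = cl ` carrier C"
  by (auto simp: completion_def FactRing_def A_RCOSETS_def' cl_def)

lemma cl_self: assumes "u \<in> carrier C" shows "u \<in> cl u"
proof -
  interpret N: ideal N C by (rule N_ideal)
  show ?thesis unfolding cl_def by (rule N.a_rcos_self[OF assms])
qed

lemma cl_mem: assumes "u \<in> carrier C" "w \<in> cl u" shows "w \<in> carrier C" "labs w = labs u"
proof -
  obtain z where z: "z \<in> N" "w = z \<oplus>\<^bsub>C\<^esub> u" using assms(2) by (auto simp: cl_def a_r_coset_def')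
  then have zC: "z \<in> carrier C" and z0: "labs z = 0" using N_iff by blast+
  show w: "w \<in> carrier C" using z(2) C_add[OF zC assms(1)] by (simp add: C_simps)
  have "labs w \<le> labs u" using labs_add[OF zC assms(1)] labs_nonneg[OF assms(1)] z0 z(2) by (simp add: C_simps)
  moreover have "u = (\<lambda>n. w n \<oplus> \<ominus> z n)"
    using z(2) assms(1) zC by (auto simp: C_simps C_carrier a_ac r_neg)
  then have "labs u \<le> labs w"
    using labs_add[OF w C_minus[OF zC]] labs_minus[OF zC] z0 labs_nonneg[OF w] by simp
  ultimately show "labs w = labs u" by simp
qed

lemma labs_powr:
  assumes "u \<in> carrier C" "c > 0" "\<And>x. x \<in> carrier R \<Longrightarrow> \<psi> x = \<phi> x powr c"
  shows "lim (\<lambda>n. \<psi> (u n)) = labs u powr c"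
proof (rule limI)
  have "(\<lambda>n. \<phi> (u n) powr c) \<longlonglongrightarrow> labs u powr c"
    using assms by (intro tendsto_powr' labs tendsto_const) (auto simp: phi_nonneg C_carrier)
  then show "(\<lambda>n. \<psi> (u n)) \<longlonglongrightarrow> labs u powr c" using assms by (simp add: C_carrier)
qed

lemma Ov_cl: assumes "u \<in> carrier C" shows "cl u \<in> carrier Ov \<longleftrightarrow> labs u \<le> 1"
proof
  assume "cl u \<in> carrier Ov"
  then show "labs u \<le> 1" using phi_v cl_self[OF assms] by (auto simp: valuation_ring_def labs_def)
next
  assume le: "labs u \<le> 1"
  have "lim (\<lambda>n. \<psi> (w n)) \<le> 1" if "\<psi> \<in> v" and w: "w \<in> cl u" for \<psi> w
  proof -
    obtain c where c: "c > 0" "\<And>x. x \<in> carrier R \<Longrightarrow> \<psi> x = \<phi> x powr c" using v_powr[OF \<open>\<psi> \<in> v\<close>] by blast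
    have "lim (\<lambda>n. \<psi> (w n)) = labs w powr c"
      by (rule labs_powr) (use cl_mem(1)[OF assms w] c in auto)
    then show ?thesis using cl_mem[OF assms w] le c(1) labs_nonneg[OF assms] by (simp add: powr_le1)
  qed
  then show "cl u \<in> carrier Ov" using assms by (auto simp: valuation_ring_def Kv_carrier)
qed

lemma Pv_cl: assumes "u \<in> carrier C" shows "cl u \<in> Pv \<longleftrightarrow> labs u < 1"
proof
  assume "cl u \<in> Pv"
  then show "labs u < 1" using phi_v cl_self[OF assms] by (auto simp: valuation_ideal_def labs_def)
next
  assume le: "labs u < 1"
  have "lim (\<lambda>n. \<psi> (w n)) < 1" if "\<psi> \<in> v" and w: "w \<in> cl u" for \<psi> w
  proof -
    obtain c where c: "c > 0" "\<And>x. x \<in> carrier R \<Longrightarrow> \<psi> x = \<phi> x powr c" using v_powr[OF \<open>\<psi> \<in> v\<close>] by blast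
    have "lim (\<lambda>n. \<psi> (w n)) = labs w powr c"
      by (rule labs_powr) (use cl_mem(1)[OF assms w] c in auto)
    then show ?thesis using cl_mem[OF assms w] le c(1) labs_nonneg[OF assms] powr_less_mono2[of c "labs u" 1] by simp
  qed
  then show "cl u \<in> Pv" using assms by (auto simp: valuation_ideal_def Kv_carrier)
qed

lemma Ov_carrier: "carrier Ov = cl ` {u \<in> carrier C. labs u \<le> 1}"
proof -
  have "carrier Ov \<subseteq> carrier Kv" by (auto simp: valuation_ring_def)
  then show ?thesis using Ov_cl by (auto simp: Kv_carrier)
qed

lemma Ov_subring: "subring (carrier Ov) Kv"
proof -
  interpret K: cring Kv by (rule Kv_cring)
  interpret h: ring_hom_ring C Kv cl by (rule cl_hom)
  show ?thesis
  proof (rule K.subringI)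
    show "carrier Ov \<subseteq> carrier Kv" by (auto simp: valuation_ring_def)
    show "\<one>\<^bsub>Kv\<^esub> \<in> carrier Ov"
      using Ov_cl[OF C_const[OF one_closed]] h.hom_one by (simp add: labs_const phi_1 C_simps)
  next
    fix x assume "x \<in> carrier Ov"
    then obtain u where u: "u \<in> carrier C" "labs u \<le> 1" "x = cl u" by (auto simp: Ov_carrier)
    have "\<ominus>\<^bsub>C\<^esub> u = (\<lambda>n. \<ominus> u n)"
      using C_minus[OF u(1)] u(1) by (intro h.R.minus_equality) (auto simp: C_simps l_neg C_carrier)
    then have "\<ominus>\<^bsub>Kv\<^esub> x = cl (\<lambda>n. \<ominus> u n)" using u by (simp flip: h.hom_a_inv)
    then show "\<ominus>\<^bsub>Kv\<^esub> x \<in> carrier Ov" using Ov_cl[OF C_minus[OF u(1)]] labs_minus[OF u(1)] u by simp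
  next
    fix x y assume "x \<in> carrier Ov" "y \<in> carrier Ov"
    then obtain u w where *: "u \<in> carrier C" "labs u \<le> 1" "x = cl u" "w \<in> carrier C" "labs w \<le> 1" "y = cl w"
      by (auto simp: Ov_carrier)
    have "x \<otimes>\<^bsub>Kv\<^esub> y = cl (\<lambda>n. u n \<otimes> w n)" "x \<oplus>\<^bsub>Kv\<^esub> y = cl (\<lambda>n. u n \<oplus> w n)"
      using * h.hom_mult[of u w] h.hom_add[of u w] by (simp_all add: C_simps)
    then show "x \<otimes>\<^bsub>Kv\<^esub> y \<in> carrier Ov" "x \<oplus>\<^bsub>Kv\<^esub> y \<in> carrier Ov"
      using * Ov_cl[OF C_mult[OF *(1,4)]] Ov_cl[OF C_add[OF *(1,4)]] labs_mult[OF *(1,4)] labs_add[OF *(1,4)]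
        labs_nonneg by (auto simp: mult_le_one)
  qed
qed

lemma Ov_simps: "x \<oplus>\<^bsub>Ov\<^esub> y = x \<oplus>\<^bsub>Kv\<^esub> y" "x \<otimes>\<^bsub>Ov\<^esub> y = x \<otimes>\<^bsub>Kv\<^esub> y" "\<zero>\<^bsub>Ov\<^esub> = \<zero>\<^bsub>Kv\<^esub>" "\<one>\<^bsub>Ov\<^esub> = \<one>\<^bsub>Kv\<^esub>"
  by (simp_all add: valuation_ring_def)

lemma Ov_cring: "cring Ov"
proof -
  interpret K: cring Kv by (rule Kv_cring)
  have eq: "Kv\<lparr>carrier := carrier Ov\<rparr> = Ov" by (simp add: valuation_ring_def)
  have "subcring (carrier Ov) Kv" by (rule K.subcringI'[OF Ov_subring])
  then show ?thesis using K.subcring_iff[OF subringE(1)[OF Ov_subring]] eq by metis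
qed

lemma cl_add: "u \<in> carrier C \<Longrightarrow> w \<in> carrier C \<Longrightarrow> cl u \<oplus>\<^bsub>Ov\<^esub> cl w = cl (\<lambda>n. u n \<oplus> w n)"
  and cl_mult: "u \<in> carrier C \<Longrightarrow> w \<in> carrier C \<Longrightarrow> cl u \<otimes>\<^bsub>Ov\<^esub> cl w = cl (\<lambda>n. u n \<otimes> w n)"
  and cl_zero: "\<zero>\<^bsub>Ov\<^esub> = cl (\<lambda>_. \<zero>)" and cl_one: "\<one>\<^bsub>Ov\<^esub> = cl (\<lambda>_. \<one>)"
proof -
  interpret h: ring_hom_ring C Kv cl by (rule cl_hom)
  show "u \<in> carrier C \<Longrightarrow> w \<in> carrier C \<Longrightarrow> cl u \<oplus>\<^bsub>Ov\<^esub> cl w = cl (\<lambda>n. u n \<oplus> w n)"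
    "u \<in> carrier C \<Longrightarrow> w \<in> carrier C \<Longrightarrow> cl u \<otimes>\<^bsub>Ov\<^esub> cl w = cl (\<lambda>n. u n \<otimes> w n)"
    "\<zero>\<^bsub>Ov\<^esub> = cl (\<lambda>_. \<zero>)" "\<one>\<^bsub>Ov\<^esub> = cl (\<lambda>_. \<one>)"
    using h.hom_mult[of u w] h.hom_add[of u w] h.hom_zero h.hom_one by (simp_all add: C_simps Ov_simps)
qed

lemma iota_Ov: "a \<in> carrier R \<Longrightarrow> iota a \<in> carrier Ov \<longleftrightarrow> \<phi> a \<le> 1"
  unfolding iota_cl using Ov_cl[OF C_const] by (simp add: labs_const)

lemma iota_hom:
  "a \<in> carrier R \<Longrightarrow> b \<in> carrier R \<Longrightarrow> iota a \<oplus>\<^bsub>Ov\<^esub> iota b = iota (a \<oplus> b)"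
  "a \<in> carrier R \<Longrightarrow> b \<in> carrier R \<Longrightarrow> iota a \<otimes>\<^bsub>Ov\<^esub> iota b = iota (a \<otimes> b)"
  "iota \<zero> = \<zero>\<^bsub>Ov\<^esub>" "iota \<one> = \<one>\<^bsub>Ov\<^esub>"
  by (simp_all add: iota_cl cl_add cl_mult cl_zero cl_one C_const)

text \<open>Density of the field in its completion. For \<open>a\<close> serves a term of the Cauchy
  sequence from which on all terms differ by less than \<open>\<phi> s\<close>, so that the
  differences remain integral after division by \<open>s\<close>.\<close>

lemma Ov_approx:
  assumes "x \<in> carrier Ov" "s \<in> carrier R" "s \<noteq> \<zero>" "\<phi> s \<le> 1"
  shows "\<exists>a\<in>carrier R. \<phi> a \<le> 1 \<and> (\<exists>y\<in>carrier Ov. x = iota a \<oplus>\<^bsub>Ov\<^esub> (iota s \<otimes>\<^bsub>Ov\<^esub> y))"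
proof -
  obtain u where u: "u \<in> carrier C" "labs u \<le> 1" "x = cl u" using assms(1) by (auto simp: Ov_carrier)
  have s0: "0 < \<phi> s" using assms phi_nonneg[of s] phi_eq_0[of s] by simp
  obtain M where M: "\<And>m n. m \<ge> M \<Longrightarrow> n \<ge> M \<Longrightarrow> \<phi> (u m \<ominus> u n) < \<phi> s" using C_cauchy[OF u(1) s0] by blast
  define a where "a = u M"
  note c = C_carrier[OF u(1)]
  have aR: "a \<in> carrier R" using c by (simp add: a_def)
  have invR: "inv s \<in> carrier R" and sinv: "s \<otimes> inv s = \<one>"
    using assms(2,3) field_Units by (auto simp: Units_r_inv)
  define w where "w n = inv s \<otimes> (u n \<ominus> a)" for n
  have d: "(\<lambda>n. u n \<ominus> a) \<in> carrier C"
    using C_add[OF u(1) C_minus[OF C_const[OF aR]]] by (simp add: a_minus_def)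
  have wC: "w \<in> carrier C" unfolding w_def by (rule C_mult[OF C_const[OF invR] d])
  have "\<phi> (inv s) * \<phi> s = 1" using phi_mult[OF assms(2) invR] sinv phi_1 by (simp add: mult.commute)
  then have pinv: "\<phi> (inv s) = 1 / \<phi> s" using s0 by (simp add: field_simps)
  have "\<phi> (w n) \<le> 1" if "n \<ge> M" for n
    using M[of n M] that s0 c invR by (simp add: w_def phi_mult pinv a_def divide_le_eq)
  then have "labs w \<le> 1" by (intro LIMSEQ_le_const2[OF labs[OF wC]]) blast
  then have y: "cl w \<in> carrier Ov" using Ov_cl[OF wC] by simp
  have "iota s \<otimes>\<^bsub>Ov\<^esub> cl w = cl (\<lambda>n. u n \<ominus> a)"
  proof -
    have "s \<otimes> w n = u n \<ominus> a" for n
      unfolding w_def using m_assoc[OF assms(2) invR, of "u n \<ominus> a"] c aR sinv by simp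
    then show ?thesis unfolding iota_cl using cl_mult[OF C_const[OF assms(2)] wC] by simp
  qed
  moreover have "iota a \<oplus>\<^bsub>Ov\<^esub> cl (\<lambda>n. u n \<ominus> a) = cl u"
    unfolding iota_cl cl_add[OF C_const[OF aR] d] using c aR
    by (simp add: a_minus_def a_ac) (simp add: a_assoc[symmetric] r_neg a_comm)
  \<comment> \<open>If \<open>\<phi> a\<close> exceeded 1, all late terms would share this absolute
    value, and so would the limit.\<close>
  moreover have "\<phi> a \<le> 1"
  proof (rule ccontr)
    assume "\<not> \<phi> a \<le> 1"
    then have gt: "1 < \<phi> a" by simp
    have "\<phi> (u n) = \<phi> a" if "n \<ge> M" for n
    proof -
      have lt: "\<phi> (u n \<ominus> a) < \<phi> a" using M[of n M] that assms(4) gt by (simp add: a_def)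
      have "\<phi> a \<le> max (\<phi> (u n)) (\<phi> (u n \<ominus> a))"
        using phi_diff[of "u n" "u n \<ominus> a"] c aR
        by (simp add: a_minus_def minus_add a_assoc[symmetric] r_neg)
      moreover have "\<phi> (u n) \<le> max (\<phi> (u n \<ominus> a)) (\<phi> a)"
        using phi_add[of "u n \<ominus> a" a] c aR by (simp add: a_minus_def a_assoc l_neg)
      ultimately show ?thesis using lt by simp
    qed
    then have "(\<lambda>n. \<phi> (u n)) \<longlonglongrightarrow> \<phi> a"
      by (intro tendsto_eventually) (auto simp: eventually_sequentially)
    then have "labs u = \<phi> a" using LIMSEQ_unique[OF labs[OF u(1)]] by blast
    then show False using u(2) gt by simp
  qed
  ultimately show ?thesis using aR y u(3) by metis
qed

lemma iota_dvd:
  assumes "a \<in> carrier R" "s \<in> carrier R" "y \<in> carrier Ov" "iota a = iota s \<otimes>\<^bsub>Ov\<^esub> y"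
  shows "\<phi> a \<le> \<phi> s"
proof -
  obtain u where u: "u \<in> carrier C" "labs u \<le> 1" "y = cl u" using assms(3) by (auto simp: Ov_carrier)
  have "cl (\<lambda>_. a) = cl (\<lambda>n. s \<otimes> u n)" using assms(4) u C_const[OF assms(2)] by (simp add: iota_cl cl_mult)
  then have "(\<lambda>_. a) \<in> cl (\<lambda>n. s \<otimes> u n)" using cl_self[OF C_const[OF assms(1)]] by simp
  then have "labs (\<lambda>_. a) = labs (\<lambda>n. s \<otimes> u n)" by (rule cl_mem(2)[OF C_mult[OF C_const[OF assms(2)] u(1)]])
  then have "\<phi> a = \<phi> s * labs u" using labs_mult[OF C_const[OF assms(2)] u(1)] by (simp add: labs_const)
  then show ?thesis using u(2) phi_nonneg[OF assms(2)] mult_left_le by metis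
qed

lemma Pv_ideal: "ideal Pv Ov"
proof -
  interpret O: cring Ov by (rule Ov_cring)
  have sub: "Pv \<subseteq> carrier Ov"
  proof
    fix x assume x: "x \<in> Pv"
    then obtain u where u: "u \<in> carrier C" "x = cl u" by (auto simp: valuation_ideal_def Kv_carrier)
    then show "x \<in> carrier Ov" using x Pv_cl[OF u(1)] Ov_cl[OF u(1)] by simp
  qed
  have P: "\<exists>u\<in>carrier C. labs u < 1 \<and> x = cl u" if "x \<in> Pv" for x
    using that Pv_cl by (auto simp: valuation_ideal_def Kv_carrier)
  show ?thesis
  proof (rule idealI[OF O.ring_axioms])
    show "subgroup Pv (add_monoid Ov)"
    proof (rule O.add.subgroupI[OF sub])
      show "Pv \<noteq> {}" using Pv_cl[OF C_const[OF zero_closed]] phi_0 by (auto simp: labs_const)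
    next
      fix x assume "x \<in> Pv"
      then obtain u where u: "u \<in> carrier C" "labs u < 1" "x = cl u" using P by blast
      have "cl (\<lambda>n. \<ominus> u n) \<oplus>\<^bsub>Ov\<^esub> x = \<zero>\<^bsub>Ov\<^esub>"
        using u C_minus[OF u(1)] by (simp add: cl_add cl_zero l_neg C_carrier)
      moreover have m: "cl (\<lambda>n. \<ominus> u n) \<in> Pv"
        using Pv_cl[OF C_minus[OF u(1)]] labs_minus[OF u(1)] u by simp
      ultimately have "\<ominus>\<^bsub>Ov\<^esub> x = cl (\<lambda>n. \<ominus> u n)"
        using sub \<open>x \<in> Pv\<close> by (intro O.minus_equality) auto
      then show "\<ominus>\<^bsub>Ov\<^esub> x \<in> Pv" using m by simp
    next
      fix x y assume "x \<in> Pv" "y \<in> Pv"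
      then obtain u w where *: "u \<in> carrier C" "labs u < 1" "x = cl u" "w \<in> carrier C" "labs w < 1" "y = cl w"
        using P by metis
      then show "x \<oplus>\<^bsub>Ov\<^esub> y \<in> Pv"
        using Pv_cl[OF C_add[OF *(1,4)]] labs_add[OF *(1,4)] by (simp add: cl_add)
    qed
  next
    fix x y assume "x \<in> Pv" "y \<in> carrier Ov"
    obtain u where u: "u \<in> carrier C" "labs u < 1" "x = cl u" using P[OF \<open>x \<in> Pv\<close>] by blast
    obtain w where "w \<in> carrier C" "labs w \<le> 1" "y = cl w"
      using \<open>y \<in> carrier Ov\<close> by (auto simp: Ov_carrier)
    note * = u this
    have "labs w * labs u \<le> 1 * labs u"
      using * labs_nonneg by (intro mult_right_mono) auto
    then have "y \<otimes>\<^bsub>Ov\<^esub> x \<in> Pv"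
      using * Pv_cl[OF C_mult[OF *(4,1)]] labs_mult[OF *(4,1)] by (simp add: cl_mult)
    then show "y \<otimes>\<^bsub>Ov\<^esub> x \<in> Pv" "x \<otimes>\<^bsub>Ov\<^esub> y \<in> Pv"
      using O.m_comm[of x y] sub \<open>x \<in> Pv\<close> \<open>y \<in> carrier Ov\<close> by auto
  qed
qed

lemma iota_minus: assumes "a \<in> carrier R" "b \<in> carrier R" "\<phi> a \<le> 1" "\<phi> b \<le> 1"
  shows "iota a \<ominus>\<^bsub>Ov\<^esub> iota b = iota (a \<ominus> b)"
proof -
  interpret O: cring Ov by (rule Ov_cring)
  have le: "\<phi> (a \<ominus> b) \<le> 1" using phi_diff[OF assms(1,2)] assms(3,4) by simp
  have "iota (a \<ominus> b) \<oplus>\<^bsub>Ov\<^esub> iota b = iota a"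
    using iota_hom(1)[of "a \<ominus> b" b] assms by (simp add: a_minus_def a_assoc l_neg)
  moreover have "iota (a \<ominus> b) \<in> carrier Ov" "iota a \<in> carrier Ov" "iota b \<in> carrier Ov"
    using assms le by (simp_all add: iota_Ov)
  ultimately show ?thesis by (intro O.minus_eqI)
qed

text \<open>By density the residue field of the completion is that of the field. Elements may be
  represented through \<open>p\<close> by another set \<open>T\<close>, so that polynomials can
  stand for elements of \<open>k[X]/(f)\<close>.\<close>

lemma residue_size_eq:
  assumes "\<And>x y. x \<in> T \<Longrightarrow> y \<in> T \<Longrightarrow> b x = b y \<longleftrightarrow> \<phi> (p x \<ominus> p y) < 1"
    and "p ` T = {a \<in> carrier R. \<phi> a \<le> 1}"
  shows "residue_size R v = card (b ` T)"
proof -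
  interpret O: cring Ov by (rule Ov_cring)
  interpret P: ideal Pv Ov by (rule Pv_ideal)
  have pT: "p x \<in> carrier R" "\<phi> (p x) \<le> 1" if "x \<in> T" for x using assms(2) that by blast+
  have same: "Pv +>\<^bsub>Ov\<^esub> iota a = Pv +>\<^bsub>Ov\<^esub> iota c \<longleftrightarrow> \<phi> (a \<ominus> c) < 1"
    if "a \<in> carrier R" "\<phi> a \<le> 1" "c \<in> carrier R" "\<phi> c \<le> 1" for a c
  proof -
    have "iota a \<ominus>\<^bsub>Ov\<^esub> iota c \<in> Pv \<longleftrightarrow> \<phi> (a \<ominus> c) < 1"
      unfolding iota_minus[OF that(1,3,2,4)] unfolding iota_cl using Pv_cl[OF C_const, of "a \<ominus> c"] that by (simp add: labs_const)
    then show ?thesis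
      using O.quotient_eq_iff_same_a_r_cos[OF Pv_ideal, of "iota a" "iota c"] iota_Ov that by simp
  qed
  have "carrier (Ov Quot Pv) = (\<lambda>x. Pv +>\<^bsub>Ov\<^esub> x) ` carrier Ov"
    by (auto simp: FactRing_def A_RCOSETS_def')
  also have "\<dots> = (\<lambda>a. Pv +>\<^bsub>Ov\<^esub> iota a) ` {a \<in> carrier R. \<phi> a \<le> 1}"
  proof (intro equalityI subsetI)
    fix D assume "D \<in> (\<lambda>x. Pv +>\<^bsub>Ov\<^esub> x) ` carrier Ov"
    then obtain x where x: "x \<in> carrier Ov" "D = Pv +>\<^bsub>Ov\<^esub> x" by blast
    \<comment> \<open>Some \<open>z\<close> has value neither 0 nor 1; either \<open>z\<close> or
      its inverse serves.\<close>
    obtain s where s: "s \<in> carrier R" "s \<noteq> \<zero>" "\<phi> s < 1"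
    proof -
      obtain z where z: "z \<in> carrier R" "z \<noteq> \<zero>" "\<phi> z \<noteq> 1" using phi_nonarch by (auto simp: nonarch_abs_def)
      have zi: "inv z \<in> carrier R" "inv z \<otimes> z = \<one>" using z field_Units by (auto simp: Units_l_inv)
      then have 1: "\<phi> (inv z) * \<phi> z = 1" using phi_mult[OF zi(1) z(1)] phi_1 by simp
      show ?thesis
      proof (cases "\<phi> z < 1")
        case True then show ?thesis using that z by blast
      next
        case False
        then have "1 < \<phi> z" using z by simp
        moreover from this have "\<phi> (inv z) = 1 / \<phi> z" using 1 by (simp add: field_simps)
        ultimately have "\<phi> (inv z) < 1" by simp
        moreover have "inv z \<noteq> \<zero>" using zi z(1) by (metis l_null one_not_zero)
        ultimately show ?thesis using that zi by blast
      qed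
    qed
    obtain a y where ay: "a \<in> carrier R" "\<phi> a \<le> 1" "y \<in> carrier Ov"
       "x = iota a \<oplus>\<^bsub>Ov\<^esub> (iota s \<otimes>\<^bsub>Ov\<^esub> y)"
      using Ov_approx[OF x(1) s(1,2)] s(3) by auto
    have "iota s \<in> Pv" unfolding iota_cl using Pv_cl[OF C_const[OF s(1)]] s(3) by (simp add: labs_const)
    then have m: "iota s \<otimes>\<^bsub>Ov\<^esub> y \<in> Pv" using ay(3) by (rule P.I_r_closed)
    have ia: "iota a \<in> carrier Ov" using ay iota_Ov by simp
    have "x \<ominus>\<^bsub>Ov\<^esub> iota a = iota s \<otimes>\<^bsub>Ov\<^esub> y"
      unfolding ay(4) using ia P.Icarr[OF m] by (intro O.minus_eqI O.a_comm)
    then have "Pv +>\<^bsub>Ov\<^esub> x = Pv +>\<^bsub>Ov\<^esub> iota a"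
      using O.quotient_eq_iff_same_a_r_cos[OF Pv_ideal x(1) ia] m by simp
    then show "D \<in> (\<lambda>a. Pv +>\<^bsub>Ov\<^esub> iota a) ` {a \<in> carrier R. \<phi> a \<le> 1}" using x(2) ay by blast
  next
    fix D assume "D \<in> (\<lambda>a. Pv +>\<^bsub>Ov\<^esub> iota a) ` {a \<in> carrier R. \<phi> a \<le> 1}"
    then show "D \<in> (\<lambda>x. Pv +>\<^bsub>Ov\<^esub> x) ` carrier Ov" using iota_Ov by blast
  qed
  also have "\<dots> = (\<lambda>x. Pv +>\<^bsub>Ov\<^esub> iota (p x)) ` T" unfolding assms(2)[symmetric] by (simp add: image_image)
  finally have "residue_size R v = card ((\<lambda>x. Pv +>\<^bsub>Ov\<^esub> iota (p x)) ` T)" by (simp add: residue_size_def)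
  also have "\<dots> = card (b ` T)"
  proof (rule image_equipotent(1))
    fix x y assume "x \<in> T" "y \<in> T"
    then show "Pv +>\<^bsub>Ov\<^esub> iota (p x) = Pv +>\<^bsub>Ov\<^esub> iota (p y) \<longleftrightarrow> b x = b y"
      using same[OF pT pT] assms(1) by simp
  qed
  finally show ?thesis .
qed

end

section \<open>The base field as a record\<close>

lemma type_ring_simps [simp]:
  "carrier (ring_of_type_algebra :: 'r::comm_ring_1 ring) = UNIV"
  "x \<otimes>\<^bsub>ring_of_type_algebra\<^esub> y = x * y" "x \<oplus>\<^bsub>ring_of_type_algebra\<^esub> y = x + y"
  "\<zero>\<^bsub>ring_of_type_algebra\<^esub> = (0 :: 'r)" "\<one>\<^bsub>ring_of_type_algebra\<^esub> = (1 :: 'r)"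
  by (simp_all add: ring_of_type_algebra_def)

lemma type_ring_minus [simp]: "x \<ominus>\<^bsub>ring_of_type_algebra\<^esub> y = x - (y :: 'r::comm_ring_1)"
proof -
  interpret ring "ring_of_type_algebra :: 'r ring" by (rule ring_from_type_algebra)
  show ?thesis by (rule minus_eqI) simp_all
qed

lemma valued_base:
  assumes "v \<in> places (base_field :: 'k::field_char_0 ring)" "\<phi> \<in> v"
  shows "valued base_field v \<phi>"
  using assms field_from_type_algebra by (simp add: valued_def valued_axioms_def)

lemma residue_size_base:
  assumes "v \<in> places (base_field :: 'k::field_char_0 ring)" "\<phi> \<in> v" "dvr_abs \<phi> t"
  shows "residue_size (base_field :: 'k ring) v = dvr_abs.q \<phi>"
proof -
  interpret valued base_field v \<phi> by (rule valued_base[OF assms(1,2)])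
  interpret D: dvr_abs \<phi> t by (rule assms(3))
  have "residue_size (base_field :: 'k ring) v = card (coset {x. \<phi> x < 1} ` {x. \<phi> x \<le> 1})"
    by (rule residue_size_eq[where p = "\<lambda>x. x"]) (simp_all add: coset_eq_iff[OF D.sgp_m])
  then show ?thesis by (simp add: D.q_def idx_def quo_def)
qed

subsection \<open>The field \<open>k[X]/(f)\<close>\<close>

definition ext_proj :: "'k::field_char_0 poly \<Rightarrow> 'k poly \<Rightarrow> 'k poly set" where
  "ext_proj f h = (PIdl\<^bsub>polys\<^esub> f) +>\<^bsub>polys\<^esub> h"

lemma ext_ideal: "ideal (PIdl\<^bsub>polys\<^esub> f) (polys :: 'k::field_char_0 poly ring)"
proof -
  interpret cring "polys :: 'k poly ring" by (rule cring_from_type_algebra)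
  show ?thesis by (rule cgenideal_ideal) simp
qed

lemma PIdl_iff: "h \<in> PIdl\<^bsub>polys\<^esub> f \<longleftrightarrow> f dvd (h :: 'k::field_char_0 poly)"
  unfolding cgenideal_def by (auto simp: dvd_def mult.commute)

lemma ext_proj_hom: "ext_proj f \<in> Ring.ring_hom (polys :: 'k::field_char_0 poly ring) (ext_field f)"
  using ideal.rcos_ring_hom[OF ext_ideal, of f] unfolding ext_proj_def[abs_def] ext_field_def .

lemma ext_proj_simps:
  fixes g h f :: "'k::field_char_0 poly"
  shows "ext_proj f (g * h) = ext_proj f g \<otimes>\<^bsub>ext_field f\<^esub> ext_proj f h"
    "ext_proj f (g + h) = ext_proj f g \<oplus>\<^bsub>ext_field f\<^esub> ext_proj f h"
    "ext_proj f 1 = \<one>\<^bsub>ext_field f\<^esub>"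
  using ring_hom_mult[OF ext_proj_hom, of g h] ring_hom_add[OF ext_proj_hom, of g h]
    ring_hom_one[OF ext_proj_hom] by simp_all

lemma ext_proj_eq_iff: "ext_proj f g = ext_proj f h \<longleftrightarrow> f dvd g - (h :: 'k::field_char_0 poly)"
proof -
  interpret ring "polys :: 'k poly ring" by (rule ring_from_type_algebra)
  show ?thesis
    using quotient_eq_iff_same_a_r_cos[OF ext_ideal, of g h f] by (simp add: ext_proj_def PIdl_iff)
qed

lemma ext_carrier: "carrier (ext_field f) = range (ext_proj (f :: 'k::field_char_0 poly))"
  by (auto simp: ext_field_def FactRing_def A_RCOSETS_def' ext_proj_def)

lemma ext_cring: "cring (ext_field (f :: 'k::field_char_0 poly))"
  unfolding ext_field_def by (rule ideal.quotient_is_cring[OF ext_ideal cring_from_type_algebra])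

lemma ext_proj_0: "ext_proj f 0 = \<zero>\<^bsub>ext_field (f :: 'k::field_char_0 poly)\<^esub>"
  by (rule ring_hom_zero[OF ext_proj_hom, simplified]) (use ext_cring cring.axioms(1) ring_from_type_algebra in auto)

lemma ext_minus: "ext_proj f g \<ominus>\<^bsub>ext_field f\<^esub> ext_proj f h = ext_proj f (g - (h :: 'k::field_char_0 poly))"
proof -
  interpret cring "ext_field f" by (rule ext_cring)
  show ?thesis by (rule minus_eqI) (simp_all add: ext_carrier flip: ext_proj_simps)
qed

lemma ext_is_field:
  assumes "Factorial_Ring.irreducible (f :: 'k::field_char_0 poly)" shows "field (ext_field f)"
proof (rule cring.cring_fieldI2[OF ext_cring])
  have "\<not> f dvd 0 - 1" using Factorial_Ring.irreducible_not_unit[OF assms] by simp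
  then show "\<zero>\<^bsub>ext_field f\<^esub> \<noteq> \<one>\<^bsub>ext_field f\<^esub>"
    unfolding ext_proj_0[symmetric] ext_proj_simps(3)[symmetric] ext_proj_eq_iff .
  fix a assume "a \<in> carrier (ext_field f)" "a \<noteq> \<zero>\<^bsub>ext_field f\<^esub>"
  then obtain g where ag: "a = ext_proj f g" and "ext_proj f g \<noteq> ext_proj f 0"
    by (auto simp: ext_carrier ext_proj_0)
  then have g: "a = ext_proj f g" "\<not> f dvd g" using ext_proj_eq_iff[of f g 0] by simp_all
  obtain u w where uw: "u * g + w * f = 1" using irreducible_bezout[OF assms g(2)] by blast
  have "g * u - 1 = f * (- w)" using uw by Groebner_Basis.algebra
  then have "ext_proj f (g * u) = ext_proj f 1" unfolding ext_proj_eq_iff by simp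
  then show "\<exists>b\<in>carrier (ext_field f). a \<otimes>\<^bsub>ext_field f\<^esub> b = \<one>\<^bsub>ext_field f\<^esub>"
    using g by (auto simp: ext_carrier ext_proj_simps)
qed

text \<open>This permits rescaling a representative within its place, in particular so that it
  restricts to a prescribed absolute value of the base field.\<close>

lemma (in valued) powr_mem:
  assumes "c > 0" shows "restrict (\<lambda>x. \<phi> x powr c) (carrier R) \<in> v" (is "?\<psi> \<in> v")
  unfolding v_iff
proof
  show "\<exists>c>0. \<forall>x\<in>carrier R. ?\<psi> x = \<phi> x powr c" using assms by auto
  obtain z where z: "z \<in> carrier R" "z \<noteq> \<zero>" "\<phi> z \<noteq> 1" using phi_nonarch by (auto simp: nonarch_abs_def)
  then have "0 < \<phi> z" using phi_nonneg phi_eq_0 by (metis less_eq_real_def)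
  then have "\<phi> z powr c \<noteq> 1" using z(3) assms by (simp add: powr_eq_one_iff_gen)
  moreover have "\<phi> (x \<oplus> y) powr c \<le> max (\<phi> x powr c) (\<phi> y powr c)" if "x \<in> carrier R" "y \<in> carrier R" for x y
  proof -
    have "\<phi> (x \<oplus> y) powr c \<le> max (\<phi> x) (\<phi> y) powr c"
      using phi_add[OF that] phi_nonneg that assms by (intro powr_mono2) auto
    then show ?thesis by (simp add: max_def split: if_splits)
  qed
  ultimately show "?\<psi> \<in> nonarch_abs R"
    using z phi_nonneg phi_eq_0 phi_mult by (auto simp: nonarch_abs_def powr_mult intro!: bexI[of _ z])
qed

context dvr_poly
begin

definition lift_abs :: "('a poly set \<Rightarrow> real) \<Rightarrow> 'a poly \<Rightarrow> real" where
  "lift_abs \<psi> h = \<psi> (ext_proj f h)"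

text \<open>The representative that restricts to \<open>\<phi>\<close> itself and not to a power of
  it. It turns places above \<open>v\<close> into functions satisfying
  \<open>ext_abs\<close>.\<close>

definition normalized :: "('a poly set \<Rightarrow> real) set \<Rightarrow> 'a poly set \<Rightarrow> real" where
  "normalized w = (SOME \<psi>. \<psi> \<in> w \<and> (\<forall>c. \<psi> (ext_embed f c) = \<phi> c))"

section \<open>Places above v and maximal ideals\<close>

lemma ext_embed_proj: "ext_embed f c = ext_proj f [:c:]"
  by (simp add: ext_embed_def ext_proj_def)

lemma lift_abs_ext_abs:
  assumes "w \<in> places (ext_field f)" "\<psi> \<in> w" "\<And>c. \<psi> (ext_embed f c) = \<phi> c"
  shows "ext_abs (lift_abs \<psi>)"
proof -
  interpret E: valued "ext_field f" w \<psi>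
    using assms ext_is_field[OF f_irr] by (simp add: valued_def valued_axioms_def)
  have c: "ext_proj f h \<in> carrier (ext_field f)" for h by (simp add: ext_carrier)
  have "lift_abs \<psi> h = 0 \<longleftrightarrow> f dvd h" for h
    using E.phi_eq_0[OF c, of h] ext_proj_eq_iff[of f h 0] by (simp add: lift_abs_def ext_proj_0[symmetric])
  then show ?thesis
    unfolding ext_abs_def using E.phi_nonneg[OF c] E.phi_mult[OF c c] E.phi_add[OF c c] assms(3)
    by (auto simp: lift_abs_def ext_proj_simps ext_embed_proj)
qed

lemma powr_unique: assumes "\<And>x. \<phi> x = \<phi> x powr c" shows "c = 1"
proof -
  have "ln (\<phi> t) = c * ln (\<phi> t)" using arg_cong[OF assms[of t], of ln] t_pos by (simp add: ln_powr)
  moreover have "ln (\<phi> t) < 0" using t_pos t_less by simp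
  ultimately show ?thesis by simp
qed

lemma normalized:
  assumes v: "v \<in> places base_field" "\<phi> \<in> v" and w: "w \<in> places_above f v"
  shows "normalized w \<in> w" "normalized w (ext_embed f c) = \<phi> c"
proof -
  have wp: "w \<in> places (ext_field f)" and above: "\<And>\<psi>. \<psi> \<in> w \<Longrightarrow> (\<lambda>c. \<psi> (ext_embed f c)) \<in> v"
    using w by (auto simp: places_above_def)
  obtain \<psi> where \<psi>: "\<psi> \<in> w" using placesD(1)[OF wp] by blast
  interpret B: valued base_field v \<phi> by (rule valued_base[OF v])
  interpret E: valued "ext_field f" w \<psi>
    using wp \<psi> ext_is_field[OF f_irr] by (simp add: valued_def valued_axioms_def)
  obtain c where c: "c > 0" "\<And>x. \<psi> (ext_embed f x) = \<phi> x powr c"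
    using B.v_powr[OF above[OF \<psi>]] by auto
  let ?\<psi> = "restrict (\<lambda>x. \<psi> x powr (1 / c)) (carrier (ext_field f))"
  have "?\<psi> \<in> w" using c by (intro E.powr_mem) simp
  moreover have "?\<psi> (ext_embed f x) = \<phi> x" for x
    using c by (simp add: ext_embed_proj[symmetric] powr_powr abs_nonneg)
      (simp add: ext_embed_proj ext_carrier)
  ultimately have "\<exists>\<psi>. \<psi> \<in> w \<and> (\<forall>c. \<psi> (ext_embed f c) = \<phi> c)" by blast
  then have "normalized w \<in> w \<and> (\<forall>c. normalized w (ext_embed f c) = \<phi> c)"
    unfolding normalized_def by (rule someI_ex)
  then show "normalized w \<in> w" "normalized w (ext_embed f c) = \<phi> c" for c by blast+
qed

text \<open>Through normalised representatives, places above \<open>v\<close> are extensions of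
  \<open>\<phi>\<close>, which \<open>ext_abs_bij\<close> matches with maximal ideals by taking
  centres.\<close>

lemma places_above_bij:
  assumes v: "v \<in> places base_field" "\<phi> \<in> v"
  shows "bij_betw (\<lambda>w. center (lift_abs (normalized w))) (places_above f v) primes"
  unfolding bij_betw_def
proof
  note n = normalized[OF v]
  have wp: "w \<in> places (ext_field f)" if "w \<in> places_above f v" for w
    using that by (simp add: places_above_def)
  have E: "ext_abs (lift_abs (normalized w))" if "w \<in> places_above f v" for w
    by (rule lift_abs_ext_abs[OF wp[OF that] n(1)[OF that]]) (rule n(2)[OF that])
  show "inj_on (\<lambda>w. center (lift_abs (normalized w))) (places_above f v)"
  proof (rule inj_onI)
    fix w w' assume w: "w \<in> places_above f v" "w' \<in> places_above f v"
      and "center (lift_abs (normalized w)) = center (lift_abs (normalized w'))"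
    then have eq: "lift_abs (normalized w) = lift_abs (normalized w')"
      using bij_betw_imp_inj_on[OF ext_abs_bij] E by (auto simp: inj_on_def)
    have na: "normalized w \<in> nonarch_abs (ext_field f)" "normalized w' \<in> nonarch_abs (ext_field f)"
      using placesD(2)[OF wp n(1)] w by blast+
    have "normalized w = normalized w'"
    proof (rule extensionalityI[of _ "carrier (ext_field f)"])
      fix x assume "x \<in> carrier (ext_field f)"
      then obtain h where "x = ext_proj f h" by (auto simp: ext_carrier)
      then show "normalized w x = normalized w' x" using fun_cong[OF eq, of h] by (simp add: lift_abs_def)
    qed (use na in \<open>auto simp: nonarch_abs_def\<close>)
    then have "(normalized w, normalized w') \<in> abs_equiv (ext_field f)"
      using placesD(3)[OF wp[OF w(1)] n(1)[OF w(1)]] n(1)[OF w(1)] by simp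
    then show "w = w'" using place_eqI[OF wp wp n(1) n(1)] w by blast
  qed
  show "(\<lambda>w. center (lift_abs (normalized w))) ` places_above f v = primes"
  proof (intro equalityI subsetI)
    fix P assume "P \<in> (\<lambda>w. center (lift_abs (normalized w))) ` places_above f v"
    then show "P \<in> primes" using center_prime E by blast
  next
    fix P assume P: "P \<in> primes"
    note EP = pabs_ext_abs[OF P]
    define \<psi> where "\<psi> = (\<lambda>x\<in>carrier (ext_field f). pabs P (SOME h. x = ext_proj f h))"
    have \<psi>: "\<psi> (ext_proj f h) = pabs P h" for h
    proof -
      have "ext_proj f h = ext_proj f (SOME g. ext_proj f h = ext_proj f g)" by (rule someI) (rule refl)
      then have "pabs P h = pabs P (SOME g. ext_proj f h = ext_proj f g)"
        unfolding ext_proj_eq_iff by (rule ext_absD(11)[OF EP])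
      then show ?thesis by (simp add: \<psi>_def ext_carrier)
    qed
    have na: "\<psi> \<in> nonarch_abs (ext_field f)"
      unfolding nonarch_abs_def
    proof (intro CollectI conjI ballI)
      show "\<psi> \<in> extensional (carrier (ext_field f))" by (simp add: \<psi>_def)
    next
      fix x assume "x \<in> carrier (ext_field f)"
      then obtain h where "x = ext_proj f h" by (auto simp: ext_carrier)
      then show "0 \<le> \<psi> x" "\<psi> x = 0 \<longleftrightarrow> x = \<zero>\<^bsub>ext_field f\<^esub>"
        using ext_absD(1,2)[OF EP, of h] by (simp_all add: \<psi> ext_proj_0[symmetric] ext_proj_eq_iff)
    next
      fix x y assume "x \<in> carrier (ext_field f)" "y \<in> carrier (ext_field f)"
      then obtain g h where "x = ext_proj f g" "y = ext_proj f h" by (auto simp: ext_carrier)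
      then show "\<psi> (x \<otimes>\<^bsub>ext_field f\<^esub> y) = \<psi> x * \<psi> y" "\<psi> (x \<oplus>\<^bsub>ext_field f\<^esub> y) \<le> max (\<psi> x) (\<psi> y)"
        using ext_absD(3,4)[OF EP, of g h] by (simp_all add: \<psi> flip: ext_proj_simps)
    next
      have "ext_proj f [:t:] \<noteq> \<zero>\<^bsub>ext_field f\<^esub>"
        unfolding ext_proj_0[symmetric] ext_proj_eq_iff using t_notin_fS by simp
      moreover have "\<psi> (ext_proj f [:t:]) \<noteq> 1" using ext_absD(5)[OF EP, of t] t_less by (simp add: \<psi>)
      ultimately show "\<exists>x\<in>carrier (ext_field f). x \<noteq> \<zero>\<^bsub>ext_field f\<^esub> \<and> \<psi> x \<noteq> 1"
        by (auto simp: ext_carrier)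
    qed
    define w where "w = abs_equiv (ext_field f) `` {\<psi>}"
    have wpl: "w \<in> places (ext_field f)" unfolding w_def places_def using na by (rule quotientI)
    have \<psi>w: "\<psi> \<in> w" unfolding w_def by (rule equiv_class_self[OF equiv_abs_equiv na])
    interpret W: valued "ext_field f" w \<psi>
      using wpl \<psi>w ext_is_field[OF f_irr] by (simp add: valued_def valued_axioms_def)
    have emb: "\<psi> (ext_embed f c) = \<phi> c" for c
      using ext_absD(5)[OF EP] by (simp add: ext_embed_proj \<psi>)
    interpret B: valued base_field v \<phi> by (rule valued_base[OF v])
    have above: "w \<in> places_above f v"
      unfolding places_above_def
    proof (intro CollectI conjI wpl ballI)
      fix \<theta> assume "\<theta> \<in> w"
      then obtain c where c: "c > 0" "\<And>x. x \<in> carrier (ext_field f) \<Longrightarrow> \<theta> x = \<psi> x powr c"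
        using W.v_powr by blast
      have "(\<lambda>x. \<theta> (ext_embed f x)) = (\<lambda>x. \<phi> x powr c)"
        using c emb by (auto simp: ext_embed_proj ext_carrier)
      then show "(\<lambda>x. \<theta> (ext_embed f x)) \<in> v" using B.powr_mem[OF c(1)] by (simp add: restrict_def)
    qed
    \<comment> \<open>The normalised representative is some power of \<open>\<psi>\<close>; since
      both restrict to \<open>\<phi>\<close>, the exponent is 1.\<close>
    obtain c where c: "c > 0" "\<And>x. x \<in> carrier (ext_field f) \<Longrightarrow> normalized w x = \<psi> x powr c"
      using W.v_powr[OF n(1)[OF above]] by blast
    have "\<phi> x = \<phi> x powr c" for x
      using c(2)[of "ext_embed f x"] n(2)[OF above, of x] emb[of x] by (simp add: ext_embed_proj ext_carrier)
    then have "c = 1" by (rule powr_unique)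
    then have "lift_abs (normalized w) h = pabs P h" for h
      using c(2)[of "ext_proj f h"] ext_absD(1)[OF EP, of h] by (simp add: lift_abs_def \<psi> ext_carrier)
    then have "center (lift_abs (normalized w)) = P" using pabs_center[OF P] by (simp add: center_def)
    then show "P \<in> (\<lambda>w. center (lift_abs (normalized w))) ` places_above f v" using above by blast
  qed
qed

lemma residue_size_ext:
  assumes v: "v \<in> places base_field" "\<phi> \<in> v" and w: "w \<in> places_above f v"
  shows "residue_size (ext_field f) w = idx S (center (lift_abs (normalized w)))"
proof -
  have wp: "w \<in> places (ext_field f)" using w by (simp add: places_above_def)
  note n = normalized[OF v w]
  have E: "ext_abs (lift_abs (normalized w))" by (rule lift_abs_ext_abs[OF wp n])
  interpret W: valued "ext_field f" w "normalized w"
    using wp n ext_is_field[OF f_irr] by (simp add: valued_def valued_axioms_def)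
  let ?L = "lift_abs (normalized w)"
  have sg: "sgp {h. ?L h < 1}" unfolding sgp_def
    using ext_absD(8)[OF E] by (auto intro!: le_less_trans[OF ext_absD(7)[OF E]])
  have "residue_size (ext_field f) w = card (coset {h. ?L h < 1} ` {h. ?L h \<le> 1})"
  proof (rule W.residue_size_eq[where p = "ext_proj f"])
    show "coset {h. ?L h < 1} x = coset {h. ?L h < 1} y \<longleftrightarrow>
        normalized w (ext_proj f x \<ominus>\<^bsub>ext_field f\<^esub> ext_proj f y) < 1" for x y
      unfolding coset_eq_iff[OF sg] ext_minus by (simp add: lift_abs_def)
    show "ext_proj f ` {h. ?L h \<le> 1} = {a \<in> carrier (ext_field f). normalized w a \<le> 1}"
      by (auto simp: ext_carrier lift_abs_def)
  qed
  also have "\<dots> = idx S (center ?L)"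
    using ext_abs_residue[OF E] by (simp add: idx_def quo_def)
  finally show ?thesis .
qed

text \<open>The index of a maximal ideal is a power of \<open>q\<close> with a unique exponent, as
  \<open>q > 1\<close>; this gives the definite description in \<open>residue_degree\<close> its
  meaning.\<close>

lemma residue_degree_eq:
  assumes v: "v \<in> places base_field" "\<phi> \<in> v" and w: "w \<in> places_above f v"
  shows "residue_size base_field v ^ residue_degree f w v = idx S (center (lift_abs (normalized w)))"
proof -
  let ?P = "center (lift_abs (normalized w))"
  have q: "residue_size base_field v = q" by (rule residue_size_base[OF v dvr_abs_axioms])
  have "?P \<in> primes" using bij_betwE[OF places_above_bij[OF v]] w by blast
  then obtain d where d: "idx S ?P = q ^ d" using idx_prime(3) by blast
  have "residue_degree f w v = d"
    unfolding residue_degree_def q residue_size_ext[OF v w] d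
    by (rule the_equality) (use q_gt_1 power_inject_exp[OF q_gt_1] in auto)
  then show ?thesis using d q by simp
qed

end

section \<open>From the completion to lattices over the ground field\<close>

lemma (in abelian_group) coset_eq_iff_minus:
  assumes H: "subgroup H (add_monoid G)" and xy: "x \<in> carrier G" "y \<in> carrier G"
  shows "H +> x = H +> y \<longleftrightarrow> x \<ominus> y \<in> H"
proof -
  interpret S: abelian_subgroup H G
    by (rule abelian_subgroupI3[OF _ abelian_group_axioms]) (rule additive_subgroup.intro[OF H])
  have HG: "h \<in> carrier G" if "h \<in> H" for h using that S.a_subset by blast
  have add: "h \<oplus> h' \<in> H" if "h \<in> H" "h' \<in> H" for h h' using that by (rule S.a_closed)
  have inv: "\<ominus> h \<in> H" if "h \<in> H" for h using that by (rule S.a_inv_closed)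
  show ?thesis
  proof
    assume "H +> x = H +> y"
    moreover have "x \<in> H +> x" using S.zero_closed xy by (force simp: a_r_coset_def')
    ultimately obtain h where h: "h \<in> H" "x = h \<oplus> y" by (auto simp: a_r_coset_def')
    then have "x \<ominus> y = h" using xy HG[OF h(1)] by (simp add: minus_eq a_assoc r_neg)
    then show "x \<ominus> y \<in> H" using h by simp
  next
    assume d: "x \<ominus> y \<in> H"
    have le: "H +> a \<subseteq> H +> b" if "a \<in> carrier G" "b \<in> carrier G" "a \<ominus> b \<in> H" for a b
    proof
      fix z assume "z \<in> H +> a"
      then obtain h where h: "h \<in> H" "z = h \<oplus> a" by (auto simp: a_r_coset_def')
      have "(h \<oplus> (a \<ominus> b)) \<oplus> b = z"
        using that h HG[OF h(1)] by (simp add: minus_eq a_assoc l_neg)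
      then show "z \<in> H +> b" using add[OF h(1) that(3)] by (auto simp: a_r_coset_def')
    qed
    have "y \<ominus> x = \<ominus> (x \<ominus> y)" using xy by (simp add: minus_eq minus_add a_comm)
    then have "y \<ominus> x \<in> H" using inv[OF d] by simp
    then show "H +> x = H +> y" using le[OF xy d] le[OF xy(2,1)] by blast
  qed
qed

lemma free_module_simps:
  "x \<in> carrier (free_module R n) \<longleftrightarrow> x \<in> carrier_vec n \<and> (\<forall>i<n. x $ i \<in> carrier R)"
  "x \<oplus>\<^bsub>free_module R n\<^esub> y = vec n (\<lambda>i. x $ i \<oplus>\<^bsub>R\<^esub> y $ i)"
  "\<zero>\<^bsub>free_module R n\<^esub> = vec n (\<lambda>_. \<zero>\<^bsub>R\<^esub>)"
  "c \<odot>\<^bsub>free_module R n\<^esub> x = vec n (\<lambda>i. c \<otimes>\<^bsub>R\<^esub> x $ i)"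
  by (simp_all add: free_module_def)

lemma free_module_module: assumes "cring R" shows "module R (free_module R n)"
proof -
  interpret cring R by (rule assms)
  show ?thesis
  proof (rule moduleI[OF assms])
    show "abelian_group (free_module R n)"
    proof (rule abelian_groupI)
      fix x assume "x \<in> carrier (free_module R n)"
      then show "\<exists>y\<in>carrier (free_module R n). y \<oplus>\<^bsub>free_module R n\<^esub> x = \<zero>\<^bsub>free_module R n\<^esub>"
        by (intro bexI[of _ "vec n (\<lambda>i. \<ominus>\<^bsub>R\<^esub> x $ i)"]) (auto simp: free_module_simps l_neg intro!: eq_vecI)
    qed (auto simp: free_module_simps a_ac intro!: eq_vecI)
  qed (auto simp: free_module_simps l_distr r_distr m_assoc intro!: eq_vecI)
qed

locale base_valued = dvr_abs +
  fixes v :: "('a \<Rightarrow> real) set"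
  assumes v_base: "v \<in> places (base_field :: 'a ring)" and phi_base: "\<phi> \<in> v"
begin

sublocale V: valued base_field v \<phi>
  by (rule valued_base[OF v_base phi_base])

abbreviation Ov where "Ov \<equiv> valuation_ring (base_field :: 'a ring) v"
abbreviation iota where "iota \<equiv> to_completion (base_field :: 'a ring) v"

lemma iota_simps:
  "iota a \<in> carrier Ov \<longleftrightarrow> \<phi> a \<le> 1"
  "iota a \<oplus>\<^bsub>Ov\<^esub> iota b = iota (a + b)" "iota a \<otimes>\<^bsub>Ov\<^esub> iota b = iota (a * b)"
  "iota 0 = \<zero>\<^bsub>Ov\<^esub>" "iota 1 = \<one>\<^bsub>Ov\<^esub>"
  using V.iota_Ov[of a] V.iota_hom(1,2)[of a b] V.iota_hom(3,4) by simp_all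

lemma Ov_approx:
  assumes "x \<in> carrier Ov"
  shows "\<exists>a y. \<phi> a \<le> 1 \<and> y \<in> carrier Ov \<and> x = iota a \<oplus>\<^bsub>Ov\<^esub> (iota (t ^ k) \<otimes>\<^bsub>Ov\<^esub> y)"
proof -
  have "\<phi> (t ^ k) \<le> 1" using t_pos t_less by (simp add: abs_power power_le_one)
  then show ?thesis using V.Ov_approx[OF assms, of "t ^ k"] t_nz by auto
qed

lemma iota_dvd: "y \<in> carrier Ov \<Longrightarrow> iota a = iota s \<otimes>\<^bsub>Ov\<^esub> y \<Longrightarrow> \<phi> a \<le> \<phi> s"
  using V.iota_dvd[of a s y] by simp

lemma t_power_le: "\<phi> (t ^ k) \<le> 1"
  using t_pos t_less by (simp add: abs_power power_le_one)

lemma unit_one_minus: assumes "0 < d" shows "\<phi> (inverse (1 - t ^ d)) = 1" "1 - t ^ d \<noteq> 0"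
proof -
  have "\<phi> (t ^ d) < 1" using assms t_pos t_less by (simp add: abs_power power_less_one_iff)
  then have "\<phi> (1 - t ^ d) = 1" using abs_add_eq[of "- (t ^ d)" 1] by simp
  then show "\<phi> (inverse (1 - t ^ d)) = 1" "1 - t ^ d \<noteq> 0" using abs_eq_0[of "1 - t ^ d"] by (auto simp: abs_inverse)
qed

end

text \<open>\<open>\<Theta>\<close> presents the integral vectors over \<open>k\<close> as
  \<open>M/K\<close>, with \<open>A\<close> acting as multiplication by the variable. The completed
  module is reached from \<open>M\<close> only through these coordinates.\<close>

locale lattice_transfer = base_valued +
  fixes n :: nat and A :: "'a mat" and scale :: "'a poly \<Rightarrow> 'v::ab_group_add \<Rightarrow> 'v" (infixr "*.." 75)
    and \<Theta> :: "'v \<Rightarrow> nat \<Rightarrow> 'a" and M K :: "'v set"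
  assumes A_carrier: "A \<in> carrier_mat n n"
    and A_int: "\<And>i j. i < n \<Longrightarrow> j < n \<Longrightarrow> \<phi> (A $$ (i, j)) \<le> 1"
    and module_scale: "Modules.module scale"
    and M_sub: "subring_module.sub scale S M" and K_sub: "subring_module.sub scale S K"
    and \<Theta>_add: "\<Theta> (g + h) i = \<Theta> g i + \<Theta> h i"
    and \<Theta>_scale: "\<Theta> ([:c:] *.. h) i = c * \<Theta> h i"
    and \<Theta>_X: "j < n \<Longrightarrow> \<Theta> (monom 1 1 *.. h) j = (\<Sum>i<n. \<Theta> h i * A $$ (i, j))"
    and \<Theta>_int: "h \<in> M \<Longrightarrow> i < n \<Longrightarrow> \<phi> (\<Theta> h i) \<le> 1"
    and \<Theta>_surj: "(\<And>i. i < n \<Longrightarrow> \<phi> (z i) \<le> 1) \<Longrightarrow> \<exists>h\<in>M. \<forall>i<n. \<Theta> h i = z i"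
    and \<Theta>_ker: "h \<in> M \<Longrightarrow> (\<forall>i<n. \<Theta> h i = 0) \<longleftrightarrow> h \<in> K" and KM: "K \<subseteq> M"
begin

sublocale L: subring_module scale S
  unfolding subring_module_def subring_module_axioms_def
  using module_scale S.S_0 S.S_1 S.S_diff S.S_mult by blast

abbreviation FM where "FM \<equiv> free_module Ov n"

definition G :: "'v \<Rightarrow> (nat \<Rightarrow> 'a) set vec" where
  "G h = vec n (\<lambda>i. iota (\<Theta> h i))"

definition pre :: "(nat \<Rightarrow> 'a) set vec set \<Rightarrow> 'v set" where
  "pre H = {h \<in> M. G h \<in> H}"

section \<open>Pulling invariant submodules back to lattices\<close>

lemma FM_module: "module Ov FM"
  by (rule free_module_module[OF V.Ov_cring])

sublocale F: module Ov FM
  by (rule FM_module)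

lemma \<Theta>_0: "\<Theta> 0 i = 0" and \<Theta>_minus: "\<Theta> (- h) i = - \<Theta> h i" and \<Theta>_diff: "\<Theta> (g - h) i = \<Theta> g i - \<Theta> h i"
proof -
  show 0: "\<Theta> 0 i = 0" using \<Theta>_add[of 0 0] by simp
  show m: "\<Theta> (- h) i = - \<Theta> h i" for h using \<Theta>_add[of h "- h" i] 0 by (simp add: eq_neg_iff_add_eq_0 add.commute)
  show "\<Theta> (g - h) i = \<Theta> g i - \<Theta> h i" using \<Theta>_add[of g "- h" i] m by simp
qed

lemma M_facts:
  "0 \<in> M" "g \<in> M \<Longrightarrow> h \<in> M \<Longrightarrow> g + h \<in> M" "g \<in> M \<Longrightarrow> h \<in> M \<Longrightarrow> g - h \<in> M"
  "c \<in> S \<Longrightarrow> h \<in> M \<Longrightarrow> c *.. h \<in> M"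
  using L.sub_sgp[OF M_sub] L.sub_scale[OF M_sub] by (simp_all add: sgp_0 sgp_add sgp_diff)

lemma G_carrier: "h \<in> M \<Longrightarrow> G h \<in> carrier FM"
  by (simp add: free_module_simps G_def iota_simps \<Theta>_int)

lemma G_add: "G (g + h) = G g \<oplus>\<^bsub>FM\<^esub> G h"
  by (auto simp: free_module_simps G_def iota_simps \<Theta>_add intro!: eq_vecI)

lemma G_scale: "G ([:c:] *.. h) = iota c \<odot>\<^bsub>FM\<^esub> G h"
  by (auto simp: free_module_simps G_def iota_simps \<Theta>_scale intro!: eq_vecI)

lemma G_0: "G 0 = \<zero>\<^bsub>FM\<^esub>"
  by (auto simp: free_module_simps G_def iota_simps \<Theta>_0 intro!: eq_vecI)

lemma G_diff: assumes "g \<in> M" "h \<in> M" shows "G (g - h) = G g \<ominus>\<^bsub>FM\<^esub> G h"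
proof -
  have "G (g - h) \<oplus>\<^bsub>FM\<^esub> G h = G g" by (simp flip: G_add)
  then show ?thesis
    using G_carrier[OF M_facts(3)[OF assms]] G_carrier[OF assms(2)]
    by (simp add: F.minus_eq F.a_assoc F.r_neg)
      (metis F.M.a_assoc F.M.a_inv_closed F.M.r_neg F.M.r_zero)
qed

lemma iota_sum:
  assumes "finite B" "\<And>i. i \<in> B \<Longrightarrow> \<phi> (g i) \<le> 1"
  shows "finsum Ov (\<lambda>i. iota (g i)) B = iota (sum g B)"
  using assms
proof (induction B)
  case empty
  then show ?case by (simp add: iota_simps)
next
  case (insert b B)
  then have "(\<lambda>i. iota (g i)) \<in> B \<rightarrow> carrier Ov" "iota (g b) \<in> carrier Ov" by (auto simp: iota_simps)
  then show ?case using insert by (simp add: F.R.finsum_insert iota_simps)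
qed

lemma row_action_simp: "row_action A v x = vec n (\<lambda>j. finsum Ov (\<lambda>i. x $ i \<otimes>\<^bsub>Ov\<^esub> iota (A $$ (i, j))) {..<n})"
  using A_carrier by (simp add: row_action_def)

lemma row_action_G: assumes "h \<in> M" shows "row_action A v (G h) = G (monom 1 1 *.. h)"
proof -
  have "finsum Ov (\<lambda>i. G h $ i \<otimes>\<^bsub>Ov\<^esub> iota (A $$ (i, j))) {..<n} = iota (\<Theta> (monom 1 1 *.. h) j)" if j: "j < n" for j
  proof -
    have "finsum Ov (\<lambda>i. G h $ i \<otimes>\<^bsub>Ov\<^esub> iota (A $$ (i, j))) {..<n} =
        finsum Ov (\<lambda>i. iota (\<Theta> h i * A $$ (i, j))) {..<n}"
      using \<Theta>_int[OF assms] A_int j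
      by (intro F.R.finsum_cong') (auto simp: G_def iota_simps abs_le_mult)
    also have "\<dots> = iota (\<Sum>i<n. \<Theta> h i * A $$ (i, j))"
      using \<Theta>_int[OF assms] A_int j by (intro iota_sum) (auto intro: abs_le_mult)
    finally show ?thesis using \<Theta>_X[OF j] by simp
  qed
  then show ?thesis unfolding row_action_simp G_def[of "monom 1 1 *.. h"] by (intro eq_vecI) simp_all
qed

lemma row_action_linear:
  assumes "x \<in> carrier FM" "y \<in> carrier FM" "c \<in> carrier Ov"
  shows "row_action A v x \<in> carrier FM"
    "row_action A v (x \<oplus>\<^bsub>FM\<^esub> (c \<odot>\<^bsub>FM\<^esub> y)) = row_action A v x \<oplus>\<^bsub>FM\<^esub> (c \<odot>\<^bsub>FM\<^esub> row_action A v y)"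
proof -
  have a: "iota (A $$ (i, j)) \<in> carrier Ov" if "i < n" "j < n" for i j
    using A_int[OF that] by (simp add: iota_simps)
  have x: "x $ i \<in> carrier Ov" and y: "y $ i \<in> carrier Ov" if "i < n" for i
    using assms that by (auto simp: free_module_simps)
  show "row_action A v x \<in> carrier FM"
    by (auto simp: free_module_simps row_action_simp intro!: F.R.finsum_closed F.R.m_closed a x)
  have "finsum Ov (\<lambda>i. (x \<oplus>\<^bsub>FM\<^esub> (c \<odot>\<^bsub>FM\<^esub> y)) $ i \<otimes>\<^bsub>Ov\<^esub> iota (A $$ (i, j))) {..<n} =
      finsum Ov (\<lambda>i. x $ i \<otimes>\<^bsub>Ov\<^esub> iota (A $$ (i, j))) {..<n} \<oplus>\<^bsub>Ov\<^esub>
      c \<otimes>\<^bsub>Ov\<^esub> finsum Ov (\<lambda>i. y $ i \<otimes>\<^bsub>Ov\<^esub> iota (A $$ (i, j))) {..<n}" if j: "j < n" for j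
  proof -
    have "finsum Ov (\<lambda>i. (x \<oplus>\<^bsub>FM\<^esub> (c \<odot>\<^bsub>FM\<^esub> y)) $ i \<otimes>\<^bsub>Ov\<^esub> iota (A $$ (i, j))) {..<n} =
        finsum Ov (\<lambda>i. x $ i \<otimes>\<^bsub>Ov\<^esub> iota (A $$ (i, j)) \<oplus>\<^bsub>Ov\<^esub> c \<otimes>\<^bsub>Ov\<^esub> (y $ i \<otimes>\<^bsub>Ov\<^esub> iota (A $$ (i, j)))) {..<n}"
      using a j x y assms(3) by (intro F.R.finsum_cong') (auto simp: F.R.l_distr F.R.m_assoc free_module_simps)
    also have "\<dots> = finsum Ov (\<lambda>i. x $ i \<otimes>\<^bsub>Ov\<^esub> iota (A $$ (i, j))) {..<n} \<oplus>\<^bsub>Ov\<^esub>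
        finsum Ov (\<lambda>i. c \<otimes>\<^bsub>Ov\<^esub> (y $ i \<otimes>\<^bsub>Ov\<^esub> iota (A $$ (i, j)))) {..<n}"
      using a j x y assms(3) by (intro F.R.finsum_addf) auto
    also have "finsum Ov (\<lambda>i. c \<otimes>\<^bsub>Ov\<^esub> (y $ i \<otimes>\<^bsub>Ov\<^esub> iota (A $$ (i, j)))) {..<n} =
        c \<otimes>\<^bsub>Ov\<^esub> finsum Ov (\<lambda>i. y $ i \<otimes>\<^bsub>Ov\<^esub> iota (A $$ (i, j))) {..<n}"
      using a j y assms(3) by (intro F.R.finsum_rdistr[symmetric]) auto
    finally show ?thesis .
  qed
  then show "row_action A v (x \<oplus>\<^bsub>FM\<^esub> (c \<odot>\<^bsub>FM\<^esub> y)) = row_action A v x \<oplus>\<^bsub>FM\<^esub> (c \<odot>\<^bsub>FM\<^esub> row_action A v y)"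
    unfolding free_module_simps(2)[of Ov n "row_action A v x"] free_module_simps(4)[of Ov n c "row_action A v y"]
    by (intro eq_vecI) (simp_all add: row_action_simp)
qed

lemma FM_approx:
  assumes "x \<in> carrier FM"
  shows "\<exists>h\<in>M. \<exists>y\<in>carrier FM. x = G h \<oplus>\<^bsub>FM\<^esub> (iota (t ^ k) \<odot>\<^bsub>FM\<^esub> y)"
proof -
  have "\<exists>a y. \<phi> a \<le> 1 \<and> y \<in> carrier Ov \<and> x $ i = iota a \<oplus>\<^bsub>Ov\<^esub> (iota (t ^ k) \<otimes>\<^bsub>Ov\<^esub> y)" if "i < n" for i
    using Ov_approx[of "x $ i" k] assms that by (simp add: free_module_simps)
  then obtain a y where ay: "\<And>i. i < n \<Longrightarrow> \<phi> (a i) \<le> 1" "\<And>i. i < n \<Longrightarrow> y i \<in> carrier Ov"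
    "\<And>i. i < n \<Longrightarrow> x $ i = iota (a i) \<oplus>\<^bsub>Ov\<^esub> (iota (t ^ k) \<otimes>\<^bsub>Ov\<^esub> y i)" by metis
  obtain h where h: "h \<in> M" "\<And>i. i < n \<Longrightarrow> \<Theta> h i = a i" using \<Theta>_surj[of a] ay(1) by blast
  have "x = G h \<oplus>\<^bsub>FM\<^esub> (iota (t ^ k) \<odot>\<^bsub>FM\<^esub> vec n y)"
    using assms ay h by (auto simp: free_module_simps G_def intro!: eq_vecI)
  moreover have "vec n y \<in> carrier FM" using ay by (simp add: free_module_simps)
  ultimately show ?thesis using h(1) by blast
qed

definition invariant :: "(nat \<Rightarrow> 'a) set vec set \<Rightarrow> bool" where
  "invariant H \<longleftrightarrow> submodule H Ov FM \<and> (\<forall>x\<in>H. row_action A v x \<in> H)"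

lemma invariantD:
  assumes "invariant H"
  shows "H \<subseteq> carrier FM" "\<zero>\<^bsub>FM\<^esub> \<in> H" "x \<in> H \<Longrightarrow> \<ominus>\<^bsub>FM\<^esub> x \<in> H" "x \<in> H \<Longrightarrow> y \<in> H \<Longrightarrow> x \<oplus>\<^bsub>FM\<^esub> y \<in> H"
    "c \<in> carrier Ov \<Longrightarrow> x \<in> H \<Longrightarrow> c \<odot>\<^bsub>FM\<^esub> x \<in> H" "x \<in> H \<Longrightarrow> row_action A v x \<in> H"
    "x \<in> H \<Longrightarrow> y \<in> H \<Longrightarrow> x \<ominus>\<^bsub>FM\<^esub> y \<in> H" "subgroup H (add_monoid FM)"
proof -
  have s: "submodule H Ov FM" using assms by (simp add: invariant_def)
  show 1: "H \<subseteq> carrier FM" using F.submoduleE(1)[OF s] .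
  show "subgroup H (add_monoid FM)" using s by (rule submodule.axioms(1))
  then interpret H: subgroup H "add_monoid FM" .
  show "\<zero>\<^bsub>FM\<^esub> \<in> H" using H.one_closed by simp
  show m: "x \<in> H \<Longrightarrow> \<ominus>\<^bsub>FM\<^esub> x \<in> H" for x using H.m_inv_closed[of x] by (simp add: a_inv_def)
  show a: "x \<in> H \<Longrightarrow> y \<in> H \<Longrightarrow> x \<oplus>\<^bsub>FM\<^esub> y \<in> H" for x y using H.m_closed[of x y] by simp
  show "x \<in> H \<Longrightarrow> y \<in> H \<Longrightarrow> x \<ominus>\<^bsub>FM\<^esub> y \<in> H" using a m by (simp add: a_minus_def)
  show "c \<in> carrier Ov \<Longrightarrow> x \<in> H \<Longrightarrow> c \<odot>\<^bsub>FM\<^esub> x \<in> H" using submodule.smult_closed[OF s] .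
  show "x \<in> H \<Longrightarrow> row_action A v x \<in> H" using assms by (simp add: invariant_def)
qed

text \<open>Closure under integral constants and under the variable suffices, because these generate
  \<open>S\<close> as a ring.\<close>

lemma pre_sub: assumes H: "invariant H" shows "L.sub (pre H)" "K \<subseteq> pre H" "pre H \<subseteq> M"
proof -
  note HD = invariantD[OF H]
  have diff: "x - y \<in> pre H" if "x \<in> pre H" "y \<in> pre H" for x y
    using that HD(7) M_facts(3) G_diff by (simp add: pre_def)
  have add: "x + y \<in> pre H" if "x \<in> pre H" "y \<in> pre H" for x y
    using that HD(4) M_facts(2) G_add by (simp add: pre_def)
  have 0: "0 \<in> pre H" using HD(2) M_facts(1) G_0 by (simp add: pre_def)
  have const: "[:c:] *.. x \<in> pre H" if "\<phi> c \<le> 1" "x \<in> pre H" for c x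
    using that HD(5)[of "iota c"] M_facts(4)[of "[:c:]" x] by (simp add: pre_def G_scale iota_simps)
  have X: "monom 1 1 *.. x \<in> pre H" if "x \<in> pre H" for x
    using that HD(6)[of "G x"] M_facts(4)[of "monom 1 1" x] row_action_G[of x] S_monom[of 1 1] by (simp add: pre_def)
  have "c *.. x \<in> pre H" if "c \<in> S" "x \<in> pre H" for c x
    using that(1)
  proof (induction c)
    case 0
    then show ?case using \<open>0 \<in> pre H\<close> by simp
  next
    case (pCons a c)
    have a: "\<phi> a \<le> 1" and c: "c \<in> S"
      using pCons.prems unfolding S_def by (auto dest: spec[of _ 0] spec[of _ "Suc _"])
    have "pCons a c = [:a:] + monom 1 1 * c" by (simp add: monom_Suc)
    then have "pCons a c *.. x = [:a:] *.. x + monom 1 1 *.. (c *.. x)"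
      by (simp only: L.scale_left_distrib L.scale_scale)
    then show ?case using add[OF const[OF a that(2)] X[OF pCons.IH[OF c]]] by simp
  qed
  then show "L.sub (pre H)" unfolding L.sub_def sgp_def using 0 diff by blast
  show "K \<subseteq> pre H"
  proof
    fix h assume h: "h \<in> K"
    then have "\<forall>i<n. \<Theta> h i = 0" using \<Theta>_ker KM by blast
    then have "G h = \<zero>\<^bsub>FM\<^esub>" by (auto simp: G_def free_module_simps iota_simps intro!: eq_vecI)
    then show "h \<in> pre H" using h KM HD(2) by (auto simp: pre_def)
  qed
  show "pre H \<subseteq> M" by (auto simp: pre_def)
qed

text \<open>As for ideals: two of the multiples \<open>t^k x\<close> agree modulo \<open>H\<close>,
  and \<open>1 - t^d\<close> is a unit.\<close>

lemma power_t_collision: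
  assumes H: "subgroup H (add_monoid FM)" "\<And>c x. c \<in> carrier Ov \<Longrightarrow> x \<in> H \<Longrightarrow> c \<odot>\<^bsub>FM\<^esub> x \<in> H"
    and fin: "finite (a_rcosets\<^bsub>FM\<^esub> H)" and x: "x \<in> carrier FM"
  shows "\<exists>k. iota (t ^ k) \<odot>\<^bsub>FM\<^esub> x \<in> H"
proof -
  have tx: "iota (t ^ k) \<odot>\<^bsub>FM\<^esub> x \<in> carrier FM" for k
    using x t_power_le by (simp add: iota_simps)
  have "(\<lambda>k. H +>\<^bsub>FM\<^esub> (iota (t ^ k) \<odot>\<^bsub>FM\<^esub> x)) ` UNIV \<subseteq> a_rcosets\<^bsub>FM\<^esub> H"
    using tx by (auto simp: A_RCOSETS_def')
  then have "finite (range (\<lambda>k. H +>\<^bsub>FM\<^esub> (iota (t ^ k) \<odot>\<^bsub>FM\<^esub> x)))" using fin by (rule finite_subset)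
  then have "\<not> inj (\<lambda>k. H +>\<^bsub>FM\<^esub> (iota (t ^ k) \<odot>\<^bsub>FM\<^esub> x))" using finite_imageD by blast
  then obtain a b where "a < b" and eq: "H +>\<^bsub>FM\<^esub> (iota (t ^ a) \<odot>\<^bsub>FM\<^esub> x) = H +>\<^bsub>FM\<^esub> (iota (t ^ b) \<odot>\<^bsub>FM\<^esub> x)"
    unfolding inj_def by (metis linorder_neqE_nat)
  define d where "d = b - a"
  have d: "0 < d" "b = a + d" using \<open>a < b\<close> by (simp_all add: d_def)
  have u: "\<phi> (inverse (1 - t ^ d)) = 1" "1 - t ^ d \<noteq> 0" using unit_one_minus[OF d(1)] .
  have mem: "(iota (t ^ a) \<odot>\<^bsub>FM\<^esub> x) \<ominus>\<^bsub>FM\<^esub> (iota (t ^ b) \<odot>\<^bsub>FM\<^esub> x) \<in> H"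
    using F.M.coset_eq_iff_minus[OF H(1) tx tx] eq by blast
  have le: "\<phi> (t ^ a * (1 - t ^ d)) \<le> 1"
    using abs_diff_le[of 1 1 "t ^ d"] t_power_le by (intro abs_le_mult) auto
  have "iota (t ^ a * (1 - t ^ d)) \<odot>\<^bsub>FM\<^esub> x \<oplus>\<^bsub>FM\<^esub> (iota (t ^ b) \<odot>\<^bsub>FM\<^esub> x) = iota (t ^ a) \<odot>\<^bsub>FM\<^esub> x"
  proof -
    have "t ^ a * (1 - t ^ d) + t ^ b = t ^ a" unfolding d(2) by (simp add: power_add right_diff_distrib)
    then show ?thesis
      using F.smult_l_distr[of "iota (t ^ a * (1 - t ^ d))" "iota (t ^ b)" x] le x t_power_le
      by (simp add: iota_simps)
  qed
  then have "(iota (t ^ a) \<odot>\<^bsub>FM\<^esub> x) \<ominus>\<^bsub>FM\<^esub> (iota (t ^ b) \<odot>\<^bsub>FM\<^esub> x) = iota (t ^ a * (1 - t ^ d)) \<odot>\<^bsub>FM\<^esub> x"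
  proof -
    have c: "iota (t ^ a * (1 - t ^ d)) \<odot>\<^bsub>FM\<^esub> x \<in> carrier FM" using le x by (simp add: iota_simps)
    show ?thesis
      unfolding \<open>iota (t ^ a * (1 - t ^ d)) \<odot>\<^bsub>FM\<^esub> x \<oplus>\<^bsub>FM\<^esub> (iota (t ^ b) \<odot>\<^bsub>FM\<^esub> x) = iota (t ^ a) \<odot>\<^bsub>FM\<^esub> x\<close>[symmetric]
      using c tx[of b] by (simp add: F.M.minus_eq F.M.a_assoc F.M.r_neg)
  qed
  then have "iota (inverse (1 - t ^ d)) \<odot>\<^bsub>FM\<^esub> (iota (t ^ a * (1 - t ^ d)) \<odot>\<^bsub>FM\<^esub> x) \<in> H"
    using mem u by (intro H(2)[of "iota (inverse (1 - t ^ d))"]) (simp_all add: iota_simps)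
  moreover have "iota (inverse (1 - t ^ d)) \<odot>\<^bsub>FM\<^esub> (iota (t ^ a * (1 - t ^ d)) \<odot>\<^bsub>FM\<^esub> x) = iota (t ^ a) \<odot>\<^bsub>FM\<^esub> x"
  proof -
    have "inverse (1 - t ^ d) * (t ^ a * (1 - t ^ d)) = t ^ a" using u(2) by simp
    then have "iota (inverse (1 - t ^ d)) \<otimes>\<^bsub>Ov\<^esub> iota (t ^ a * (1 - t ^ d)) = iota (t ^ a)"
      by (simp only: iota_simps(3))
    then show ?thesis
      using F.smult_assoc1[of "iota (inverse (1 - t ^ d))" "iota (t ^ a * (1 - t ^ d))" x] le x u(1)
      by (simp only: iota_simps(1))
  qed
  ultimately show ?thesis by metis
qed

lemma power_t_mono:
  assumes "\<And>c x. c \<in> carrier Ov \<Longrightarrow> x \<in> H \<Longrightarrow> c \<odot>\<^bsub>FM\<^esub> x \<in> H"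
    "x \<in> carrier FM" "iota (t ^ k) \<odot>\<^bsub>FM\<^esub> x \<in> H" "k \<le> l"
  shows "iota (t ^ l) \<odot>\<^bsub>FM\<^esub> x \<in> H"
proof -
  have "iota (t ^ l) \<odot>\<^bsub>FM\<^esub> x = iota (t ^ (l - k)) \<odot>\<^bsub>FM\<^esub> (iota (t ^ k) \<odot>\<^bsub>FM\<^esub> x)"
    using F.smult_assoc1[of "iota (t ^ (l - k))" "iota (t ^ k)" x] assms t_power_le
    by (simp add: iota_simps flip: power_add)
  then show ?thesis using assms t_power_le by (simp add: iota_simps)
qed

text \<open>Finitely many coset representatives require finitely many powers of \<open>t\<close>;
  the largest exponent serves for all vectors.\<close>

lemma power_t_absorb:
  assumes H: "invariant H" and fin: "finite (a_rcosets\<^bsub>FM\<^esub> H)"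
  shows "\<exists>k. \<forall>x\<in>carrier FM. iota (t ^ k) \<odot>\<^bsub>FM\<^esub> x \<in> H"
proof -
  note HD = invariantD[OF H]
  define r where "r D = (SOME x. x \<in> carrier FM \<and> D = H +>\<^bsub>FM\<^esub> x)" for D
  have r: "r D \<in> carrier FM \<and> D = H +>\<^bsub>FM\<^esub> r D" if "D \<in> a_rcosets\<^bsub>FM\<^esub> H" for D
  proof -
    have "\<exists>x. x \<in> carrier FM \<and> D = H +>\<^bsub>FM\<^esub> x" using that by (auto simp: A_RCOSETS_def')
    then show ?thesis unfolding r_def by (rule someI_ex)
  qed
  have "\<exists>k. iota (t ^ k) \<odot>\<^bsub>FM\<^esub> r D \<in> H" if "D \<in> a_rcosets\<^bsub>FM\<^esub> H" for D
    using power_t_collision[OF HD(8) HD(5) fin] r[OF that] by blast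
  then obtain k where k: "\<And>D. D \<in> a_rcosets\<^bsub>FM\<^esub> H \<Longrightarrow> iota (t ^ k D) \<odot>\<^bsub>FM\<^esub> r D \<in> H" by metis
  define m where "m = Max (k ` (a_rcosets\<^bsub>FM\<^esub> H))"
  have km: "k D \<le> m" if "D \<in> a_rcosets\<^bsub>FM\<^esub> H" for D
    unfolding m_def using fin that by (intro Max_ge) auto
  have "iota (t ^ m) \<odot>\<^bsub>FM\<^esub> x \<in> H" if x: "x \<in> carrier FM" for x
  proof -
    let ?D = "H +>\<^bsub>FM\<^esub> x"
    have D: "?D \<in> a_rcosets\<^bsub>FM\<^esub> H" using x by (auto simp: A_RCOSETS_def')
    have 1: "iota (t ^ m) \<odot>\<^bsub>FM\<^esub> r ?D \<in> H"
      by (rule power_t_mono[OF HD(5) _ k[OF D] km[OF D]]) (use r[OF D] in auto)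
    have d: "x \<ominus>\<^bsub>FM\<^esub> r ?D \<in> H" using F.M.coset_eq_iff_minus[OF HD(8) x] r[OF D] by blast
    have 2: "iota (t ^ m) \<odot>\<^bsub>FM\<^esub> (x \<ominus>\<^bsub>FM\<^esub> r ?D) \<in> H"
      using d t_power_le by (intro HD(5)) (auto simp: iota_simps)
    have "(x \<ominus>\<^bsub>FM\<^esub> r ?D) \<oplus>\<^bsub>FM\<^esub> r ?D = x"
      using x r[OF D] by (simp add: F.M.minus_eq F.M.a_assoc F.M.l_neg)
    then have "iota (t ^ m) \<odot>\<^bsub>FM\<^esub> x =
        iota (t ^ m) \<odot>\<^bsub>FM\<^esub> (x \<ominus>\<^bsub>FM\<^esub> r ?D) \<oplus>\<^bsub>FM\<^esub> (iota (t ^ m) \<odot>\<^bsub>FM\<^esub> r ?D)"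
      using F.smult_r_distr[of "iota (t ^ m)" "x \<ominus>\<^bsub>FM\<^esub> r ?D" "r ?D"] x r[OF D] t_power_le by (simp add: iota_simps)
    then show ?thesis using HD(4)[OF 2 1] by simp
  qed
  then show ?thesis by blast
qed

text \<open>\<open>H\<close> contains \<open>t^k\<close> times the whole module, and modulo this
  every vector comes from \<open>M\<close>; so each coset of \<open>H\<close> meets the image of
  \<open>M\<close>.\<close>

lemma pre_index:
  assumes H: "invariant H" and abs: "\<And>x. x \<in> carrier FM \<Longrightarrow> iota (t ^ k) \<odot>\<^bsub>FM\<^esub> x \<in> H"
  shows "idx M (pre H) = card (a_rcosets\<^bsub>FM\<^esub> H)" "fin M (pre H) \<longleftrightarrow> finite (a_rcosets\<^bsub>FM\<^esub> H)"
proof -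
  note HD = invariantD[OF H] and P = pre_sub[OF H]
  have eq: "coset (pre H) g = coset (pre H) h \<longleftrightarrow> H +>\<^bsub>FM\<^esub> G g = H +>\<^bsub>FM\<^esub> G h" if "g \<in> M" "h \<in> M" for g h
    unfolding coset_eq_iff[OF L.sub_sgp[OF P(1)]] F.M.coset_eq_iff_minus[OF HD(8) G_carrier[OF that(1)] G_carrier[OF that(2)]]
    using M_facts(3)[OF that] G_diff[OF that] by (simp add: pre_def)
  have "a_rcosets\<^bsub>FM\<^esub> H = (\<lambda>h. H +>\<^bsub>FM\<^esub> G h) ` M"
  proof (intro equalityI subsetI)
    fix D assume "D \<in> a_rcosets\<^bsub>FM\<^esub> H"
    then obtain x where x: "x \<in> carrier FM" "D = H +>\<^bsub>FM\<^esub> x" by (auto simp: A_RCOSETS_def')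
    obtain h y where hy: "h \<in> M" "y \<in> carrier FM" "x = G h \<oplus>\<^bsub>FM\<^esub> (iota (t ^ k) \<odot>\<^bsub>FM\<^esub> y)"
      using FM_approx[OF x(1)] by blast
    have ty: "iota (t ^ k) \<odot>\<^bsub>FM\<^esub> y \<in> carrier FM" using abs[OF hy(2)] HD(1) by blast
    have "x \<ominus>\<^bsub>FM\<^esub> G h = iota (t ^ k) \<odot>\<^bsub>FM\<^esub> y"
    proof -
      have "x = (iota (t ^ k) \<odot>\<^bsub>FM\<^esub> y) \<oplus>\<^bsub>FM\<^esub> G h" using hy ty G_carrier F.M.a_comm by simp
      then show ?thesis using ty G_carrier[OF hy(1)] by (simp add: F.M.minus_eq F.M.a_assoc F.M.r_neg)
    qed
    then have "H +>\<^bsub>FM\<^esub> x = H +>\<^bsub>FM\<^esub> G h"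
      using F.M.coset_eq_iff_minus[OF HD(8) x(1) G_carrier[OF hy(1)]] abs[OF hy(2)] by simp
    then show "D \<in> (\<lambda>h. H +>\<^bsub>FM\<^esub> G h) ` M" using x hy by blast
  qed (use G_carrier in \<open>auto simp: A_RCOSETS_def'\<close>)
  then show "idx M (pre H) = card (a_rcosets\<^bsub>FM\<^esub> H)" "fin M (pre H) \<longleftrightarrow> finite (a_rcosets\<^bsub>FM\<^esub> H)"
    unfolding idx_def fin_def quo_def using image_equipotent[of M "coset (pre H)" "\<lambda>h. H +>\<^bsub>FM\<^esub> G h"] eq by simp_all
qed

text \<open>Both submodules contain \<open>t^l\<close> times the whole module for a common
  \<open>l\<close>, and modulo this every element of \<open>H\<close> is the image of an element of
  \<open>M\<close>.\<close>

lemma pre_inj: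
  assumes H: "invariant H" "finite (a_rcosets\<^bsub>FM\<^esub> H)" and H': "invariant H'" "finite (a_rcosets\<^bsub>FM\<^esub> H')"
    and "pre H \<subseteq> pre H'"
  shows "H \<subseteq> H'"
proof
  fix x assume x: "x \<in> H"
  note HD = invariantD[OF H(1)] and HD' = invariantD[OF H'(1)]
  obtain k where k: "\<And>x. x \<in> carrier FM \<Longrightarrow> iota (t ^ k) \<odot>\<^bsub>FM\<^esub> x \<in> H" using power_t_absorb[OF H] by blast
  obtain k' where k': "\<And>x. x \<in> carrier FM \<Longrightarrow> iota (t ^ k') \<odot>\<^bsub>FM\<^esub> x \<in> H'" using power_t_absorb[OF H'] by blast
  define l where "l = max k k'"
  have xc: "x \<in> carrier FM" using x HD(1) by blast
  obtain h y where hy: "h \<in> M" "y \<in> carrier FM" "x = G h \<oplus>\<^bsub>FM\<^esub> (iota (t ^ l) \<odot>\<^bsub>FM\<^esub> y)"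
    using FM_approx[OF xc] by blast
  have l: "iota (t ^ l) \<odot>\<^bsub>FM\<^esub> y \<in> H" "iota (t ^ l) \<odot>\<^bsub>FM\<^esub> y \<in> H'"
    using power_t_mono[OF HD(5) hy(2) k[OF hy(2)], of l] power_t_mono[OF HD'(5) hy(2) k'[OF hy(2)], of l]
    by (simp_all add: l_def)
  have lc: "iota (t ^ l) \<odot>\<^bsub>FM\<^esub> y \<in> carrier FM" using l(1) HD(1) by blast
  have "x \<ominus>\<^bsub>FM\<^esub> (iota (t ^ l) \<odot>\<^bsub>FM\<^esub> y) = G h"
    using hy(3) lc G_carrier[OF hy(1)] by (simp add: F.M.minus_eq F.M.a_assoc F.M.r_neg)
  then have "G h \<in> H" using HD(7)[OF x l(1)] by simp
  then have "G h \<in> H'" using hy(1) assms(5) by (auto simp: pre_def)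
  then show "x \<in> H'" using hy(3) HD'(4)[OF _ l(2)] by simp
qed

text \<open>The counterpart of \<open>power_t_absorb\<close> for lattices over \<open>k\<close>,
  again by coinciding cosets.\<close>

lemma lattice_power_t:
  assumes N: "N \<in> L.lattices K M" shows "\<exists>k. \<forall>h\<in>M. [:t ^ k:] *.. h \<in> N"
proof -
  note ND = L.lattices_sub[OF N]
  have tS: "[:t ^ k:] \<in> S" for k using t_power_le by simp
  have single: "\<exists>k. [:t ^ k:] *.. h \<in> N" if h: "h \<in> M" for h
  proof -
    have "(\<lambda>k. coset N ([:t ^ k:] *.. h)) ` UNIV \<subseteq> quo M N"
      using M_facts(4)[OF tS h] by (auto simp: quo_def)
    then have "finite (range (\<lambda>k. coset N ([:t ^ k:] *.. h)))"
      using ND(5) unfolding fin_def by (rule finite_subset)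
    then have "\<not> inj (\<lambda>k. coset N ([:t ^ k:] *.. h))" using finite_imageD by blast
    then obtain a b where "a < b" and eq: "coset N ([:t ^ a:] *.. h) = coset N ([:t ^ b:] *.. h)"
      unfolding inj_def by (metis linorder_neqE_nat)
    define d where "d = b - a"
    have d: "0 < d" "b = a + d" using \<open>a < b\<close> by (simp_all add: d_def)
    note u = unit_one_minus[OF d(1)]
    have "[:t ^ a:] *.. h - [:t ^ b:] *.. h \<in> N" using eq coset_eq_iff[OF ND(2)] by blast
    then have "[:inverse (1 - t ^ d):] *.. ([:t ^ a:] *.. h - [:t ^ b:] *.. h) \<in> N"
      using u by (intro L.sub_scale[OF ND(1)]) auto
    moreover have "[:inverse (1 - t ^ d):] *.. ([:t ^ a:] *.. h - [:t ^ b:] *.. h) = [:t ^ a:] *.. h"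
    proof -
      have "inverse (1 - t ^ d) * (t ^ a - t ^ b) = t ^ a * (inverse (1 - t ^ d) * (1 - t ^ d))"
        unfolding d(2) by (simp only: power_add) (simp add: algebra_simps)
      also have "\<dots> = t ^ a" using u(2) by simp
      finally have "[:inverse (1 - t ^ d):] * ([:t ^ a:] - [:t ^ b:]) = [:t ^ a:]" by (simp add: mult.commute)
      then show ?thesis by (simp only: L.scale_left_diff_distrib[symmetric] L.scale_scale)
    qed
    ultimately show ?thesis by metis
  qed
  define r where "r D = (SOME h. h \<in> M \<and> D = coset N h)" for D
  have r: "r D \<in> M \<and> D = coset N (r D)" if "D \<in> quo M N" for D
  proof -
    have "\<exists>h. h \<in> M \<and> D = coset N h" using that by (auto simp: quo_def)
    then show ?thesis unfolding r_def by (rule someI_ex)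
  qed
  have "\<exists>k. [:t ^ k:] *.. r D \<in> N" if "D \<in> quo M N" for D using single r[OF that] by blast
  then obtain k where k: "\<And>D. D \<in> quo M N \<Longrightarrow> [:t ^ k D:] *.. r D \<in> N" by metis
  define m where "m = Max (k ` quo M N)"
  have km: "k D \<le> m" if "D \<in> quo M N" for D
    unfolding m_def using ND(5) that by (intro Max_ge) (auto simp: fin_def)
  have "[:t ^ m:] *.. h \<in> N" if h: "h \<in> M" for h
  proof -
    let ?D = "coset N h"
    have D: "?D \<in> quo M N" using h by (simp add: quo_def)
    have "[:t ^ (m - k ?D):] *.. ([:t ^ k ?D:] *.. r ?D) \<in> N" by (rule L.sub_scale[OF ND(1) tS k[OF D]])
    then have 1: "[:t ^ m:] *.. r ?D \<in> N" using km[OF D] by (simp flip: power_add)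
    have "h - r ?D \<in> N" using r[OF D] coset_eq_iff[OF ND(2)] by blast
    then have "[:t ^ m:] *.. (h - r ?D) \<in> N" by (rule L.sub_scale[OF ND(1) tS])
    then have "[:t ^ m:] *.. (h - r ?D) + [:t ^ m:] *.. r ?D \<in> N" using 1 by (rule sgp_add[OF ND(2)])
    then show ?thesis by (simp add: L.scale_right_diff_distrib)
  qed
  then show ?thesis by blast
qed

text \<open>The submodule is the image of \<open>N\<close> enlarged by \<open>t^k\<close> times the
  whole completed module. As \<open>t^k M\<close> lies in \<open>N\<close>, the enlargement adds
  nothing on the level of \<open>M\<close>.\<close>

lemma pre_surj:
  assumes N: "N \<in> L.lattices K M"
  shows "\<exists>H. invariant H \<and> finite (a_rcosets\<^bsub>FM\<^esub> H) \<and> pre H = N"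
proof -
  note ND = L.lattices_sub[OF N]
  obtain k where k: "\<And>h. h \<in> M \<Longrightarrow> [:t ^ k:] *.. h \<in> N" using lattice_power_t[OF N] by blast
  let ?T = "iota (t ^ k)"
  have T: "?T \<in> carrier Ov" using t_power_le by (simp add: iota_simps)
  define H where "H = {G h \<oplus>\<^bsub>FM\<^esub> (?T \<odot>\<^bsub>FM\<^esub> y) | h y. h \<in> N \<and> y \<in> carrier FM}"
  have HI: "G h \<oplus>\<^bsub>FM\<^esub> (?T \<odot>\<^bsub>FM\<^esub> y) \<in> H" if "h \<in> N" "y \<in> carrier FM" for h y
    using that by (auto simp: H_def)
  have NM: "h \<in> M" if "h \<in> N" for h using that ND(4) by blast
  have Gc: "G h \<in> carrier FM" if "h \<in> N" for h using G_carrier[OF NM[OF that]] .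
  have HE: "\<exists>h y. h \<in> N \<and> y \<in> carrier FM \<and> x = G h \<oplus>\<^bsub>FM\<^esub> (?T \<odot>\<^bsub>FM\<^esub> y)" if "x \<in> H" for x
    using that by (auto simp: H_def)
  have N0: "0 \<in> N" using sgp_0[OF ND(2)] .
  \<comment> \<open>A scalar of the completion is approximated modulo \<open>t^k\<close> by an
    integral element of \<open>k\<close>; the error is absorbed by the second summand.\<close>
  have scale: "c \<odot>\<^bsub>FM\<^esub> x \<in> H" if c: "c \<in> carrier Ov" and x: "x \<in> H" for c x
  proof -
    obtain h y where hy: "h \<in> N" "y \<in> carrier FM" "x = G h \<oplus>\<^bsub>FM\<^esub> (?T \<odot>\<^bsub>FM\<^esub> y)" using HE[OF x] by blast
    obtain a z where az: "\<phi> a \<le> 1" "z \<in> carrier Ov" "c = iota a \<oplus>\<^bsub>Ov\<^esub> (?T \<otimes>\<^bsub>Ov\<^esub> z)"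
      using Ov_approx[OF c] by blast
    have ia: "iota a \<in> carrier Ov" using az by (simp add: iota_simps)
    have "c \<odot>\<^bsub>FM\<^esub> x = c \<odot>\<^bsub>FM\<^esub> G h \<oplus>\<^bsub>FM\<^esub> (c \<odot>\<^bsub>FM\<^esub> (?T \<odot>\<^bsub>FM\<^esub> y))"
      unfolding hy(3) using c T hy(2) Gc[OF hy(1)] by (simp add: F.smult_r_distr)
    also have "c \<odot>\<^bsub>FM\<^esub> (?T \<odot>\<^bsub>FM\<^esub> y) = ?T \<odot>\<^bsub>FM\<^esub> (c \<odot>\<^bsub>FM\<^esub> y)"
      using c T hy(2) F.smult_assoc1[of c ?T y] F.smult_assoc1[of ?T c y] F.R.m_comm[of c ?T] by simp
    also have "c \<odot>\<^bsub>FM\<^esub> G h = iota a \<odot>\<^bsub>FM\<^esub> G h \<oplus>\<^bsub>FM\<^esub> (?T \<odot>\<^bsub>FM\<^esub> (z \<odot>\<^bsub>FM\<^esub> G h))"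
      unfolding az(3) using ia T az(2) Gc[OF hy(1)] by (simp add: F.smult_l_distr F.smult_assoc1)
    also have "iota a \<odot>\<^bsub>FM\<^esub> G h \<oplus>\<^bsub>FM\<^esub> (?T \<odot>\<^bsub>FM\<^esub> (z \<odot>\<^bsub>FM\<^esub> G h)) \<oplus>\<^bsub>FM\<^esub> (?T \<odot>\<^bsub>FM\<^esub> (c \<odot>\<^bsub>FM\<^esub> y)) =
        G ([:a:] *.. h) \<oplus>\<^bsub>FM\<^esub> (?T \<odot>\<^bsub>FM\<^esub> (z \<odot>\<^bsub>FM\<^esub> G h \<oplus>\<^bsub>FM\<^esub> c \<odot>\<^bsub>FM\<^esub> y))"
      using ia T az(2) Gc[OF hy(1)] hy(2) c by (simp add: F.smult_r_distr F.M.a_assoc G_scale)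
    also have "\<dots> \<in> H"
      using az(1) hy(1,2) c az(2) Gc[OF hy(1)] by (intro HI L.sub_scale[OF ND(1)]) auto
    finally show ?thesis .
  qed
  have Hsub: "H \<subseteq> carrier FM" using Gc T by (auto simp: H_def)
  have add: "x \<oplus>\<^bsub>FM\<^esub> x' \<in> H" if x: "x \<in> H" "x' \<in> H" for x x'
  proof -
    obtain h y where hy: "h \<in> N" "y \<in> carrier FM" "x = G h \<oplus>\<^bsub>FM\<^esub> (?T \<odot>\<^bsub>FM\<^esub> y)" using HE[OF x(1)] by blast
    obtain h' y' where hy': "h' \<in> N" "y' \<in> carrier FM" "x' = G h' \<oplus>\<^bsub>FM\<^esub> (?T \<odot>\<^bsub>FM\<^esub> y')" using HE[OF x(2)] by blast
    have "x \<oplus>\<^bsub>FM\<^esub> x' = G (h + h') \<oplus>\<^bsub>FM\<^esub> (?T \<odot>\<^bsub>FM\<^esub> (y \<oplus>\<^bsub>FM\<^esub> y'))"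
      unfolding hy(3) hy'(3) G_add using T hy(2) hy'(2) Gc[OF hy(1)] Gc[OF hy'(1)]
      by (simp add: F.smult_r_distr F.M.a_ac)
    then show ?thesis using HI[OF sgp_add[OF ND(2) hy(1) hy'(1)]] hy(2) hy'(2) by simp
  qed
  have zero: "\<zero>\<^bsub>FM\<^esub> \<in> H"
  proof -
    have "G 0 \<oplus>\<^bsub>FM\<^esub> (?T \<odot>\<^bsub>FM\<^esub> \<zero>\<^bsub>FM\<^esub>) = \<zero>\<^bsub>FM\<^esub>" using T by (simp add: G_0 F.smult_r_null)
    then show ?thesis using HI[OF N0 F.M.zero_closed] by simp
  qed
  have minus: "\<ominus>\<^bsub>FM\<^esub> x \<in> H" if "x \<in> H" for x
  proof -
    have xc: "x \<in> carrier FM" using that Hsub by blast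
    have "\<ominus>\<^bsub>FM\<^esub> x = (\<ominus>\<^bsub>Ov\<^esub> \<one>\<^bsub>Ov\<^esub>) \<odot>\<^bsub>FM\<^esub> x" using xc by (simp add: F.smult_l_minus)
    then show ?thesis using scale[OF _ that, of "\<ominus>\<^bsub>Ov\<^esub> \<one>\<^bsub>Ov\<^esub>"] by simp
  qed
  have sm: "submodule H Ov FM"
    by (rule F.submoduleI[OF Hsub zero]) (use minus add scale in auto)
  have inv: "row_action A v x \<in> H" if x: "x \<in> H" for x
  proof -
    obtain h y where hy: "h \<in> N" "y \<in> carrier FM" "x = G h \<oplus>\<^bsub>FM\<^esub> (?T \<odot>\<^bsub>FM\<^esub> y)" using HE[OF x] by blast
    have "row_action A v x = G (monom 1 1 *.. h) \<oplus>\<^bsub>FM\<^esub> (?T \<odot>\<^bsub>FM\<^esub> row_action A v y)"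
      unfolding hy(3) row_action_linear(2)[OF Gc[OF hy(1)] hy(2) T] row_action_G[OF NM[OF hy(1)]] ..
    then show ?thesis
      using HI[OF L.sub_scale[OF ND(1) S_monom[of 1 1] hy(1)] row_action_linear(1)[OF hy(2,2) T]] by simp
  qed
  have I: "invariant H" unfolding invariant_def using sm inv by blast
  have abs: "?T \<odot>\<^bsub>FM\<^esub> x \<in> H" if "x \<in> carrier FM" for x
    using HI[OF N0 that] that T by (simp add: G_0)
  have "pre H = N"
  proof (intro equalityI subsetI)
    fix h assume "h \<in> N"
    have "G h \<oplus>\<^bsub>FM\<^esub> (?T \<odot>\<^bsub>FM\<^esub> \<zero>\<^bsub>FM\<^esub>) = G h" using T Gc[OF \<open>h \<in> N\<close>] by (simp add: F.smult_r_null)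
    then show "h \<in> pre H" using HI[OF \<open>h \<in> N\<close> F.M.zero_closed] NM[OF \<open>h \<in> N\<close>] by (simp add: pre_def)
  next
    fix g assume "g \<in> pre H"
    then have g: "g \<in> M" "G g \<in> H" by (auto simp: pre_def)
    obtain h y where hy: "h \<in> N" "y \<in> carrier FM" "G g = G h \<oplus>\<^bsub>FM\<^esub> (?T \<odot>\<^bsub>FM\<^esub> y)" using HE[OF g(2)] by blast
    have "G (g - h) = ?T \<odot>\<^bsub>FM\<^esub> y"
    proof -
      have "G (g - h) = G g \<ominus>\<^bsub>FM\<^esub> G h" by (rule G_diff[OF g(1) NM[OF hy(1)]])
      also have "G g = (?T \<odot>\<^bsub>FM\<^esub> y) \<oplus>\<^bsub>FM\<^esub> G h" using hy(3) F.M.a_comm[of "G h" "?T \<odot>\<^bsub>FM\<^esub> y"] T hy(2) Gc[OF hy(1)] by simp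
      finally show ?thesis using T hy(2) Gc[OF hy(1)] by (simp add: F.M.minus_eq F.M.a_assoc F.M.r_neg)
    qed
    then have "iota (\<Theta> (g - h) i) = ?T \<otimes>\<^bsub>Ov\<^esub> y $ i" if "i < n" for i
      using that by (simp only: free_module_simps G_def) (drule arg_cong[where f = "\<lambda>x. vec_index x i"], simp)
    then have le: "\<phi> (\<Theta> (g - h) i) \<le> \<phi> (t ^ k)" if "i < n" for i
      using iota_dvd[of "y $ i" "\<Theta> (g - h) i" "t ^ k"] hy(2) that by (auto simp: free_module_simps)
    have "\<phi> (\<Theta> (g - h) i / t ^ k) \<le> 1" if "i < n" for i
      using le[OF that] t_pos by (simp add: abs_divide abs_power)
    \<comment> \<open>\<open>g - h\<close> is \<open>t^k\<close> times some \<open>u\<close> up to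
      the kernel \<open>K\<close>, and both parts lie in \<open>N\<close>.\<close>
    then obtain u where u: "u \<in> M" "\<And>i. i < n \<Longrightarrow> \<Theta> u i = \<Theta> (g - h) i / t ^ k"
      using \<Theta>_surj[of "\<lambda>i. \<Theta> (g - h) i / t ^ k"] by blast
    have w: "(g - h) - [:t ^ k:] *.. u \<in> M"
      using t_power_le by (intro M_facts g NM hy u) simp
    have "\<Theta> ((g - h) - [:t ^ k:] *.. u) i = 0" if "i < n" for i
      using u(2)[OF that] t_nz by (simp add: \<Theta>_diff[of "g - h"] \<Theta>_scale)
    then have "(g - h) - [:t ^ k:] *.. u \<in> N" using \<Theta>_ker[OF w] ND(3) by blast
    then have "((g - h) - [:t ^ k:] *.. u) + ([:t ^ k:] *.. u + h) \<in> N"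
      by (intro sgp_add[OF ND(2)] k u hy)
    then show "g \<in> N" by simp
  qed
  moreover from this have "finite (a_rcosets\<^bsub>FM\<^esub> H)" using pre_index(2)[OF I abs] ND(5) by simp
  ultimately show ?thesis using I by blast
qed

lemma num_invariant_submodules_eq:
  assumes "1 \<le> m"
  shows "num_invariant_submodules A v m = card {N \<in> L.lattices K M. idx M N = m}"
    "finite {H. submodule H Ov FM \<and> (\<forall>x\<in>H. row_action A v x \<in> H) \<and> card (a_rcosets\<^bsub>FM\<^esub> H) = m} \<longleftrightarrow>
     finite {N \<in> L.lattices K M. idx M N = m}"
proof -
  let ?A = "{H. invariant H \<and> card (a_rcosets\<^bsub>FM\<^esub> H) = m}"
  \<comment> \<open>A positive cardinality excludes infinite index, where \<open>card\<close> is
    0.\<close>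
  have fin: "finite (a_rcosets\<^bsub>FM\<^esub> H)" if "H \<in> ?A" for H
    using that assms card.infinite by fastforce
  have "bij_betw pre ?A {N \<in> L.lattices K M. idx M N = m}"
    unfolding bij_betw_def
  proof
    show "inj_on pre ?A"
    proof (rule inj_onI)
      fix H H' assume H: "H \<in> ?A" "H' \<in> ?A" and eq: "pre H = pre H'"
      have i: "invariant H" "invariant H'" using H by simp_all
      show "H = H'"
        using pre_inj[OF i(1) fin[OF H(1)] i(2) fin[OF H(2)]] pre_inj[OF i(2) fin[OF H(2)] i(1) fin[OF H(1)]] eq by simp
    qed
    show "pre ` ?A = {N \<in> L.lattices K M. idx M N = m}"
    proof (intro equalityI subsetI)
      fix N assume "N \<in> pre ` ?A"
      then obtain H where H: "H \<in> ?A" "N = pre H" by blast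
      then obtain k where k: "\<And>x. x \<in> carrier FM \<Longrightarrow> iota (t ^ k) \<odot>\<^bsub>FM\<^esub> x \<in> H"
        using power_t_absorb[OF _ fin[OF H(1)]] by blast
      show "N \<in> {N \<in> L.lattices K M. idx M N = m}"
        using H pre_sub[of H] pre_index[OF _ k] fin[OF H(1)] by (auto simp: L.lattices_def)
    next
      fix N assume N: "N \<in> {N \<in> L.lattices K M. idx M N = m}"
      then obtain H where H: "invariant H" "finite (a_rcosets\<^bsub>FM\<^esub> H)" "pre H = N" using pre_surj by blast
      obtain k where "\<And>x. x \<in> carrier FM \<Longrightarrow> iota (t ^ k) \<odot>\<^bsub>FM\<^esub> x \<in> H" using power_t_absorb[OF H(1,2)] by blast
      from pre_index(1)[OF H(1) this] have "H \<in> ?A" using N H by simp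
      then show "N \<in> pre ` ?A" using H(3) by blast
    qed
  qed
  moreover have "{H. submodule H Ov FM \<and> (\<forall>x\<in>H. row_action A v x \<in> H) \<and> card (a_rcosets\<^bsub>FM\<^esub> H) = m} = ?A"
    unfolding invariant_def by blast
  moreover have "num_invariant_submodules A v m =
      card {H. submodule H Ov FM \<and> (\<forall>x\<in>H. row_action A v x \<in> H) \<and> card (a_rcosets\<^bsub>FM\<^esub> H) = m}"
    unfolding num_invariant_submodules_def Let_def carrier_matD(1)[OF A_carrier] ..
  ultimately show "num_invariant_submodules A v m = card {N \<in> L.lattices K M. idx M N = m}"
    "finite {H. submodule H Ov FM \<and> (\<forall>x\<in>H. row_action A v x \<in> H) \<and> card (a_rcosets\<^bsub>FM\<^esub> H) = m} \<longleftrightarrow>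
     finite {N \<in> L.lattices K M. idx M N = m}"
    by (simp_all only: bij_betw_same_card bij_betw_finite)
qed

end

section \<open>Diagonal lattices over the ring of integral polynomials\<close>

text \<open>Stated for commutative monoids because it cuts up both the product of the Euler factors
  and the sum of the exponents.\<close>

lemma (in comm_monoid_set) partition_blocks:
  "n \<le> length mu \<Longrightarrow> F g {1..sum_list (take n mu)} =
     F (\<lambda>t. F (\<lambda>i. g (Suc (sum_list (take t mu) + i))) {..<mu ! t}) {..<n}"
proof (induction n)
  case (Suc n)
  let ?a = "sum_list (take n mu)"
  have s: "sum_list (take (Suc n) mu) = ?a + mu ! n" using Suc.prems by (simp add: take_Suc_conv_app_nth)
  have "F g {1..?a + mu ! n} = F g ({1..?a} \<union> {?a + 1..?a + mu ! n})"
    by (rule arg_cong[where f = "F g"]) auto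
  also have "\<dots> = f (F g {1..?a}) (F g {?a + 1..?a + mu ! n})"
    by (rule union_disjoint) auto
  also have "F g {?a + 1..?a + mu ! n} = F (\<lambda>i. g (Suc (?a + i))) {..<mu ! n}"
    by (rule reindex_bij_witness[of _ "\<lambda>i. Suc (?a + i)" "\<lambda>j. j - Suc ?a"]) auto
  finally show ?case using Suc by (simp add: s commute)
qed simp

lemma sum_list_take_le: "i \<le> j \<Longrightarrow> sum_list (take i mu) \<le> sum_list (take j (mu :: nat list))"
  by (metis le_add1 le_iff_add sum_list_append take_add)

lemma partition_inv_block:
  assumes "t < length mu" "i < mu ! t"
  shows "partition_inv mu (Suc (sum_list (take t mu) + i)) = Suc t"
  unfolding partition_inv_def
proof (rule Least_equality)
  show "1 \<le> Suc t \<and> Suc (sum_list (take t mu) + i) \<le> sum_list (take (Suc t) mu)"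
    using assms by (simp add: take_Suc_conv_app_nth)
next
  fix y assume y: "1 \<le> y \<and> Suc (sum_list (take t mu) + i) \<le> sum_list (take y mu)"
  then show "Suc t \<le> y" using sum_list_take_le[of y t mu] by (cases "y \<le> t") auto
qed

section \<open>Dual partitions\<close>

lemma dual_partition_length: "l \<noteq> [] \<Longrightarrow> length (dual_partition l) = l ! 0"
  by (simp add: dual_partition_def)

lemma dual_partition_nth: "l \<noteq> [] \<Longrightarrow> t < l ! 0 \<Longrightarrow> dual_partition l ! t = length (filter (\<lambda>p. t < p) l)"
  by (simp add: dual_partition_def length_filter_conv_card Suc_le_eq del: upt_Suc)

lemma partition_nth_le: "is_partition l \<Longrightarrow> j < length l \<Longrightarrow> l ! j \<le> l ! 0"
  by (cases j) (auto simp: is_partition_def sorted_wrt_iff_nth_less)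

text \<open>The boxes of the Young diagram are counted by columns and by rows.\<close>

lemma sum_list_dual:
  assumes "is_partition l" "l \<noteq> []" shows "sum_list (dual_partition l) = sum_list l"
proof -
  have "sum_list (dual_partition l) = (\<Sum>t<l ! 0. \<Sum>j<length l. of_bool (t < l ! j))"
    using assms(2) by (simp add: sum_list_sum_nth dual_partition_length dual_partition_nth
      length_filter_conv_card atLeast0LessThan of_bool_def sum.If_cases Int_def)
  also have "\<dots> = (\<Sum>j<length l. \<Sum>t<l ! 0. of_bool (t < l ! j))" by (rule sum.swap)
  also have "\<dots> = (\<Sum>j<length l. l ! j)"
  proof (rule sum.cong[OF refl])
    fix j assume "j \<in> {..<length l}"
    then have "{t. t < l ! 0 \<and> t < l ! j} = {..<l ! j}" using partition_nth_le[OF assms(1), of j] by auto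
    then show "(\<Sum>t<l ! 0. of_bool (t < l ! j)) = l ! j" by (simp add: of_bool_def sum.If_cases Int_def)
  qed
  finally show ?thesis by (simp add: sum_list_sum_nth atLeast0LessThan)
qed

context dvr_abs
begin

sublocale Vec: subring_module Polynomial.smult S
  unfolding subring_module_def subring_module_axioms_def
  using S.S_0 S.S_1 S.S_diff S.S_mult
  by (auto simp: Modules.module_def smult_add_right smult_add_left)

\<comment> \<open>For \<open>S\<close> acting by multiplication this is associativity, which loops with \<open>mult.assoc\<close>.\<close>
declare S.scale_scale [simp del]

text \<open>Vectors of length \<open>r\<close> over \<open>k[X]\<close> are encoded as polynomials
  with coefficients in \<open>k[X]\<close>, the outer variable merely indexing the coordinates. The
  lattice is the direct sum of the principal modules generated by the \<open>H j\<close>.\<close>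

definition lat :: "nat \<Rightarrow> (nat \<Rightarrow> 'k poly) \<Rightarrow> 'k poly poly set" where
  "lat r H = {h. (\<forall>j<r. coeff h j \<in> (*) (H j) ` S) \<and> (\<forall>j\<ge>r. coeff h j = 0)}"

definition vecp :: "nat \<Rightarrow> (nat \<Rightarrow> 'k poly) \<Rightarrow> 'k poly poly" where
  "vecp r c = (\<Sum>i<r. monom (c i) i)"

section \<open>Coordinatewise arithmetic of diagonal lattices\<close>

lemma coeff_vecp: "coeff (vecp r c) j = (if j < r then c j else 0)"
  by (simp add: vecp_def coeff_sum coeff_monom)

lemma multiples_sgp: "a \<in> (*) H ` S \<Longrightarrow> b \<in> (*) H ` S \<Longrightarrow> a - b \<in> (*) H ` S"
  "a \<in> (*) H ` S \<Longrightarrow> b \<in> (*) H ` S \<Longrightarrow> a + b \<in> (*) H ` S"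
  by (auto simp flip: right_diff_distrib distrib_left intro: S.S_diff S.S_add)

lemma multiples_scale: "c \<in> S \<Longrightarrow> a \<in> (*) H ` S \<Longrightarrow> c * a \<in> (*) H ` S"
  by (auto simp: mult.left_commute intro: S.S_mult)

lemma multiples_0: "0 \<in> (*) H ` S"
  using S.S_0 by (auto intro: image_eqI[of _ _ 0])

lemma lat_sub: "Vec.sub (lat r H)"
  unfolding Vec.sub_def sgp_def lat_def
  by (auto simp: multiples_0 intro!: multiples_sgp multiples_scale)

lemma lat_mono: "(\<And>j. j < r \<Longrightarrow> H' j \<in> (*) (H j) ` S) \<Longrightarrow> lat r H' \<subseteq> lat r H"
proof -
  assume a: "\<And>j. j < r \<Longrightarrow> H' j \<in> (*) (H j) ` S"
  have "x \<in> (*) (H j) ` S" if j: "j < r" and x: "x \<in> (*) (H' j) ` S" for j x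
  proof -
    obtain c where "c \<in> S" "x = H' j * c" using x by blast
    then show ?thesis using multiples_scale[OF _ a[OF j]] by (simp add: mult.commute)
  qed
  then show "lat r H' \<subseteq> lat r H" by (simp add: lat_def subset_iff)
qed

lemma lat_cong: "(\<And>j. j < r \<Longrightarrow> H j = H' j) \<Longrightarrow> lat r H = lat r H'"
  by (auto simp: lat_def)

text \<open>In each coordinate the right-hand side is \<open>F S + f H S\<close>. On
  \<open>T\<close> the first module lies in the second; off \<open>T\<close> the cofactor of
  \<open>H\<close> in \<open>F\<close> is comaximal with \<open>f\<close>, so the sum is all of
  \<open>H S\<close>.\<close>

lemma lat_layer:
  assumes f: "f \<in> S"
    and T: "\<And>j. j < r \<Longrightarrow> j \<in> T \<Longrightarrow> \<exists>G\<in>S. F j = H j * f * G"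
    and nT: "\<And>j. j < r \<Longrightarrow> j \<notin> T \<Longrightarrow> \<exists>G\<in>S. F j = H j * G \<and> (\<exists>u\<in>S. \<exists>w\<in>S. u * f + w * G = 1)"
  shows "lat r (\<lambda>j. if j \<in> T then f * H j else H j) = lat r F \<uplus> Polynomial.smult f ` lat r H"
    (is "lat r ?H' = _")
proof
  show "lat r F \<uplus> Polynomial.smult f ` lat r H \<subseteq> lat r ?H'"
  proof (rule sadd_least[OF Vec.sub_sgp[OF lat_sub]])
    show "lat r F \<subseteq> lat r ?H'"
    proof (rule lat_mono)
      fix j assume "j < r"
      then obtain G where G: "G \<in> S" "F j = ?H' j * G"
        using T[of j] nT[of j] by (cases "j \<in> T") (auto simp: mult.commute[of f])
      then show "F j \<in> (*) (?H' j) ` S" by blast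
    qed
    show "Polynomial.smult f ` lat r H \<subseteq> lat r ?H'"
    proof
      fix g assume "g \<in> Polynomial.smult f ` lat r H"
      then obtain h where h: "h \<in> lat r H" "g = Polynomial.smult f h" by blast
      have "f * coeff h j \<in> (*) (?H' j) ` S" if "j < r" for j
      proof -
        obtain c where c: "c \<in> S" "coeff h j = H j * c" using h(1) \<open>j < r\<close> by (auto simp: lat_def)
        have e: "f * coeff h j = (f * H j) * c" "f * coeff h j = H j * (f * c)" "f * c \<in> S"
          unfolding c(2) by (rule mult.assoc[symmetric], rule mult.left_commute, rule S.S_mult[OF f c(1)])
        have "f * coeff h j \<in> (*) (f * H j) ` S" unfolding e(1) using \<open>c \<in> S\<close> by (rule imageI)
        moreover have "f * coeff h j \<in> (*) (H j) ` S" unfolding e(2) using e(3) by (rule imageI)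
        ultimately show ?thesis by (cases "j \<in> T") (simp_all only: if_True if_False)
      qed
      moreover have "coeff h j = 0" if "j \<ge> r" for j using h(1) that by (simp add: lat_def)
      ultimately show "g \<in> lat r ?H'" unfolding lat_def mem_Collect_eq h(2) coeff_smult by simp
    qed
  qed
  show "lat r ?H' \<subseteq> lat r F \<uplus> Polynomial.smult f ` lat r H"
  proof
    fix h assume h: "h \<in> lat r ?H'"
    have "\<exists>a b. a \<in> (*) (F j) ` S \<and> b \<in> (*) (H j) ` S \<and> coeff h j = a + f * b" if j: "j < r" for j
    proof -
      obtain c where c: "c \<in> S" "coeff h j = ?H' j * c" using h \<open>j < r\<close> by (auto simp: lat_def)
      show ?thesis
      proof (cases "j \<in> T")
        case True
        have "coeff h j = 0 + f * (H j * c)" unfolding c(2) by (simp add: True mult.assoc)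
        then show ?thesis using imageI[OF c(1), of "(*) (H j)"] multiples_0 by metis
      next
        case False
        obtain G u w where G: "G \<in> S" "F j = H j * G" "u \<in> S" "w \<in> S" "u * f + w * G = 1"
          using nT[OF j False] by blast
        have "coeff h j = (u * f + w * G) * (H j * c)" using c(2) False G(5) by simp
        also have "\<dots> = F j * (w * c) + f * (H j * (u * c))" by (simp add: G(2) algebra_simps)
        finally show ?thesis
          using imageI[OF S.S_mult[OF G(4) c(1)], of "(*) (F j)"] imageI[OF S.S_mult[OF G(3) c(1)], of "(*) (H j)"] by metis
      qed
    qed
    then obtain a b where ab: "\<And>j. j < r \<Longrightarrow> a j \<in> (*) (F j) ` S" "\<And>j. j < r \<Longrightarrow> b j \<in> (*) (H j) ` S"
      "\<And>j. j < r \<Longrightarrow> coeff h j = a j + f * b j" by metis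
    have "h = vecp r a + Polynomial.smult f (vecp r b)"
      by (rule poly_eqI) (use ab h in \<open>auto simp: coeff_vecp lat_def\<close>)
    moreover have "vecp r a \<in> lat r F" "vecp r b \<in> lat r H" using ab by (auto simp: lat_def coeff_vecp)
    ultimately show "h \<in> lat r F \<uplus> Polynomial.smult f ` lat r H" by (auto intro: saddI)
  qed
qed

lemma lat_add_line:
  assumes f: "f \<in> S" and U: "U \<subseteq> T" "i \<in> T - U" "i < r"
  shows "lat r (\<lambda>j. if j \<in> T - insert i U then f * H j else H j) =
    lat r (\<lambda>j. if j \<in> T - U then f * H j else H j) \<uplus> Vec.spn (monom (H i) i)"
    (is "lat r ?A = lat r ?B \<uplus> _")
proof
  show "lat r ?B \<uplus> Vec.spn (monom (H i) i) \<subseteq> lat r ?A"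
  proof (rule sadd_least[OF Vec.sub_sgp[OF lat_sub]])
    show "lat r ?B \<subseteq> lat r ?A"
    proof (rule lat_mono)
      fix j :: nat
      have "H j \<in> (*) (H j) ` S" "f * H j \<in> (*) (H j) ` S" "f * H j \<in> (*) (f * H j) ` S"
        using imageI[OF S.S_1, of "(*) (H j)"] imageI[OF f, of "(*) (H j)"] imageI[OF S.S_1, of "(*) (f * H j)"]
        by (simp_all only: mult_1_right mult.commute[of "H j" f])
      then show "?B j \<in> (*) (?A j) ` S" by (cases "j \<in> T - U"; cases "j = i") auto
    qed
    have "H i \<in> (*) (?A i) ` S" using S.S_1 by (auto intro: image_eqI[of _ _ 1])
    then have "monom (H i) i \<in> lat r ?A" using U(3) multiples_0 by (auto simp: lat_def coeff_monom)
    then show "Vec.spn (monom (H i) i) \<subseteq> lat r ?A" by (rule Vec.spn_least[OF lat_sub])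
  qed
  show "lat r ?A \<subseteq> lat r ?B \<uplus> Vec.spn (monom (H i) i)"
  proof
    fix h assume h: "h \<in> lat r ?A"
    then obtain c where c: "c \<in> S" "coeff h i = H i * c" using U by (auto simp: lat_def)
    define g where "g = h - Polynomial.smult c (monom (H i) i)"
    have gi: "coeff g i = 0" using c by (simp add: g_def mult.commute)
    have gj: "coeff g j = coeff h j" if "j \<noteq> i" for j using that by (simp add: g_def coeff_monom)
    have "coeff g j \<in> (*) (?B j) ` S" if j: "j < r" for j
    proof (cases "j = i")
      case True
      show ?thesis unfolding True gi by (rule multiples_0)
    next
      case False
      have AB: "?A j = ?B j" using False by simp
      have "coeff h j \<in> (*) (?A j) ` S" using h j by (simp add: lat_def)
      then show ?thesis unfolding AB gj[OF False] .
    qed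
    moreover have "coeff g j = 0" if "j \<ge> r" for j
      using h that U(3) gj[of j] by (simp add: lat_def)
    ultimately have "g \<in> lat r ?B" by (simp add: lat_def)
    moreover have "Polynomial.smult c (monom (H i) i) \<in> Vec.spn (monom (H i) i)" using c by (auto simp: Vec.spn_def)
    moreover have "h = g + Polynomial.smult c (monom (H i) i)" by (simp add: g_def)
    ultimately show "h \<in> lat r ?B \<uplus> Vec.spn (monom (H i) i)" by (metis saddI)
  qed
qed

text \<open>The coordinates in \<open>T\<close> are divided by \<open>f\<close> one after the other,
  each contributing one free generator.\<close>

lemma lat_free:
  assumes f: "f \<in> S" and T: "T \<subseteq> {..<r}" and H: "\<And>j. j \<in> T \<Longrightarrow> H j \<noteq> 0"
  shows "Vec.free f (lat r (\<lambda>j. if j \<in> T then f * H j else H j)) (card T) (lat r H)"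
proof -
  have "finite T" using T finite_subset by blast
  have "Vec.free f (lat r (\<lambda>j. if j \<in> T then f * H j else H j)) (card U)
      (lat r (\<lambda>j. if j \<in> T - U then f * H j else H j))" if "U \<subseteq> T" for U
    using finite_subset[OF that \<open>finite T\<close>] that
  proof (induction U)
    case empty
    then show ?case by (simp add: Vec.free_0)
  next
    case (insert i U)
    let ?B = "\<lambda>j. if j \<in> T - U then f * H j else H j"
    have i: "i \<in> T - U" "i < r" using insert T by auto
    have "Vec.free f (lat r (\<lambda>j. if j \<in> T then f * H j else H j)) (Suc (card U)) (lat r ?B \<uplus> Vec.spn (monom (H i) i))"
    proof (rule Vec.free_Suc)
      show "Vec.free f (lat r (\<lambda>j. if j \<in> T then f * H j else H j)) (card U) (lat r ?B)" using insert by simp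
      have "f * H i \<in> (*) (f * H i) ` S" using S.S_1 by (auto intro: image_eqI[of _ _ 1])
      then show "Polynomial.smult f (monom (H i) i) \<in> lat r (\<lambda>j. if j \<in> T then f * H j else H j)"
        using i multiples_0 by (auto simp: lat_def smult_monom coeff_monom)
      fix c assume c: "c \<in> S" "Polynomial.smult c (monom (H i) i) \<in> lat r ?B"
      then have "c * H i \<in> (*) (f * H i) ` S" using i by (auto simp: lat_def smult_monom dest!: spec[of _ i])
      then show "c \<in> (*) f ` S" using H[of i] i by auto
    qed
    then show ?case using lat_add_line[OF f _ i] insert by simp
  qed
  from this[of T] show ?thesis by simp
qed

text \<open>One phase treats a single \<open>f\<close>: the generators pass from \<open>H j\<close>
  to \<open>H j * f ^ e j\<close>, by one power of \<open>f\<close> per layer as long as any is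
  left. What then remains is comaximal with \<open>f\<close>, so the remaining sum has no second
  weight and the next polynomial can start from it.\<close>

lemma lat_phase:
  assumes f: "f \<in> S" "S.pid f" "f \<noteq> 0"
    and H: "\<And>j. j < r \<Longrightarrow> H j \<noteq> 0"
    and F: "\<And>j. j < r \<Longrightarrow> \<exists>G\<in>S. F j = H j * f ^ e j * G \<and> (\<exists>u\<in>S. \<exists>w\<in>S. u * f + w * G = 1)"
    and e: "\<And>j. j < r \<Longrightarrow> e j \<le> n"
  defines "\<mu> \<equiv> \<lambda>t. card {j. j < r \<and> t < e j}"
  shows "esum (Vec.lattices (lat r F) (lat r H)) (\<lambda>N. wt s (idx (lat r H) N)) =
    (\<Prod>t<n. \<Prod>i<\<mu> t. S.ideal_zeta f (real (Suc t) * s - real (\<Sum>t'<t. \<mu> t') - real i)) *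
    esum (Vec.lattices (lat r F) (lat r (\<lambda>j. H j * f ^ e j))) (\<lambda>N. wt s (idx (lat r (\<lambda>j. H j * f ^ e j)) N))"
proof -
  define Ht where "Ht t j = H j * f ^ min t (e j)" for t j
  \<comment> \<open>Closed form of the recursion that replaces the second exponent \<open>t\<close>
    by \<open>m + t - s\<close>, started at 0.\<close>
  define \<tau> where "\<tau> t = real (\<Sum>t'<t. \<mu> t') - real t * s" for t
  have next_H: "lat r (Ht (Suc t)) = lat r (\<lambda>j. if j \<in> {j. j < r \<and> t < e j} then f * Ht t j else Ht t j)" for t
    by (rule lat_cong) (auto simp: Ht_def min_def le_Suc_eq)
  have layer: "lat r (Ht (Suc t)) = lat r F \<uplus> Polynomial.smult f ` lat r (Ht t)" for t
    unfolding next_H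
  proof (rule lat_layer[OF f(1)])
    fix j assume j: "j < r" "j \<in> {j. j < r \<and> t < e j}"
    obtain G where G: "G \<in> S" "F j = H j * f ^ e j * G" using F[OF j(1)] by blast
    have "f ^ e j = f ^ (Suc t + (e j - Suc t))" using j by simp
    also have "\<dots> = f ^ t * f * f ^ (e j - Suc t)" by (simp only: power_add power_Suc2)
    finally have "f ^ e j = f ^ t * f * f ^ (e j - Suc t)" .
    then have "F j = Ht t j * f * (f ^ (e j - Suc t) * G)" using j G(2) by (simp add: Ht_def mult_ac)
    then show "\<exists>G\<in>S. F j = Ht t j * f * G" using S.S_mult[OF S_power[OF f(1)] G(1)] by blast
  next
    fix j assume j: "j < r" "j \<notin> {j. j < r \<and> t < e j}"
    then have "Ht t j = H j * f ^ e j" by (simp add: Ht_def min_def)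
    then show "\<exists>G\<in>S. F j = Ht t j * G \<and> (\<exists>u\<in>S. \<exists>w\<in>S. u * f + w * G = 1)" using F[OF j(1)] by simp
  qed
  have free: "Vec.free f (lat r (Ht (Suc t))) (\<mu> t) (lat r (Ht t))" for t
    unfolding next_H \<mu>_def by (rule lat_free[OF f(1)]) (use H f(3) in \<open>auto simp: Ht_def\<close>)
  have step: "Vec.layer_sum f (lat r F) (lat r (Ht t)) s (\<tau> t) =
      (\<Prod>i<\<mu> t. S.ideal_zeta f (real (Suc t) * s - real (\<Sum>t'<t. \<mu> t') - real i)) *
      Vec.layer_sum f (lat r F) (lat r (Ht (Suc t))) s (\<tau> (Suc t))" for t
  proof -
    have "real (\<mu> t) + \<tau> t - s = \<tau> (Suc t)" "s - \<tau> t = real (Suc t) * s - real (\<Sum>t'<t. \<mu> t')"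
      by (simp_all add: \<tau>_def algebra_simps)
    then show ?thesis using Vec.layer_sum_step[OF f(1,2) lat_sub lat_sub layer free, where s = s and t = "\<tau> t"] by simp
  qed
  have all: "Vec.layer_sum f (lat r F) (lat r (Ht 0)) s (\<tau> 0) =
      (\<Prod>t<m. \<Prod>i<\<mu> t. S.ideal_zeta f (real (Suc t) * s - real (\<Sum>t'<t. \<mu> t') - real i)) *
      Vec.layer_sum f (lat r F) (lat r (Ht m)) s (\<tau> m)" for m
  proof (induction m)
    case (Suc m)
    show ?case unfolding Suc.IH step[of m] by (simp only: prod.lessThan_Suc mult.assoc)
  qed simp
  have H0: "lat r (Ht 0) = lat r H" by (rule lat_cong) (simp add: Ht_def)
  have Hn: "lat r (Ht n) = lat r (\<lambda>j. H j * f ^ e j)" by (rule lat_cong) (simp add: Ht_def e min_absorb2)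
  \<comment> \<open>No exponent exceeds \<open>n\<close>, so one more layer changes nothing; by
    \<open>layer\<close> this is the stability that removes the second weight.\<close>
  have "lat r (Ht (Suc n)) = lat r (Ht n)" by (rule lat_cong) (simp add: Ht_def e min_absorb2 le_SucI)
  then have stable: "lat r (Ht n) = lat r F \<uplus> Polynomial.smult f ` lat r (Ht n)" using layer[of n] by simp
  have FH: "lat r F \<subseteq> lat r H"
  proof (rule lat_mono)
    fix j assume "j < r"
    then obtain G where "G \<in> S" "F j = H j * f ^ e j * G" using F by blast
    then show "F j \<in> (*) (H j) ` S" using S.S_mult[OF S_power[OF f(1)]] by (auto simp: mult.assoc)
  qed
  have \<tau>0: "\<tau> 0 = 0" by (simp add: \<tau>_def)
  show ?thesis
    using all[of n] unfolding H0 \<tau>0 Vec.layer_sum_0[OF lat_sub f(1) FH]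
      Vec.layer_sum_stable[OF lat_sub lat_sub stable]
    unfolding Hn .
qed

end

text \<open>One entry for each companion block, in the order of the block diagonal matrix.\<close>

definition blocks :: "('a \<times> nat list) list \<Rightarrow> ('a \<times> nat) list" where
  "blocks ed = concat (map (\<lambda>(f, l). map (Pair f) l) ed)"

lemma set_blocks: "(f, p) \<in> set (blocks ed) \<longleftrightarrow> (\<exists>l. (f, l) \<in> set ed \<and> p \<in> set l)"
  by (auto simp: blocks_def)

lemma filter_blocks_other: "f \<notin> fst ` set ed \<Longrightarrow> filter (\<lambda>(g, p). g = f \<and> P p) (blocks ed) = []"
  by (auto simp: filter_empty_conv set_blocks rev_image_eqI)

lemma filter_blocks:
  "distinct (map fst ed) \<Longrightarrow> (f, l) \<in> set ed \<Longrightarrow>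
    length (filter (\<lambda>(g, p). g = f \<and> P p) (blocks ed)) = length (filter P l)"
proof (induction ed)
  case (Cons x ed)
  obtain g m where x: "x = (g, m)" by (cases x)
  have b: "blocks ((g, m) # ed) = map (Pair g) m @ blocks ed" by (simp add: blocks_def)
  show ?case
  proof (cases "g = f")
    case True
    then have "f \<notin> fst ` set ed" "m = l" using Cons.prems by (auto simp: x rev_image_eqI)
    then show ?thesis using filter_blocks_other[of f ed P] True unfolding x b by (simp add: filter_map o_def)
  next
    case False
    then show ?thesis using Cons unfolding x b by (simp add: x filter_map o_def)
  qed
qed simp

locale diagonal_model = dvr_abs +
  fixes ed :: "('a poly \<times> nat list) list"
  assumes ed_distinct: "distinct (map fst ed)"
    and ed_partition: "(f, l) \<in> set ed \<Longrightarrow> is_partition l \<and> l \<noteq> []"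
    and ed_poly: "(f, l) \<in> set ed \<Longrightarrow> dvr_poly \<phi> t f"
    and ed_comaximal: "(f, l) \<in> set ed \<Longrightarrow> (g, m) \<in> set ed \<Longrightarrow> f \<noteq> g \<Longrightarrow>
      \<exists>u\<in>S. \<exists>w\<in>S. u * f + w * g = 1"
begin

abbreviation rk where "rk \<equiv> length (blocks ed)"
abbreviation bp where "bp j \<equiv> fst (blocks ed ! j)"
abbreviation be where "be j \<equiv> snd (blocks ed ! j)"

lemma block: assumes "j < rk" shows "\<exists>l. (bp j, l) \<in> set ed \<and> be j \<in> set l"
proof -
  have "(bp j, be j) \<in> set (blocks ed)" using nth_mem[OF assms] by simp
  then show ?thesis by (simp only: set_blocks)
qed

lemma ed_S: "(f, l) \<in> set ed \<Longrightarrow> f \<in> S" and ed_monic: "(f, l) \<in> set ed \<Longrightarrow> Polynomial.lead_coeff f = 1"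
  using ed_poly by (auto simp: dvr_poly_def dvr_poly_axioms_def)

lemma comaximal_power:
  assumes "g \<in> S" "u \<in> S" "w \<in> S" "u * f + w * g = 1" "f \<in> S"
  shows "\<exists>u\<in>S. \<exists>w\<in>S. u * f + w * g ^ p = 1"
proof (induction p)
  case 0
  have "0 * f + 1 * g ^ 0 = 1" by simp
  then show ?case using S.S_0 S.S_1 by blast
next
  case (Suc p)
  then obtain a b where ab: "a \<in> S" "b \<in> S" "a * f + b * g ^ p = 1" by blast
  have "(a + b * g ^ p * u) * f + (b * w) * g ^ Suc p = a * f + b * g ^ p * (u * f + w * g)"
    by (simp only: power_Suc distrib_right distrib_left mult_ac add_ac)
  also have "\<dots> = 1" using ab assms(4) by simp
  finally show ?case
    using S.S_add[OF ab(1) S.S_mult[OF S.S_mult[OF ab(2) S_power[OF assms(1)]] assms(2)]] S.S_mult[OF ab(2) assms(3)] by blast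
qed

text \<open>\<open>D\<close> collects the polynomials already treated: their powers have been split
  off, and the coordinates of all others are still those of the full lattice.\<close>

definition stage :: "'a poly set \<Rightarrow> nat \<Rightarrow> 'a poly" where
  "stage D j = (if bp j \<in> D then bp j ^ be j else 1)"

definition lattice_sum :: "'a poly set \<Rightarrow> real \<Rightarrow> ennreal" where
  "lattice_sum D s = esum (Vec.lattices (lat rk (\<lambda>j. bp j ^ be j)) (lat rk (stage D)))
     (\<lambda>N. wt s (idx (lat rk (stage D)) N))"

text \<open>\<open>lat_phase\<close> for the blocks of \<open>f\<close>. The rank of layer
  \<open>t\<close>, counted from 0, is the number of blocks of \<open>f\<close> with exponent above
  \<open>t\<close>, a part of the dual partition.\<close>

lemma lattice_sum_insert:
  assumes fl: "(f, l) \<in> set ed" and D: "f \<notin> D"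
  shows "lattice_sum D s =
    (\<Prod>j = 1..sum_list l. S.ideal_zeta f (real (partition_inv (dual_partition l) j) * s - real j + 1)) *
    lattice_sum (insert f D) s"
proof -
  let ?mu = "dual_partition l"
  have l: "is_partition l" "l \<noteq> []" using ed_partition[OF fl] by auto
  interpret f: dvr_poly \<phi> t f by (rule ed_poly[OF fl])
  define e where "e j = (if bp j = f then be j else 0)" for j
  have stage_nz: "stage D j \<noteq> 0" if j: "j < rk" for j
  proof -
    obtain m where "(bp j, m) \<in> set ed" using block[OF j] by blast
    then have "bp j \<noteq> 0" using ed_monic by fastforce
    then show ?thesis by (simp add: stage_def)
  qed
  have e_le: "e j \<le> l ! 0" if "j < rk" for j
  proof (cases "bp j = f")
    case True
    then obtain m where m: "(f, m) \<in> set ed" "be j \<in> set m" using block[OF \<open>j < rk\<close>] by auto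
    then have "m = l" using fl ed_distinct by (metis eq_key_imp_eq_value)
    then obtain i where "i < length l" "l ! i = be j" using m(2) by (auto simp: in_set_conv_nth)
    then show ?thesis using partition_nth_le[OF l(1), of i] True by (simp add: e_def)
  qed (simp add: e_def)
  have F: "\<exists>G\<in>S. bp j ^ be j = stage D j * f ^ e j * G \<and> (\<exists>u\<in>S. \<exists>w\<in>S. u * f + w * G = 1)"
    if j: "j < rk" for j
  proof -
    have one: "\<exists>u\<in>S. \<exists>w\<in>S. u * f + w * 1 = 1"
      by (intro bexI[of _ 0] bexI[of _ 1] S.S_0 S.S_1) simp
    obtain m where m: "(bp j, m) \<in> set ed" using block[OF j] by blast
    consider "bp j = f" | "bp j \<in> D" "bp j \<noteq> f" | "bp j \<notin> D" "bp j \<noteq> f" by blast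
    then show ?thesis
    proof cases
      \<comment> \<open>A block of another polynomial not yet treated contains no power of
        \<open>f\<close>; its whole power is the cofactor comaximal with \<open>f\<close>.\<close>
      case 3
      obtain u w where "u \<in> S" "w \<in> S" "u * f + w * bp j = 1"
        using ed_comaximal[OF fl m] 3 by auto
      then have "\<exists>u\<in>S. \<exists>w\<in>S. u * f + w * bp j ^ be j = 1"
        by (rule comaximal_power[OF ed_S[OF m] _ _ _ ed_S[OF fl]])
      then show ?thesis using 3 S_power[OF ed_S[OF m]] by (intro bexI[of _ "bp j ^ be j"]) (auto simp: stage_def e_def)
    next
      case 1
      then have "bp j ^ be j = stage D j * f ^ e j * 1" using D by (simp add: stage_def e_def)
      then show ?thesis using one S.S_1 by metis
    next
      case 2
      then have "bp j ^ be j = stage D j * f ^ e j * 1" by (simp add: stage_def e_def)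
      then show ?thesis using one S.S_1 by metis
    qed
  qed
  have mu: "card {j. j < rk \<and> t < e j} = ?mu ! t" if "t < l ! 0" for t
  proof -
    have "{j. j < rk \<and> t < e j} = {j. j < rk \<and> (case blocks ed ! j of (g, p) \<Rightarrow> g = f \<and> t < p)}"
      by (auto simp: e_def split_beta split: if_splits)
    then show ?thesis
      using filter_blocks[OF ed_distinct fl, of "\<lambda>p. t < p"] dual_partition_nth[OF l(2) that]
      by (simp add: length_filter_conv_card)
  qed
  have stage': "lat rk (\<lambda>j. stage D j * f ^ e j) = lat rk (stage (insert f D))"
    by (rule lat_cong) (use D in \<open>auto simp: stage_def e_def\<close>)
  have sums: "(\<Sum>t'<t. card {j. j < rk \<and> t' < e j}) = sum_list (take t ?mu)" if "t < l ! 0" for t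
  proof -
    have "(\<Sum>t'<t. card {j. j < rk \<and> t' < e j}) = (\<Sum>t'<t. ?mu ! t')"
      using that by (intro sum.cong refl mu) auto
    then show ?thesis using that by (simp add: sum_list_sum_nth dual_partition_length[OF l(2)] atLeast0LessThan)
  qed
  \<comment> \<open>Counting consecutively, factor \<open>i\<close> of layer \<open>t\<close> has
    number \<open>j = 1 + i\<close> plus the ranks of the earlier layers. Hence the coefficient
    \<open>t + 1\<close> of \<open>s\<close> is the inverse of the dual partition at
    \<open>j\<close>, and the shift is \<open>1 - j\<close>.\<close>
  have "(\<Prod>j = 1..sum_list l. S.ideal_zeta f (real (partition_inv ?mu j) * s - real j + 1)) =
      (\<Prod>t<l ! 0. \<Prod>i<?mu ! t. S.ideal_zeta f
        (real (partition_inv ?mu (Suc (sum_list (take t ?mu) + i))) * s -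
         real (Suc (sum_list (take t ?mu) + i)) + 1))"
    using prod.partition_blocks[where n = "l ! 0" and mu = "?mu" and
      g = "\<lambda>j. S.ideal_zeta f (real (partition_inv ?mu j) * s - real j + 1)"]
      dual_partition_length[OF l(2)] sum_list_dual[OF l]
    by (simp only: take_all order_refl simp_thms)
  also have "\<dots> = (\<Prod>t<l ! 0. \<Prod>i<card {j. j < rk \<and> t < e j}. S.ideal_zeta f
      (real (Suc t) * s - real (\<Sum>t'<t. card {j. j < rk \<and> t' < e j}) - real i))"
  proof (rule prod.cong[OF refl])
    fix t assume "t \<in> {..<l ! 0}"
    then have t: "t < l ! 0" by simp
    show "(\<Prod>i<?mu ! t. S.ideal_zeta f
        (real (partition_inv ?mu (Suc (sum_list (take t ?mu) + i))) * s -
         real (Suc (sum_list (take t ?mu) + i)) + 1)) =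
      (\<Prod>i<card {j. j < rk \<and> t < e j}. S.ideal_zeta f
        (real (Suc t) * s - real (\<Sum>t'<t. card {j. j < rk \<and> t' < e j}) - real i))"
      unfolding mu[OF t] sums[OF t]
    proof (rule prod.cong[OF refl])
      fix i assume "i \<in> {..<?mu ! t}"
      then have "partition_inv ?mu (Suc (sum_list (take t ?mu) + i)) = Suc t"
        using partition_inv_block[of t "?mu" i] t dual_partition_length[OF l(2)] by simp
      then show "S.ideal_zeta f
        (real (partition_inv ?mu (Suc (sum_list (take t ?mu) + i))) * s -
         real (Suc (sum_list (take t ?mu) + i)) + 1) =
        S.ideal_zeta f (real (Suc t) * s - real (sum_list (take t ?mu)) - real i)"
        by (simp only:) (rule arg_cong[where f = "S.ideal_zeta f"], simp)
    qed
  qed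
  finally show ?thesis
    using lat_phase[where r = rk and H = "stage D" and F = "\<lambda>j. bp j ^ be j" and e = e and s = s,
      OF f.f_S f.pid_f f.f_nz stage_nz F e_le]
    unfolding lattice_sum_def stage' by (simp only:)
qed

text \<open>Once every polynomial is treated, the kernel is the only lattice left.\<close>

lemma lattice_sum_all: "lattice_sum (fst ` set ed) s = 1"
proof -
  let ?K = "lat rk (\<lambda>j. bp j ^ be j)"
  have K: "lat rk (stage (fst ` set ed)) = ?K"
  proof (rule lat_cong)
    fix j assume "j < rk"
    then have "bp j \<in> fst ` set ed" using block[of j] by force
    then show "stage (fst ` set ed) j = bp j ^ be j" by (simp add: stage_def)
  qed
  have "Vec.lattices ?K ?K = {?K}"
    using lat_sub idx_same[OF Vec.sub_sgp[OF lat_sub]] by (auto simp: Vec.lattices_def)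
  then show ?thesis unfolding lattice_sum_def K
    using idx_same[OF Vec.sub_sgp[OF lat_sub]] by (simp add: esum_singleton wt_1)
qed

theorem diagonal_lattice_sum:
  "esum (Vec.lattices (lat rk (\<lambda>j. bp j ^ be j)) (lat rk (\<lambda>_. 1))) (\<lambda>N. wt s (idx (lat rk (\<lambda>_. 1)) N)) =
    (\<Prod>(f, l)\<leftarrow>ed. \<Prod>j = 1..sum_list l. S.ideal_zeta f (real (partition_inv (dual_partition l) j) * s - real j + 1))"
proof -
  \<comment> \<open>Generalised for the induction: \<open>es\<close> lists the polynomials still to
    be treated and \<open>D\<close> is their complement.\<close>
  have main: "lattice_sum D s = (\<Prod>(f, l)\<leftarrow>es. \<Prod>j = 1..sum_list l.
      S.ideal_zeta f (real (partition_inv (dual_partition l) j) * s - real j + 1))"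
    if "set es \<subseteq> set ed" "distinct (map fst es)" "D \<inter> fst ` set es = {}" "D \<union> fst ` set es = fst ` set ed" for es D
    using that
  proof (induction es arbitrary: D)
    case Nil
    then show ?case using lattice_sum_all by simp
  next
    case (Cons x es)
    obtain f l where x: "x = (f, l)" by (cases x)
    have "lattice_sum (insert f D) s = (\<Prod>(f, l)\<leftarrow>es. \<Prod>j = 1..sum_list l.
      S.ideal_zeta f (real (partition_inv (dual_partition l) j) * s - real j + 1))"
      using Cons.prems by (intro Cons.IH) (auto simp: x)
    moreover have "(f, l) \<in> set ed" "f \<notin> D" using Cons.prems by (auto simp: x)
    ultimately show ?case using lattice_sum_insert[of f l D s] by (simp add: x)
  qed
  have "lattice_sum {} s = esum (Vec.lattices (lat rk (\<lambda>j. bp j ^ be j)) (lat rk (\<lambda>_. 1))) (\<lambda>N. wt s (idx (lat rk (\<lambda>_. 1)) N))"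
    unfolding lattice_sum_def using lat_cong[of rk "stage {}" "\<lambda>_. 1"] by (simp add: stage_def)
  then show ?thesis using main[of ed "{}"] ed_distinct by simp
qed

end

section \<open>The lattice attached to an elementary divisor vector\<close>

text \<open>The direct sum of the \<open>k[X]/(F)\<close> in coordinates with respect to the powers
  of the variable. The argument \<open>m\<close> is the position of the first coordinate still to be
  read, as the recursion demands.\<close>

fun residues :: "nat \<Rightarrow> 'a::field poly list \<Rightarrow> 'a poly poly \<Rightarrow> 'a vec" where
  "residues m [] h = 0\<^sub>v 0"
| "residues m (F # Fs) h = vec (degree F) (coeff (coeff h m mod F)) @\<^sub>v residues (Suc m) Fs h"

section \<open>Reduction of polynomial vectors modulo the blocks\<close>

lemma residues_carrier: "residues m Fs h \<in> carrier_vec (sum_list (map degree Fs))"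
  by (induction Fs arbitrary: m) (auto intro!: append_carrier_vec)

lemma residues_dim [simp]: "dim_vec (residues m Fs h) = sum_list (map degree Fs)"
  using residues_carrier[of m Fs h] by (rule carrier_vecD)

lemma residues_add: "residues m Fs (g + h) = residues m Fs g + residues m Fs h"
proof (induction Fs arbitrary: m)
  case (Cons F Fs)
  show ?case by (rule eq_vecI) (auto simp: Cons poly_mod_add_left)
qed (auto intro: eq_vecI)

lemma residues_scale: "residues m Fs (Polynomial.smult [:c:] h) = c \<cdot>\<^sub>v residues m Fs h"
proof (induction Fs arbitrary: m)
  case (Cons F Fs)
  show ?case by (rule eq_vecI) (auto simp: Cons mod_smult_left)
qed auto

text \<open>Right multiplication of row vectors by the companion matrix is multiplication by the
  variable on \<open>k[X]/(F)\<close>; the transpose expresses it on column vectors.\<close>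

lemma companion_residue:
  assumes "Polynomial.lead_coeff F = 1"
  shows "transpose_mat (companion F) *\<^sub>v vec (degree F) (coeff (g mod F)) =
    vec (degree F) (coeff ((monom 1 1 * g) mod F))"
proof (rule eq_vecI)
  show "dim_vec (transpose_mat (companion F) *\<^sub>v vec (degree F) (coeff (g mod F))) =
    dim_vec (vec (degree F) (coeff ((monom 1 1 * g) mod F)))" by (simp add: companion_def)
next
  fix j assume "j < dim_vec (vec (degree F) (coeff ((monom 1 1 * g) mod F)))"
  then have j: "j < degree F" by simp
  define d where "d = degree F - 1"
  have d: "degree F = Suc d" using j by (simp add: d_def)
  define g0 where "g0 = g mod F"
  have F: "F \<noteq> 0" using j by auto
  have dg: "degree g0 < Suc d" using degree_mod_less'[of F g] j F unfolding g0_def d by fastforce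
  \<comment> \<open>Since \<open>F\<close> is monic, one subtraction cancels the only possible term
    of degree \<open>degree F\<close>, and \<open>r\<close> is already the remainder.\<close>
  define r where "r = monom 1 1 * g0 - Polynomial.smult (coeff g0 d) F"
  have lead: "coeff F (Suc d) = 1" using assms by (simp add: d)
  have "degree r < Suc d"
  proof -
    have "coeff r i = 0" if "i \<ge> Suc d" for i
    proof (cases "i = Suc d")
      case False
      then have "degree F < i" "degree g0 < i - 1" using that d dg by auto
      then show ?thesis by (simp add: r_def coeff_monom_mult coeff_eq_0)
    qed (simp add: r_def coeff_monom_mult lead)
    then show ?thesis using degree_le[of d r] by auto
  qed
  then have "r mod F = r" by (intro mod_poly_less) (simp add: d)
  moreover have "(monom 1 1 * g) mod F = (r + Polynomial.smult (coeff g0 d) F) mod F"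
    unfolding r_def g0_def by (simp add: mod_mult_right_eq)
  moreover have "(r + Polynomial.smult (coeff g0 d) F) mod F = r mod F"
    by (simp add: poly_mod_add_left mod_smult_left)
  ultimately have mod: "(monom 1 1 * g) mod F = r" by simp
  have "(transpose_mat (companion F) *\<^sub>v vec (degree F) (coeff (g mod F))) $ j =
      (\<Sum>i<Suc d. (if Suc i = Suc d then - coeff F j else if j = Suc i then 1 else 0) * coeff g0 i)"
    using j by (simp add: companion_def scalar_prod_def d g0_def atLeast0LessThan)
  also have "\<dots> = (\<Sum>i<Suc d. (if i = d then - coeff F j * coeff g0 i else 0) + (if Suc i = j then coeff g0 i else 0))"
    by (rule sum.cong[OF refl]) (use j d in auto)
  also have "\<dots> = - coeff F j * coeff g0 d + (\<Sum>i<Suc d. if Suc i = j then coeff g0 i else 0)"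
    by (simp add: sum.distrib)
  also have "(\<Sum>i<Suc d. if Suc i = j then coeff g0 i else 0) = coeff (monom 1 1 * g0) j"
    using j d by (cases j) (auto simp: coeff_monom_mult)
  finally show "(transpose_mat (companion F) *\<^sub>v vec (degree F) (coeff (g mod F))) $ j =
      vec (degree F) (coeff ((monom 1 1 * g) mod F)) $ j"
    unfolding mod using j by (simp add: r_def mult.commute)
qed

lemma residues_companion:
  assumes "\<And>F. F \<in> set Fs \<Longrightarrow> Polynomial.lead_coeff F = 1"
  shows "transpose_mat (diag_block_mat (map companion Fs)) *\<^sub>v residues m Fs h =
    residues m Fs (Polynomial.smult (monom 1 1) h)"
  using assms
proof (induction Fs arbitrary: m)
  case Nil
  show ?case by (rule eq_vecI) auto
next
  case (Cons F Fs)
  define D where "D = diag_block_mat (map companion Fs)"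
  define e where "e = sum_list (map degree Fs)"
  have C: "companion F \<in> carrier_mat (degree F) (degree F)" by (simp add: companion_def)
  have D: "D \<in> carrier_mat e e"
  proof -
    have "dim_row \<circ> (companion :: 'a poly \<Rightarrow> _) = degree" "dim_col \<circ> (companion :: 'a poly \<Rightarrow> _) = degree"
      by (simp_all add: fun_eq_iff companion_def)
    then show ?thesis by (intro carrier_matI) (simp_all only: D_def dim_diag_block_mat e_def list.map_comp)
  qed
  have "diag_block_mat (map companion (F # Fs)) =
      four_block_mat (companion F) (0\<^sub>m (degree F) e) (0\<^sub>m e (degree F)) D"
    using C D by (auto simp: Let_def D_def)
  then have T: "transpose_mat (diag_block_mat (map companion (F # Fs))) =
      four_block_mat (transpose_mat (companion F)) (0\<^sub>m (degree F) e) (0\<^sub>m e (degree F)) (transpose_mat D)"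
    using transpose_four_block_mat[OF C zero_carrier_mat zero_carrier_mat D] by simp
  have "four_block_mat (transpose_mat (companion F)) (0\<^sub>m (degree F) e) (0\<^sub>m e (degree F)) (transpose_mat D) *\<^sub>v
      (vec (degree F) (coeff (coeff h m mod F)) @\<^sub>v residues (Suc m) Fs h) =
      (transpose_mat (companion F) *\<^sub>v vec (degree F) (coeff (coeff h m mod F))) @\<^sub>v
      (transpose_mat D *\<^sub>v residues (Suc m) Fs h)"
    by (rule mult_mat_vec_split) (use C D residues_carrier[of "Suc m" Fs h] in \<open>auto simp: e_def\<close>)
  also have "transpose_mat D *\<^sub>v residues (Suc m) Fs h = residues (Suc m) Fs (Polynomial.smult (monom 1 1) h)"
    unfolding D_def using Cons by simp
  also have "transpose_mat (companion F) *\<^sub>v vec (degree F) (coeff (coeff h m mod F)) =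
      vec (degree F) (coeff ((monom 1 1 * coeff h m) mod F))"
    using Cons.prems by (intro companion_residue) simp
  finally show ?case unfolding T by simp
qed

lemma residues_0_iff:
  assumes "\<And>F. F \<in> set Fs \<Longrightarrow> F \<noteq> 0"
  shows "(\<forall>i<sum_list (map degree Fs). residues m Fs h $ i = 0) \<longleftrightarrow> (\<forall>j<length Fs. Fs ! j dvd coeff h (m + j))"
  using assms
proof (induction Fs arbitrary: m)
  case (Cons F Fs)
  let ?e = "sum_list (map degree Fs)"
  have "(\<forall>i<degree F. coeff (coeff h m mod F) i = 0) \<longleftrightarrow> F dvd coeff h m"
  proof
    assume z: "\<forall>i<degree F. coeff (coeff h m mod F) i = 0"
    show "F dvd coeff h m"
    proof (rule ccontr)
      assume "\<not> F dvd coeff h m"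
      then have "coeff h m mod F \<noteq> 0" by (simp add: dvd_eq_mod_eq_0)
      then have "degree (coeff h m mod F) < degree F" using degree_mod_less'[of F] Cons.prems by simp
      then have "Polynomial.lead_coeff (coeff h m mod F) = 0" using z by blast
      then show False using \<open>coeff h m mod F \<noteq> 0\<close> by simp
    qed
  qed (simp add: dvd_eq_mod_eq_0)
  moreover have "(\<forall>i<?e. residues (Suc m) Fs h $ i = 0) \<longleftrightarrow> (\<forall>j<length Fs. Fs ! j dvd coeff h (Suc m + j))"
    using Cons by simp
  moreover have "(\<forall>i<degree F + ?e. residues m (F # Fs) h $ i = 0) \<longleftrightarrow>
      (\<forall>i<degree F. coeff (coeff h m mod F) i = 0) \<and> (\<forall>i<?e. residues (Suc m) Fs h $ i = 0)"
    (is "?l \<longleftrightarrow> ?a \<and> ?b")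
  proof
    assume l: ?l
    have ?a
    proof (intro allI impI)
      fix i assume "i < degree F"
      then show "coeff (coeff h m mod F) i = 0" using l[rule_format, of i] by simp
    qed
    moreover have ?b
    proof (intro allI impI)
      fix i assume "i < ?e"
      then show "residues (Suc m) Fs h $ i = 0" using l[rule_format, of "degree F + i"] by simp
    qed
    ultimately show "?a \<and> ?b" by blast
  qed auto
  moreover have "(\<forall>j<length (F # Fs). (F # Fs) ! j dvd coeff h (m + j)) \<longleftrightarrow>
      F dvd coeff h m \<and> (\<forall>j<length Fs. Fs ! j dvd coeff h (Suc m + j))"
    by (auto simp: less_Suc_eq_0_disj)
  ultimately show ?case by simp
qed simp

context dvr_abs
begin

lemma residues_integral:
  assumes "\<And>F. F \<in> set Fs \<Longrightarrow> F \<in> S \<and> Polynomial.lead_coeff F = 1" "\<And>j. coeff h j \<in> S"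
    and "i < sum_list (map degree Fs)"
  shows "\<phi> (residues m Fs h $ i) \<le> 1"
  using assms(1,3)
proof (induction Fs arbitrary: m i)
  case (Cons F Fs)
  have "coeff h m mod F \<in> S" using Cons.prems(1)[of F] assms(2) by (intro monic_mod) auto
  then show ?case using Cons.IH[of "i - degree F" "Suc m"] Cons.prems by (auto simp: S_def)
qed simp

lemma residues_surj:
  assumes "\<And>F. F \<in> set Fs \<Longrightarrow> Polynomial.lead_coeff F = 1"
    and "x \<in> carrier_vec (sum_list (map degree Fs))" "\<And>i. i < dim_vec x \<Longrightarrow> \<phi> (x $ i) \<le> 1"
  shows "\<exists>h. (\<forall>j. coeff h j \<in> S) \<and> (\<forall>j\<ge>m + length Fs. coeff h j = 0) \<and> residues m Fs h = x"
  using assms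
proof (induction Fs arbitrary: m x)
  case Nil
  then show ?case using S.S_0 by (intro exI[of _ 0]) auto
next
  case (Cons F Fs)
  let ?e = "sum_list (map degree Fs)"
  define y where "y = vec ?e (\<lambda>i. x $ (degree F + i))"
  have dx: "dim_vec x = degree F + ?e" using Cons.prems(2) by simp
  have "\<exists>h. (\<forall>j. coeff h j \<in> S) \<and> (\<forall>j\<ge>Suc m + length Fs. coeff h j = 0) \<and> residues (Suc m) Fs h = y"
    using Cons.prems dx by (intro Cons.IH) (auto simp: y_def)
  then obtain h where h: "\<And>j. coeff h j \<in> S" "\<And>j. j \<ge> Suc m + length Fs \<Longrightarrow> coeff h j = 0"
    "residues (Suc m) Fs h = y" by blast
  define p where "p = (\<Sum>k<degree F. monom (x $ k) k)"
  have cp: "coeff p k = (if k < degree F then x $ k else 0)" for k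
    by (simp add: p_def coeff_sum coeff_monom)
  \<comment> \<open>Only the coefficient at position \<open>m\<close> is altered, so the residues at
    later positions persist.\<close>
  define h' where "h' = h + monom (p - coeff h m) m"
  have ch: "coeff h' j = (if j = m then p else coeff h j)" for j by (simp add: h'_def coeff_monom)
  have res: "residues k Gs h' = residues k Gs h" if "k > m" for k Gs
    using that by (induction Gs arbitrary: k) (simp_all add: ch)
  have pm: "p mod F = p"
  proof (cases "degree F = 0")
    case True
    then show ?thesis by (simp add: p_def)
  next
    case False
    have "degree p < degree F"
      using degree_le[of "degree F - 1" p] False cp by fastforce
    then show ?thesis by (rule mod_poly_less)
  qed
  have "residues m (F # Fs) h' = x"
    using h(3) by (intro eq_vecI) (auto simp: ch pm cp res y_def dx)
  moreover have "coeff h' j \<in> S" for j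
    using h(1) Cons.prems(3) dx by (auto simp: ch S_def cp)
  moreover have "coeff h' j = 0" if "j \<ge> m + length (F # Fs)" for j
    using h(2) that by (simp add: ch)
  ultimately show ?case by blast
qed

end

text \<open>Finiteness of the extended sum also makes each count finite: an infinite fibre over some
  \<open>m \<ge> 1\<close> would contribute infinity.\<close>

lemma sums_of_esum:
  fixes p :: "'b \<Rightarrow> nat"
  assumes p: "\<And>x. x \<in> U \<Longrightarrow> 1 \<le> p x" and total: "esum U (\<lambda>x. wt s (p x)) = ennreal R" "0 \<le> R"
  shows "(\<lambda>m. real (card {x \<in> U. p x = m}) * real m powr (- s)) sums R"
proof -
  have fin: "finite {x \<in> U. p x = m}" for m
  proof (rule ccontr)
    assume inf: "infinite {x \<in> U. p x = m}"
    then obtain x where "x \<in> U" "p x = m" using not_finite_existsD by auto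
    then have m: "1 \<le> m" using p by blast
    have "esum {x \<in> U. p x = m} (\<lambda>x. wt s (p x)) = esum {x \<in> U. p x = m} (\<lambda>_. wt s m)"
      by (rule esum_cong) simp
    also have "\<dots> = wt s m * emeasure (count_space {x \<in> U. p x = m}) (space (count_space {x \<in> U. p x = m}))"
      by (rule nn_integral_const)
    also have "\<dots> = \<infinity>"
      using inf m by (simp add: emeasure_count_space_infinite wt_def ennreal_mult_top)
    finally have "esum {x \<in> U. p x = m} (\<lambda>x. wt s (p x)) = \<infinity>" .
    moreover have "esum {x \<in> U. p x = m} (\<lambda>x. wt s (p x)) \<le> esum UNIV (\<lambda>m. esum {x \<in> U. p x = m} (\<lambda>x. wt s (p x)))"
      by (rule nn_integral_ge_point[where p = "\<lambda>m. esum {x \<in> U. p x = m} (\<lambda>x. wt s (p x))"]) simp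
    moreover have "\<dots> = ennreal R"
      using esum_fibres[of U p UNIV "\<lambda>x. wt s (p x)"] total by simp
    ultimately show False by (simp add: top_unique)
  qed
  define g where "g m = real (card {x \<in> U. p x = m}) * real m powr (- s)" for m
  have g0: "0 \<le> g m" for m by (simp add: g_def)
  have "ennreal R = esum UNIV (\<lambda>m. of_nat (card {x \<in> U. p x = m}) * wt s m)"
    using esum_const_fibres[of U p UNIV "wt s"] fin total by simp
  also have "\<dots> = esum UNIV (\<lambda>m. ennreal (g m))"
    by (rule esum_cong) (simp add: g_def wt_def ennreal_of_nat_eq_real_of_nat ennreal_mult)
  also have "\<dots> = (\<Sum>m. ennreal (g m))" by (rule nn_integral_count_space_nat)
  finally have s: "(\<Sum>m. ennreal (g m)) = ennreal R" ..
  then have "summable g" by (intro summable_suminf_not_top g0) simp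
  moreover from this have "suminf g = R"
    using s suminf_ennreal2[OF g0] total(2) by (simp add: suminf_nonneg g0)
  ultimately show ?thesis unfolding g_def[symmetric] by (metis summable_sums)
qed

text \<open>\<open>P\<close> and \<open>Q\<close> are inverse to each other and both integral, so
  they preserve the integral vectors and carry the companion form over to \<open>A\<close> without
  changing the standard lattice.\<close>

locale good_place = base_valued \<phi> t v + diagonal_model \<phi> t ed
  for \<phi> :: "'a::field_char_0 \<Rightarrow> real" and t v ed +
  fixes n :: nat and A P Q :: "'a mat"
  assumes A_dim: "A \<in> carrier_mat n n"
    and similar: "similar_mat_wit A (diag_block_mat (concat (map (\<lambda>(f, l). map (\<lambda>p. companion (f ^ p)) l) ed))) P Q"
    and entries: "i < n \<Longrightarrow> j < n \<Longrightarrow> \<phi> (A $$ (i, j)) \<le> 1 \<and> \<phi> (P $$ (i, j)) \<le> 1 \<and> \<phi> (Q $$ (i, j)) \<le> 1"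
begin

definition Fs :: "'a poly list" where "Fs = map (\<lambda>(f, p). f ^ p) (blocks ed)"
definition B :: "'a mat" where "B = diag_block_mat (map companion Fs)"
text \<open>The row vector of residues times \<open>Q\<close>, written with transposes. From
  \<open>A = P B Q\<close> follows \<open>B Q = Q A\<close>, so multiplication by the variable
  becomes the action of \<open>A\<close>. The value 0 outside the range keeps the map linear at
  every index.\<close>

definition \<Theta> :: "'a poly poly \<Rightarrow> nat \<Rightarrow> 'a" where
  "\<Theta> h i = (if i < n then (transpose_mat Q *\<^sub>v residues 0 Fs h) $ i else 0)"

section \<open>The coordinate map at a good place\<close>

lemma Fs_nth: "j < rk \<Longrightarrow> Fs ! j = bp j ^ be j" and Fs_length: "length Fs = rk"
  by (simp_all add: Fs_def split_beta)

lemma Fs_monic: assumes "F \<in> set Fs" shows "F \<in> S" "Polynomial.lead_coeff F = 1" "F \<noteq> 0"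
proof -
  obtain j where j: "j < rk" "F = bp j ^ be j" using assms Fs_nth Fs_length by (metis in_set_conv_nth)
  obtain l where l: "(bp j, l) \<in> set ed" using block[OF j(1)] by blast
  show "F \<in> S" using S_power[OF ed_S[OF l]] j by simp
  show "Polynomial.lead_coeff F = 1" using ed_monic[OF l] by (simp add: j Polynomial.lead_coeff_power)
  then show "F \<noteq> 0" by auto
qed

lemma wit: "P * Q = 1\<^sub>m n" "Q * P = 1\<^sub>m n" "A = P * B * Q"
  "B \<in> carrier_mat n n" "P \<in> carrier_mat n n" "Q \<in> carrier_mat n n"
proof -
  have "concat (map (\<lambda>(f, l). map (\<lambda>p. companion (f ^ p)) l) ed) = map companion Fs"
    unfolding Fs_def blocks_def map_concat map_map by (simp add: o_def split_def)
  then have "similar_mat_wit A B P Q" using similar by (simp add: B_def)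
  from similar_mat_witD2[OF A_dim this]
  show "P * Q = 1\<^sub>m n" "Q * P = 1\<^sub>m n" "A = P * B * Q"
    "B \<in> carrier_mat n n" "P \<in> carrier_mat n n" "Q \<in> carrier_mat n n" by blast+
qed

lemma degree_sum: "sum_list (map degree Fs) = n"
proof -
  have "dim_row \<circ> (companion :: 'a poly \<Rightarrow> _) = degree" by (simp add: fun_eq_iff companion_def)
  then have "dim_row B = sum_list (map degree Fs)" by (simp only: B_def dim_diag_block_mat list.map_comp)
  then show ?thesis using wit(4) by simp
qed

lemma residues_n: "residues 0 Fs h \<in> carrier_vec n"
  using residues_carrier[of 0 Fs h] by (simp add: degree_sum)

lemma vec_sum_le:
  fixes C :: "'a mat" and x :: "'a vec"
  assumes "C \<in> carrier_mat n n" "x \<in> carrier_vec n" "i < n"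
    "\<And>j. j < n \<Longrightarrow> \<phi> (C $$ (j, i)) \<le> 1" "\<And>j. j < n \<Longrightarrow> \<phi> (x $ j) \<le> 1"
  shows "\<phi> ((transpose_mat C *\<^sub>v x) $ i) \<le> 1"
  using assms by (auto simp: scalar_prod_def intro!: abs_sum_le abs_le_mult)

lemma transpose_inverse:
  assumes "x \<in> carrier_vec n"
  shows "transpose_mat Q *\<^sub>v (transpose_mat P *\<^sub>v x) = x" "transpose_mat P *\<^sub>v (transpose_mat Q *\<^sub>v x) = x"
proof -
  have "transpose_mat Q *\<^sub>v (transpose_mat P *\<^sub>v x) = transpose_mat (P * Q) *\<^sub>v x"
    using wit(5,6) assms by (simp add: transpose_mult[of P n n Q n])
  then show "transpose_mat Q *\<^sub>v (transpose_mat P *\<^sub>v x) = x" using wit(1) assms by simp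
  have "transpose_mat P *\<^sub>v (transpose_mat Q *\<^sub>v x) = transpose_mat (Q * P) *\<^sub>v x"
    using wit(5,6) assms by (simp add: transpose_mult[of Q n n P n])
  then show "transpose_mat P *\<^sub>v (transpose_mat Q *\<^sub>v x) = x" using wit(2) assms by simp
qed

lemma \<Theta>_action: assumes "j < n"
  shows "\<Theta> (Polynomial.smult (monom 1 1) h) j = (\<Sum>i<n. \<Theta> h i * A $$ (i, j))"
proof -
  let ?x = "residues 0 Fs h"
  have x: "?x \<in> carrier_vec n" by (rule residues_n)
  have QA: "B * Q = Q * A"
  proof -
    have "Q * A = (Q * P) * (B * Q)"
      unfolding wit(3) using wit(4-6) by (simp add: assoc_mult_mat[of _ n n _ n _ n])
    then show ?thesis using wit(2,4,6) by simp
  qed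
  have "transpose_mat Q *\<^sub>v residues 0 Fs (Polynomial.smult (monom 1 1) h) =
      transpose_mat Q *\<^sub>v (transpose_mat B *\<^sub>v ?x)"
    unfolding B_def by (subst residues_companion) (auto simp: Fs_monic)
  also have "\<dots> = transpose_mat (B * Q) *\<^sub>v ?x" using wit(4,6) x by (simp add: transpose_mult[of B n n Q n])
  also have "\<dots> = transpose_mat A *\<^sub>v (transpose_mat Q *\<^sub>v ?x)"
    unfolding QA using wit(6) A_dim x by (simp add: transpose_mult[of Q n n A n])
  finally have "\<Theta> (Polynomial.smult (monom 1 1) h) j = (transpose_mat A *\<^sub>v (transpose_mat Q *\<^sub>v ?x)) $ j"
    using assms by (simp add: \<Theta>_def)
  also have "\<dots> = (\<Sum>i<n. A $$ (i, j) * (transpose_mat Q *\<^sub>v ?x) $ i)"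
    using assms A_dim wit(6) by (simp add: scalar_prod_def[of "col A j"] atLeast0LessThan)
  finally show ?thesis by (simp add: \<Theta>_def mult.commute)
qed

text \<open>Integral vectors are reached because \<open>P\<close>, the inverse of \<open>Q\<close>,
  is integral. The kernel consists of coordinatewise multiples of the block polynomials, and since
  these are monic the quotients are integral too.\<close>

sublocale LT: lattice_transfer \<phi> t v n A Polynomial.smult \<Theta> "lat rk (\<lambda>_. 1)" "lat rk (\<lambda>j. bp j ^ be j)"
proof (intro lattice_transfer.intro lattice_transfer_axioms.intro)
  show "base_valued \<phi> t v" by (rule base_valued_axioms)
  have MS: "coeff h j \<in> S" if "h \<in> lat rk (\<lambda>_. 1)" for h j
    using that S.S_0 by (cases "j < rk") (auto simp: lat_def)
  show "A \<in> carrier_mat n n" by (rule A_dim)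
  show "\<phi> (A $$ (i, j)) \<le> 1" if "i < n" "j < n" for i j using entries[OF that] by blast
  show "Modules.module (Polynomial.smult :: 'a poly \<Rightarrow> _)" by (rule Vec.module_axioms)
  show "Vec.sub (lat rk (\<lambda>_. 1))" "Vec.sub (lat rk (\<lambda>j. bp j ^ be j))" by (rule lat_sub)+
  show "\<Theta> (g + h) i = \<Theta> g i + \<Theta> h i" for g h i
    using wit(6) by (simp add: \<Theta>_def residues_add mult_add_distrib_mat_vec[OF _ residues_n residues_n, of "transpose_mat Q"])
  show "\<Theta> (Polynomial.smult [:c:] h) i = c * \<Theta> h i" for c h i
    using wit(6) residues_n[of h] by (simp add: \<Theta>_def residues_scale mult_mat_vec[of _ n n])
  show "j < n \<Longrightarrow> \<Theta> (Polynomial.smult (monom 1 1) h) j = (\<Sum>i<n. \<Theta> h i * A $$ (i, j))" for h j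
    by (rule \<Theta>_action)
  show "\<phi> (\<Theta> h i) \<le> 1" if "h \<in> lat rk (\<lambda>_. 1)" "i < n" for h i
    using that entries residues_integral[of Fs h _ 0] Fs_monic MS[OF that(1)]
    by (simp add: \<Theta>_def) (intro vec_sum_le wit residues_n, auto simp: degree_sum)
  show "\<exists>h\<in>lat rk (\<lambda>_. 1). \<forall>i<n. \<Theta> h i = z i" if z: "\<And>i. i < n \<Longrightarrow> \<phi> (z i) \<le> 1" for z
  proof -
    let ?x = "transpose_mat P *\<^sub>v vec n z"
    have x: "?x \<in> carrier_vec n" using wit(5) by simp
    have "\<exists>h. (\<forall>j. coeff h j \<in> S) \<and> (\<forall>j\<ge>0 + length Fs. coeff h j = 0) \<and> residues 0 Fs h = ?x"
    proof (rule residues_surj)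
      show "\<phi> (?x $ i) \<le> 1" if "i < dim_vec ?x" for i
        using that x z entries wit(5) by (intro vec_sum_le wit) auto
    qed (use x Fs_monic in \<open>auto simp: degree_sum\<close>)
    then obtain h where h: "\<And>j. coeff h j \<in> S" "\<And>j. j \<ge> rk \<Longrightarrow> coeff h j = 0" "residues 0 Fs h = ?x"
      by (auto simp: Fs_length)
    have "h \<in> lat rk (\<lambda>_. 1)" using h by (auto simp: lat_def)
    moreover have "\<Theta> h i = z i" if "i < n" for i
      using that by (simp add: \<Theta>_def h(3) transpose_inverse)
    ultimately show ?thesis by blast
  qed
  show "(\<forall>i<n. \<Theta> h i = 0) \<longleftrightarrow> h \<in> lat rk (\<lambda>j. bp j ^ be j)" if h: "h \<in> lat rk (\<lambda>_. 1)" for h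
  proof -
    let ?x = "residues 0 Fs h"
    have "(\<forall>i<n. \<Theta> h i = 0) \<longleftrightarrow> transpose_mat Q *\<^sub>v ?x = 0\<^sub>v n"
      using wit(6) by (auto simp: \<Theta>_def vec_eq_iff intro!: eq_vecI)
    also have "\<dots> \<longleftrightarrow> ?x = 0\<^sub>v n"
    proof
      assume "transpose_mat Q *\<^sub>v ?x = 0\<^sub>v n"
      then have "?x = transpose_mat P *\<^sub>v 0\<^sub>v n" using transpose_inverse(2)[OF residues_n[of h]] by simp
      then show "?x = 0\<^sub>v n" using wit(5) by (auto intro!: eq_vecI)
    qed (use wit(6) in \<open>auto intro!: eq_vecI\<close>)
    also have "\<dots> \<longleftrightarrow> (\<forall>i<n. ?x $ i = 0)" using residues_n[of h] by (auto simp: degree_sum intro!: eq_vecI)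
    also have "\<dots> \<longleftrightarrow> (\<forall>j<rk. Fs ! j dvd coeff h j)"
      using residues_0_iff[of Fs 0 h] Fs_monic(3) by (simp add: degree_sum Fs_length)
    also have "\<dots> \<longleftrightarrow> (\<forall>j<rk. coeff h j \<in> (*) (Fs ! j) ` S)"
      using monic_dvd[OF Fs_monic(1,2) MS[OF h]] by (simp add: Fs_length)
    also have "\<dots> \<longleftrightarrow> h \<in> lat rk (\<lambda>j. bp j ^ be j)" using h by (auto simp: lat_def Fs_nth)
    finally show ?thesis .
  qed
  show "lat rk (\<lambda>j. bp j ^ be j) \<subseteq> lat rk (\<lambda>_. 1)"
  proof (rule lat_mono)
    fix j assume "j < rk"
    then show "bp j ^ be j \<in> (*) 1 ` S" using Fs_monic(1)[OF nth_mem, of j] Fs_nth[of j] by (simp add: Fs_length)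
  qed
qed

lemma partition_inv_ge_1:
  assumes "(f, l) \<in> set ed" "j \<in> {1..sum_list l}" shows "1 \<le> partition_inv (dual_partition l) j"
proof -
  have l: "is_partition l" "l \<noteq> []" using ed_partition[OF assms(1)] by auto
  \<comment> \<open>A witness for the \<open>LEAST\<close> in \<open>partition_inv\<close>, which
    asks for an index of at least 1: all parts together reach \<open>sum_list l\<close>.\<close>
  have "1 \<le> max 1 (length (dual_partition l)) \<and> j \<le> sum_list (take (max 1 (length (dual_partition l))) (dual_partition l))"
    using assms(2) sum_list_dual[OF l] by simp
  from LeastI[of "\<lambda>i. 1 \<le> i \<and> j \<le> sum_list (take i (dual_partition l))", OF this]
  show ?thesis by (simp add: partition_inv_def)
qed

definition euler :: "real \<Rightarrow> real" where
  "euler s = (\<Prod>(f, l)\<leftarrow>ed. \<Prod>j = 1..sum_list l. \<Prod>w\<in>places_above f v.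
     1 / (1 - real (residue_size (base_field :: 'a ring) v) powr
       (- (real (residue_degree f w v) * (real (partition_inv (dual_partition l) j) * s - real j + 1)))))"

text \<open>\<open>ideal_zeta_product\<close> carried from maximal ideals to places. The sum of the
  residue degrees is the exponent of \<open>q\<close> in \<open>prod_idx_primes\<close>.\<close>

lemma ideal_zeta_places:
  assumes fl: "(f, l) \<in> set ed" and s: "0 < s"
  shows "S.ideal_zeta f s = ennreal (\<Prod>w\<in>places_above f v.
      1 / (1 - real (residue_size (base_field :: 'a ring) v) powr (- (real (residue_degree f w v) * s))))"
    and "0 < (\<Prod>w\<in>places_above f v.
      1 / (1 - real (residue_size (base_field :: 'a ring) v) powr (- (real (residue_degree f w v) * s))))"
    and "finite (places_above f v)"
    and "(\<Sum>w\<in>places_above f v. residue_degree f w v) = degree f"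
    and "1 < residue_size (base_field :: 'a ring) v"
proof -
  interpret f: dvr_poly \<phi> t f by (rule ed_poly[OF fl])
  let ?q = "residue_size (base_field :: 'a ring) v"
  let ?P = "\<lambda>w. f.center (f.lift_abs (f.normalized w))"
  note bij = f.places_above_bij[OF v_base phi_base]
  have q: "?q = q" by (rule residue_size_base[OF v_base phi_base dvr_abs_axioms])
  show q1: "1 < ?q" using q q_gt_1 by simp
  show fin: "finite (places_above f v)" using bij f.finite_primes bij_betw_finite by blast
  have idx: "idx S (?P w) = ?q ^ residue_degree f w v" "1 < idx S (?P w)" if "w \<in> places_above f v" for w
    using f.residue_degree_eq[OF v_base phi_base that] f.idx_prime(2)[OF bij_betwE[OF bij, rule_format, OF that]] by simp_all
  have pow: "real (idx S (?P w)) powr (- s) = real ?q powr (- (real (residue_degree f w v) * s))"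
    if "w \<in> places_above f v" for w
    using q1 by (simp add: idx[OF that] powr_powr flip: powr_realpow)
  have nn: "0 < 1 / (1 - real ?q powr (- (real (residue_degree f w v) * s)))" if "w \<in> places_above f v" for w
    using idx(2)[OF that] s powr_less_cancel_iff[of "real (idx S (?P w))" "- s" 0] by (simp flip: pow[OF that])
  show "0 < (\<Prod>w\<in>places_above f v. 1 / (1 - real ?q powr (- (real (residue_degree f w v) * s))))"
    by (rule prod_pos) (use nn in blast)
  have "S.ideal_zeta f s = (\<Prod>w\<in>places_above f v. ennreal (1 / (1 - real (idx S (?P w)) powr (- s))))"
    unfolding f.ideal_zeta_product[OF s] by (rule prod.reindex_bij_betw[OF bij, symmetric])
  also have "\<dots> = (\<Prod>w\<in>places_above f v. ennreal (1 / (1 - real ?q powr (- (real (residue_degree f w v) * s)))))"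
    by (rule prod.cong) (simp_all add: pow)
  also have "\<dots> = ennreal (\<Prod>w\<in>places_above f v. 1 / (1 - real ?q powr (- (real (residue_degree f w v) * s))))"
    by (rule prod_ennreal) (use nn less_imp_le in blast)
  finally show "S.ideal_zeta f s = ennreal (\<Prod>w\<in>places_above f v.
      1 / (1 - real ?q powr (- (real (residue_degree f w v) * s))))" .
  have "?q ^ (\<Sum>w\<in>places_above f v. residue_degree f w v) = (\<Prod>w\<in>places_above f v. idx S (?P w))"
    by (simp add: power_sum idx)
  also have "\<dots> = (\<Prod>P\<in>f.primes. idx S P)" by (rule prod.reindex_bij_betw[OF bij])
  also have "\<dots> = ?q ^ degree f" using f.prod_idx_primes q by simp
  finally show "(\<Sum>w\<in>places_above f v. residue_degree f w v) = degree f"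
    using power_inject_exp[OF q1] by blast
qed

text \<open>The bound on \<open>s\<close> exceeds every \<open>j\<close> that occurs, and the
  coefficient of \<open>s\<close> is at least 1; so all arguments of ideal zeta functions are
  positive, where their Euler products are valid.\<close>

lemma zeta_sums:
  assumes s: "real (\<Sum>(f, l)\<leftarrow>ed. sum_list l) < s"
  shows "(\<lambda>m. real (num_invariant_submodules A v m) * real m powr (- s)) sums euler s"
    and "0 < euler s"
proof -
  let ?M = "lat rk (\<lambda>_. 1)" and ?K = "lat rk (\<lambda>j. bp j ^ be j)"
  let ?e = "\<lambda>f l j. \<Prod>w\<in>places_above f v. 1 / (1 - real (residue_size (base_field :: 'a ring) v) powr
       (- (real (residue_degree f w v) * (real (partition_inv (dual_partition l) j) * s - real j + 1))))"
  have pos: "0 < real (partition_inv (dual_partition l) j) * s - real j + 1"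
    if "(f, l) \<in> set ed" "j \<in> {1..sum_list l}" for f l j
  proof -
    have "sum_list l \<le> (\<Sum>(f, l)\<leftarrow>ed. sum_list l)"
      using that(1) by (intro member_le_sum_list) (auto simp: image_iff intro!: bexI[of _ "(f, l)"])
    then have "real j < s" using that(2) s by simp
    moreover have "1 * s \<le> real (partition_inv (dual_partition l) j) * s"
      using partition_inv_ge_1[OF that] \<open>real j < s\<close> by (intro mult_right_mono) auto
    ultimately show ?thesis by linarith
  qed
  have e0: "0 < ?e f l j" and e: "S.ideal_zeta f (real (partition_inv (dual_partition l) j) * s - real j + 1) = ennreal (?e f l j)"
    if "(f, l) \<in> set ed" "j \<in> {1..sum_list l}" for f l j
    using ideal_zeta_places(1,2)[OF that(1) pos[OF that]] by simp_all
  have "(\<Prod>(f, l)\<leftarrow>es. \<Prod>j = 1..sum_list l. S.ideal_zeta f (real (partition_inv (dual_partition l) j) * s - real j + 1))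
      = ennreal (\<Prod>(f, l)\<leftarrow>es. \<Prod>j = 1..sum_list l. ?e f l j) \<and> 0 < (\<Prod>(f, l)\<leftarrow>es. \<Prod>j = 1..sum_list l. ?e f l j)"
    if "set es \<subseteq> set ed" for es
    using that
  proof (induction es)
    case (Cons x es)
    obtain f l where x: "x = (f, l)" by (cases x)
    have fl: "(f, l) \<in> set ed" using Cons.prems by (simp add: x)
    have "(\<Prod>j = 1..sum_list l. S.ideal_zeta f (real (partition_inv (dual_partition l) j) * s - real j + 1)) =
        (\<Prod>j = 1..sum_list l. ennreal (?e f l j))"
      by (rule prod.cong[OF refl]) (rule e[OF fl])
    also have "\<dots> = ennreal (\<Prod>j = 1..sum_list l. ?e f l j)"
      by (rule prod_ennreal) (rule less_imp_le, rule e0[OF fl])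
    finally have 1: "(\<Prod>j = 1..sum_list l. S.ideal_zeta f (real (partition_inv (dual_partition l) j) * s - real j + 1)) =
        ennreal (\<Prod>j = 1..sum_list l. ?e f l j)" .
    have 2: "0 < (\<Prod>j = 1..sum_list l. ?e f l j)" by (rule prod_pos) (use e0[OF fl] in blast)
    have IH: "(\<Prod>(f, l)\<leftarrow>es. \<Prod>j = 1..sum_list l. S.ideal_zeta f (real (partition_inv (dual_partition l) j) * s - real j + 1))
      = ennreal (\<Prod>(f, l)\<leftarrow>es. \<Prod>j = 1..sum_list l. ?e f l j)" "0 < (\<Prod>(f, l)\<leftarrow>es. \<Prod>j = 1..sum_list l. ?e f l j)"
      using Cons by simp_all
    show ?case unfolding x list.map prod_list.Cons prod.case 1 IH(1)
      using 2 IH(2) by (simp only: ennreal_mult less_imp_le mult_pos_pos simp_thms)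
  qed simp
  then have total: "esum (Vec.lattices ?K ?M) (\<lambda>N. wt s (idx ?M N)) = ennreal (euler s)" "0 < euler s"
    unfolding diagonal_lattice_sum euler_def by simp_all
  show "0 < euler s" by (rule total)
  have ge1: "1 \<le> idx ?M N" if "N \<in> Vec.lattices ?K ?M" for N
  proof -
    note ND = Vec.lattices_sub[OF that]
    have "?M \<noteq> {}" using sgp_0[OF Vec.sub_sgp[OF lat_sub]] by blast
    then show ?thesis using idx_pos[OF ND(5)] by (simp add: Suc_le_eq)
  qed
  \<comment> \<open>At \<open>m = 0\<close> both sides vanish, because \<open>powr\<close> sends 0
    to 0.\<close>
  have "real (card {N \<in> Vec.lattices ?K ?M. idx ?M N = m}) * real m powr (- s) =
      real (num_invariant_submodules A v m) * real m powr (- s)" for m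
    using LT.num_invariant_submodules_eq(1)[of m] by (cases "m = 0") auto
  then show "(\<lambda>m. real (num_invariant_submodules A v m) * real m powr (- s)) sums euler s"
    using sums_of_esum[OF ge1 total(1) less_imp_le[OF total(2)]] by (simp only:)
qed

end

section \<open>Analytic continuation and the functional equation\<close>

text \<open>The norm of a term depends only on the real part of \<open>s\<close>. So convergence at
  real arguments gives absolute convergence in the half-plane, uniformly on suitable discs.\<close>

lemma dirichlet_series:
  fixes a :: "nat \<Rightarrow> real"
  assumes a: "\<And>m. 0 \<le> a m" and sm: "\<forall>s>\<sigma>. summable (\<lambda>m. a m * real m powr (- s))"
  defines "D \<equiv> \<lambda>s. \<Sum>m. of_real (a m) * of_nat m powr (- s)"
  shows "D holomorphic_on {s. \<sigma> < Re s}"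
    and "\<sigma> < Re s \<Longrightarrow> ((\<lambda>m. of_real (a m) * of_nat m powr (- s)) has_sum D s) {1..}"
    and "\<sigma> < x \<Longrightarrow> D (of_real x) = of_real (\<Sum>m. a m * real m powr (- x))"
proof -
  let ?g = "\<lambda>m s. of_real (a m) * of_nat m powr (- s) :: complex"
  have norm: "norm (?g m s) = a m * real m powr (- Re s)" for m s
    using a[of m] by (simp add: norm_mult norm_powr_real_powr)
  show "((\<lambda>m. ?g m s) has_sum D s) {1..}" if s: "\<sigma> < Re s" for s
  proof -
    have n: "summable (\<lambda>m. norm (?g m s))" unfolding norm using sm s by blast
    then have "((\<lambda>m. ?g m s) has_sum D s) UNIV"
      unfolding D_def by (intro norm_summable_imp_has_sum summable_sums summable_norm_cancel[OF n])
    moreover have "((\<lambda>m. ?g m s) has_sum D s) UNIV \<longleftrightarrow> ((\<lambda>m. ?g m s) has_sum D s) {1..}"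
      by (rule has_sum_cong_neutral) (auto simp: not_less_eq_eq)
    ultimately show ?thesis by blast
  qed
  show "D holomorphic_on {s. \<sigma> < Re s}"
  proof (rule holomorphic_uniform_sequence[OF open_halfspace_Re_gt, where f = "\<lambda>n s. \<Sum>m<n. ?g m s"])
    have "(\<lambda>s. ?g m s) holomorphic_on {s. \<sigma> < Re s}" for m
      by (cases "m = 0") (auto simp: powr_def intro!: holomorphic_intros)
    then show "(\<lambda>s. \<Sum>m<n. ?g m s) holomorphic_on {s. \<sigma> < Re s}" for n
      by (intro holomorphic_on_sum)
  next
    fix x assume "x \<in> {s. \<sigma> < Re s}"
    then have x: "\<sigma> < Re x" by simp
    \<comment> \<open>Half the distance to the boundary line, so that on the disc the real part is
      at least \<open>\<sigma> + d\<close>.\<close>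
    define d where "d = (Re x - \<sigma>) / 2"
    have d: "0 < d" using x by (simp add: d_def)
    have re: "\<sigma> + d \<le> Re y" if "y \<in> cball x d" for y
      using complex_Re_le_cmod[of "x - y"] that by (simp add: dist_norm d_def field_simps)
    have "uniform_limit (cball x d) (\<lambda>n s. \<Sum>m<n. ?g m s) (\<lambda>s. \<Sum>m. ?g m s) sequentially"
    proof (rule Weierstrass_m_test[where M = "\<lambda>m. a m * real m powr (- (\<sigma> + d))"])
      fix m y assume "y \<in> cball x d"
      from re[OF this] show "norm (?g m y) \<le> a m * real m powr (- (\<sigma> + d))"
        unfolding norm using a by (cases "m = 0") (auto intro!: mult_left_mono powr_mono)
    qed (use sm[rule_format, of "\<sigma> + d"] d in simp)
    moreover have "cball x d \<subseteq> {s. \<sigma> < Re s}" using re d by force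
    ultimately show "\<exists>d>0. cball x d \<subseteq> {s. \<sigma> < Re s} \<and>
        uniform_limit (cball x d) (\<lambda>n s. \<Sum>m<n. ?g m s) D sequentially"
      unfolding D_def using d by blast
  qed
  show "D (of_real x) = of_real (\<Sum>m. a m * real m powr (- x))" if "\<sigma> < x" for x
  proof -
    have "?g m (of_real x) = of_real (a m * real m powr (- x))" for m
      using powr_of_real[of "real m" "- x"] by simp
    then show ?thesis unfolding D_def by (simp only: suminf_of_real[OF sm[rule_format, OF that]])
  qed
qed

text \<open>Identity theorem: the real ray has a limit point inside the half-plane.\<close>

lemma eq_on_halfplane:
  assumes h: "h holomorphic_on {s. \<sigma> < Re s}" and z: "\<And>x. \<sigma> < x \<Longrightarrow> h (of_real x) = 0" and s: "\<sigma> < Re s"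
  shows "h s = 0"
proof (rule analytic_continuation[OF h open_halfspace_Re_gt])
  show "connected {s. \<sigma> < Re s}" by (intro convex_connected convex_halfspace_Re_gt)
  show "of_real ` {\<sigma><..} \<subseteq> {s. \<sigma> < Re s}" by auto
  show "of_real (\<sigma> + 1) \<in> {s. \<sigma> < Re s}" by simp
  show "of_real (\<sigma> + 1) islimpt (of_real ` {\<sigma><..} :: complex set)"
    unfolding islimpt_approachable
  proof (intro allI impI)
    fix e :: real assume "0 < e"
    define y where "y = \<sigma> + 1 + e / 2"
    have "y \<noteq> \<sigma> + 1" "dist y (\<sigma> + 1) < e" "\<sigma> < y"
      using \<open>0 < e\<close> by (auto simp: y_def dist_real_def)
    then have "of_real y \<in> (of_real ` {\<sigma><..} :: complex set)" "of_real y \<noteq> (of_real (\<sigma> + 1) :: complex)"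
      "dist (of_real y :: complex) (of_real (\<sigma> + 1)) < e"
      unfolding of_real_eq_iff dist_of_real by (simp_all only: greaterThan_iff imageI not_False_eq_True)
    then show "\<exists>x'\<in>of_real ` {\<sigma><..}. x' \<noteq> of_real (\<sigma> + 1) \<and> dist x' (of_real (\<sigma> + 1) :: complex) < e"
      by blast
  qed
qed (use z s in auto)

lemma inverse_euler_factor:
  assumes "0 < q"
  shows "inverse (1 - of_real (inverse q) powr (- z)) =
    - (of_real q powr (- z)) * inverse (1 - of_real q powr (- z) :: complex)"
proof -
  define u :: complex where "u = of_real q powr z"
  have u: "u \<noteq> 0" using assms by (simp add: u_def)
  have "of_real (inverse q) powr (- z) = u"
    using assms by (simp add: u_def powr_def Ln_of_real ln_inverse flip: of_real_inverse)
  moreover have "of_real q powr (- z) = inverse u" by (simp add: u_def powr_minus)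
  \<comment> \<open>At \<open>u = 1\<close> both sides are 0 because \<open>inverse 0 = 0\<close>,
    so the functional equation needs no exception at poles.\<close>
  moreover have "inverse (1 - u) = - inverse u * inverse (1 - inverse u)"
  proof (cases "u = 1")
    case False
    then have "1 - u \<noteq> 0" "u - 1 \<noteq> 0" by auto
    then show ?thesis using u by (simp add: field_simps)
  qed simp
  ultimately show ?thesis by simp
qed

section \<open>Exponents in the functional equation\<close>

lemma prod_powr: "finite W \<Longrightarrow> q \<noteq> 0 \<Longrightarrow> (\<Prod>w\<in>W. q powr (y w)) = (q :: complex) powr (\<Sum>w\<in>W. y w)"
  by (simp add: powr_def exp_sum sum_distrib_right)

lemma sum_pred_choose_2: "(\<Sum>j = 1..N. j - 1) = N choose 2"
  by (induction N) (simp_all add: numeral_2_eq_2)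

text \<open>The value \<open>t\<close> is attained as often as the \<open>t\<close>-th part of the
  dual partition says. This sum becomes the coefficient of \<open>s\<close> in the exponent of
  \<open>q\<close>.\<close>

lemma sum_partition_inv:
  assumes "is_partition l" "l \<noteq> []"
  shows "(\<Sum>j = 1..sum_list l. partition_inv (dual_partition l) j) = (\<Sum>j = 1..l ! 0. j * dual_partition l ! (j - 1))"
proof -
  let ?mu = "dual_partition l"
  have len: "length ?mu = l ! 0" by (rule dual_partition_length[OF assms(2)])
  have "(\<Sum>j = 1..sum_list l. partition_inv ?mu j) =
      (\<Sum>t<l ! 0. \<Sum>i<?mu ! t. partition_inv ?mu (Suc (sum_list (take t ?mu) + i)))"
    using sum.partition_blocks[of "l ! 0" ?mu "partition_inv ?mu"] len sum_list_dual[OF assms] by simp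
  also have "\<dots> = (\<Sum>t<l ! 0. \<Sum>i<?mu ! t. Suc t)"
    by (intro sum.cong refl partition_inv_block) (auto simp: len)
  also have "\<dots> = (\<Sum>j = 1..l ! 0. j * ?mu ! (j - 1))"
    by (simp add: sum.atLeast1_atMost_eq mult.commute)
  finally show ?thesis .
qed

lemma prod_list_factors:
  assumes "\<And>x. x \<in> set ed \<Longrightarrow> g x = c x * h x"
  shows "prod_list (map g ed) = prod_list (map c ed) * (prod_list (map h ed) :: 'b::comm_monoid_mult)"
  using assms by (induction ed) (simp_all add: mult_ac)

lemma prod_list_sign_powr:
  assumes "q \<noteq> 0"
  shows "(\<Prod>x\<leftarrow>ed. (-1) ^ m x * q powr y x) = (-1) ^ (\<Sum>x\<leftarrow>ed. m x) * (q :: complex) powr (\<Sum>x\<leftarrow>ed. y x)"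
  using assms by (induction ed) (simp_all add: power_add powr_add mult_ac)

context good_place
begin

abbreviation qv :: nat where "qv \<equiv> residue_size (base_field :: 'a ring) v"

text \<open>For fixed \<open>j\<close> the residue degrees add up to \<open>degree f\<close>, so the
  factors over all places together contribute \<open>degree f\<close> times minus the argument to
  the exponent. Summed over \<open>j\<close>, the constants \<open>j - 1\<close> give the binomial
  coefficient and the multiples of \<open>s\<close> give the weighted sum of the dual parts.\<close>

lemma functional_equation_block:
  fixes s :: complex
  assumes fl: "(f, l) \<in> set ed"
  shows "(\<Prod>j = 1..sum_list l. \<Prod>w\<in>places_above f v.
      inverse (1 - of_real (inverse (real qv)) powr (- (of_nat (residue_degree f w v) *
        (of_nat (partition_inv (dual_partition l) j) * s - of_nat j + 1))))) =
    (-1) ^ (sum_list l * card (places_above f v)) *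
    of_real (real qv) powr (of_nat (degree f * (sum_list l choose 2)) -
      of_nat (degree f * (\<Sum>j = 1..l ! 0. j * dual_partition l ! (j - 1))) * s) *
    (\<Prod>j = 1..sum_list l. \<Prod>w\<in>places_above f v.
      inverse (1 - of_real (real qv) powr (- (of_nat (residue_degree f w v) *
        (of_nat (partition_inv (dual_partition l) j) * s - of_nat j + 1)))))"
proof -
  let ?W = "places_above f v" and ?q = "of_real (real qv) :: complex"
  let ?y = "\<lambda>j. of_nat (partition_inv (dual_partition l) j) * s - of_nat j + 1 :: complex"
  have l: "is_partition l" "l \<noteq> []" using ed_partition[OF fl] by auto
  have one: "(0 :: real) < 1" by simp
  note pl = ideal_zeta_places[OF fl one]
  have q: "0 < real qv" "?q \<noteq> 0" using pl(5) by auto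
  have inner: "(\<Prod>w\<in>?W. inverse (1 - of_real (inverse (real qv)) powr (- (of_nat (residue_degree f w v) * ?y j)))) =
      ((-1) ^ card ?W * ?q powr (- (of_nat (degree f) * ?y j))) *
      (\<Prod>w\<in>?W. inverse (1 - ?q powr (- (of_nat (residue_degree f w v) * ?y j))))" for j
  proof -
    have "(\<Sum>w\<in>?W. - (of_nat (residue_degree f w v) * ?y j)) = - (of_nat (\<Sum>w\<in>?W. residue_degree f w v) * ?y j)"
      by (simp only: sum_negf sum_distrib_right of_nat_sum)
    also have "\<dots> = - (of_nat (degree f) * ?y j)" by (simp only: pl(4))
    finally have e: "(\<Sum>w\<in>?W. - (of_nat (residue_degree f w v) * ?y j)) = - (of_nat (degree f) * ?y j)" .
    have "(\<Prod>w\<in>?W. - (?q powr (- (of_nat (residue_degree f w v) * ?y j)))) =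
        (-1) ^ card ?W * (\<Prod>w\<in>?W. ?q powr (- (of_nat (residue_degree f w v) * ?y j)))"
      by (rule prod_uminus)
    also have "(\<Prod>w\<in>?W. ?q powr (- (of_nat (residue_degree f w v) * ?y j))) = ?q powr (- (of_nat (degree f) * ?y j))"
      unfolding prod_powr[OF pl(3) q(2)] e ..
    finally show ?thesis unfolding inverse_euler_factor[OF q(1)] prod.distrib by (simp only:)
  qed
  \<comment> \<open>The difference \<open>j - 1\<close> of natural numbers is not truncated, as
    \<open>j\<close> starts at 1.\<close>
  have "(\<Sum>j = 1..sum_list l. - (of_nat (degree f) * ?y j)) =
      of_nat (degree f * (\<Sum>j = 1..sum_list l. j - 1)) -
      of_nat (degree f * (\<Sum>j = 1..sum_list l. partition_inv (dual_partition l) j)) * s"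
    unfolding of_nat_mult of_nat_sum sum_distrib_left sum_distrib_right sum_subtractf[symmetric]
    by (rule sum.cong[OF refl]) (simp add: of_nat_diff algebra_simps)
  then have e: "(\<Sum>j = 1..sum_list l. - (of_nat (degree f) * ?y j)) =
      of_nat (degree f * (sum_list l choose 2)) -
      of_nat (degree f * (\<Sum>j = 1..l ! 0. j * dual_partition l ! (j - 1))) * s"
    unfolding sum_pred_choose_2 sum_partition_inv[OF l] .
  have "(\<Prod>j = 1..sum_list l. (-1) ^ card ?W * ?q powr (- (of_nat (degree f) * ?y j))) =
      (-1) ^ (sum_list l * card ?W) * ?q powr (\<Sum>j = 1..sum_list l. - (of_nat (degree f) * ?y j))"
    unfolding prod.distrib prod_powr[OF finite_atLeastAtMost q(2)]
    by (simp add: mult.commute flip: power_mult)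
  then show ?thesis unfolding inner prod.distrib e by (simp only:)
qed

lemma functional_equation:
  "zeta_expr ed v (inverse (real qv)) s =
    (-1) ^ (\<Sum>(f, l)\<leftarrow>ed. sum_list l * card (places_above f v)) *
    of_real (real qv) powr
      (of_nat (\<Sum>(f, l)\<leftarrow>ed. degree f * (sum_list l choose 2)) -
       of_nat (\<Sum>(f, l)\<leftarrow>ed. degree f * (\<Sum>j = 1..l ! 0. j * dual_partition l ! (j - 1))) * s) *
    zeta_expr ed v (real qv) s"
proof -
  let ?q = "of_real (real qv) :: complex"
  let ?m = "\<lambda>(f, l). sum_list l * card (places_above f v)"
  let ?b = "\<lambda>(f :: 'a poly, l). degree f * (sum_list l choose 2)"
  let ?c = "\<lambda>(f :: 'a poly, l). degree f * (\<Sum>j = 1..l ! 0. j * dual_partition l ! (j - 1))"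
  have "0 < q" using q_gt_1 by simp
  then have q: "?q \<noteq> 0" using residue_size_base[OF v_base phi_base dvr_abs_axioms] by simp
  have "zeta_expr ed v (inverse (real qv)) s =
      (\<Prod>x\<leftarrow>ed. (-1) ^ ?m x * ?q powr (of_nat (?b x) - of_nat (?c x) * s)) * zeta_expr ed v (real qv) s"
    unfolding zeta_expr_def
  proof (rule prod_list_factors)
    fix x assume x: "x \<in> set ed"
    obtain f l where fl: "x = (f, l)" by (cases x)
    show "(case x of (f, l) \<Rightarrow> \<Prod>j = 1..sum_list l. \<Prod>w\<in>places_above f v.
        inverse (1 - of_real (inverse (real qv)) powr (- (of_nat (residue_degree f w v) *
          (of_nat (partition_inv (dual_partition l) j) * s - of_nat j + 1))))) =
      ((-1) ^ ?m x * ?q powr (of_nat (?b x) - of_nat (?c x) * s)) *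
      (case x of (f, l) \<Rightarrow> \<Prod>j = 1..sum_list l. \<Prod>w\<in>places_above f v.
        inverse (1 - of_real (real qv) powr (- (of_nat (residue_degree f w v) *
          (of_nat (partition_inv (dual_partition l) j) * s - of_nat j + 1)))))"
      unfolding fl prod.case by (rule functional_equation_block) (use x fl in simp)
  qed
  also have "(\<Prod>x\<leftarrow>ed. (-1) ^ ?m x * ?q powr (of_nat (?b x) - of_nat (?c x) * s)) =
      (-1) ^ (\<Sum>x\<leftarrow>ed. ?m x) * ?q powr (\<Sum>x\<leftarrow>ed. of_nat (?b x) - of_nat (?c x) * s)"
    by (rule prod_list_sign_powr[OF q])
  also have "(\<Sum>x\<leftarrow>ed. of_nat (?b x) - of_nat (?c x) * s) = of_nat (\<Sum>x\<leftarrow>ed. ?b x) - of_nat (\<Sum>x\<leftarrow>ed. ?c x) * s"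
    by (induction ed) (simp_all add: algebra_simps)
  finally show ?thesis .
qed

text \<open>An entire function; comparing with the reciprocal of the zeta expression keeps poles out
  of the identity theorem.\<close>

definition denom :: "complex \<Rightarrow> complex" where
  "denom s = (\<Prod>(f, l)\<leftarrow>ed. \<Prod>j = 1..sum_list l. \<Prod>w\<in>places_above f v.
     1 - of_real (real qv) powr (- (of_nat (residue_degree f w v) *
       (of_nat (partition_inv (dual_partition l) j) * s - of_nat j + 1))))"

lemma zeta_expr_denom: "zeta_expr ed v (real qv) s = inverse (denom s)"
proof -
  have "inverse (prod_list (map g es)) = prod_list (map (\<lambda>x. inverse (g x)) es)"
    for g :: "'a poly \<times> nat list \<Rightarrow> complex" and es
    by (induction es) simp_all
  then show ?thesis unfolding zeta_expr_def denom_def split_def by (simp add: prod_inversef[unfolded o_def, symmetric])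
qed

lemma denom_holomorphic: "denom holomorphic_on U"
proof -
  have q: "real qv \<noteq> 0" using residue_size_base[OF v_base phi_base dvr_abs_axioms] q_gt_1 by simp
  have list: "(\<lambda>s. prod_list (map (\<lambda>x. g x s) es)) holomorphic_on U" if "\<And>x. (\<lambda>s. g x s) holomorphic_on U"
    for g :: "'a poly \<times> nat list \<Rightarrow> complex \<Rightarrow> complex" and es
    using that by (induction es) (simp_all add: holomorphic_on_mult)
  have factor: "(\<lambda>s. 1 - of_real (real qv) powr (- (of_nat d * (of_nat a * s - of_nat j + 1)))) holomorphic_on U"
    for d a j
    using q by (auto simp: powr_def intro!: holomorphic_intros)
  show ?thesis unfolding denom_def[abs_def] split_def
    by (rule list) (intro holomorphic_on_prod factor)
qed

lemma zeta_expr_real: "zeta_expr ed v (real qv) (of_real x) = of_real (euler x)"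
proof -
  have f: "inverse (1 - of_real (real qv) powr (- (of_nat d * (of_nat a * of_real x - of_nat j + 1)))) =
      (of_real (1 / (1 - real qv powr (- (real d * (real a * x - real j + 1))))) :: complex)" for d a j
    using powr_of_real[of "real qv" "- (real d * (real a * x - real j + 1))"] by (simp add: inverse_eq_divide)
  have "(of_real (prod_list (map g es)) :: complex) = prod_list (map (\<lambda>x. of_real (g x)) es)"
    for g :: "'a poly \<times> nat list \<Rightarrow> real" and es
    by (induction es) simp_all
  then show ?thesis
    unfolding zeta_expr_def euler_def f by (simp only: split_def of_real_prod)
qed

text \<open>\<open>denom * D = 1\<close> is an equation between holomorphic functions on a
  half-plane, and at real arguments it is \<open>zeta_sums\<close>. It also shows that
  \<open>denom\<close> has no zeros there.\<close>

theorem zeta: "is_zeta A v (zeta_expr ed v (real qv))"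
proof -
  define \<sigma> where "\<sigma> = real (\<Sum>(f, l)\<leftarrow>ed. sum_list l)"
  define a where "a m = real (num_invariant_submodules A v m)" for m
  define D where "D = (\<lambda>s. \<Sum>m. of_real (a m) * of_nat m powr (- s) :: complex)"
  have sums: "(\<lambda>m. a m * real m powr (- x)) sums euler x" "0 < euler x" if "\<sigma> < x" for x
    using zeta_sums that by (simp_all add: \<sigma>_def a_def)
  have a0: "0 \<le> a m" for m by (simp add: a_def)
  have "\<forall>x>\<sigma>. summable (\<lambda>m. a m * real m powr (- x))" using sums(1) sums_summable by blast
  note dir = dirichlet_series[of a \<sigma>, OF a0 this, folded D_def]
  have D: "D s = zeta_expr ed v (real qv) s" if s: "\<sigma> < Re s" for s
  proof -
    have "denom s * D s - 1 = 0"
    proof (rule eq_on_halfplane[where h = "\<lambda>s. denom s * D s - 1" and \<sigma> = \<sigma>])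
      show "(\<lambda>s. denom s * D s - 1) holomorphic_on {s. \<sigma> < Re s}"
        by (intro holomorphic_intros denom_holomorphic dir)
      show "denom (of_real x) * D (of_real x) - 1 = 0" if x: "\<sigma> < x" for x
      proof -
        have "D (of_real x) = of_real (euler x)" using dir(3)[OF x] sums_unique[OF sums(1)[OF x]] by (simp add: D_def)
        moreover have "inverse (denom (of_real x)) = of_real (euler x)" using zeta_expr_real zeta_expr_denom by simp
        moreover from this have "denom (of_real x) \<noteq> 0" using sums(2)[OF x] by auto
        ultimately show ?thesis by (metis diff_self right_inverse)
      qed
    qed (rule s)
    then show ?thesis unfolding zeta_expr_denom by (metis eq_iff_diff_eq_0 inverse_unique)
  qed
  \<comment> \<open>Zeros of \<open>denom\<close> become poles, and \<open>inverse 0 = 0\<close> is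
    just the value that \<open>nicely_meromorphic_on\<close> prescribes at a pole.\<close>
  have "(\<lambda>s. inverse (denom s)) nicely_meromorphic_on UNIV"
    by (intro nicely_meromorphic_on_inverse analytic_on_imp_nicely_meromorphic_on)
      (simp add: analytic_on_open denom_holomorphic)
  then have "zeta_expr ed v (real qv) nicely_meromorphic_on UNIV" by (simp add: zeta_expr_denom[abs_def])
  moreover have "((\<lambda>m. of_nat (num_invariant_submodules A v m) * of_nat m powr (- s)) has_sum zeta_expr ed v (real qv) s) {1..}"
    if "\<sigma> < Re s" for s
    using dir(2)[OF that] unfolding D[OF that, symmetric] D_def a_def by simp
  ultimately show ?thesis unfolding is_zeta_def by blast
qed

lemma integral: "integral_at A v"
  unfolding integral_at_def using A_dim entries iota_simps(1) by auto

end

text \<open>In characteristic 0 the derivative is non-zero of smaller degree, and distinct monic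
  irreducible polynomials are not associated; in both cases \<open>f\<close> does not divide the
  other polynomial.\<close>

lemma irreducible_monic_bezout:
  fixes f g :: "'k::field_char_0 poly"
  assumes f: "Factorial_Ring.irreducible f" "Polynomial.lead_coeff f = 1"
  shows "\<exists>u w. u * f + w * pderiv f = 1"
    and "Factorial_Ring.irreducible g \<Longrightarrow> Polynomial.lead_coeff g = 1 \<Longrightarrow> f \<noteq> g \<Longrightarrow> \<exists>u w. u * f + w * g = 1"
proof -
  have "degree f \<noteq> 0"
  proof
    assume "degree f = 0"
    then obtain c where "f = [:c:]" by (rule degree_eq_zeroE)
    then have "f = 1" using f(2) by (simp add: one_pCons)
    then show False using f(1) by simp
  qed
  then have "pderiv f \<noteq> 0" "degree (pderiv f) < degree f" by (simp_all add: pderiv_eq_0_iff degree_pderiv)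
  then have "\<not> f dvd pderiv f" using dvd_imp_degree_le by fastforce
  then obtain u v where "u * pderiv f + v * f = 1" using irreducible_bezout[OF f(1)] by blast
  then have "v * f + u * pderiv f = 1" by (simp add: add.commute)
  then show "\<exists>u w. u * f + w * pderiv f = 1" by blast
  assume g: "Factorial_Ring.irreducible g" "Polynomial.lead_coeff g = 1" "f \<noteq> g"
  have "\<not> f dvd g"
  proof
    assume "f dvd g"
    then obtain c where c: "g = f * c" by blast
    then have "is_unit c" using g(1) f(1) by (metis Factorial_Ring.irreducibleD irreducible_not_unit)
    then obtain b where "c = [:b:]" by (metis is_unit_polyE)
    then have "b = 1" using c f(2) g(2) by (cases "b = 0") simp_all
    then show False using c g(3) \<open>c = [:b:]\<close> by simp
  qed
  then obtain u v where "u * g + v * f = 1" using irreducible_bezout[OF f(1)] by blast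
  then have "v * f + u * g = 1" by (simp add: add.commute)
  then show "\<exists>u w. u * f + w * g = 1" by blast
qed

theorem theoremB:
  fixes A :: "'k::field_char_0 mat" and ed :: "('k poly \<times> nat list) list" and n :: nat
  assumes "number_field TYPE('k)"
    and "1 \<le> n"
    and "A \<in> carrier_mat n n"
    and "elementary_divisor_vector A ed"
  shows "finite {v \<in> places (base_field :: 'k ring). \<not> (
    integral_at A v \<and>
    (\<exists>Z. is_zeta A v Z \<and>
      (let q = real (residue_size (base_field :: 'k ring) v) in
        (\<forall>s. Z s = zeta_expr ed v q s) \<and>
        (\<forall>s. zeta_expr ed v (inverse q) s =
          (-1) ^ (\<Sum>(f, l)\<leftarrow>ed. sum_list l * card (places_above f v)) *
          of_real q powr
            (of_nat (\<Sum>(f, l)\<leftarrow>ed. degree f * (sum_list l choose 2)) -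
             of_nat (\<Sum>(f, l)\<leftarrow>ed. degree f *
               (\<Sum>j = 1..l ! 0. j * dual_partition l ! (j - 1))) * s) *
          Z s))))}"
proof -
  let ?fs = "fst ` set ed"
  have ed: "distinct (map fst ed)"
    "\<And>f l. (f, l) \<in> set ed \<Longrightarrow> Polynomial.lead_coeff f = 1 \<and> Factorial_Ring.irreducible f \<and> is_partition l \<and> l \<noteq> []"
    using assms(4) by (auto simp: elementary_divisor_vector_def)
  obtain P Q where PQ: "similar_mat_wit A (diag_block_mat (concat (map (\<lambda>(f, l). map (\<lambda>p. companion (f ^ p)) l) ed))) P Q"
    using assms(4) by (auto simp: elementary_divisor_vector_def similar_mat_def)
  have fs: "Polynomial.lead_coeff f = 1" "Factorial_Ring.irreducible f" if "f \<in> ?fs" for f using that ed(2) by auto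
  obtain u w where uw: "\<And>f. f \<in> ?fs \<Longrightarrow> u f * f + w f * pderiv f = 1"
    using irreducible_monic_bezout(1)[OF fs(2,1)] by metis
  obtain a b where ab: "\<And>f g. f \<in> ?fs \<Longrightarrow> g \<in> ?fs \<Longrightarrow> f \<noteq> g \<Longrightarrow> a f g * f + b f g * g = 1"
    using irreducible_monic_bezout(2)[OF fs(2,1) fs(2,1)] by metis
  \<comment> \<open>The Bezout coefficients are chosen once over \<open>k\<close>, independently of
    the place, so that only finitely many elements of \<open>k\<close> have to be integral.\<close>
  define polynomials where "polynomials = ?fs \<union> u ` ?fs \<union> w ` ?fs \<union> (\<Union>f\<in>?fs. a f ` ?fs) \<union> (\<Union>f\<in>?fs. b f ` ?fs)"
  define E where "E = (\<lambda>ij. A $$ ij) ` ({..<n} \<times> {..<n}) \<union> (\<lambda>ij. P $$ ij) ` ({..<n} \<times> {..<n}) \<union>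
    (\<lambda>ij. Q $$ ij) ` ({..<n} \<times> {..<n}) \<union> (\<Union>p\<in>polynomials. set (coeffs p))"
  show ?thesis (is "finite {v \<in> _. \<not> ?good v}")
  proof (rule finite_subset)
    \<comment> \<open>Every exceptional place makes some element of the finite set \<open>E\<close>
      non-integral, and each element is non-integral at finitely many places only.\<close>
    show "finite (\<Union>x\<in>E. {v \<in> places (base_field :: 'k ring). \<exists>\<phi>\<in>v. 1 < \<phi> x})"
      by (intro finite_UN_I finite_places_large[OF assms(1)]) (simp add: E_def polynomials_def)
  next
    have "?good v" if vp: "v \<in> places (base_field :: 'k ring)" and E1: "\<And>x \<phi>. x \<in> E \<Longrightarrow> \<phi> \<in> v \<Longrightarrow> \<phi> x \<le> 1" for v
    proof -
    obtain \<phi> where \<phi>: "\<phi> \<in> v" using placesD(1)[OF vp] by blast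
    then have "nabs \<phi>" using placesD(2)[OF vp] nonarch_abs_base by blast
    then obtain t where t: "dvr_abs \<phi> t" using nabs_dvr[OF assms(1)] by blast
    interpret dvr_abs \<phi> t by (rule t)
    have le: "\<phi> x \<le> 1" if "x \<in> E" for x by (rule E1[OF that \<phi>])
    have pS: "p \<in> S" if p: "p \<in> polynomials" for p
    proof -
      have "\<phi> (coeff p i) \<le> 1" for i
      proof (cases "i \<le> degree p \<and> p \<noteq> 0")
        case True
        then have "coeff p i \<in> set (coeffs p)" by (intro coeff_in_coeffs) auto
        then show ?thesis using p by (intro le) (auto simp: E_def)
      next
        case False
        then have "coeff p i = 0" by (auto simp: coeff_eq_0)
        then show ?thesis by simp
      qed
      then show ?thesis by (simp add: S_def)
    qed
    have poly: "dvr_poly \<phi> t f" if "(f, l) \<in> set ed" for f l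
    proof (unfold_locales)
      have f: "f \<in> ?fs" using that by force
      show "f \<in> S" using f by (intro pS) (simp add: polynomials_def)
      show "Polynomial.lead_coeff f = 1" "Factorial_Ring.irreducible f" using fs[OF f] by blast+
      have "u f \<in> polynomials" "w f \<in> polynomials" unfolding polynomials_def using f by blast+
      then have "u f \<in> S" "w f \<in> S" using pS by blast+
      then show "\<exists>u\<in>S. \<exists>v\<in>S. u * f + v * pderiv f = 1" using uw[OF f] by blast
    qed
    have comax: "\<exists>u\<in>S. \<exists>w\<in>S. u * f + w * g = 1" if "(f, l) \<in> set ed" "(g, m) \<in> set ed" "f \<noteq> g" for f l g m
    proof -
      have fg: "f \<in> ?fs" "g \<in> ?fs" using that by force+
      then have "a f g \<in> polynomials" "b f g \<in> polynomials" unfolding polynomials_def by blast+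
      then have "a f g \<in> S" "b f g \<in> S" using pS by blast+
      then show ?thesis using ab[OF fg that(3)] by blast
    qed
    have entries: "\<phi> (A $$ (i, j)) \<le> 1 \<and> \<phi> (P $$ (i, j)) \<le> 1 \<and> \<phi> (Q $$ (i, j)) \<le> 1" if "i < n" "j < n" for i j
      using that by (auto intro!: le simp: E_def)
    interpret good_place \<phi> t v ed n A P Q
    proof (intro good_place.intro base_valued.intro base_valued_axioms.intro diagonal_model.intro
        diagonal_model_axioms.intro good_place_axioms.intro)
      show "is_partition l \<and> l \<noteq> []" if "(f, l) \<in> set ed" for f l using ed(2)[OF that] by blast
    qed (fact t vp \<phi> ed(1) poly comax assms(3) PQ entries)+
    show ?thesis using integral zeta functional_equation by (auto simp: Let_def)
    qed
    then show "{v \<in> places (base_field :: 'k ring). \<not> ?good v} \<subseteq>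
        (\<Union>x\<in>E. {v \<in> places (base_field :: 'k ring). \<exists>\<phi>\<in>v. 1 < \<phi> x})"
      by (fastforce simp: not_le)
  qed
qed

end
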